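(* Assume $(\mathbf{a1})$, $(\mathbf{a2})$, $(\mathbf{a3})$, $(\mathbf{h1})$, $(\mathbf{h2})$ (stated in the context). Then for any fixed terminal time $T>0$ and initial distribution $m\in\mathcal P_2(\mathbb R^{d_x})$: if there exists a solution pair $(\tilde X^{0,m}_s(x),\tilde Z^{0,m}_s(x))_{x\in\mathbb R^{d_x},s\in[0,T]}$, continuously differentiable in $s\in[0,T]$, of the FBODE system (with terminal data $p(x,\mu)=\int\partial_\mu k(\tilde x,\mu)(x)d\mu(\tilde x)+\partial_xk(x,\mu)$) subject to the initial distribution $m$ at the initial time $t=0$, then it must be equal to the solution pair $(X^{0,m}_s(x),Z^{0,m}_s(x):=\gamma(s,X^{0,m}_s(x),X^{0,m}_s\#m))_{x\in\mathbb R^{d_x},s\in[0,T]}$ generated by the global decoupling field $\gamma$ (see context).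
   Context: **Notation.** $\mathcal P_2(\mathbb R^d)$: Borel probability measures on $\mathbb R^d$ with finite second moment; $W_p$: $p$-Wasserstein metric; $\|\mu\|_p=(\int|x|^pd\mu)^{1/p}$; $\delta_0$: Dirac mass at $0$; $X\#m$: push-forward of $m$ under $X$; $\|\cdot\|$: operator norm of (multi)linear maps; $a\vee b=\max\{a,b\}$. For $z\in\mathbb R^{d_x}$: $\partial_xf\cdot z=\sum_iz_i\partial_xf_i$, and similarly for $\partial_\alpha f\cdot z$, $\partial_\mu f(\cdot)(\tilde x)\cdot z$. **Derivatives in measure.** $h:\mathcal P_2(\mathbb R^d)\to\mathbb R$ has linear functional derivative $\frac{\delta h}{\delta\mu}(\mu)(x)$ if this function is jointly continuous, $|\frac{\delta h}{\delta\mu}(\mu)(x)|\le c(\mu)(1+|x|^2)$ with $c$ bounded on bounded sets, and $h(\nu_1)-h(\nu_2)=\int_0^1\int\frac{\delta h}{\delta\mu}(\theta\nu_1+(1-\theta)\nu_2)(x)\,d(\nu_1-\nu_2)(x)d\theta$; normalization $\int\frac{\delta h}{\delta\mu}(\mu)d\mu=0$. A second-order linear functional derivative $\frac{\delta^2h}{\delta\mu^2}(\mu)(x,\tilde x)$ is jointly continuous, bounded by $c(\mu)(1+|x|^2+|\tilde x|^2)$, has zero $\mu$-integral in each variable, and satisfies $h(\nu_1)-h(\nu_2)=\int\frac{\delta h}{\delta\mu}(\nu_2)d(\nu_1-\nu_2)+\int_0^1\int_0^1\iint\theta\frac{\delta^2h}{\delta\mu^2}(\nu_2+\lambda\theta(\nu_1-\nu_2))(x,\tilde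 x)d(\nu_1-\nu_2)(x)d(\nu_1-\nu_2)(\tilde x)d\lambda d\theta$. $h$ is second-order regularly differentiable if both exist and $\partial_x\partial_x\frac{\delta h}{\delta\mu}$, $\partial_x\partial_{\tilde x}\frac{\delta^2h}{\delta\mu^2}$ are jointly continuous and bounded by $c(\mu)$. $h$ is $L$-differentiable at $\mu$ if the lift $X\mapsto h(\mathrm{Law}(X))$ on square-integrable random vectors is Fréchet differentiable at some $X$ with law $\mu$; the derivative is represented by $\partial_\mu h(\mu)(X)$, and $\partial_\mu h(\mu)(x)=\partial_x\frac{\delta h}{\delta\mu}(\mu)(x)$ for regularly differentiable $h$. Also $\partial_\mu\partial_\mu h(\mu)(\tilde x,\hat x)=\partial_{\tilde x}\partial_{\hat x}\frac{\delta^2h}{\delta\mu^2}(\mu)(\tilde x,\hat x)$. For vector-valued maps everything is componentwise. **(a1)** $f:\mathbb R^{d_x}\times\mathcal P_2(\mathbb R^{d_x})\times\mathbb R^{d_\alpha}\to\mathbb R^{d_x}$ is twice differentiable in $x,\alpha$, second-order regularly differentiable in $\mu$, with jointly continuous derivatives, and for constants $\lambda_f,\Lambda_f,\bar l_f,\mathrm{Lip}_f>0$ and all arguments: (i) $\sum_{i,j}(\xi_i\partial_\alpha f_i)\cdot(\xi_j\partial_\alpha f_j)\ge\lambda_f|\xi|^2$ for $\xi\in\mathbb R^{d_x}$; (ii) $\|\partial_\alpha f\|\vee\|\partial_\mu f(x,\mu,\alpha)(\tilde x)\|\vee\|\partial_xf\|\le\Lambda_f$; (iii) each of $\partial_\mu\partial_\mu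 f(x,\mu,\alpha)(\tilde x,\hat x)$, $\partial_\alpha\partial_\alpha f$, $\partial_\mu\partial_\alpha f(\cdot)(\tilde x)$, $\partial_\alpha\partial_xf$, $\partial_x\partial_xf$, $\partial_{\tilde x}\partial_\mu f(\cdot)(\tilde x)$, $\partial_x\partial_\mu f(\cdot)(\tilde x)$ has norm at most $\bar l_f/(1+|x|+\|\mu\|_1)$; (iv) each of these is jointly Lipschitz with constant $\mathrm{Lip}_f/(1+\max\{|x|,|x'|\}+\max\{\|\mu\|_1,\|\mu'\|_1\})$ with respect to $|x-x'|+W_2(\mu,\mu')+|\alpha-\alpha'|$ (plus $|\tilde x-\tilde x'|$, $|\hat x-\hat x'|$ when these variables occur). **(a2)** $g:\mathbb R^{d_x}\times\mathcal P_2(\mathbb R^{d_x})\times\mathbb R^{d_\alpha}\to\mathbb R$ is twice differentiable in $x,\alpha$, second-order regularly differentiable in $\mu$, with jointly Lipschitz second-order derivatives, and for constants $\lambda_g,\Lambda_g,\bar l_g>0$, $l_g\ge0$: (i) $\xi^\top\partial_\alpha\partial_\alpha g\,\xi\ge\lambda_g|\xi|^2$; (ii) with $G(x,\mu,\alpha):=g(x,\mu,\alpha)+\int\frac{\delta}{\delta\mu}g(\tilde x,\mu,\alpha)(x)d\mu(\tilde x)$: $\xi^\top\partial_x\partial_xG\,\xi\ge\lambda_g|\xi|^2$ and $\int(G(x,\mu',\alpha)-G(x,\mu,\alpha))d(\mu'-\mu)(x)\ge-l_g|\int y\,d(\mu-\mu')(y)|^2$ for all $\mu,\mu',\alpha$,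 with $l_g\le\frac12\lambda_g$; (iii) the norms of $\partial_\mu\partial_\mu g(\cdot)(\tilde x,\hat x)$, $\partial_\alpha\partial_\alpha g$, $\partial_x\partial_\mu g(\cdot)(\tilde x)$, $\partial_x\partial_xg$, $\partial_{\tilde x}\partial_\mu g(\cdot)(\tilde x)$ are $\le\Lambda_g$, and those of $\partial_x\partial_\alpha g$, $\partial_\alpha\partial_\mu g(\cdot)(\tilde x)$ are $\le\bar l_g$. **(a3)** $k:\mathbb R^{d_x}\times\mathcal P_2(\mathbb R^{d_x})\to\mathbb R$ is twice differentiable in $x$, second-order regularly differentiable in $\mu$, with jointly Lipschitz second-order derivatives, and for constants $\lambda_k,\Lambda_k>0$, $l_k\ge0$: (i) with $K(x,\mu):=k(x,\mu)+\int\frac{\delta}{\delta\mu}k(\tilde x,\mu)(x)d\mu(\tilde x)$: $\xi^\top\partial_x\partial_xK\,\xi\ge\lambda_k|\xi|^2$ and $\int(K(x,\mu')-K(x,\mu))d(\mu'-\mu)(x)\ge-l_k|\int y\,d(\mu-\mu')(y)|^2$, with $l_k\le\frac12\lambda_k$; (ii) the norms of $\partial_\mu\partial_\mu k(\cdot)(\tilde x,\hat x)$, $\partial_x\partial_\mu k(\cdot)(\tilde x)$, $\partial_x\partial_xk$, $\partial_{\tilde x}\partial_\mu k(\cdot)(\tilde x)$ are $\le\Lambda_k$. **Constants.** $\bar L_k=3\Lambda_k$; $\lambda_z=\frac{\lambda_f^2}{\Lambda_g+\lambda_g/20}$, $\lambda_x=\frac{17}{20}\lambda_g$, $\bar\lambda_k=\frac14\lambda_k$,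 $\bar\lambda_z=\frac12\lambda_z$, $\bar\lambda_x=\frac1{40}\lambda_g$; $\kappa_1=\min\{\frac{\lambda_k}4,\frac{\lambda_z}2,\frac{\lambda_g}{40}\}$, $\kappa_2=\min\{\frac{\lambda_k}4,\frac{\lambda_z}4,\frac{\lambda_g}5\}$; $L_1^*=\max\{\frac{4\Lambda_k^2}{\lambda_k},\frac1{\lambda_z}(2\Lambda_g+\frac3{20}\lambda_g),\frac1{\lambda_x}(\frac52\Lambda_f+2\Lambda_g+\frac3{20}\lambda_g)\}$; $L_4^*=\max\{\frac{\Lambda_k^2}{\kappa_1\lambda_k},\frac1{4\kappa_1\lambda_x}(\frac{25}{16}\Lambda_f^2+(2\Lambda_g+\frac15\lambda_g)^2)\}$; $L_5^*=\max\{\frac{9\Lambda_k^2}{4\kappa_2\bar\lambda_k},\frac{25\Lambda_f^2}{64\kappa_2\bar\lambda_z},\frac1{4\kappa_2\bar\lambda_x}(\frac{25}{16}\Lambda_f^2+9(\frac1{10}\lambda_g+\Lambda_g)^2)\}$; $L_6^*=\max\{\frac{27\Lambda_k^2}{\bar\lambda_k},\frac{\Lambda_g+\lambda_g/10}{\bar\lambda_x},\frac{\Lambda_g+\lambda_g/10}{\bar\lambda_z},\frac{12\Lambda_k^2}{\lambda_k},\frac{2\Lambda_g+\lambda_g/5}{\lambda_x},\frac{6\Lambda_k^2}{\bar\lambda_k},\frac{2\Lambda_g+3\lambda_g/20}{\bar\lambda_x},\frac{\frac{15}4\Lambda_f+7\Lambda_g+\frac{13}{20}\lambda_g}{\bar\lambda_z}\}$;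 $L_0^*=d_x\max\{L_1^*,\sqrt{(L_4^*(2+L_5^* )+1)L_1^*L_6^*}\}$; $k_0=4\max\{\bar L_k,L_0^*\}$. **(h1)** $f(0,\delta_0,0)=0$, $\partial_xg(0,\delta_0,0)=0$, $\partial_\alpha g(0,\delta_0,0)=0$, $\partial_\mu g(0,\delta_0,0)(0)=0$, $\partial_xk(0,\delta_0)=0$, $\partial_\mu k(0,\delta_0)(0)=0$. **(h2)** $8\bar l_g\le\lambda_g$ and $\bar l_f\le\frac{\lambda_g}{40\max\{\bar L_k,L_0^*\}}$. **Optimal control.** $\alpha(x,\mu,z)\in\mathbb R^{d_\alpha}$ denotes the optimal control: a minimizer of $a\mapsto f(x,\mu,a)\cdot z+g(x,\mu,a)$ over $\mathbb R^{d_\alpha}$, which solves the first order condition $\partial_\alpha f(x,\mu,\alpha)\cdot z+\partial_\alpha g(x,\mu,\alpha)=0$. Under the assumptions of the claim it is uniquely determined by this condition whenever $(x,\mu,z)$ lies in $c_{k_0}=\{(x,\mu,z)\in\mathbb R^{d_x}\times\mathcal P_2(\mathbb R^{d_x})\times\mathbb R^{d_x}:|z|\le\frac12k_0(1+|x|+\|\mu\|_1)\}$. **FBODE system.** For maps $X,Z:\mathbb R^{d_x}\to\mathbb R^{d_x}$ put $a_x=\alpha(X(x),X\#m,Z(x))$ and $\Phi(X,Z,m)(x)=\partial_xf(X(x),X\#m,a_x)\cdot Z(x)+\partial_xg(X(x),X\#m,a_x)+\int\big(\partial_\mu f(X(\tilde x),X\#m,a_{\tilde x})(X(x))\cdot Z(\tilde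 x)+\partial_\mu g(X(\tilde x),X\#m,a_{\tilde x})(X(x))\big)dm(\tilde x)$. The FBODE system on $[t,T]$ is: for all $x\in\mathbb R^{d_x}$ and $s\in[t,T]$, $\frac d{ds}X^{t,m}_s(x)=f(X^{t,m}_s(x),X^{t,m}_s\#m,\alpha(X^{t,m}_s(x),X^{t,m}_s\#m,Z^{t,m}_s(x)))$, $X^{t,m}_t(x)=x$; $\frac d{ds}Z^{t,m}_s(x)=-\Phi(X^{t,m}_s,Z^{t,m}_s,m)(x)$, $Z^{t,m}_T(x)=p(X^{t,m}_T(x),X^{t,m}_T\#m)$. A solution pair is a pair solving this system collectively for all $x\in\mathbb R^{d_x}$; membership of $(X_s(x),X_s\#m,Z_s(x))$ in $c_{k_0}$ is not assumed. **Global decoupling field.** $\gamma:[0,T]\times\mathbb R^{d_x}\times\mathcal P_2(\mathbb R^{d_x})\to\mathbb R^{d_x}$ is a decoupling field on $[0,T]$ if for all $s,x,m$: $\gamma(s,x,m)=p(X^{s,m}_T(x),X^{s,m}_T\#m)+\int_s^T\Phi(X^{s,m}_\tau,Z^{s,m}_\tau,m)(x)d\tau$, where $Z^{s,m}_\tau(x)=\gamma(\tau,X^{s,m}_\tau(x),X^{s,m}_\tau\#m)$ and $X^{s,m}_\tau(x)=x+\int_s^\tau f(X^{s,m}_r(x),X^{s,m}_r\#m,\alpha(X^{s,m}_r(x),X^{s,m}_r\#m,\gamma(r,X^{s,m}_r(x),X^{s,m}_r\#m)))dr$. Under the assumptions of the claim the FBODE system has a decoupling field $\gamma$ on $[0,T]$,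 differentiable in $s,x$ and $L$-differentiable in $\mu$ with $\partial_x\gamma$, $\partial_\mu\gamma$ jointly continuous and bounded in operator norm by $L_0^*$; this is the $\gamma$ of the claim, and $X^{0,m}$ is obtained from it by the last displayed formula with $s=0$. *)

theory Defs
  imports "HOL-Probability.Probability"
begin

section \<open>Probability measures with finite second moment\<close>

definition P2 :: "'x::euclidean_space measure set" where
  "P2 = {\<mu>. prob_space \<mu> \<and> sets \<mu> = sets borel \<and> integrable \<mu> (\<lambda>x. (norm x)\<^sup>2)}"

definition moment_norm :: "nat \<Rightarrow> 'x::euclidean_space measure \<Rightarrow> real" where
  "moment_norm p \<mu> = root p (\<integral>x. norm x ^ p \<partial>\<mu>)"

definition couplings :: "'x::euclidean_space measure \<Rightarrow> 'x measure \<Rightarrow> ('x \<times> 'x) measure set" where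
  "couplings \<mu> \<nu> = {\<pi>. sets \<pi> = sets borel \<and> distr \<pi> borel fst = \<mu> \<and> distr \<pi> borel snd = \<nu>}"

definition wasserstein :: "nat \<Rightarrow> 'x::euclidean_space measure \<Rightarrow> 'x measure \<Rightarrow> real" where
  "wasserstein p \<mu> \<nu> = root p (INF \<pi>\<in>couplings \<mu> \<nu>. \<integral>z. dist (fst z) (snd z) ^ p \<partial>\<pi>)"

abbreviation W2 :: "'x::euclidean_space measure \<Rightarrow> 'x measure \<Rightarrow> real" where
  "W2 \<equiv> wasserstein 2"

abbreviation dirac0 :: "'x::euclidean_space measure" where
  "dirac0 \<equiv> return borel 0"

abbreviation push :: "'y measure \<Rightarrow> ('y \<Rightarrow> 'x::euclidean_space) \<Rightarrow> 'x measure" where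
  "push m X \<equiv> distr m borel X"

text \<open>\<open>mix \<theta> \<mu> \<nu>\<close> is the measure \<open>\<theta>\<mu> + (1 - \<theta>)\<nu>\<close>, and \<open>dint \<mu> \<nu> \<phi>\<close> is the integral of \<open>\<phi>\<close>
  against the signed measure \<open>\<mu> - \<nu>\<close>.\<close>

definition mix :: "real \<Rightarrow> 'x::euclidean_space measure \<Rightarrow> 'x measure \<Rightarrow> 'x measure" where
  "mix \<theta> \<mu> \<nu> = measure_of UNIV (sets borel)
     (\<lambda>A. ennreal \<theta> * emeasure \<mu> A + ennreal (1 - \<theta>) * emeasure \<nu> A)"

definition dint :: "'x::euclidean_space measure \<Rightarrow> 'x measure \<Rightarrow> ('x \<Rightarrow> 'b) \<Rightarrow> 'b::euclidean_space" where
  "dint \<mu> \<nu> \<phi> = (\<integral>x. \<phi> x \<partial>\<mu>) - (\<integral>x. \<phi> x \<partial>\<nu>)"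

text \<open>Finite-dimensional arguments are collected in \<open>e\<close> (usually a tuple); \<open>P2\<close> carries the
  metric \<open>W2\<close>.\<close>

definition jointly_continuous ::
  "'e::metric_space set \<Rightarrow> ('e \<Rightarrow> 'x::euclidean_space measure \<Rightarrow> 'v::metric_space) \<Rightarrow> bool" where
  "jointly_continuous S Q \<longleftrightarrow>
     (\<forall>e\<in>S. \<forall>\<mu>\<in>P2. \<forall>\<epsilon>>0. \<exists>\<delta>>0. \<forall>e'\<in>S. \<forall>\<mu>'\<in>P2.
        dist e e' < \<delta> \<and> W2 \<mu> \<mu>' < \<delta> \<longrightarrow> dist (Q e \<mu>) (Q e' \<mu>') < \<epsilon>)"

definition jointly_lipschitz ::
  "('e::metric_space \<Rightarrow> 'x::euclidean_space measure \<Rightarrow> 'v::real_normed_vector) \<Rightarrow> bool" where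
  "jointly_lipschitz Q \<longleftrightarrow>
     (\<exists>C. \<forall>e e'. \<forall>\<mu>\<in>P2. \<forall>\<mu>'\<in>P2. norm (Q e \<mu> - Q e' \<mu>') \<le> C * (dist e e' + W2 \<mu> \<mu>'))"

definition bounded_on_bounded :: "('x::euclidean_space measure \<Rightarrow> real) \<Rightarrow> bool" where
  "bounded_on_bounded c \<longleftrightarrow>
     (\<forall>B. B \<subseteq> P2 \<and> (\<exists>R. \<forall>\<mu>\<in>B. \<forall>\<nu>\<in>B. W2 \<mu> \<nu> \<le> R) \<longrightarrow> (\<exists>C. \<forall>\<mu>\<in>B. \<bar>c \<mu>\<bar> \<le> C))"


section \<open>Derivatives\<close>

text \<open>Derivatives are bounded linear maps, so that \<open>norm\<close> is the operator norm; iterating gives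
  multilinear maps (curried) with their operator norm.\<close>

definition Dfr :: "('u::real_normed_vector \<Rightarrow> 'v::real_normed_vector) \<Rightarrow> 'u \<Rightarrow> 'u \<Rightarrow>\<^sub>L 'v" where
  "Dfr F u = Blinfun (frechet_derivative F (at u))"

definition twice_differentiable :: "('u::real_normed_vector \<Rightarrow> 'v::real_normed_vector) \<Rightarrow> bool" where
  "twice_differentiable F \<longleftrightarrow>
     (\<forall>u. F differentiable (at u)) \<and> (\<forall>u. Dfr F differentiable (at u))"

definition grad :: "('u::euclidean_space \<Rightarrow>\<^sub>L real) \<Rightarrow> 'u" where
  "grad A = (\<Sum>b\<in>Basis. blinfun_apply A b *\<^sub>R b)"

text \<open>If \<open>A\<close> is the derivative of \<open>f\<close>, then \<open>A \<bullet>\<^sub>D z\<close> is the sum over \<open>i\<close> of \<open>z\<^sub>i\<close> times the gradient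
  of \<open>f\<^sub>i\<close>, i.e. the transposed Jacobian applied to \<open>z\<close>.\<close>

definition dotD :: "('u::euclidean_space \<Rightarrow>\<^sub>L 'v::euclidean_space) \<Rightarrow> 'v \<Rightarrow> 'u" (infixl "\<bullet>\<^sub>D" 70) where
  "A \<bullet>\<^sub>D z = (\<Sum>b\<in>Basis. (blinfun_apply A b \<bullet> z) *\<^sub>R b)"

text \<open>Linear functional derivatives. For vector-valued maps all conditions are equivalent to the
  same conditions on each component.\<close>

definition is_lfd ::
  "('x::euclidean_space measure \<Rightarrow> 'b::euclidean_space) \<Rightarrow> ('x measure \<Rightarrow> 'x \<Rightarrow> 'b) \<Rightarrow> bool" where
  "is_lfd h D \<longleftrightarrow>
     jointly_continuous UNIV (\<lambda>x \<mu>. D \<mu> x) \<and>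
     (\<exists>c. bounded_on_bounded c \<and> (\<forall>\<mu>\<in>P2. \<forall>x. norm (D \<mu> x) \<le> c \<mu> * (1 + (norm x)\<^sup>2))) \<and>
     (\<forall>\<nu>1\<in>P2. \<forall>\<nu>2\<in>P2.
        ((\<lambda>\<theta>. dint \<nu>1 \<nu>2 (D (mix \<theta> \<nu>1 \<nu>2))) has_integral (h \<nu>1 - h \<nu>2)) {0..1}) \<and>
     (\<forall>\<mu>\<in>P2. (\<integral>x. D \<mu> x \<partial>\<mu>) = 0)"

definition lfd ::
  "('x::euclidean_space measure \<Rightarrow> 'b::euclidean_space) \<Rightarrow> 'x measure \<Rightarrow> 'x \<Rightarrow> 'b" where
  "lfd h = (SOME D. is_lfd h D)"

text \<open>The second-order expansion only determines the symmetric part of the second-order derivative;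
  as usual, the symmetric representative is meant.\<close>

definition is_lfd2 ::
  "('x::euclidean_space measure \<Rightarrow> 'b::euclidean_space) \<Rightarrow> ('x measure \<Rightarrow> 'x \<Rightarrow> 'x \<Rightarrow> 'b) \<Rightarrow> bool" where
  "is_lfd2 h D \<longleftrightarrow>
     jointly_continuous UNIV (\<lambda>(x, y) \<mu>. D \<mu> x y) \<and>
     (\<exists>c. bounded_on_bounded c \<and>
        (\<forall>\<mu>\<in>P2. \<forall>x y. norm (D \<mu> x y) \<le> c \<mu> * (1 + (norm x)\<^sup>2 + (norm y)\<^sup>2))) \<and>
     (\<forall>\<mu>\<in>P2. \<forall>y. (\<integral>x. D \<mu> x y \<partial>\<mu>) = 0) \<and>
     (\<forall>\<mu>\<in>P2. \<forall>x. (\<integral>y. D \<mu> x y \<partial>\<mu>) = 0) \<and>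
     (\<forall>\<mu>\<in>P2. \<forall>x y. D \<mu> x y = D \<mu> y x) \<and>
     (\<forall>\<nu>1\<in>P2. \<forall>\<nu>2\<in>P2.
        ((\<lambda>(l, \<theta>). \<theta> *\<^sub>R dint \<nu>1 \<nu>2 (\<lambda>y. dint \<nu>1 \<nu>2 (\<lambda>x. D (mix (l * \<theta>) \<nu>1 \<nu>2) x y)))
           has_integral (h \<nu>1 - h \<nu>2 - dint \<nu>1 \<nu>2 (lfd h \<nu>2))) (cbox (0, 0) (1::real, 1::real)))"

definition lfd2 ::
  "('x::euclidean_space measure \<Rightarrow> 'b::euclidean_space) \<Rightarrow> 'x measure \<Rightarrow> 'x \<Rightarrow> 'x \<Rightarrow> 'b" where
  "lfd2 h = (SOME D. is_lfd2 h D)"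

definition D_mu ::
  "('x::euclidean_space measure \<Rightarrow> 'b::euclidean_space) \<Rightarrow> 'x measure \<Rightarrow> 'x \<Rightarrow> 'x \<Rightarrow>\<^sub>L 'b" where
  "D_mu h \<mu> = Dfr (lfd h \<mu>)"

definition D_mumu ::
  "('x::euclidean_space measure \<Rightarrow> 'b::euclidean_space) \<Rightarrow> 'x measure \<Rightarrow> 'x \<Rightarrow> 'x
     \<Rightarrow> 'x \<Rightarrow>\<^sub>L 'x \<Rightarrow>\<^sub>L 'b" where
  "D_mumu h \<mu> y z = Dfr (\<lambda>y. Dfr (lfd2 h \<mu> y) z) y"

definition mu_differentiable :: "('x::euclidean_space measure \<Rightarrow> 'b::euclidean_space) \<Rightarrow> bool" where
  "mu_differentiable h \<longleftrightarrow>
     (\<exists>D. is_lfd h D) \<and> (\<forall>\<mu>\<in>P2. \<forall>y. lfd h \<mu> differentiable (at y))"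

definition regular2 :: "('x::euclidean_space measure \<Rightarrow> 'b::euclidean_space) \<Rightarrow> bool" where
  "regular2 h \<longleftrightarrow>
     (\<exists>D. is_lfd h D) \<and> (\<exists>D. is_lfd2 h D) \<and>
     (\<forall>\<mu>\<in>P2. twice_differentiable (lfd h \<mu>)) \<and>
     (\<forall>\<mu>\<in>P2. \<forall>y z. lfd2 h \<mu> y differentiable (at z) \<and>
        (\<lambda>y. Dfr (lfd2 h \<mu> y) z) differentiable (at y)) \<and>
     jointly_continuous UNIV (\<lambda>y \<mu>. Dfr (Dfr (lfd h \<mu>)) y) \<and>
     jointly_continuous UNIV (\<lambda>(y, z) \<mu>. D_mumu h \<mu> y z) \<and>
     (\<exists>c. bounded_on_bounded c \<and>
        (\<forall>\<mu>\<in>P2. \<forall>y z. norm (Dfr (Dfr (lfd h \<mu>)) y) \<le> c \<mu> \<and> norm (D_mumu h \<mu> y z) \<le> c \<mu>))"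

text \<open>L-derivative through the lift to square-integrable random vectors; the unit interval with
  Lebesgue measure carries random vectors of every law.\<close>

abbreviation unit_prob :: "real measure" where
  "unit_prob \<equiv> restrict_space lborel {0..1}"

definition L2_rv :: "(real \<Rightarrow> 'v::real_normed_vector) set" where
  "L2_rv = {X. X \<in> borel_measurable unit_prob \<and> integrable unit_prob (\<lambda>w. (norm (X w))\<^sup>2)}"

definition L2_norm_rv :: "(real \<Rightarrow> 'v::real_normed_vector) \<Rightarrow> real" where
  "L2_norm_rv X = sqrt (\<integral>w. (norm (X w))\<^sup>2 \<partial>unit_prob)"

definition has_L_derivative ::
  "('x::euclidean_space measure \<Rightarrow> 'b::euclidean_space) \<Rightarrow> ('x \<Rightarrow> 'x \<Rightarrow>\<^sub>L 'b) \<Rightarrow> 'x measure \<Rightarrow> bool" where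
  "has_L_derivative h D \<mu> \<longleftrightarrow>
     (\<exists>X\<in>L2_rv. push unit_prob X = \<mu> \<and> (\<lambda>w. D (X w)) \<in> L2_rv \<and>
        (\<forall>\<epsilon>>0. \<exists>\<delta>>0. \<forall>Y\<in>L2_rv. L2_norm_rv Y < \<delta> \<longrightarrow>
           norm (h (push unit_prob (\<lambda>w. X w + Y w)) - h \<mu>
                 - (\<integral>w. blinfun_apply (D (X w)) (Y w) \<partial>unit_prob)) \<le> \<epsilon> * L2_norm_rv Y))"

text \<open>Derivatives of functions of \<open>(x, \<mu>, \<alpha>)\<close>; nested applications give higher ones, e.g.
  \<open>D_a (D_x h)\<close> is \<open>\<partial>\<^sub>\<alpha>\<partial>\<^sub>xh\<close>.\<close>

definition D_x :: "('x::euclidean_space \<Rightarrow> 'x measure \<Rightarrow> 'a::euclidean_space \<Rightarrow> 'v::real_normed_vector)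
    \<Rightarrow> 'x \<Rightarrow> 'x measure \<Rightarrow> 'a \<Rightarrow> 'x \<Rightarrow>\<^sub>L 'v" where
  "D_x h x \<mu> a = Dfr (\<lambda>x. h x \<mu> a) x"

definition D_a :: "('x::euclidean_space \<Rightarrow> 'x measure \<Rightarrow> 'a::euclidean_space \<Rightarrow> 'v::real_normed_vector)
    \<Rightarrow> 'x \<Rightarrow> 'x measure \<Rightarrow> 'a \<Rightarrow> 'a \<Rightarrow>\<^sub>L 'v" where
  "D_a h x \<mu> a = Dfr (\<lambda>a. h x \<mu> a) a"

definition D_m :: "('x::euclidean_space \<Rightarrow> 'x measure \<Rightarrow> 'a::euclidean_space \<Rightarrow> 'b::euclidean_space)
    \<Rightarrow> 'x \<Rightarrow> 'x measure \<Rightarrow> 'a \<Rightarrow> 'x \<Rightarrow> 'x \<Rightarrow>\<^sub>L 'b" where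
  "D_m h x \<mu> a y = D_mu (\<lambda>\<nu>. h x \<nu> a) \<mu> y"

definition D_mm :: "('x::euclidean_space \<Rightarrow> 'x measure \<Rightarrow> 'a::euclidean_space \<Rightarrow> 'b::euclidean_space)
    \<Rightarrow> 'x \<Rightarrow> 'x measure \<Rightarrow> 'a \<Rightarrow> 'x \<Rightarrow> 'x \<Rightarrow> 'x \<Rightarrow>\<^sub>L 'x \<Rightarrow>\<^sub>L 'b" where
  "D_mm h x \<mu> a y z = D_mumu (\<lambda>\<nu>. h x \<nu> a) \<mu> y z"

definition D_xm :: "('x::euclidean_space \<Rightarrow> 'x measure \<Rightarrow> 'a::euclidean_space \<Rightarrow> 'b::euclidean_space)
    \<Rightarrow> 'x \<Rightarrow> 'x measure \<Rightarrow> 'a \<Rightarrow> 'x \<Rightarrow> 'x \<Rightarrow>\<^sub>L 'x \<Rightarrow>\<^sub>L 'b" where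
  "D_xm h x \<mu> a y = Dfr (\<lambda>x. D_m h x \<mu> a y) x"

definition D_am :: "('x::euclidean_space \<Rightarrow> 'x measure \<Rightarrow> 'a::euclidean_space \<Rightarrow> 'b::euclidean_space)
    \<Rightarrow> 'x \<Rightarrow> 'x measure \<Rightarrow> 'a \<Rightarrow> 'x \<Rightarrow> 'a \<Rightarrow>\<^sub>L 'x \<Rightarrow>\<^sub>L 'b" where
  "D_am h x \<mu> a y = Dfr (\<lambda>a. D_m h x \<mu> a y) a"

definition D_ym :: "('x::euclidean_space \<Rightarrow> 'x measure \<Rightarrow> 'a::euclidean_space \<Rightarrow> 'b::euclidean_space)
    \<Rightarrow> 'x \<Rightarrow> 'x measure \<Rightarrow> 'a \<Rightarrow> 'x \<Rightarrow> 'x \<Rightarrow>\<^sub>L 'x \<Rightarrow>\<^sub>L 'b" where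
  "D_ym h x \<mu> a y = Dfr (D_m h x \<mu> a) y"

text \<open>\<open>\<partial>\<^sub>\<mu>\<partial>\<^sub>\<alpha>h\<close>, computed for each partial derivative of \<open>h\<close> in a basis direction of \<open>\<alpha>\<close> and
  assembled into a bilinear map.\<close>

definition D_ma :: "('x::euclidean_space \<Rightarrow> 'x measure \<Rightarrow> 'a::euclidean_space \<Rightarrow> 'b::euclidean_space)
    \<Rightarrow> 'x \<Rightarrow> 'x measure \<Rightarrow> 'a \<Rightarrow> 'x \<Rightarrow> 'a \<Rightarrow>\<^sub>L 'x \<Rightarrow>\<^sub>L 'b" where
  "D_ma h x \<mu> a y =
     Blinfun (\<lambda>u. \<Sum>b\<in>Basis. (u \<bullet> b) *\<^sub>R D_mu (\<lambda>\<nu>. blinfun_apply (D_a h x \<nu> a) b) \<mu> y)"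


section \<open>Assumptions on the coefficients\<close>

text \<open>Bound and Lipschitz estimate required of the second-order derivatives of \<open>f\<close>. Derivatives
  not depending on \<open>y\<close> or \<open>z\<close> are passed with dummy arguments, which makes the respective
  distance irrelevant.\<close>

definition decay :: "real \<Rightarrow> real \<Rightarrow>
    ('x::euclidean_space \<Rightarrow> 'x measure \<Rightarrow> 'a::euclidean_space \<Rightarrow> 'x \<Rightarrow> 'x \<Rightarrow> 'v::real_normed_vector) \<Rightarrow> bool" where
  "decay l L Q \<longleftrightarrow>
     (\<forall>\<mu>\<in>P2. \<forall>x a y z. norm (Q x \<mu> a y z) \<le> l / (1 + norm x + moment_norm 1 \<mu>)) \<and>
     (\<forall>\<mu>\<in>P2. \<forall>\<mu>'\<in>P2. \<forall>x x' a a' y y' z z'.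
        norm (Q x \<mu> a y z - Q x' \<mu>' a' y' z')
        \<le> L / (1 + max (norm x) (norm x') + max (moment_norm 1 \<mu>) (moment_norm 1 \<mu>'))
          * (norm (x - x') + W2 \<mu> \<mu>' + norm (a - a') + norm (y - y') + norm (z - z')))"

text \<open>The joint continuity of the second-order derivatives of \<open>f\<close> is contained in the \<open>decay\<close>
  clauses. The double sum is the squared norm of the sum over \<open>i\<close> of \<open>\<xi>\<^sub>i\<close> times the
  \<open>\<alpha>\<close>-gradient of \<open>f\<^sub>i\<close>.\<close>

definition assumption_a1 ::
  "('x::euclidean_space \<Rightarrow> 'x measure \<Rightarrow> 'a::euclidean_space \<Rightarrow> 'x)
    \<Rightarrow> real \<Rightarrow> real \<Rightarrow> real \<Rightarrow> real \<Rightarrow> bool" where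
  "assumption_a1 f lam_f Lam_f bl_f Lip_f \<longleftrightarrow>
     lam_f > 0 \<and> Lam_f > 0 \<and> bl_f > 0 \<and> Lip_f > 0 \<and>
     (\<forall>\<mu>\<in>P2. twice_differentiable (\<lambda>(x, a). f x \<mu> a)) \<and>
     (\<forall>x a. regular2 (\<lambda>\<mu>. f x \<mu> a)) \<and>
     (\<forall>x a. \<forall>b\<in>Basis. mu_differentiable (\<lambda>\<mu>. blinfun_apply (D_a f x \<mu> a) b)) \<and>
     (\<forall>\<mu>\<in>P2. \<forall>x a y. (\<lambda>x. D_m f x \<mu> a y) differentiable (at x)) \<and>
     jointly_continuous UNIV (\<lambda>(x, a) \<mu>. D_x f x \<mu> a) \<and>
     jointly_continuous UNIV (\<lambda>(x, a) \<mu>. D_a f x \<mu> a) \<and>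
     jointly_continuous UNIV (\<lambda>(x, a, y) \<mu>. D_m f x \<mu> a y) \<and>
     (\<forall>\<mu>\<in>P2. \<forall>x a \<xi>.
        (\<Sum>i\<in>Basis. \<Sum>j\<in>Basis. ((\<xi> \<bullet> i) *\<^sub>R (D_a f x \<mu> a \<bullet>\<^sub>D i)) \<bullet> ((\<xi> \<bullet> j) *\<^sub>R (D_a f x \<mu> a \<bullet>\<^sub>D j)))
        \<ge> lam_f * (norm \<xi>)\<^sup>2) \<and>
     (\<forall>\<mu>\<in>P2. \<forall>x a y. max (norm (D_a f x \<mu> a)) (max (norm (D_m f x \<mu> a y)) (norm (D_x f x \<mu> a))) \<le> Lam_f) \<and>
     decay bl_f Lip_f (D_mm f) \<and>
     decay bl_f Lip_f (\<lambda>x \<mu> a y z. D_a (D_a f) x \<mu> a) \<and>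
     decay bl_f Lip_f (\<lambda>x \<mu> a y z. D_ma f x \<mu> a y) \<and>
     decay bl_f Lip_f (\<lambda>x \<mu> a y z. D_a (D_x f) x \<mu> a) \<and>
     decay bl_f Lip_f (\<lambda>x \<mu> a y z. D_x (D_x f) x \<mu> a) \<and>
     decay bl_f Lip_f (\<lambda>x \<mu> a y z. D_ym f x \<mu> a y) \<and>
     decay bl_f Lip_f (\<lambda>x \<mu> a y z. D_xm f x \<mu> a y)"

definition G_fun :: "('x::euclidean_space \<Rightarrow> 'x measure \<Rightarrow> 'a::euclidean_space \<Rightarrow> real)
    \<Rightarrow> 'x \<Rightarrow> 'x measure \<Rightarrow> 'a \<Rightarrow> real" where
  "G_fun g x \<mu> a = g x \<mu> a + (\<integral>y. lfd (\<lambda>\<nu>. g y \<nu> a) \<mu> x \<partial>\<mu>)"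

definition K_fun :: "('x::euclidean_space \<Rightarrow> 'x measure \<Rightarrow> real) \<Rightarrow> 'x \<Rightarrow> 'x measure \<Rightarrow> real" where
  "K_fun k x \<mu> = k x \<mu> + (\<integral>y. lfd (k y) \<mu> x \<partial>\<mu>)"

definition assumption_a2 ::
  "('x::euclidean_space \<Rightarrow> 'x measure \<Rightarrow> 'a::euclidean_space \<Rightarrow> real)
    \<Rightarrow> real \<Rightarrow> real \<Rightarrow> real \<Rightarrow> real \<Rightarrow> bool" where
  "assumption_a2 g lam_g Lam_g bl_g l_g \<longleftrightarrow>
     lam_g > 0 \<and> Lam_g > 0 \<and> bl_g > 0 \<and> l_g \<ge> 0 \<and>
     (\<forall>\<mu>\<in>P2. twice_differentiable (\<lambda>(x, a). g x \<mu> a)) \<and>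
     (\<forall>x a. regular2 (\<lambda>\<mu>. g x \<mu> a)) \<and>
     (\<forall>\<mu>\<in>P2. \<forall>x a y. (\<lambda>x. D_m g x \<mu> a y) differentiable (at x) \<and>
        (\<lambda>a. D_m g x \<mu> a y) differentiable (at a)) \<and>
     jointly_lipschitz (\<lambda>(x, a, y, z) \<mu>. D_mm g x \<mu> a y z) \<and>
     jointly_lipschitz (\<lambda>(x, a) \<mu>. D_a (D_a g) x \<mu> a) \<and>
     jointly_lipschitz (\<lambda>(x, a, y) \<mu>. D_xm g x \<mu> a y) \<and>
     jointly_lipschitz (\<lambda>(x, a) \<mu>. D_x (D_x g) x \<mu> a) \<and>
     jointly_lipschitz (\<lambda>(x, a, y) \<mu>. D_ym g x \<mu> a y) \<and>
     jointly_lipschitz (\<lambda>(x, a) \<mu>. D_x (D_a g) x \<mu> a) \<and>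
     jointly_lipschitz (\<lambda>(x, a, y) \<mu>. D_am g x \<mu> a y) \<and>
     (\<forall>\<mu>\<in>P2. \<forall>x a \<xi>. blinfun_apply (blinfun_apply (D_a (D_a g) x \<mu> a) \<xi>) \<xi> \<ge> lam_g * (norm \<xi>)\<^sup>2) \<and>
     (\<forall>\<mu>\<in>P2. \<forall>a. twice_differentiable (\<lambda>x. G_fun g x \<mu> a)) \<and>
     (\<forall>\<mu>\<in>P2. \<forall>x a \<xi>.
        blinfun_apply (blinfun_apply (D_x (D_x (G_fun g)) x \<mu> a) \<xi>) \<xi> \<ge> lam_g * (norm \<xi>)\<^sup>2) \<and>
     (\<forall>\<mu>\<in>P2. \<forall>\<mu>'\<in>P2. \<forall>a.
        dint \<mu>' \<mu> (\<lambda>x. G_fun g x \<mu>' a - G_fun g x \<mu> a) \<ge> - l_g * (norm (dint \<mu> \<mu>' (\<lambda>y. y)))\<^sup>2) \<and>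
     l_g \<le> lam_g / 2 \<and>
     (\<forall>\<mu>\<in>P2. \<forall>x a y z.
        norm (D_mm g x \<mu> a y z) \<le> Lam_g \<and>
        norm (D_a (D_a g) x \<mu> a) \<le> Lam_g \<and>
        norm (D_xm g x \<mu> a y) \<le> Lam_g \<and>
        norm (D_x (D_x g) x \<mu> a) \<le> Lam_g \<and>
        norm (D_ym g x \<mu> a y) \<le> Lam_g \<and>
        norm (D_x (D_a g) x \<mu> a) \<le> bl_g \<and>
        norm (D_am g x \<mu> a y) \<le> bl_g)"

definition assumption_a3 ::
  "('x::euclidean_space \<Rightarrow> 'x measure \<Rightarrow> real) \<Rightarrow> real \<Rightarrow> real \<Rightarrow> real \<Rightarrow> bool" where
  "assumption_a3 k lam_k Lam_k l_k \<longleftrightarrow>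
     lam_k > 0 \<and> Lam_k > 0 \<and> l_k \<ge> 0 \<and>
     (\<forall>\<mu>\<in>P2. twice_differentiable (\<lambda>x. k x \<mu>)) \<and>
     (\<forall>x. regular2 (k x)) \<and>
     (\<forall>\<mu>\<in>P2. \<forall>x y. (\<lambda>x. D_mu (k x) \<mu> y) differentiable (at x)) \<and>
     jointly_lipschitz (\<lambda>(x, y, z) \<mu>. D_mumu (k x) \<mu> y z) \<and>
     jointly_lipschitz (\<lambda>(x, y) \<mu>. Dfr (\<lambda>x. D_mu (k x) \<mu> y) x) \<and>
     jointly_lipschitz (\<lambda>x \<mu>. Dfr (Dfr (\<lambda>x. k x \<mu>)) x) \<and>
     jointly_lipschitz (\<lambda>(x, y) \<mu>. Dfr (D_mu (k x) \<mu>) y) \<and>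
     (\<forall>\<mu>\<in>P2. twice_differentiable (\<lambda>x. K_fun k x \<mu>)) \<and>
     (\<forall>\<mu>\<in>P2. \<forall>x \<xi>.
        blinfun_apply (blinfun_apply (Dfr (Dfr (\<lambda>x. K_fun k x \<mu>)) x) \<xi>) \<xi> \<ge> lam_k * (norm \<xi>)\<^sup>2) \<and>
     (\<forall>\<mu>\<in>P2. \<forall>\<mu>'\<in>P2.
        dint \<mu>' \<mu> (\<lambda>x. K_fun k x \<mu>' - K_fun k x \<mu>) \<ge> - l_k * (norm (dint \<mu> \<mu>' (\<lambda>y. y)))\<^sup>2) \<and>
     l_k \<le> lam_k / 2 \<and>
     (\<forall>\<mu>\<in>P2. \<forall>x y z.
        norm (D_mumu (k x) \<mu> y z) \<le> Lam_k \<and>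
        norm (Dfr (\<lambda>x. D_mu (k x) \<mu> y) x) \<le> Lam_k \<and>
        norm (Dfr (Dfr (\<lambda>x. k x \<mu>)) x) \<le> Lam_k \<and>
        norm (Dfr (D_mu (k x) \<mu>) y) \<le> Lam_k)"

text \<open>Explicit constant bounding the first derivatives of the decoupling field; \<open>d\<close> is the state
  dimension.\<close>

definition L0_star :: "nat \<Rightarrow> real \<Rightarrow> real \<Rightarrow> real \<Rightarrow> real \<Rightarrow> real \<Rightarrow> real \<Rightarrow> real" where
  "L0_star d lam_f Lam_f lam_g Lam_g lam_k Lam_k =
    (let
       lam_z = lam_f\<^sup>2 / (Lam_g + lam_g / 20);
       lam_x = 17 / 20 * lam_g;
       blam_k = lam_k / 4;
       blam_z = lam_z / 2;
       blam_x = lam_g / 40;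
       kap1 = Min {lam_k / 4, lam_z / 2, lam_g / 40};
       kap2 = Min {lam_k / 4, lam_z / 4, lam_g / 5};
       L1 = Max {4 * Lam_k\<^sup>2 / lam_k,
                 1 / lam_z * (2 * Lam_g + 3 / 20 * lam_g),
                 1 / lam_x * (5 / 2 * Lam_f + 2 * Lam_g + 3 / 20 * lam_g)};
       L4 = Max {Lam_k\<^sup>2 / (kap1 * lam_k),
                 1 / (4 * kap1 * lam_x) * (25 / 16 * Lam_f\<^sup>2 + (2 * Lam_g + lam_g / 5)\<^sup>2)};
       L5 = Max {9 * Lam_k\<^sup>2 / (4 * kap2 * blam_k),
                 25 * Lam_f\<^sup>2 / (64 * kap2 * blam_z),
                 1 / (4 * kap2 * blam_x) * (25 / 16 * Lam_f\<^sup>2 + 9 * (lam_g / 10 + Lam_g)\<^sup>2)};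
       L6 = Max {27 * Lam_k\<^sup>2 / blam_k,
                 (Lam_g + lam_g / 10) / blam_x,
                 (Lam_g + lam_g / 10) / blam_z,
                 12 * Lam_k\<^sup>2 / lam_k,
                 (2 * Lam_g + lam_g / 5) / lam_x,
                 6 * Lam_k\<^sup>2 / blam_k,
                 (2 * Lam_g + 3 * lam_g / 20) / blam_x,
                 (15 / 4 * Lam_f + 7 * Lam_g + 13 / 20 * lam_g) / blam_z}
     in real d * max L1 (sqrt ((L4 * (2 + L5) + 1) * L1 * L6)))"

definition assumption_h1 ::
  "('x::euclidean_space \<Rightarrow> 'x measure \<Rightarrow> 'a::euclidean_space \<Rightarrow> 'x)
    \<Rightarrow> ('x \<Rightarrow> 'x measure \<Rightarrow> 'a \<Rightarrow> real) \<Rightarrow> ('x \<Rightarrow> 'x measure \<Rightarrow> real) \<Rightarrow> bool" where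
  "assumption_h1 f g k \<longleftrightarrow>
     f 0 dirac0 0 = 0 \<and> D_x g 0 dirac0 0 = 0 \<and> D_a g 0 dirac0 0 = 0 \<and> D_m g 0 dirac0 0 0 = 0 \<and>
     Dfr (\<lambda>x. k x dirac0) 0 = 0 \<and> D_mu (k 0) dirac0 0 = 0"

definition assumption_h2 :: "real \<Rightarrow> real \<Rightarrow> real \<Rightarrow> real \<Rightarrow> real \<Rightarrow> bool" where
  "assumption_h2 bl_f lam_g bl_g Lam_k L0 \<longleftrightarrow>
     8 * bl_g \<le> lam_g \<and> bl_f \<le> lam_g / (40 * max (3 * Lam_k) L0)"


section \<open>The forward-backward system and decoupling fields\<close>

text \<open>Outside of the cone on which the minimizer is unique, \<open>\<alpha>\<close> is an arbitrary selection of
  minimizers.\<close>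

definition optimal_control ::
  "('x::euclidean_space \<Rightarrow> 'x measure \<Rightarrow> 'a::euclidean_space \<Rightarrow> 'x)
    \<Rightarrow> ('x \<Rightarrow> 'x measure \<Rightarrow> 'a \<Rightarrow> real) \<Rightarrow> ('x \<Rightarrow> 'x measure \<Rightarrow> 'x \<Rightarrow> 'a) \<Rightarrow> bool" where
  "optimal_control f g \<alpha> \<longleftrightarrow>
     (\<forall>x z. \<forall>\<mu>\<in>P2. is_arg_min (\<lambda>a. f x \<mu> a \<bullet> z + g x \<mu> a) (\<lambda>_. True) (\<alpha> x \<mu> z))"

definition terminal_p :: "('x::euclidean_space \<Rightarrow> 'x measure \<Rightarrow> real) \<Rightarrow> 'x \<Rightarrow> 'x measure \<Rightarrow> 'x" where
  "terminal_p k x \<mu> = (\<integral>y. grad (D_mu (k y) \<mu> x) \<partial>\<mu>) + grad (Dfr (\<lambda>x. k x \<mu>) x)"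

definition Phi_integrand ::
  "('x::euclidean_space \<Rightarrow> 'x measure \<Rightarrow> 'a::euclidean_space \<Rightarrow> 'x)
    \<Rightarrow> ('x \<Rightarrow> 'x measure \<Rightarrow> 'a \<Rightarrow> real) \<Rightarrow> ('x \<Rightarrow> 'x measure \<Rightarrow> 'x \<Rightarrow> 'a)
    \<Rightarrow> ('x \<Rightarrow> 'x) \<Rightarrow> ('x \<Rightarrow> 'x) \<Rightarrow> 'x measure \<Rightarrow> 'x \<Rightarrow> 'x \<Rightarrow> 'x" where
  "Phi_integrand f g \<alpha> X Z m x y =
     (let \<mu> = push m X; a = \<alpha> (X y) \<mu> (Z y)
      in D_m f (X y) \<mu> a (X x) \<bullet>\<^sub>D Z y + grad (D_m g (X y) \<mu> a (X x)))"

definition Phi ::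
  "('x::euclidean_space \<Rightarrow> 'x measure \<Rightarrow> 'a::euclidean_space \<Rightarrow> 'x)
    \<Rightarrow> ('x \<Rightarrow> 'x measure \<Rightarrow> 'a \<Rightarrow> real) \<Rightarrow> ('x \<Rightarrow> 'x measure \<Rightarrow> 'x \<Rightarrow> 'a)
    \<Rightarrow> ('x \<Rightarrow> 'x) \<Rightarrow> ('x \<Rightarrow> 'x) \<Rightarrow> 'x measure \<Rightarrow> 'x \<Rightarrow> 'x" where
  "Phi f g \<alpha> X Z m x =
     (let \<mu> = push m X; a = \<alpha> (X x) \<mu> (Z x)
      in D_x f (X x) \<mu> a \<bullet>\<^sub>D Z x + grad (D_x g (X x) \<mu> a)
         + (\<integral>y. Phi_integrand f g \<alpha> X Z m x y \<partial>m))"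

text \<open>The conditions under which \<open>X\<close> has a law in \<open>P2\<close> and the integral in \<open>Phi\<close> makes sense
  (in HOL a divergent integral would silently be \<open>0\<close>).\<close>

definition Phi_defined ::
  "('x::euclidean_space \<Rightarrow> 'x measure \<Rightarrow> 'a::euclidean_space \<Rightarrow> 'x)
    \<Rightarrow> ('x \<Rightarrow> 'x measure \<Rightarrow> 'a \<Rightarrow> real) \<Rightarrow> ('x \<Rightarrow> 'x measure \<Rightarrow> 'x \<Rightarrow> 'a)
    \<Rightarrow> ('x \<Rightarrow> 'x) \<Rightarrow> ('x \<Rightarrow> 'x) \<Rightarrow> 'x measure \<Rightarrow> bool" where
  "Phi_defined f g \<alpha> X Z m \<longleftrightarrow>
     X \<in> borel_measurable borel \<and> push m X \<in> P2 \<and> integrable m Z \<and>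
     (\<forall>x. integrable m (Phi_integrand f g \<alpha> X Z m x))"

definition C1_on :: "real \<Rightarrow> real \<Rightarrow> (real \<Rightarrow> 'v::real_normed_vector) \<Rightarrow> bool" where
  "C1_on t T u \<longleftrightarrow>
     (\<exists>D. (\<forall>s\<in>{t..T}. (u has_vector_derivative D s) (at s within {t..T})) \<and> continuous_on {t..T} D)"

definition fbode_solution ::
  "('x::euclidean_space \<Rightarrow> 'x measure \<Rightarrow> 'a::euclidean_space \<Rightarrow> 'x)
    \<Rightarrow> ('x \<Rightarrow> 'x measure \<Rightarrow> 'a \<Rightarrow> real) \<Rightarrow> ('x \<Rightarrow> 'x measure \<Rightarrow> 'x \<Rightarrow> 'a) \<Rightarrow> ('x \<Rightarrow> 'x measure \<Rightarrow> 'x)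
    \<Rightarrow> real \<Rightarrow> real \<Rightarrow> 'x measure \<Rightarrow> (real \<Rightarrow> 'x \<Rightarrow> 'x) \<Rightarrow> (real \<Rightarrow> 'x \<Rightarrow> 'x) \<Rightarrow> bool" where
  "fbode_solution f g \<alpha> p t T m X Z \<longleftrightarrow>
     (\<forall>s\<in>{t..T}. Phi_defined f g \<alpha> (X s) (Z s) m) \<and>
     (\<forall>x. \<forall>s\<in>{t..T}.
        ((\<lambda>r. X r x) has_vector_derivative
           f (X s x) (push m (X s)) (\<alpha> (X s x) (push m (X s)) (Z s x))) (at s within {t..T}) \<and>
        ((\<lambda>r. Z r x) has_vector_derivative - Phi f g \<alpha> (X s) (Z s) m x) (at s within {t..T})) \<and>
     (\<forall>x. X t x = x \<and> Z T x = p (X T x) (push m (X T)))"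

text \<open>\<open>X\<close> is the flow started from \<open>m\<close> at time \<open>s\<close> that is obtained by feeding back \<open>\<gamma>\<close>.\<close>

definition field_flow ::
  "('x::euclidean_space \<Rightarrow> 'x measure \<Rightarrow> 'a::euclidean_space \<Rightarrow> 'x) \<Rightarrow> ('x \<Rightarrow> 'x measure \<Rightarrow> 'x \<Rightarrow> 'a)
    \<Rightarrow> (real \<Rightarrow> 'x \<Rightarrow> 'x measure \<Rightarrow> 'x) \<Rightarrow> real \<Rightarrow> real \<Rightarrow> 'x measure \<Rightarrow> (real \<Rightarrow> 'x \<Rightarrow> 'x) \<Rightarrow> bool" where
  "field_flow f \<alpha> \<gamma> T s m X \<longleftrightarrow>
     (\<forall>\<tau>\<in>{s..T}. X \<tau> \<in> borel_measurable borel \<and> push m (X \<tau>) \<in> P2) \<and>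
     (\<forall>x. \<forall>\<tau>\<in>{s..T}.
        ((\<lambda>r. f (X r x) (push m (X r)) (\<alpha> (X r x) (push m (X r)) (\<gamma> r (X r x) (push m (X r)))))
           has_integral (X \<tau> x - x)) {s..\<tau>})"

definition decoupling_field ::
  "('x::euclidean_space \<Rightarrow> 'x measure \<Rightarrow> 'a::euclidean_space \<Rightarrow> 'x)
    \<Rightarrow> ('x \<Rightarrow> 'x measure \<Rightarrow> 'a \<Rightarrow> real) \<Rightarrow> ('x \<Rightarrow> 'x measure \<Rightarrow> 'x \<Rightarrow> 'a) \<Rightarrow> ('x \<Rightarrow> 'x measure \<Rightarrow> 'x)
    \<Rightarrow> real \<Rightarrow> (real \<Rightarrow> 'x \<Rightarrow> 'x measure \<Rightarrow> 'x) \<Rightarrow> bool" where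
  "decoupling_field f g \<alpha> p T \<gamma> \<longleftrightarrow>
     (\<forall>s\<in>{0..T}. \<forall>m\<in>P2. \<exists>X Z.
        field_flow f \<alpha> \<gamma> T s m X \<and>
        (\<forall>\<tau>\<in>{s..T}. \<forall>x. Z \<tau> x = \<gamma> \<tau> (X \<tau> x) (push m (X \<tau>))) \<and>
        (\<forall>\<tau>\<in>{s..T}. Phi_defined f g \<alpha> (X \<tau>) (Z \<tau>) m) \<and>
        (\<forall>x. ((\<lambda>\<tau>. Phi f g \<alpha> (X \<tau>) (Z \<tau>) m x)
                has_integral (\<gamma> s x m - p (X T x) (push m (X T)))) {s..T}))"

definition regular_field :: "real \<Rightarrow> real \<Rightarrow> (real \<Rightarrow> 'x \<Rightarrow> 'x::euclidean_space measure \<Rightarrow> 'x) \<Rightarrow> bool" where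
  "regular_field T L \<gamma> \<longleftrightarrow>
     (\<forall>s\<in>{0..T}. \<forall>x. \<forall>\<mu>\<in>P2. (\<lambda>s. \<gamma> s x \<mu>) differentiable (at s within {0..T})) \<and>
     (\<forall>s\<in>{0..T}. \<forall>x. \<forall>\<mu>\<in>P2. (\<lambda>x. \<gamma> s x \<mu>) differentiable (at x)) \<and>
     jointly_continuous ({0..T} \<times> UNIV) (\<lambda>(s, x) \<mu>. Dfr (\<lambda>x. \<gamma> s x \<mu>) x) \<and>
     (\<forall>s\<in>{0..T}. \<forall>x. \<forall>\<mu>\<in>P2. norm (Dfr (\<lambda>x. \<gamma> s x \<mu>) x) \<le> L) \<and>
     (\<exists>D :: real \<Rightarrow> 'x \<Rightarrow> 'x measure \<Rightarrow> 'x \<Rightarrow> 'x \<Rightarrow>\<^sub>L 'x.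
        (\<forall>s\<in>{0..T}. \<forall>x. \<forall>\<mu>\<in>P2. has_L_derivative (\<gamma> s x) (D s x \<mu>) \<mu>) \<and>
        jointly_continuous ({0..T} \<times> UNIV) (\<lambda>(s, x, y) \<mu>. D s x \<mu> y) \<and>
        (\<forall>s\<in>{0..T}. \<forall>x y. \<forall>\<mu>\<in>P2. norm (D s x \<mu> y) \<le> L))"

end

theory Submission
  imports Defs
begin

text \<open>Let \<open>(X', Z')\<close> be a solution and \<open>\<delta> s x = Z' s x - \<gamma> s (X' s x) (X' s # m)\<close>. For each \<open>s\<close>, start the
  flow of the field from the law of \<open>X' s\<close> and compare it with \<open>(X', Z')\<close> on \<open>[s, T]\<close>. If
  \<open>|\<delta> r x| \<le> D exp (\<eta> (T - r)) \<omega> x\<close>, Gronwall bounds the forward error by a multiple of \<open>1 / \<eta>\<close> of the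
  same expression, and then the backward equation and the representation of \<open>\<gamma> s\<close> by its flow do the same for
  \<open>\<delta> s\<close>. For large \<open>\<eta>\<close> this is a contraction, hence \<open>\<delta> = 0\<close>, and the forward error vanishes as well.

  The solution is not assumed to stay in the cone where the control is well behaved. This does not matter:
  the first order conditions at two points can be compared as soon as one of them lies in the cone, and
  points of the field do, since \<open>\<gamma>\<close> is Lipschitz with constant \<open>L0\<close> in \<open>x\<close> and in \<open>W\<^sub>1\<close> and vanishes at the
  origin. The weight \<open>\<omega>\<close> is integrable by an a priori bound valid for every solution. The Lipschitz
  bounds in the measure argument come from the second-order expansions (for the coefficients) and from the
  expansion of the lift along simple random vectors (for \<open>\<gamma>\<close>).\<close>

text \<open>All Gronwall-type steps have the form of \<open>contraction_bound\<close>: a supremum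
  \<open>S\<close> with \<open>S \<le> A + S / 2\<close>. This form asks nothing of the dependence
  on time of integrals over \<open>m\<close>, which the definitions leave open, but it says
  something only once the supremum is known to be finite. Finiteness is the real obstacle: a
  solution has an integrable slice at every time, with no uniformity in time. Two facts supply it.
  The coefficients grow linearly at every point, in or out of the cone, because they can be compared
  with the origin, where the control is 0 by (h1); and a path with such growth has bounded first
  moments by a category argument. That \<open>\<gamma>\<close> vanishes at the origin is not assumed
  either: it follows from the same backward contraction, run along the flow started from the Dirac
  mass at 0, where the mean field terms are point evaluations.\<close>

section \<open>Kantorovich--Rubinstein bounds and mixtures of measures\<close>

text \<open>The dual form of \<open>W\<^sub>1 \<nu>1 \<nu>2 \<le> w\<close>: it is stable under mixtures and needs no optimal couplings.\<close>

definition kr_le :: "'x::euclidean_space measure \<Rightarrow> 'x measure \<Rightarrow> real \<Rightarrow> bool" where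
  "kr_le \<nu>1 \<nu>2 w \<longleftrightarrow>
     (\<forall>\<psi>. (\<forall>x y. \<bar>\<psi> x - \<psi> y\<bar> \<le> norm (x - y)) \<longrightarrow> \<bar>dint \<nu>1 \<nu>2 \<psi>\<bar> \<le> w)"

lemma P2_D:
  assumes "\<mu> \<in> P2"
  shows "prob_space \<mu>" "sets \<mu> = sets borel" "space \<mu> = UNIV" "integrable \<mu> (\<lambda>x. (norm x)\<^sup>2)"
  using assms sets_eq_imp_space_eq[of \<mu> borel] by (auto simp: P2_def)

lemma measurable_P2 [simp]: "\<mu> \<in> P2 \<Longrightarrow> measurable \<mu> N = measurable borel N"
  by (rule measurable_cong_sets[OF P2_D(2) refl])

lemma integrable_quadratic_growth:
  fixes \<phi> :: "'x::euclidean_space \<Rightarrow> 'b::euclidean_space"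
  assumes "\<mu> \<in> P2" and "\<phi> \<in> borel_measurable borel" and "\<And>x. norm (\<phi> x) \<le> c * (1 + (norm x)\<^sup>2)"
  shows "integrable \<mu> \<phi>"
proof -
  interpret prob_space \<mu> using assms(1) by (rule P2_D)
  have "integrable \<mu> (\<lambda>x. c * (1 + (norm x)\<^sup>2))"
    using P2_D(4)[OF assms(1)] by simp
  moreover have "\<phi> \<in> borel_measurable \<mu>"
    using assms(1,2) by simp
  ultimately show ?thesis
    by (rule Bochner_Integration.integrable_bound) (auto intro!: AE_I2 order_trans[OF assms(3)])
qed

lemma integrable_linear_growth:
  fixes \<phi> :: "'x::euclidean_space \<Rightarrow> 'b::euclidean_space"
  assumes "\<mu> \<in> P2" and "\<phi> \<in> borel_measurable borel"
    and "\<And>x. norm (\<phi> x) \<le> c * (1 + norm x)"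
  shows "integrable \<mu> \<phi>"
proof (rule integrable_quadratic_growth[OF assms(1,2)])
  fix x :: 'x
  have c: "c \<ge> 0" using order_trans[OF norm_ge_zero assms(3)[of 0]] by simp
  have "1 + norm x \<le> 2 * (1 + (norm x)\<^sup>2)"
    using zero_le_power2[of "norm x - 1"] zero_le_power2[of "norm x"] unfolding power2_eq_square
    by argo
  then show "norm (\<phi> x) \<le> (c * 2) * (1 + (norm x)\<^sup>2)"
    using assms(3)[of x] mult_left_mono[OF _ c, of "1 + norm x" "2 * (1 + (norm x)\<^sup>2)"]
    by (simp add: algebra_simps)
qed

lemma continuous_of_norm_lipschitz:
  fixes \<phi> :: "'x::real_normed_vector \<Rightarrow> 'b::real_normed_vector"
  assumes "\<And>x y. norm (\<phi> x - \<phi> y) \<le> L * norm (x - y)"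
  shows "continuous_on UNIV \<phi>"
proof -
  have "(max 0 L)-lipschitz_on UNIV \<phi>"
  proof (rule lipschitz_onI)
    fix x y
    show "dist (\<phi> x) (\<phi> y) \<le> max 0 L * dist x y"
      using assms[of x y] mult_right_mono[OF max.cobounded2[of L 0] norm_ge_zero[of "x - y"]]
      by (simp add: dist_norm)
  qed simp
  then show ?thesis by (rule lipschitz_on_continuous_on)
qed

lemma integrable_lipschitz:
  fixes \<phi> :: "'x::euclidean_space \<Rightarrow> 'b::euclidean_space"
  assumes "\<mu> \<in> P2" and "\<And>x y. norm (\<phi> x - \<phi> y) \<le> L * norm (x - y)"
  shows "integrable \<mu> \<phi>"
proof (rule integrable_linear_growth[OF assms(1)])
  show "\<phi> \<in> borel_measurable borel"
    using continuous_of_norm_lipschitz[OF assms(2)] borel_measurable_continuous_onI by blast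
  fix x :: 'x
  have "norm (\<phi> x) \<le> norm (\<phi> 0) + L * norm x"
    using assms(2)[of x 0] norm_triangle_sub[of "\<phi> x" "\<phi> 0"] by simp
  also have "\<dots> \<le> (norm (\<phi> 0) + \<bar>L\<bar>) * (1 + norm x)"
    using mult_right_mono[OF abs_ge_self[of L] norm_ge_zero[of x]]
      mult_nonneg_nonneg[OF norm_ge_zero[of "\<phi> 0"] norm_ge_zero[of x]] abs_ge_zero[of L]
    unfolding distrib_left distrib_right mult_1_right by linarith
  finally show "norm (\<phi> x) \<le> (norm (\<phi> 0) + \<bar>L\<bar>) * (1 + norm x)" .
qed

lemma kr_le_nonneg: "kr_le \<nu>1 \<nu>2 w \<Longrightarrow> 0 \<le> w"
  unfolding kr_le_def by (drule spec[of _ "\<lambda>_. 0"]) (simp add: dint_def)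

text \<open>Testing against the direction of the integral itself reduces to scalar functions, and
  division by the Lipschitz constant to the test functions of \<open>kr_le\<close>. Vector values
  therefore cost no dimensional factor.\<close>

lemma norm_dint_lipschitz:
  fixes \<phi> :: "'x::euclidean_space \<Rightarrow> 'b::euclidean_space"
  assumes "\<nu>1 \<in> P2" "\<nu>2 \<in> P2" "kr_le \<nu>1 \<nu>2 w"
    and lip: "\<And>x y. norm (\<phi> x - \<phi> y) \<le> L * norm (x - y)"
  shows "norm (dint \<nu>1 \<nu>2 \<phi>) \<le> L * w"
proof -
  define u where "u = sgn (dint \<nu>1 \<nu>2 \<phi>)"
  \<comment> \<open>A basis vector and 0 are at distance 1.\<close>
  have L: "0 \<le> L" using order_trans[OF norm_ge_zero lip[of "SOME x. x \<in> Basis" 0]]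
    by (simp add: SOME_Basis)
  have int: "integrable \<nu>1 \<phi>" "integrable \<nu>2 \<phi>"
    using integrable_lipschitz[OF _ lip] assms(1,2) by auto
  have eq: "dint \<nu>1 \<nu>2 (\<lambda>x. \<phi> x \<bullet> u) = dint \<nu>1 \<nu>2 \<phi> \<bullet> u"
    by (simp add: dint_def int inner_diff_left)
  have nu: "norm u \<le> 1" by (simp add: u_def norm_sgn)
  have l1: "\<bar>\<phi> x \<bullet> u - \<phi> y \<bullet> u\<bar> \<le> L * norm (x - y)" for x y
  proof -
    have "\<bar>\<phi> x \<bullet> u - \<phi> y \<bullet> u\<bar> \<le> norm (\<phi> x - \<phi> y) * norm u"
      using Cauchy_Schwarz_ineq2[of "\<phi> x - \<phi> y" u] by (simp add: inner_diff_left)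
    also have "\<dots> \<le> norm (\<phi> x - \<phi> y) * 1" using nu by (intro mult_left_mono) auto
    finally show ?thesis using lip[of x y] by simp
  qed
  have main: "\<bar>dint \<nu>1 \<nu>2 (\<lambda>x. \<phi> x \<bullet> u)\<bar> \<le> K * w" if K: "K > 0" "K \<ge> L" for K
  proof -
    have "\<bar>\<phi> x \<bullet> u / K - \<phi> y \<bullet> u / K\<bar> \<le> norm (x - y)" for x y
    proof -
      have "\<bar>\<phi> x \<bullet> u - \<phi> y \<bullet> u\<bar> \<le> K * norm (x - y)"
        using l1[of x y] mult_right_mono[OF K(2), of "norm (x - y)"] by simp
      then show ?thesis using K(1) by (simp add: field_simps flip: diff_divide_distrib)
    qed
    then have "\<bar>dint \<nu>1 \<nu>2 (\<lambda>x. \<phi> x \<bullet> u / K)\<bar> \<le> w"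
      using assms(3)[unfolded kr_le_def, rule_format, of "\<lambda>x. \<phi> x \<bullet> u / K"] by simp
    moreover have "dint \<nu>1 \<nu>2 (\<lambda>x. \<phi> x \<bullet> u / K) = dint \<nu>1 \<nu>2 (\<lambda>x. \<phi> x \<bullet> u) / K"
      by (simp add: dint_def diff_divide_distrib)
    ultimately show ?thesis using K(1) by (simp add: field_simps)
  qed
  \<comment> \<open>\<open>L\<close> may be 0, so the division is carried out with constants
    slightly above it.\<close>
  have "\<bar>dint \<nu>1 \<nu>2 (\<lambda>x. \<phi> x \<bullet> u)\<bar> \<le> L * w"
  proof (rule field_le_epsilon)
    fix e :: real assume e: "e > 0"
    have w: "0 \<le> w" by (rule kr_le_nonneg[OF assms(3)])
    have "0 < e / (1 + w)" using w e by simp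
    then have "\<bar>dint \<nu>1 \<nu>2 (\<lambda>x. \<phi> x \<bullet> u)\<bar> \<le> (L + e / (1 + w)) * w"
      using L by (intro main) linarith+
    also have "\<dots> \<le> L * w + e"
      using w e by (simp add: field_simps)
    finally show "\<bar>dint \<nu>1 \<nu>2 (\<lambda>x. \<phi> x \<bullet> u)\<bar> \<le> L * w + e" .
  qed
  moreover have "dint \<nu>1 \<nu>2 \<phi> \<bullet> u = norm (dint \<nu>1 \<nu>2 \<phi>)"
    unfolding u_def sgn_div_norm
    by (cases "dint \<nu>1 \<nu>2 \<phi> = 0") (simp_all add: power2_norm_eq_inner[symmetric] power2_eq_square)
  ultimately show ?thesis unfolding eq by simp
qed

lemma integrable_push_P2:
  fixes X :: "'y \<Rightarrow> 'x::euclidean_space"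
  assumes "X \<in> borel_measurable m" "push m X \<in> P2"
  shows "integrable m X"
proof -
  have "integrable (push m X) (\<lambda>x. x)"
    by (rule integrable_lipschitz[where L = 1, OF assms(2)]) simp
  then show ?thesis using integrable_distr[OF assms(1), of "\<lambda>x. x"] by blast
qed

text \<open>The pair \<open>(X, Y)\<close> couples the two laws, and integrating
  \<open>\<psi>\<close> along it is the elementary half of Kantorovich duality. Solution and flow
  live on the same space \<open>m\<close>, so this coupling is always at hand.\<close>

lemma kr_le_push:
  fixes X Y :: "'y \<Rightarrow> 'x::euclidean_space"
  assumes [measurable]: "X \<in> borel_measurable m" "Y \<in> borel_measurable m"
    and P: "push m X \<in> P2" "push m Y \<in> P2"
  shows "kr_le (push m X) (push m Y) (\<integral>x. norm (X x - Y x) \<partial>m)"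
  unfolding kr_le_def
proof (intro allI impI)
  fix \<psi> :: "'x \<Rightarrow> real"
  assume lip: "\<forall>x y. \<bar>\<psi> x - \<psi> y\<bar> \<le> norm (x - y)"
  have [measurable]: "\<psi> \<in> borel_measurable borel"
    by (intro borel_measurable_continuous_onI continuous_of_norm_lipschitz[where L = 1]) (use lip in simp)
  have "integrable (push m X) \<psi>" "integrable (push m Y) \<psi>"
    by (rule integrable_lipschitz[where L = 1], use P lip in simp, use lip in simp)+
  then have i2: "integrable m (\<lambda>x. \<psi> (X x))" "integrable m (\<lambda>x. \<psi> (Y x))"
    by (simp_all add: integrable_distr_eq)
  have i3: "integrable m X" "integrable m Y"
    by (rule integrable_push_P2; use P in simp)+
  have "dint (push m X) (push m Y) \<psi> = (\<integral>x. \<psi> (X x) - \<psi> (Y x) \<partial>m)"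
    by (simp add: dint_def integral_distr i2)
  also have "\<bar>\<dots>\<bar> \<le> (\<integral>x. \<bar>\<psi> (X x) - \<psi> (Y x)\<bar> \<partial>m)"
    using integral_norm_bound[of m "\<lambda>x. \<psi> (X x) - \<psi> (Y x)"] by simp
  also have "\<dots> \<le> (\<integral>x. norm (X x - Y x) \<partial>m)"
    by (rule integral_mono) (use i2 i3 lip in auto)
  finally show "\<bar>dint (push m X) (push m Y) \<psi>\<bar> \<le> (\<integral>x. norm (X x - Y x) \<partial>m)" .
qed

section \<open>Mixtures of measures and first moments\<close>

lemma sets_mix [simp]: "sets (mix \<theta> \<mu> \<nu>) = sets borel"
  unfolding mix_def using sets.sigma_sets_eq[of borel] by (simp add: sets_measure_of_conv)

lemma space_mix [simp]: "space (mix \<theta> \<mu> \<nu>) = UNIV"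
  using sets_eq_imp_space_eq[OF sets_mix] by simp

text \<open>Valid for every real \<open>\<theta>\<close>: \<open>ennreal\<close> cuts a negative
  weight off to 0, so the set function is a measure in any case.\<close>

lemma emeasure_mix:
  fixes \<mu> \<nu> :: "'x::euclidean_space measure"
  assumes "sets \<mu> = sets borel" "sets \<nu> = sets borel" "A \<in> sets borel"
  shows "emeasure (mix \<theta> \<mu> \<nu>) A = ennreal \<theta> * emeasure \<mu> A + ennreal (1 - \<theta>) * emeasure \<nu> A"
  unfolding mix_def
proof (rule emeasure_measure_of_sigma)
  show "sigma_algebra UNIV (sets (borel :: 'x measure))"
    using sets.sigma_algebra_axioms[of "borel :: 'x measure"] by simp
  show "positive (sets borel) (\<lambda>A. ennreal \<theta> * emeasure \<mu> A + ennreal (1 - \<theta>) * emeasure \<nu> A)"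
    by (simp add: positive_def)
  show "countably_additive (sets borel)
     (\<lambda>A. ennreal \<theta> * emeasure \<mu> A + ennreal (1 - \<theta>) * emeasure \<nu> A)"
  proof (rule countably_additiveI)
    fix F :: "nat \<Rightarrow> 'x set"
    assume F: "range F \<subseteq> sets borel" "disjoint_family F" "\<Union> (range F) \<in> sets borel"
    have "(\<Sum>i. ennreal \<theta> * emeasure \<mu> (F i) + ennreal (1 - \<theta>) * emeasure \<nu> (F i))
        = ennreal \<theta> * (\<Sum>i. emeasure \<mu> (F i)) + ennreal (1 - \<theta>) * (\<Sum>i. emeasure \<nu> (F i))"
      by (simp flip: suminf_add ennreal_suminf_cmult)
    also have "\<dots> = ennreal \<theta> * emeasure \<mu> (\<Union> (range F)) + ennreal (1 - \<theta>) * emeasure \<nu> (\<Union> (range F))"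
      using F assms by (simp add: suminf_emeasure)
    finally show "(\<Sum>i. ennreal \<theta> * emeasure \<mu> (F i) + ennreal (1 - \<theta>) * emeasure \<nu> (F i))
      = ennreal \<theta> * emeasure \<mu> (\<Union> (range F)) + ennreal (1 - \<theta>) * emeasure \<nu> (\<Union> (range F))" .
  qed
qed (use assms in auto)

lemma nn_integral_mix:
  fixes \<mu> \<nu> :: "'x::euclidean_space measure"
  assumes s: "sets \<mu> = sets borel" "sets \<nu> = sets borel"
    and "f \<in> borel_measurable borel"
  shows "(\<integral>\<^sup>+x. f x \<partial>mix \<theta> \<mu> \<nu>)
     = ennreal \<theta> * (\<integral>\<^sup>+x. f x \<partial>\<mu>) + ennreal (1 - \<theta>) * (\<integral>\<^sup>+x. f x \<partial>\<nu>)"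
  using assms(3)
proof (induction rule: borel_measurable_induct)
  case (cong f g)
  then have "f = g" by (auto simp: fun_eq_iff)
  with cong show ?case by simp
next
  case (set A)
  then show ?case using s emeasure_mix[OF s set] by simp
next
  case (mult u c)
  then show ?case
    by (simp add: nn_integral_cmult s measurable_cong_sets[OF s(1) refl] measurable_cong_sets[OF s(2) refl]
        measurable_cong_sets[OF sets_mix refl] distrib_left mult_ac)
next
  case (add u v)
  then show ?case
    by (simp add: nn_integral_add s measurable_cong_sets[OF s(1) refl] measurable_cong_sets[OF s(2) refl]
        measurable_cong_sets[OF sets_mix refl] distrib_left add_ac)
next
  case (seq U)
  have inc_U: "incseq U" and U: "\<And>i. U i \<in> borel_measurable borel"
    and IH: "\<And>i. (\<integral>\<^sup>+x. U i x \<partial>mix \<theta> \<mu> \<nu>)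
      = ennreal \<theta> * (\<integral>\<^sup>+x. U i x \<partial>\<mu>) + ennreal (1 - \<theta>) * (\<integral>\<^sup>+x. U i x \<partial>\<nu>)"
    using seq by blast+
  have e: "(\<integral>\<^sup>+x. (SUP i. U i) x \<partial>M) = (SUP i. \<integral>\<^sup>+x. U i x \<partial>M)"
    if "sets M = sets borel" for M :: "'x measure"
    unfolding SUP_apply
    by (rule nn_integral_monotone_convergence_SUP[OF inc_U])
      (simp add: measurable_cong_sets[OF that refl] U)
  have inc2: "incseq (\<lambda>i. c * (\<integral>\<^sup>+x. U i x \<partial>M))" for M :: "'x measure" and c :: ennreal
    using inc_U by (auto simp: incseq_def le_fun_def intro!: mult_left_mono nn_integral_mono)
  show ?case
    unfolding e[OF s(1)] e[OF s(2)] e[OF sets_mix] IH SUP_mult_left_ennreal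
    by (rule ennreal_SUP_add[OF inc2 inc2])
qed

lemma integrable_mix:
  fixes \<phi> :: "'x::euclidean_space \<Rightarrow> 'b::euclidean_space"
  assumes s: "sets \<mu> = sets borel" "sets \<nu> = sets borel"
    and i: "integrable \<mu> \<phi>" "integrable \<nu> \<phi>"
  shows "integrable (mix \<theta> \<mu> \<nu>) \<phi>"
proof (rule integrableI_bounded)
  have b: "\<phi> \<in> borel_measurable borel"
    using borel_measurable_integrable[OF i(1)] by (simp add: measurable_cong_sets[OF s(1) refl])
  then show "\<phi> \<in> borel_measurable (mix \<theta> \<mu> \<nu>)"
    by (simp add: measurable_cong_sets[OF sets_mix refl])
  show "(\<integral>\<^sup>+ x. ennreal (norm (\<phi> x)) \<partial>mix \<theta> \<mu> \<nu>) < \<infinity>"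
    using i b by (subst nn_integral_mix[OF s]) (auto simp: integrable_iff_bounded ennreal_mult_less_top)
qed

lemma integral_mix:
  fixes \<phi> :: "'x::euclidean_space \<Rightarrow> 'b::euclidean_space"
  assumes s: "sets \<mu> = sets borel" "sets \<nu> = sets borel" and \<theta>: "0 \<le> \<theta>" "\<theta> \<le> 1"
    and i: "integrable \<mu> \<phi>" "integrable \<nu> \<phi>"
  shows "(\<integral>x. \<phi> x \<partial>mix \<theta> \<mu> \<nu>) = \<theta> *\<^sub>R (\<integral>x. \<phi> x \<partial>\<mu>) + (1 - \<theta>) *\<^sub>R (\<integral>x. \<phi> x \<partial>\<nu>)"
proof (rule euclidean_eqI)
  fix b :: 'b assume "b \<in> Basis"
  define u where "u x = \<phi> x \<bullet> b" for x
  have iu: "integrable \<mu> u" "integrable \<nu> u" using i by (auto simp: u_def[abs_def])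
  have [measurable]: "u \<in> borel_measurable borel"
    using borel_measurable_integrable[OF iu(1)] by (simp add: measurable_cong_sets[OF s(1) refl])
  have ium: "integrable (mix \<theta> \<mu> \<nu>) u" by (rule integrable_mix[OF s iu])
  have fin: "(\<integral>\<^sup>+ x. ennreal (u x) \<partial>M) \<noteq> \<infinity> \<and> (\<integral>\<^sup>+ x. ennreal (- u x) \<partial>M) \<noteq> \<infinity>"
    if "integrable M u" for M
    using that by (simp add: real_integrable_def)
  \<comment> \<open>\<open>enn2real\<close> sends infinity to 0, so additivity is claimed for finite
    values only.\<close>
  have e: "enn2real (ennreal \<theta> * p + ennreal (1 - \<theta>) * q) = \<theta> * enn2real p + (1 - \<theta>) * enn2real q"
    if "p \<noteq> \<infinity>" "q \<noteq> \<infinity>" for p q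
    using that \<theta> by (simp add: enn2real_plus enn2real_mult ennreal_mult_less_top less_top[symmetric] ennreal_mult_eq_top_iff)
  have "integral\<^sup>L (mix \<theta> \<mu> \<nu>) u = \<theta> * integral\<^sup>L \<mu> u + (1 - \<theta>) * integral\<^sup>L \<nu> u"
    unfolding real_lebesgue_integral_def[OF iu(1)] real_lebesgue_integral_def[OF iu(2)]
      real_lebesgue_integral_def[OF ium]
    using fin[OF iu(1)] fin[OF iu(2)] by (simp add: nn_integral_mix[OF s] e algebra_simps)
  then show "(\<integral>x. \<phi> x \<partial>mix \<theta> \<mu> \<nu>) \<bullet> b = (\<theta> *\<^sub>R (\<integral>x. \<phi> x \<partial>\<mu>) + (1 - \<theta>) *\<^sub>R (\<integral>x. \<phi> x \<partial>\<nu>)) \<bullet> b"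
    using i integrable_mix[OF s i, of \<theta>] by (simp add: u_def[abs_def] inner_add_left)
qed

lemma mix_P2:
  assumes "\<mu> \<in> P2" "\<nu> \<in> P2" "0 \<le> \<theta>" "\<theta> \<le> 1"
  shows "mix \<theta> \<mu> \<nu> \<in> P2"
proof -
  note s = P2_D(2)[OF assms(1)] P2_D(2)[OF assms(2)]
  have "emeasure (mix \<theta> \<mu> \<nu>) UNIV = 1"
    using prob_space.emeasure_space_1[OF P2_D(1)[OF assms(1)]] P2_D(3)[OF assms(1)]
      prob_space.emeasure_space_1[OF P2_D(1)[OF assms(2)]] P2_D(3)[OF assms(2)] assms(3,4)
    by (simp add: emeasure_mix[OF s] flip: ennreal_plus)
  then have "prob_space (mix \<theta> \<mu> \<nu>)" by (intro prob_spaceI) simp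
  then show ?thesis
    using integrable_mix[OF s P2_D(4)[OF assms(1)] P2_D(4)[OF assms(2)]] by (simp add: P2_def)
qed

lemma moment_norm_1: "moment_norm 1 \<mu> = (\<integral>x. norm x \<partial>\<mu>)"
  by (simp add: moment_norm_def)

lemma moment_norm_1_nonneg: "0 \<le> moment_norm 1 \<mu>"
  unfolding moment_norm_1 by simp

lemma moment_norm_kr:
  assumes "kr_le \<mu> \<nu> w"
  shows "\<bar>moment_norm 1 \<mu> - moment_norm 1 \<nu>\<bar> \<le> w"
  using assms norm_triangle_ineq3 unfolding kr_le_def moment_norm_1 dint_def by auto

lemma moment_norm_mix:
  assumes "\<mu> \<in> P2" "\<nu> \<in> P2" "0 \<le> \<theta>" "\<theta> \<le> 1"
  shows "moment_norm 1 (mix \<theta> \<mu> \<nu>) = \<theta> * moment_norm 1 \<mu> + (1 - \<theta>) * moment_norm 1 \<nu>"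
proof -
  have i: "integrable M norm" if "M \<in> P2" for M :: "'a measure"
    using integrable_lipschitz[OF that, of norm 1] by (simp add: norm_triangle_ineq3)
  show ?thesis unfolding moment_norm_1
    by (simp add: integral_mix assms i[OF assms(1)] i[OF assms(2)] P2_D(2)[OF assms(1)] P2_D(2)[OF assms(2)])
qed

lemma return_P2 [simp]: "return borel y \<in> P2"
proof -
  have "integrable (return borel y) (\<lambda>x. (norm x)\<^sup>2)"
    by (rule integrableI_bounded) (auto simp: nn_integral_return)
  then show ?thesis by (auto simp: P2_def prob_space_return)
qed

lemma integral_return_borel [simp]:
  fixes \<phi> :: "'x::euclidean_space \<Rightarrow> 'b::euclidean_space"
  assumes "\<phi> \<in> borel_measurable borel"
  shows "(\<integral>x. \<phi> x \<partial>return borel y) = \<phi> y"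
  by (rule integral_return) (use assms in auto)

text \<open>Lets the origin serve as second point in the Lipschitz estimates; linear growth of the
  coefficients is read off from them in this way.\<close>

lemma kr_le_dirac0:
  assumes "\<mu> \<in> P2"
  shows "kr_le \<mu> dirac0 (moment_norm 1 \<mu>)"
  unfolding kr_le_def
proof (intro allI impI)
  fix \<psi> :: "'a \<Rightarrow> real"
  assume l: "\<forall>x y. \<bar>\<psi> x - \<psi> y\<bar> \<le> norm (x - y)"
  interpret prob_space \<mu> using assms by (rule P2_D)
  have c: "\<psi> \<in> borel_measurable borel"
    by (intro borel_measurable_continuous_onI continuous_of_norm_lipschitz[where L = 1]) (use l in simp)
  have i: "integrable \<mu> \<psi>" by (rule integrable_lipschitz[where L = 1]) (use assms l in auto)
  have i': "integrable \<mu> norm"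
    using integrable_lipschitz[OF assms, of norm 1] by (simp add: norm_triangle_ineq3)
  have "dint \<mu> dirac0 \<psi> = (\<integral>x. \<psi> x - \<psi> 0 \<partial>\<mu>)"
    using i by (simp add: dint_def c prob_space)
  also have "\<bar>\<dots>\<bar> \<le> (\<integral>x. \<bar>\<psi> x - \<psi> 0\<bar> \<partial>\<mu>)"
    using integral_norm_bound[of \<mu> "\<lambda>x. \<psi> x - \<psi> 0"] by simp
  also have "\<dots> \<le> (\<integral>x. norm x \<partial>\<mu>)"
    by (rule integral_mono) (use i i' l[rule_format, of _ 0] in auto)
  finally show "\<bar>dint \<mu> dirac0 \<psi>\<bar> \<le> moment_norm 1 \<mu>" unfolding moment_norm_1 .
qed

section \<open>Linear functional derivatives\<close>

lemma has_derivative_Dfr: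
  assumes "F differentiable (at u)"
  shows "(F has_derivative blinfun_apply (Dfr F u)) (at u)"
proof -
  have "(F has_derivative frechet_derivative F (at u)) (at u)"
    using assms frechet_derivative_works by blast
  then show ?thesis
    by (simp add: Dfr_def bounded_linear_Blinfun_apply has_derivative_bounded_linear)
qed

text \<open>A converse of the mean value inequality: difference quotients of \<open>F - G\<close> at
  \<open>u\<close> converge to the difference of the derivatives. It turns bounds on second
  differences into bounds on increments of a derivative, without any second derivative of
  \<open>F\<close> or \<open>G\<close>.\<close>

lemma norm_Dfr_diff_le:
  fixes F G :: "'u::real_normed_vector \<Rightarrow> 'v::real_normed_vector"
  assumes F: "F differentiable (at u)" and G: "G differentiable (at u)" and r: "r > 0" and c: "c \<ge> 0"
    and lip: "\<And>v. norm (v - u) < r \<Longrightarrow> norm ((F v - G v) - (F u - G u)) \<le> c * norm (v - u)"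
  shows "norm (Dfr F u - Dfr G u) \<le> c"
proof (rule norm_blinfun_bound[OF c])
  fix h :: 'u
  define A where "A = Dfr F u - Dfr G u"
  have dA: "((\<lambda>v. F v - G v) has_derivative blinfun_apply A) (at u)"
    using has_derivative_diff[OF has_derivative_Dfr[OF F] has_derivative_Dfr[OF G]]
    by (simp add: A_def minus_blinfun.rep_eq[symmetric] blinfun.diff_left[abs_def, symmetric])
  have "norm (A h) \<le> c * norm h"
  proof (cases "h = 0")
    case False
    show ?thesis
    proof (rule field_le_epsilon)
      fix e :: real assume e: "e > 0"
      define e' where "e' = e / norm h"
      have e': "e' > 0" using e False by (simp add: e'_def)
      obtain d where d: "d > 0"
        and dd: "\<And>y. norm (y - u) < d \<Longrightarrow> norm ((F y - G y) - (F u - G u) - A (y - u)) \<le> e' * norm (y - u)"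
        using dA e' unfolding has_derivative_at_alt by blast
      \<comment> \<open>Half of the smaller radius in direction \<open>h\<close>: both the expansion
        and the hypothesis apply at \<open>u + t *\<^sub>R h\<close>.\<close>
      define t where "t = min d r / (2 * norm h)"
      have t: "t > 0" using d r False by (simp add: t_def)
      have th: "norm (t *\<^sub>R h) < d" "norm (t *\<^sub>R h) < r"
        using d r False by (auto simp: t_def)
      have "norm (A (t *\<^sub>R h)) \<le> norm ((F (u + t *\<^sub>R h) - G (u + t *\<^sub>R h)) - (F u - G u))
          + norm ((F (u + t *\<^sub>R h) - G (u + t *\<^sub>R h)) - (F u - G u) - A (t *\<^sub>R h))"
        using norm_triangle_ineq4[of "(F (u + t *\<^sub>R h) - G (u + t *\<^sub>R h)) - (F u - G u)"
            "(F (u + t *\<^sub>R h) - G (u + t *\<^sub>R h)) - (F u - G u) - A (t *\<^sub>R h)"] by simp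
      also have "\<dots> \<le> c * norm (t *\<^sub>R h) + e' * norm (t *\<^sub>R h)"
        using lip[of "u + t *\<^sub>R h"] dd[of "u + t *\<^sub>R h"] th by (intro add_mono) simp_all
      finally have "t * norm (A h) \<le> t * (c * norm h + e' * norm h)"
        using t by (simp add: blinfun.scaleR_right algebra_simps)
      then show "norm (A h) \<le> c * norm h + e"
        using t False by (simp add: e'_def)
    qed
  qed simp
  then show "norm ((Dfr F u - Dfr G u) h) \<le> c * norm h" by (simp add: A_def)
qed

lemma norm_diff_le_Dfr:
  fixes F :: "'u::real_normed_vector \<Rightarrow> 'v::real_normed_vector"
  assumes "convex S" and "\<And>x. x \<in> S \<Longrightarrow> F differentiable (at x)"
    and "\<And>x. x \<in> S \<Longrightarrow> norm (Dfr F x) \<le> c" and "x \<in> S" "y \<in> S"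
  shows "norm (F x - F y) \<le> c * norm (x - y)"
  by (rule differentiable_bound[OF assms(1), where f' = "\<lambda>x. blinfun_apply (Dfr F x)"])
    (use assms in \<open>auto simp flip: norm_blinfun.rep_eq
      intro!: has_derivative_at_withinI[OF has_derivative_Dfr]\<close>)

lemma norm_diff_diff_le_Dfr:
  fixes F G :: "'u::real_normed_vector \<Rightarrow> 'v::real_normed_vector"
  assumes "convex S" and F: "\<And>x. x \<in> S \<Longrightarrow> F differentiable (at x)"
    and G: "\<And>x. x \<in> S \<Longrightarrow> G differentiable (at x)"
    and le: "\<And>x. x \<in> S \<Longrightarrow> norm (Dfr F x - Dfr G x) \<le> c" and "x \<in> S" "y \<in> S"
  shows "norm ((F x - G x) - (F y - G y)) \<le> c * norm (x - y)"
proof (rule differentiable_bound[OF assms(1), where f' = "\<lambda>x. blinfun_apply (Dfr F x - Dfr G x)"])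
  fix x assume x: "x \<in> S"
  show "((\<lambda>x. F x - G x) has_derivative blinfun_apply (Dfr F x - Dfr G x)) (at x within S)"
    using has_derivative_at_withinI[OF
        has_derivative_diff[OF has_derivative_Dfr[OF F[OF x]] has_derivative_Dfr[OF G[OF x]]]]
    by (simp add: blinfun.diff_left[abs_def])
qed (use assms in \<open>auto simp flip: norm_blinfun.rep_eq\<close>)

text \<open>A substitute for the symmetry of mixed derivatives: a bound on one order controls second
  differences of \<open>h\<close>, and these control increments of the derivative taken in the other
  order. (a1) bounds \<open>D_a (D_x f)\<close> and (a2) bounds \<open>D_x (D_a g)\<close>, whereas
  increments of \<open>D_a f\<close> in \<open>x\<close> and of \<open>D_x g\<close> in
  \<open>a\<close> are wanted.\<close>

lemma norm_Dfr_diff_interchange: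
  fixes h :: "'u::real_normed_vector \<Rightarrow> 'w::real_normed_vector \<Rightarrow> 'v::real_normed_vector"
  assumes du: "\<And>u w. (\<lambda>u. h u w) differentiable (at u)"
    and dw: "\<And>u w. h u differentiable (at w)"
    and duw: "\<And>u w. (\<lambda>w. Dfr (\<lambda>u. h u w) u) differentiable (at w)"
    and le: "\<And>u w. u \<in> closed_segment u1 u2 \<Longrightarrow> norm (Dfr (\<lambda>w. Dfr (\<lambda>u. h u w) u) w) \<le> c"
  shows "norm (Dfr (h u1) w0 - Dfr (h u2) w0) \<le> c * norm (u1 - u2)"
proof (rule norm_Dfr_diff_le[OF dw dw zero_less_one])
  have c: "0 \<le> c" using order_trans[OF norm_ge_zero le[of u1 w0]] by simp
  then show "0 \<le> c * norm (u1 - u2)" by simp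
  fix w :: 'w
  have "norm (Dfr (\<lambda>u. h u w) u - Dfr (\<lambda>u. h u w0) u) \<le> c * norm (w - w0)"
    if "u \<in> closed_segment u1 u2" for u
    by (rule norm_diff_le_Dfr[of UNIV "\<lambda>w. Dfr (\<lambda>u. h u w) u"]) (use duw le that in auto)
  then have "norm ((h u1 w - h u1 w0) - (h u2 w - h u2 w0)) \<le> c * norm (w - w0) * norm (u1 - u2)"
    by (intro norm_diff_diff_le_Dfr[of "closed_segment u1 u2" "\<lambda>u. h u w" "\<lambda>u. h u w0"]) (use du in auto)
  then show "norm ((h u1 w - h u2 w) - (h u1 w0 - h u2 w0)) \<le> c * norm (u1 - u2) * norm (w - w0)"
    by (simp add: algebra_simps)
qed

section \<open>Expansions of a functional along mixtures\<close>

lemma is_lfd_lfd: "\<exists>D. is_lfd h D \<Longrightarrow> is_lfd h (lfd h)"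
  unfolding lfd_def by (rule someI_ex[of "is_lfd h"])

lemma is_lfd2_lfd2: "\<exists>D. is_lfd2 h D \<Longrightarrow> is_lfd2 h (lfd2 h)"
  unfolding lfd2_def by (rule someI_ex[of "is_lfd2 h"])

lemma borel_measurable_differentiable:
  fixes F :: "'x::euclidean_space \<Rightarrow> 'b::euclidean_space"
  assumes "\<And>y. F differentiable (at y)"
  shows "F \<in> borel_measurable borel"
  using assms differentiable_imp_continuous_within
  by (intro borel_measurable_continuous_onI) (auto simp: continuous_on_eq_continuous_within)

lemma is_lfd_integrable:
  assumes D: "is_lfd h D" and "\<mu> \<in> P2" "\<nu> \<in> P2" and m: "D \<mu> \<in> borel_measurable borel"
  shows "integrable \<nu> (D \<mu>)"
proof -
  obtain c where "\<And>x. norm (D \<mu> x) \<le> c \<mu> * (1 + (norm x)\<^sup>2)"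
    using D \<open>\<mu> \<in> P2\<close> unfolding is_lfd_def by blast
  then show ?thesis by (rule integrable_quadratic_growth[OF \<open>\<nu> \<in> P2\<close> m])
qed

lemma dint_diff:
  assumes "integrable \<nu>1 \<phi>" "integrable \<nu>2 \<phi>" "integrable \<nu>1 \<psi>" "integrable \<nu>2 \<psi>"
  shows "dint \<nu>1 \<nu>2 (\<lambda>x. \<phi> x - \<psi> x) = dint \<nu>1 \<nu>2 \<phi> - dint \<nu>1 \<nu>2 \<psi>"
  using assms by (simp add: dint_def)

text \<open>By duality each integrand along the mixtures is at most \<open>L * w\<close>. Two
  functionals are compared because increments in a parameter have this shape; the derivatives are
  arbitrary witnesses of \<open>is_lfd\<close>, so that the zero functional can enter with
  derivative 0.\<close>

lemma lfd_diff_bound: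
  assumes h1: "is_lfd h1 D1" and h2: "is_lfd h2 D2" and P: "\<nu>1 \<in> P2" "\<nu>2 \<in> P2" and kr: "kr_le \<nu>1 \<nu>2 w"
    and m1: "\<And>\<mu>. \<mu> \<in> P2 \<Longrightarrow> D1 \<mu> \<in> borel_measurable borel"
    and m2: "\<And>\<mu>. \<mu> \<in> P2 \<Longrightarrow> D2 \<mu> \<in> borel_measurable borel"
    and lip: "\<And>\<theta> y y'. 0 \<le> \<theta> \<Longrightarrow> \<theta> \<le> 1 \<Longrightarrow>
      norm ((D1 (mix \<theta> \<nu>1 \<nu>2) y - D2 (mix \<theta> \<nu>1 \<nu>2) y) - (D1 (mix \<theta> \<nu>1 \<nu>2) y' - D2 (mix \<theta> \<nu>1 \<nu>2) y'))
        \<le> L * norm (y - y')"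
    and L: "0 \<le> L"
  shows "norm ((h1 \<nu>1 - h1 \<nu>2) - (h2 \<nu>1 - h2 \<nu>2)) \<le> L * w"
proof -
  let ?M = "\<lambda>\<theta>. mix \<theta> \<nu>1 \<nu>2"
  have "((\<lambda>\<theta>. dint \<nu>1 \<nu>2 (D1 (?M \<theta>)) - dint \<nu>1 \<nu>2 (D2 (?M \<theta>))) has_integral
      ((h1 \<nu>1 - h1 \<nu>2) - (h2 \<nu>1 - h2 \<nu>2))) {0..1}"
    using h1 h2 P unfolding is_lfd_def by (intro has_integral_diff) auto
  moreover have "norm (dint \<nu>1 \<nu>2 (D1 (?M \<theta>)) - dint \<nu>1 \<nu>2 (D2 (?M \<theta>))) \<le> L * w" if "\<theta> \<in> {0..1}" for \<theta>
  proof -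
    have M: "?M \<theta> \<in> P2" using that P by (auto intro: mix_P2)
    have "dint \<nu>1 \<nu>2 (D1 (?M \<theta>)) - dint \<nu>1 \<nu>2 (D2 (?M \<theta>)) = dint \<nu>1 \<nu>2 (\<lambda>x. D1 (?M \<theta>) x - D2 (?M \<theta>) x)"
      using is_lfd_integrable[OF h1 M _ m1[OF M]] is_lfd_integrable[OF h2 M _ m2[OF M]] P
      by (simp add: dint_diff)
    also have "norm \<dots> \<le> L * w"
      by (rule norm_dint_lipschitz[OF P kr lip]) (use that in auto)
    finally show ?thesis .
  qed
  ultimately have "norm ((h1 \<nu>1 - h1 \<nu>2) - (h2 \<nu>1 - h2 \<nu>2)) \<le> L * w * measure lborel {0..1::real}"
    by (intro has_integral_bound_real) (use L kr_le_nonneg[OF kr] in auto)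
  then show ?thesis by simp
qed

lemma is_lfd_zero: "is_lfd (\<lambda>_. 0) (\<lambda>_ _. 0)"
  unfolding is_lfd_def
  by (auto simp: jointly_continuous_def bounded_on_bounded_def dint_def intro!: exI[of _ "\<lambda>_. 0"] exI[of _ 1])

lemma lfd_bound:
  assumes h: "mu_differentiable h" and P: "\<nu>1 \<in> P2" "\<nu>2 \<in> P2" and kr: "kr_le \<nu>1 \<nu>2 w"
    and le: "\<And>\<theta> y. 0 \<le> \<theta> \<Longrightarrow> \<theta> \<le> 1 \<Longrightarrow> norm (D_mu h (mix \<theta> \<nu>1 \<nu>2) y) \<le> L"
  shows "norm (h \<nu>1 - h \<nu>2) \<le> L * w"
proof -
  have "norm ((h \<nu>1 - h \<nu>2) - (0 - 0)) \<le> L * w"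
  proof (rule lfd_diff_bound[OF is_lfd_lfd is_lfd_zero P kr])
    show "\<exists>D. is_lfd h D" using h by (simp add: mu_differentiable_def)
    show "lfd h \<mu> \<in> borel_measurable borel" if "\<mu> \<in> P2" for \<mu>
      using h that by (intro borel_measurable_differentiable) (auto simp: mu_differentiable_def)
    show "0 \<le> L" using order_trans[OF norm_ge_zero le[of 0 0]] by simp
    fix \<theta> :: real and y y' assume t: "0 \<le> \<theta>" "\<theta> \<le> 1"
    have "norm (lfd h (mix \<theta> \<nu>1 \<nu>2) y - lfd h (mix \<theta> \<nu>1 \<nu>2) y') \<le> L * norm (y - y')"
      by (rule norm_diff_le_Dfr[of UNIV])
        (use h t le mix_P2[OF P t] in \<open>auto simp: mu_differentiable_def D_mu_def\<close>)
    then show "norm (lfd h (mix \<theta> \<nu>1 \<nu>2) y - 0 - (lfd h (mix \<theta> \<nu>1 \<nu>2) y' - 0)) \<le> L * norm (y - y')"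
      by simp
  qed simp
  then show ?thesis by simp
qed

lemma regular2_mu_differentiable: "regular2 h \<Longrightarrow> mu_differentiable h"
  unfolding regular2_def mu_differentiable_def twice_differentiable_def by blast

text \<open>Interchange of derivatives once more, now between a parameter and the measure: what is
  bounded is the \<open>v\<close>-derivative of \<open>D_mu (h v)\<close>. The bound is asked for
  near \<open>u\<close> only, since the decay of the coefficients gives a uniform constant only
  there.\<close>

lemma norm_Dfr_diff_measure:
  fixes h :: "'u::real_normed_vector \<Rightarrow> 'x::euclidean_space measure \<Rightarrow> 'b::euclidean_space"
  assumes r: "r > 0" and P: "\<mu>1 \<in> P2" "\<mu>2 \<in> P2" and kr: "kr_le \<mu>1 \<mu>2 w"
    and h: "\<And>v. mu_differentiable (h v)"
    and dm: "\<And>v y \<mu>. \<mu> \<in> P2 \<Longrightarrow> (\<lambda>v. D_mu (h v) \<mu> y) differentiable (at v)"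
    and du: "\<And>\<mu>. \<mu> \<in> P2 \<Longrightarrow> (\<lambda>v. h v \<mu>) differentiable (at u)"
    and le: "\<And>v y \<theta>. norm (v - u) < r \<Longrightarrow> 0 \<le> \<theta> \<Longrightarrow> \<theta> \<le> 1 \<Longrightarrow>
      norm (Dfr (\<lambda>v. D_mu (h v) (mix \<theta> \<mu>1 \<mu>2) y) v) \<le> c"
  shows "norm (Dfr (\<lambda>v. h v \<mu>1) u - Dfr (\<lambda>v. h v \<mu>2) u) \<le> c * w"
proof (rule norm_Dfr_diff_le[OF du du r])
  have c: "0 \<le> c" using order_trans[OF norm_ge_zero le[of u 0 0]] r by simp
  then show "0 \<le> c * w" using kr_le_nonneg[OF kr] by simp
  fix v assume v: "norm (v - u) < r"
  have "norm ((h v \<mu>1 - h v \<mu>2) - (h u \<mu>1 - h u \<mu>2)) \<le> c * norm (v - u) * w"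
  proof (rule lfd_diff_bound[OF is_lfd_lfd is_lfd_lfd P kr])
    show "\<exists>D. is_lfd (h v) D" "\<exists>D. is_lfd (h u) D" using h by (auto simp: mu_differentiable_def)
    show "\<And>\<mu>. \<mu> \<in> P2 \<Longrightarrow> lfd (h v) \<mu> \<in> borel_measurable borel"
      "\<And>\<mu>. \<mu> \<in> P2 \<Longrightarrow> lfd (h u) \<mu> \<in> borel_measurable borel"
      using h by (auto intro!: borel_measurable_differentiable simp: mu_differentiable_def)
    show "0 \<le> c * norm (v - u)" using c by simp
    fix \<theta> :: real and y y' assume t: "0 \<le> \<theta>" "\<theta> \<le> 1"
    let ?M = "mix \<theta> \<mu>1 \<mu>2"
    have M: "?M \<in> P2" by (rule mix_P2[OF P t])
    have "norm (D_mu (h v) ?M y - D_mu (h u) ?M y) \<le> c * norm (v - u)" for y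
      by (rule norm_diff_le_Dfr[of "ball u r" "\<lambda>v. D_mu (h v) ?M y"])
        (use dm M le t v r in \<open>auto simp: dist_norm norm_minus_commute\<close>)
    then show "norm (lfd (h v) ?M y - lfd (h u) ?M y - (lfd (h v) ?M y' - lfd (h u) ?M y'))
      \<le> c * norm (v - u) * norm (y - y')"
      by (intro norm_diff_diff_le_Dfr[of UNIV])
        (use h M in \<open>auto simp: mu_differentiable_def D_mu_def\<close>)
  qed
  then show "norm ((h v \<mu>1 - h v \<mu>2) - (h u \<mu>1 - h u \<mu>2)) \<le> c * w * norm (v - u)"
    by (simp add: algebra_simps)
qed (use P in auto)

text \<open>Duality is applied twice, once in each variable of the kernel: a mixed derivative
  bounded by \<open>c\<close> makes second differences of \<open>lfd2 h\<close> at most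
  \<open>c\<close> times the product of the two displacements. Because the result is quadratic in
  \<open>w\<close>, it survives division by the mass of a small perturbation.\<close>

lemma lfd2_remainder:
  fixes h :: "'x::euclidean_space measure \<Rightarrow> 'b::euclidean_space"
  assumes h: "regular2 h" and P: "\<nu>1 \<in> P2" "\<nu>2 \<in> P2" and kr: "kr_le \<nu>1 \<nu>2 w"
    and le: "\<And>\<theta> y z. 0 \<le> \<theta> \<Longrightarrow> \<theta> \<le> 1 \<Longrightarrow> norm (D_mumu h (mix \<theta> \<nu>1 \<nu>2) y z) \<le> c"
  shows "norm (h \<nu>1 - h \<nu>2 - dint \<nu>1 \<nu>2 (lfd h \<nu>2)) \<le> c * w\<^sup>2"
proof -
  have c: "0 \<le> c" using order_trans[OF norm_ge_zero le[of 0 0 0]] by simp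
  have w: "0 \<le> w" by (rule kr_le_nonneg[OF kr])
  have h2: "is_lfd2 h (lfd2 h)" using h is_lfd2_lfd2 by (auto simp: regular2_def)
  have "\<exists>C. bounded_on_bounded C \<and>
      (\<forall>\<mu>\<in>P2. \<forall>x y. norm (lfd2 h \<mu> x y) \<le> C \<mu> * (1 + (norm x)\<^sup>2 + (norm y)\<^sup>2))"
    using h2 unfolding is_lfd2_def by (elim conjE)
  then obtain C
    where C: "\<And>\<mu> x y. \<mu> \<in> P2 \<Longrightarrow> norm (lfd2 h \<mu> x y) \<le> C \<mu> * (1 + (norm x)\<^sup>2 + (norm y)\<^sup>2)"
    by blast
  have sym: "lfd2 h \<mu> x y = lfd2 h \<mu> y x" if "\<mu> \<in> P2" for \<mu> x y
    using h2 that unfolding is_lfd2_def by blast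
  have diff: "lfd2 h \<mu> y differentiable (at z)" "(\<lambda>y. Dfr (lfd2 h \<mu> y) z) differentiable (at y)"
    if "\<mu> \<in> P2" for \<mu> y z
    using h that unfolding regular2_def by blast+
  have inner: "norm (dint \<nu>1 \<nu>2 (\<lambda>y. dint \<nu>1 \<nu>2 (\<lambda>x. lfd2 h M x y))) \<le> c * w\<^sup>2"
    if t: "0 \<le> t" "t \<le> 1" and M: "M = mix t \<nu>1 \<nu>2" for t M
  proof -
    have MP: "M \<in> P2" unfolding M by (rule mix_P2[OF P t])
    have int: "integrable \<nu> (\<lambda>x. lfd2 h M x y)" if "\<nu> \<in> P2" for \<nu> y
    proof (rule integrable_quadratic_growth[OF that])
      show "(\<lambda>x. lfd2 h M x y) \<in> borel_measurable borel"
        \<comment> \<open>Differentiability is known in the second argument; the symmetric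
          representative carries it to the first.\<close>
        unfolding sym[OF MP, of _ y] by (rule borel_measurable_differentiable) (rule diff[OF MP])
      fix x
      have C0: "0 \<le> C M" using order_trans[OF norm_ge_zero C[OF MP, of 0 0]] by simp
      have "norm (lfd2 h M x y) \<le> C M * (1 + (norm x)\<^sup>2 + (norm y)\<^sup>2)" by (rule C[OF MP])
      also have "\<dots> \<le> C M * ((1 + (norm y)\<^sup>2) * (1 + (norm x)\<^sup>2))"
        by (rule mult_left_mono[OF _ C0]) (simp add: algebra_simps)
      finally show "norm (lfd2 h M x y) \<le> C M * (1 + (norm y)\<^sup>2) * (1 + (norm x)\<^sup>2)"
        by (simp add: mult.assoc)
    qed
    have "norm (dint \<nu>1 \<nu>2 (\<lambda>x. lfd2 h M x y) - dint \<nu>1 \<nu>2 (\<lambda>x. lfd2 h M x y')) \<le> c * w * norm (y - y')" for y y'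
    proof -
      have "norm (Dfr (lfd2 h M y) z - Dfr (lfd2 h M y') z) \<le> c * norm (y - y')" for z
        by (rule norm_diff_le_Dfr[of UNIV "\<lambda>y. Dfr (lfd2 h M y) z"])
          (use diff[OF MP] le[OF t] M in \<open>auto simp: D_mumu_def\<close>)
      then have "norm ((lfd2 h M y x - lfd2 h M y' x) - (lfd2 h M y x' - lfd2 h M y' x')) \<le> c * norm (y - y') * norm (x - x')" for x x'
        by (intro norm_diff_diff_le_Dfr[of UNIV]) (use diff[OF MP] in auto)
      then have "norm ((lfd2 h M x y - lfd2 h M x y') - (lfd2 h M x' y - lfd2 h M x' y')) \<le> c * norm (y - y') * norm (x - x')" for x x'
        using sym[OF MP] by metis
      then have "norm (dint \<nu>1 \<nu>2 (\<lambda>x. lfd2 h M x y - lfd2 h M x y')) \<le> c * norm (y - y') * w"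
        by (rule norm_dint_lipschitz[OF P kr])
      then show ?thesis using int P by (simp add: dint_diff algebra_simps)
    qed
    then have "norm (dint \<nu>1 \<nu>2 (\<lambda>y. dint \<nu>1 \<nu>2 (\<lambda>x. lfd2 h M x y))) \<le> c * w * w"
      by (rule norm_dint_lipschitz[OF P kr])
    then show ?thesis by (simp add: power2_eq_square mult.assoc)
  qed
  have "((\<lambda>(l, \<theta>). \<theta> *\<^sub>R dint \<nu>1 \<nu>2 (\<lambda>y. dint \<nu>1 \<nu>2 (\<lambda>x. lfd2 h (mix (l * \<theta>) \<nu>1 \<nu>2) x y)))
     has_integral (h \<nu>1 - h \<nu>2 - dint \<nu>1 \<nu>2 (lfd h \<nu>2))) (cbox (0, 0) (1::real, 1::real))"
    using h2 P unfolding is_lfd2_def by blast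
  then have "norm (h \<nu>1 - h \<nu>2 - dint \<nu>1 \<nu>2 (lfd h \<nu>2)) \<le> c * w\<^sup>2 * measure lborel (cbox (0, 0) (1::real, 1::real))"
  proof (rule has_integral_bound[rotated])
    show "0 \<le> c * w\<^sup>2" using c by simp
    fix p :: "real \<times> real" assume p: "p \<in> cbox (0, 0) (1, 1)"
    obtain l \<theta> where lt: "p = (l, \<theta>)" by (cases p)
    have b: "0 \<le> l" "l \<le> 1" "0 \<le> \<theta>" "\<theta> \<le> 1" using p by (auto simp: lt)
    \<comment> \<open>\<open>\<theta>\<close> is estimated by 1 instead of being integrated, so the
      remainder has \<open>c\<close> where Taylor's formula has \<open>c / 2\<close>.\<close>
    have "norm (\<theta> *\<^sub>R dint \<nu>1 \<nu>2 (\<lambda>y. dint \<nu>1 \<nu>2 (\<lambda>x. lfd2 h (mix (l * \<theta>) \<nu>1 \<nu>2) x y))) \<le> 1 * (c * w\<^sup>2)"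
      unfolding norm_scaleR using b by (intro mult_mono inner[OF _ _ refl]) (auto simp: mult_le_one)
    then show "norm (case p of (l, \<theta>) \<Rightarrow> \<theta> *\<^sub>R dint \<nu>1 \<nu>2 (\<lambda>y. dint \<nu>1 \<nu>2 (\<lambda>x. lfd2 h (mix (l * \<theta>) \<nu>1 \<nu>2) x y))) \<le> c * w\<^sup>2"
      by (simp add: lt)
  qed
  then show ?thesis by (simp add: content_Pair)
qed

section \<open>Perturbation by a Dirac mass and regularity of the measure derivative\<close>

lemma kr_le_mono: "kr_le \<nu>1 \<nu>2 w \<Longrightarrow> w \<le> w' \<Longrightarrow> kr_le \<nu>1 \<nu>2 w'"
  unfolding kr_le_def by (meson order_trans)

lemma mix_0_1:
  assumes "sets \<mu> = sets borel" "sets \<nu> = sets borel"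
  shows "mix 1 \<mu> \<nu> = \<mu>" "mix 0 \<mu> \<nu> = \<nu>"
  by (rule measure_eqI; use assms in \<open>auto simp: emeasure_mix\<close>)+

lemma dint_mix_mix:
  fixes \<phi> :: "'x::euclidean_space \<Rightarrow> 'b::euclidean_space"
  assumes "\<mu> \<in> P2" "\<mu>' \<in> P2" "\<nu> \<in> P2" "\<nu>' \<in> P2" "0 \<le> \<theta>" "\<theta> \<le> 1"
    and "\<And>\<rho>. \<rho> \<in> P2 \<Longrightarrow> integrable \<rho> \<phi>"
  shows "dint (mix \<theta> \<mu> \<nu>) (mix \<theta> \<mu>' \<nu>') \<phi> = \<theta> *\<^sub>R dint \<mu> \<mu>' \<phi> + (1 - \<theta>) *\<^sub>R dint \<nu> \<nu>' \<phi>"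
  by (simp add: dint_def integral_mix assms P2_D(2) algebra_simps)

lemma dint_mix_param:
  fixes \<phi> :: "'x::euclidean_space \<Rightarrow> 'b::euclidean_space"
  assumes "\<mu> \<in> P2" "\<nu> \<in> P2" "0 \<le> s" "s \<le> 1" "0 \<le> t" "t \<le> 1"
    and "\<And>\<rho>. \<rho> \<in> P2 \<Longrightarrow> integrable \<rho> \<phi>"
  shows "dint (mix s \<mu> \<nu>) (mix t \<mu> \<nu>) \<phi> = (s - t) *\<^sub>R dint \<mu> \<nu> \<phi>"
  by (simp add: dint_def integral_mix assms P2_D(2) algebra_simps)

lemma kr_le_mix_param:
  assumes P: "\<mu> \<in> P2" "\<nu> \<in> P2" and t: "0 \<le> s" "s \<le> 1" "0 \<le> t" "t \<le> 1" and kr: "kr_le \<mu> \<nu> w"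
  shows "kr_le (mix s \<mu> \<nu>) (mix t \<mu> \<nu>) (\<bar>s - t\<bar> * w)"
  unfolding kr_le_def
proof (intro allI impI)
  fix \<psi> :: "'a \<Rightarrow> real" assume l: "\<forall>x y. \<bar>\<psi> x - \<psi> y\<bar> \<le> norm (x - y)"
  have "integrable \<rho> \<psi>" if "\<rho> \<in> P2" for \<rho>
    by (rule integrable_lipschitz[OF that, where L = 1]) (use l in auto)
  then have "\<bar>dint (mix s \<mu> \<nu>) (mix t \<mu> \<nu>) \<psi>\<bar> = \<bar>s - t\<bar> * \<bar>dint \<mu> \<nu> \<psi>\<bar>"
    by (simp add: dint_mix_param[OF P t] abs_mult)
  also have "\<dots> \<le> \<bar>s - t\<bar> * w"
    using kr l by (intro mult_left_mono) (auto simp: kr_le_def)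
  finally show "\<bar>dint (mix s \<mu> \<nu>) (mix t \<mu> \<nu>) \<psi>\<bar> \<le> \<bar>s - t\<bar> * w" .
qed

lemma kr_le_mix_mix:
  assumes P: "\<mu> \<in> P2" "\<mu>' \<in> P2" "\<nu> \<in> P2" "\<nu>' \<in> P2" and t: "0 \<le> \<theta>" "\<theta> \<le> 1"
    and kr: "kr_le \<mu> \<mu>' v" "kr_le \<nu> \<nu>' w"
  shows "kr_le (mix \<theta> \<mu> \<nu>) (mix \<theta> \<mu>' \<nu>') (\<theta> * v + (1 - \<theta>) * w)"
  unfolding kr_le_def
proof (intro allI impI)
  fix \<psi> :: "'a \<Rightarrow> real" assume l: "\<forall>x y. \<bar>\<psi> x - \<psi> y\<bar> \<le> norm (x - y)"
  have "integrable \<rho> \<psi>" if "\<rho> \<in> P2" for \<rho>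
    by (rule integrable_lipschitz[OF that, where L = 1]) (use l in auto)
  then have "\<bar>dint (mix \<theta> \<mu> \<nu>) (mix \<theta> \<mu>' \<nu>') \<psi>\<bar> \<le> \<theta> * \<bar>dint \<mu> \<mu>' \<psi>\<bar> + (1 - \<theta>) * \<bar>dint \<nu> \<nu>' \<psi>\<bar>"
    using t by (simp add: dint_mix_mix[OF P t] order_trans[OF abs_triangle_ineq] abs_mult)
  also have "\<dots> \<le> \<theta> * v + (1 - \<theta>) * w"
    using kr l t by (intro add_mono mult_left_mono) (auto simp: kr_le_def)
  finally show "\<bar>dint (mix \<theta> \<mu> \<nu>) (mix \<theta> \<mu>' \<nu>') \<psi>\<bar> \<le> \<theta> * v + (1 - \<theta>) * w" .
qed

lemma kr_le_return: "kr_le (return borel y) (return borel y') (norm (y - y'))"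
  unfolding kr_le_def
proof (intro allI impI)
  fix \<psi> :: "'a \<Rightarrow> real" assume l: "\<forall>x y. \<bar>\<psi> x - \<psi> y\<bar> \<le> norm (x - y)"
  then have "\<psi> \<in> borel_measurable borel"
    by (intro borel_measurable_continuous_onI continuous_of_norm_lipschitz[where L = 1]) simp
  then show "\<bar>dint (return borel y) (return borel y') \<psi>\<bar> \<le> norm (y - y')"
    using l by (simp add: dint_def)
qed

lemma kr_le_refl: "kr_le \<mu> \<mu> 0"
  by (simp add: kr_le_def dint_def)

text \<open>Joint continuity is stated in \<open>W2\<close>, so a small mass at \<open>y\<close>
  must be shown to be a small perturbation there. The coupling keeps the mass
  \<open>1 - \<epsilon>\<close> on the diagonal (\<open>b\<close>) and carries the mass
  \<open>\<epsilon>\<close> from \<open>\<mu>\<close> to \<open>y\<close>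
  (\<open>a\<close>).\<close>

lemma W2_mix_return:
  fixes \<mu> :: "'x::euclidean_space measure"
  assumes \<mu>: "\<mu> \<in> P2" and e: "0 \<le> \<epsilon>" "\<epsilon> \<le> 1"
  shows "W2 \<mu> (mix \<epsilon> (return borel y) \<mu>) \<le> sqrt (\<epsilon> * (\<integral>x. (dist x y)\<^sup>2 \<partial>\<mu>))"
proof -
  interpret prob_space \<mu> using \<mu> by (rule P2_D)
  note s = P2_D(2)[OF \<mu>]
  define a b where "a = distr \<mu> borel (\<lambda>x. (x, y))" and "b = distr \<mu> borel (\<lambda>x. (x, x))"
  have sab: "sets a = sets borel" "sets b = sets borel" by (simp_all add: a_def b_def)
  have [measurable]: "(\<lambda>x. (x, y)) \<in> measurable \<mu> borel" "(\<lambda>x. (x, x)) \<in> measurable \<mu> borel"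
    using \<mu> by (auto intro!: borel_measurable_continuous_onI continuous_intros)
  define \<pi> where "\<pi> = mix \<epsilon> a b"
  have sp\<pi>: "space \<pi> = UNIV" by (simp add: \<pi>_def)
  have [measurable]: "fst \<in> borel_measurable \<pi>" "snd \<in> borel_measurable \<pi>"
    by (auto simp: \<pi>_def measurable_cong_sets[OF sets_mix refl]
        intro!: borel_measurable_continuous_onI continuous_intros)
  have bm: "fst \<in> borel_measurable (borel :: ('x \<times> 'x) measure)" "snd \<in> borel_measurable (borel :: ('x \<times> 'x) measure)"
    by (auto intro!: borel_measurable_continuous_onI continuous_intros)
  have vim: "(fst :: 'x \<times> 'x \<Rightarrow> 'x) -` A \<in> sets borel" "(snd :: 'x \<times> 'x \<Rightarrow> 'x) -` A \<in> sets borel" if "A \<in> sets borel" for A :: "'x set"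
    using measurable_sets[OF bm(1) that] measurable_sets[OF bm(2) that] by auto
  have sp: "space \<mu> = UNIV" by (rule P2_D(3)[OF \<mu>])
  have A: "(emeasure a (fst -` A)) = emeasure \<mu> A" "(emeasure b (fst -` A)) = emeasure \<mu> A"
    "(emeasure b (snd -` A)) = emeasure \<mu> A" "(emeasure a (snd -` A)) = emeasure (return borel y) A"
    if "A \<in> sets borel" for A
    using vim[OF that] that
    by (auto simp: a_def b_def emeasure_distr vimage_def sp indicator_def emeasure_space_1[unfolded sp])
  have ee: "ennreal \<epsilon> + ennreal (1 - \<epsilon>) = 1" using e by (simp flip: ennreal_plus)
  have "distr \<pi> borel fst = \<mu>"
  proof (rule measure_eqI)
    fix B assume "B \<in> sets (distr \<pi> borel fst)"
    then have B: "B \<in> sets borel" by simp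
    have "emeasure (distr \<pi> borel fst) B = emeasure \<pi> (fst -` B)"
      using B by (simp add: emeasure_distr sp\<pi>)
    also have "\<dots> = (ennreal \<epsilon> + ennreal (1 - \<epsilon>)) * emeasure \<mu> B"
      using vim[OF B] by (simp add: \<pi>_def emeasure_mix[OF sab] A[OF B] distrib_right)
    finally show "emeasure (distr \<pi> borel fst) B = emeasure \<mu> B" unfolding ee by simp
  qed (simp add: s)
  moreover have "distr \<pi> borel snd = mix \<epsilon> (return borel y) \<mu>"
  proof (rule measure_eqI)
    fix B assume "B \<in> sets (distr \<pi> borel snd)"
    then have B: "B \<in> sets borel" by simp
    have "emeasure (distr \<pi> borel snd) B = emeasure \<pi> (snd -` B)"
      using B by (simp add: emeasure_distr sp\<pi>)
    then show "emeasure (distr \<pi> borel snd) B = emeasure (mix \<epsilon> (return borel y) \<mu>) B"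
      using vim[OF B] B s by (simp add: \<pi>_def emeasure_mix[OF sab] emeasure_mix A[OF B])
  qed simp
  ultimately have \<pi>: "\<pi> \<in> couplings \<mu> (mix \<epsilon> (return borel y) \<mu>)"
    by (simp add: couplings_def \<pi>_def)
  have m: "(\<lambda>z. (dist (fst z) (snd z))\<^sup>2) \<in> borel_measurable (borel :: ('x \<times> 'x) measure)"
    by (auto intro!: borel_measurable_continuous_onI continuous_intros)
  have int: "integrable \<mu> (\<lambda>x. (dist x y)\<^sup>2)"
  proof (rule integrable_quadratic_growth[OF \<mu>])
    show "(\<lambda>x. (dist x y)\<^sup>2) \<in> borel_measurable borel"
      by (auto intro!: borel_measurable_continuous_onI continuous_intros)
    fix x :: 'x
    have "(dist x y)\<^sup>2 \<le> (norm x + norm y)\<^sup>2"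
      by (rule power_mono) (simp_all add: dist_norm norm_triangle_ineq4)
    also have "\<dots> \<le> 2 * (norm x)\<^sup>2 + 2 * (norm y)\<^sup>2"
      using sum_squares_bound[of "norm x" "norm y"] by (simp add: power2_sum)
    also have "\<dots> \<le> (2 + 2 * (norm y)\<^sup>2) * (1 + (norm x)\<^sup>2)"
      by (simp add: algebra_simps)
    finally show "norm ((dist x y)\<^sup>2) \<le> (2 + 2 * (norm y)\<^sup>2) * (1 + (norm x)\<^sup>2)" by simp
  qed
  have iab: "integrable a (\<lambda>z. (dist (fst z) (snd z))\<^sup>2)" "integrable b (\<lambda>z. (dist (fst z) (snd z))\<^sup>2)"
    using int m by (simp_all add: a_def b_def integrable_distr_eq)
  have cost: "(\<integral>z. (dist (fst z) (snd z))\<^sup>2 \<partial>\<pi>) = \<epsilon> * (\<integral>x. (dist x y)\<^sup>2 \<partial>\<mu>)"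
    unfolding \<pi>_def integral_mix[OF sab e iab] using m by (simp add: a_def b_def integral_distr)
  have "(INF \<pi>\<in>couplings \<mu> (mix \<epsilon> (return borel y) \<mu>). \<integral>z. (dist (fst z) (snd z))\<^sup>2 \<partial>\<pi>)
      \<le> \<epsilon> * (\<integral>x. (dist x y)\<^sup>2 \<partial>\<mu>)"
    unfolding cost[symmetric] by (rule cINF_lower[OF bdd_belowI2[of _ 0] \<pi>]) simp
  then show ?thesis
    unfolding wasserstein_def sqrt_def by simp
qed

lemma jointly_continuous_mix_return:
  fixes D :: "'x::euclidean_space measure \<Rightarrow> 'x \<Rightarrow> 'b::metric_space"
  assumes D: "jointly_continuous UNIV (\<lambda>x \<mu>. D \<mu> x)" and \<mu>: "\<mu> \<in> P2"
    and e: "\<epsilon> \<longlonglongrightarrow> 0" "\<And>n. 0 \<le> \<epsilon> n" "\<And>n. \<epsilon> n \<le> 1"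
  shows "(\<lambda>n. D (mix (\<epsilon> n) (return borel y) \<mu>) x) \<longlonglongrightarrow> D \<mu> x"
proof (rule tendstoI)
  fix r :: real assume "r > 0"
  then obtain \<delta> where \<delta>: "\<delta> > 0"
    and c: "\<And>e' \<mu>'. \<mu>' \<in> P2 \<Longrightarrow> dist x e' < \<delta> \<Longrightarrow> W2 \<mu> \<mu>' < \<delta> \<Longrightarrow> dist (D \<mu> x) (D \<mu>' e') < r"
    using D \<mu> unfolding jointly_continuous_def by (metis UNIV_I)
  have "(\<lambda>n. sqrt (\<epsilon> n * (\<integral>x. (dist x y)\<^sup>2 \<partial>\<mu>))) \<longlonglongrightarrow> sqrt (0 * (\<integral>x. (dist x y)\<^sup>2 \<partial>\<mu>))"
    by (intro tendsto_intros e)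
  then have "eventually (\<lambda>n. sqrt (\<epsilon> n * (\<integral>x. (dist x y)\<^sup>2 \<partial>\<mu>)) < \<delta>) sequentially"
    using \<delta> by (auto dest: order_tendstoD)
  then show "eventually (\<lambda>n. dist (D (mix (\<epsilon> n) (return borel y) \<mu>) x) (D \<mu> x) < r) sequentially"
  proof eventually_elim
    case (elim n)
    then have "dist (D \<mu> x) (D (mix (\<epsilon> n) (return borel y) \<mu>) x) < r"
      using W2_mix_return[OF \<mu> e(2,3), of n y] \<delta> by (intro c mix_P2) (auto simp: \<mu> e)
    then show ?case by (simp add: dist_commute)
  qed
qed

lemma moment_norm_mix_ge:
  assumes "\<mu> \<in> P2" "\<nu> \<in> P2" "0 \<le> \<theta>" "\<theta> \<le> 1" "\<rho> \<le> moment_norm 1 \<mu>" "\<rho> \<le> moment_norm 1 \<nu>"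
  shows "\<rho> \<le> moment_norm 1 (mix \<theta> \<mu> \<nu>)"
proof -
  have "\<rho> = \<theta> * \<rho> + (1 - \<theta>) * \<rho>" by (simp add: algebra_simps)
  also have "\<dots> \<le> moment_norm 1 (mix \<theta> \<mu> \<nu>)"
    unfolding moment_norm_mix[OF assms(1-4)] using assms by (intro add_mono mult_left_mono) auto
  finally show ?thesis .
qed

text \<open>At least half of \<open>\<mu>\<close> survives. This is why the estimates below ask for
  first moment \<open>2 * \<rho>\<close> at the measure of interest and for bounds at measures above
  \<open>\<rho>\<close>.\<close>

lemma moment_norm_mix_return_ge:
  assumes "\<mu> \<in> P2" "0 \<le> \<epsilon>" "\<epsilon> \<le> 1 / 2" "2 * \<rho> \<le> moment_norm 1 \<mu>"
  shows "\<rho> \<le> moment_norm 1 (mix \<epsilon> (return borel y) \<mu>)"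
proof -
  have "(1 / 2) * moment_norm 1 \<mu> \<le> (1 - \<epsilon>) * moment_norm 1 \<mu>"
    using assms moment_norm_1_nonneg by (intro mult_right_mono) auto
  moreover have "0 \<le> \<epsilon> * moment_norm 1 (return borel y)"
    using assms moment_norm_1_nonneg by (intro mult_nonneg_nonneg)
  moreover have "moment_norm 1 (mix \<epsilon> (return borel y) \<mu>)
      = \<epsilon> * moment_norm 1 (return borel y) + (1 - \<epsilon>) * moment_norm 1 \<mu>"
    using assms by (intro moment_norm_mix) auto
  ultimately show ?thesis using assms(4) by linarith
qed

lemma regular2_integrable_lfd:
  assumes "regular2 h" "\<mu> \<in> P2" "\<nu> \<in> P2"
  shows "integrable \<nu> (lfd h \<mu>)"
  using assms by (intro is_lfd_integrable[OF is_lfd_lfd] borel_measurable_differentiable)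
    (auto simp: regular2_def twice_differentiable_def)

lemma dint_mix_return:
  fixes \<phi> :: "'x::euclidean_space \<Rightarrow> 'b::euclidean_space"
  assumes "\<mu> \<in> P2" "0 \<le> \<epsilon>" "\<epsilon> \<le> 1" and \<phi>: "\<And>\<rho>. \<rho> \<in> P2 \<Longrightarrow> integrable \<rho> \<phi>"
  shows "dint (mix \<epsilon> (return borel y) \<mu>) (mix \<epsilon> (return borel y') \<mu>) \<phi> = \<epsilon> *\<^sub>R (\<phi> y - \<phi> y')"
proof -
  have "\<phi> \<in> borel_measurable borel"
    using borel_measurable_integrable[OF \<phi>[OF return_P2]] by simp
  then show ?thesis using assms by (subst dint_mix_mix) (auto simp: dint_def)
qed

text \<open>Mixing in a mass \<open>\<epsilon>\<close> at \<open>y\<close> instead of \<open>x\<close> changes \<open>h\<close> by \<open>\<epsilon> (lfd h y - lfd h x)\<close> up to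
  \<open>O(\<epsilon>\<^sup>2)\<close>, so bounds on increments of \<open>h1 - h2\<close> pass to the measure derivative. The bounds are
  only assumed for measures with first moment at least \<open>\<rho>\<close>, because they come from the decay condition.\<close>

lemma norm_D_mu_diff_le:
  fixes h1 h2 :: "'x::euclidean_space measure \<Rightarrow> 'b::euclidean_space"
  assumes h: "regular2 h1" "regular2 h2" and \<mu>: "\<mu> \<in> P2" "2 * \<rho> \<le> moment_norm 1 \<mu>"
    and c1: "\<And>\<nu> y z. \<nu> \<in> P2 \<Longrightarrow> \<rho> \<le> moment_norm 1 \<nu> \<Longrightarrow> norm (D_mumu h1 \<nu> y z) \<le> c"
    and c2: "\<And>\<nu> y z. \<nu> \<in> P2 \<Longrightarrow> \<rho> \<le> moment_norm 1 \<nu> \<Longrightarrow> norm (D_mumu h2 \<nu> y z) \<le> c"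
    and K: "\<And>\<nu>1 \<nu>2 w. \<nu>1 \<in> P2 \<Longrightarrow> \<nu>2 \<in> P2 \<Longrightarrow> \<rho> \<le> moment_norm 1 \<nu>1 \<Longrightarrow> \<rho> \<le> moment_norm 1 \<nu>2 \<Longrightarrow>
      kr_le \<nu>1 \<nu>2 w \<Longrightarrow> norm ((h1 \<nu>1 - h1 \<nu>2) - (h2 \<nu>1 - h2 \<nu>2)) \<le> K * w"
    and K0: "0 \<le> K"
  shows "norm (D_mu h1 \<mu> x - D_mu h2 \<mu> x) \<le> K"
  unfolding D_mu_def
proof (rule norm_Dfr_diff_le[OF _ _ zero_less_one K0])
  show "lfd h1 \<mu> differentiable at x" "lfd h2 \<mu> differentiable at x"
    using h \<mu> by (auto simp: regular2_def twice_differentiable_def)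
  fix y :: 'x
  define d where "d = norm (y - x)"
  \<comment> \<open>Starting at 1/2 keeps half of \<open>\<mu>\<close> in the mixture.\<close>
  define \<epsilon> where "\<epsilon> n = 1 / (real n + 2)" for n
  have e: "0 < \<epsilon> n" "\<epsilon> n \<le> 1 / 2" for n by (auto simp: \<epsilon>_def field_simps)
  have e1: "0 \<le> \<epsilon> n" "\<epsilon> n \<le> 1" for n using e[of n] by auto
  have elim: "\<epsilon> \<longlonglongrightarrow> 0" unfolding \<epsilon>_def by real_asymp
  define \<nu> where "\<nu> n = mix (\<epsilon> n) (return borel x) \<mu>" for n
  define \<nu>' where "\<nu>' n = mix (\<epsilon> n) (return borel y) \<mu>" for n
  have P: "\<nu> n \<in> P2" "\<nu>' n \<in> P2" for n using e1 \<mu> by (auto simp: \<nu>_def \<nu>'_def intro!: mix_P2)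
  have M: "\<rho> \<le> moment_norm 1 (\<nu> n)" "\<rho> \<le> moment_norm 1 (\<nu>' n)" for n
    using e[of n] \<mu> by (auto simp: \<nu>_def \<nu>'_def intro!: moment_norm_mix_return_ge[unfolded One_nat_def])
  have kr: "kr_le (\<nu>' n) (\<nu> n) (\<epsilon> n * d)" for n
    using kr_le_mix_mix[OF return_P2 return_P2 \<mu>(1) \<mu>(1) e1[of n] kr_le_return kr_le_refl, of y x]
    by (simp add: \<nu>_def \<nu>'_def d_def)
  have exp: "norm (h (\<nu>' n) - h (\<nu> n) - \<epsilon> n *\<^sub>R (lfd h (\<nu> n) y - lfd h (\<nu> n) x)) \<le> c * (\<epsilon> n * d)\<^sup>2"
    if h: "regular2 h" and c: "\<And>\<nu> y z. \<nu> \<in> P2 \<Longrightarrow> \<rho> \<le> moment_norm 1 \<nu> \<Longrightarrow> norm (D_mumu h \<nu> y z) \<le> c"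
    for h :: "'x measure \<Rightarrow> 'b" and n
  proof -
    have "dint (\<nu>' n) (\<nu> n) (lfd h (\<nu> n)) = \<epsilon> n *\<^sub>R (lfd h (\<nu> n) y - lfd h (\<nu> n) x)"
      unfolding \<nu>'_def \<nu>_def by (rule dint_mix_return)
        (use \<mu> e1 P h in \<open>auto simp flip: \<nu>_def intro: regular2_integrable_lfd\<close>)
    moreover have "norm (h (\<nu>' n) - h (\<nu> n) - dint (\<nu>' n) (\<nu> n) (lfd h (\<nu> n))) \<le> c * (\<epsilon> n * d)\<^sup>2"
      by (rule lfd2_remainder[OF h P(2) P(1) kr])
        (auto intro!: c mix_P2 P moment_norm_mix_ge M)
    ultimately show ?thesis by simp
  qed
  let ?q = "\<lambda>n. (lfd h1 (\<nu> n) y - lfd h2 (\<nu> n) y) - (lfd h1 (\<nu> n) x - lfd h2 (\<nu> n) x)"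
  \<comment> \<open>Both remainders are quadratic in \<open>\<epsilon> n\<close>, so after division
    by it the bound on increments is all that remains in the limit.\<close>
  have le: "norm (?q n) \<le> K * d + 2 * c * d\<^sup>2 * \<epsilon> n" for n
  proof -
    define r1 where "r1 = h1 (\<nu>' n) - h1 (\<nu> n) - \<epsilon> n *\<^sub>R (lfd h1 (\<nu> n) y - lfd h1 (\<nu> n) x)"
    define r2 where "r2 = h2 (\<nu>' n) - h2 (\<nu> n) - \<epsilon> n *\<^sub>R (lfd h2 (\<nu> n) y - lfd h2 (\<nu> n) x)"
    define q0 where "q0 = (h1 (\<nu>' n) - h1 (\<nu> n)) - (h2 (\<nu>' n) - h2 (\<nu> n))"
    have eq: "\<epsilon> n *\<^sub>R ?q n = q0 - r1 + r2"
      by (simp add: q0_def r1_def r2_def algebra_simps)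
    have "\<epsilon> n * norm (?q n) = norm (q0 - r1 + r2)"
      unfolding eq[symmetric] using e(1)[of n] by simp
    also have "\<dots> \<le> norm q0 + norm r1 + norm r2"
      by (meson add_right_mono norm_triangle_ineq norm_triangle_ineq4 order_trans)
    also have "\<dots> \<le> K * (\<epsilon> n * d) + c * (\<epsilon> n * d)\<^sup>2 + c * (\<epsilon> n * d)\<^sup>2"
      unfolding q0_def r1_def r2_def
      by (intro add_mono K[OF P(2,1) M(2,1) kr] exp[OF h(1) c1] exp[OF h(2) c2]) auto
    also have "\<dots> = \<epsilon> n * (K * d + 2 * c * d\<^sup>2 * \<epsilon> n)"
      by (simp add: power2_eq_square algebra_simps)
    finally show ?thesis using e(1)[of n] by simp
  qed
  \<comment> \<open>The expansion yields the derivative at \<open>\<nu> n\<close>; joint continuity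
    brings it back to \<open>\<mu>\<close>.\<close>
  have lim: "(\<lambda>n. lfd h (\<nu> n) z) \<longlonglongrightarrow> lfd h \<mu> z" if "regular2 h" for h :: "'x measure \<Rightarrow> 'b" and z
    unfolding \<nu>_def using that is_lfd_lfd[of h] \<mu> elim e1
    by (intro jointly_continuous_mix_return) (auto simp: regular2_def is_lfd_def)
  have "(\<lambda>n. norm (?q n)) \<longlonglongrightarrow> norm ((lfd h1 \<mu> y - lfd h2 \<mu> y) - (lfd h1 \<mu> x - lfd h2 \<mu> x))"
    by (intro tendsto_intros lim h)
  moreover have "(\<lambda>n. K * d + 2 * c * d\<^sup>2 * \<epsilon> n) \<longlonglongrightarrow> K * d + 2 * c * d\<^sup>2 * 0"
    by (intro tendsto_intros elim)
  ultimately show "norm ((lfd h1 \<mu> y - lfd h2 \<mu> y) - (lfd h1 \<mu> x - lfd h2 \<mu> x)) \<le> K * norm (y - x)"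
    using le by (auto intro!: LIMSEQ_le simp flip: d_def)
qed

text \<open>Same perturbation, along a subdivision of the segment from \<open>\<mu>1\<close> to \<open>\<mu>2\<close> into \<open>N\<close> pieces with
  \<open>\<epsilon> d = w / N\<close>: each of the \<open>N\<close> steps costs \<open>O((w / N)\<^sup>2)\<close>, and dividing the sum by \<open>\<epsilon>\<close>
  leaves \<open>O(w d)\<close>. No regularity of the second-order derivative beyond its bound is used.\<close>

lemma D_mu_lipschitz:
  fixes h :: "'x::euclidean_space measure \<Rightarrow> 'b::euclidean_space"
  assumes h: "regular2 h" and P: "\<mu>1 \<in> P2" "\<mu>2 \<in> P2"
    and \<rho>: "2 * \<rho> \<le> moment_norm 1 \<mu>1" "2 * \<rho> \<le> moment_norm 1 \<mu>2" and kr: "kr_le \<mu>1 \<mu>2 w"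
    and c: "\<And>\<nu> y z. \<nu> \<in> P2 \<Longrightarrow> \<rho> \<le> moment_norm 1 \<nu> \<Longrightarrow> norm (D_mumu h \<nu> y z) \<le> c"
    and c0: "0 \<le> c"
  shows "norm (D_mu h \<mu>1 x - D_mu h \<mu>2 x) \<le> 6 * c * w"
proof -
  \<comment> \<open>\<open>w > 0\<close> makes the mass \<open>\<epsilon> n\<close> positive; the
    case \<open>w = 0\<close> is reached at the end by enlarging \<open>w\<close>.\<close>
  have pos: "norm (D_mu h \<mu>1 x - D_mu h \<mu>2 x) \<le> 6 * c * w"
    if w: "0 < w" and kr: "kr_le \<mu>1 \<mu>2 w" for w
    unfolding D_mu_def
  proof (rule norm_Dfr_diff_le[OF _ _ zero_less_one])
    show "lfd h \<mu>1 differentiable at x" "lfd h \<mu>2 differentiable at x"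
      using h P by (auto simp: regular2_def twice_differentiable_def)
    show "0 \<le> 6 * c * w" using c0 w by simp
    fix y :: 'x
    define d where "d = norm (y - x)"
    show "norm ((lfd h \<mu>1 y - lfd h \<mu>2 y) - (lfd h \<mu>1 x - lfd h \<mu>2 x)) \<le> 6 * c * w * norm (y - x)"
    proof (cases "y = x")
      case False
      then have d: "d > 0" by (simp add: d_def)
      \<comment> \<open>At least \<open>2 * w / d\<close> pieces, so that the mass
        \<open>\<epsilon> n\<close> is at most 1/2.\<close>
      define N0 where "N0 = nat \<lceil>2 * w / d\<rceil>"
      define N where "N n = n + N0 + 1" for n
      have N: "0 < N n" for n by (simp add: N_def)
      define \<epsilon> where "\<epsilon> n = w / (d * real (N n))" for n
      have Nge: "2 * w / d \<le> real (N n)" for n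
        unfolding N_def N0_def by linarith
      have e: "0 < \<epsilon> n" "\<epsilon> n \<le> 1 / 2" for n
        using Nge[of n] w d N[of n] by (auto simp: \<epsilon>_def field_simps)
      have e1: "0 \<le> \<epsilon> n" "\<epsilon> n \<le> 1" for n using e[of n] by auto
      have ed: "\<epsilon> n * d = w / N n" for n using d by (simp add: \<epsilon>_def)
      have elim: "\<epsilon> \<longlonglongrightarrow> 0"
        using d unfolding \<epsilon>_def N_def by real_asymp
      define \<kappa> where "\<kappa> n i = mix (real i / real (N n)) \<mu>1 \<mu>2" for n i
      define \<nu> where "\<nu> n i = mix (\<epsilon> n) (return borel x) (\<kappa> n i)" for n i
      define \<nu>' where "\<nu>' n i = mix (\<epsilon> n) (return borel y) (\<kappa> n i)" for n i
      let ?A = "\<lambda>n i. lfd h (\<nu> n i) y - lfd h (\<nu> n i) x"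
      have step: "\<epsilon> n * norm (?A n (Suc i) - ?A n i) \<le> 6 * c * (w / N n)\<^sup>2" if i: "i < N n" for n i
      proof -
        have t: "0 \<le> real i / real (N n)" "real i / real (N n) \<le> 1"
          "0 \<le> real (Suc i) / real (N n)" "real (Suc i) / real (N n) \<le> 1" using i by auto
        have K: "\<kappa> n i \<in> P2" "\<kappa> n (Suc i) \<in> P2" unfolding \<kappa>_def by (intro mix_P2 P t)+
        have KM: "2 * \<rho> \<le> moment_norm 1 (\<kappa> n i)" "2 * \<rho> \<le> moment_norm 1 (\<kappa> n (Suc i))"
          unfolding \<kappa>_def by (intro moment_norm_mix_ge P t \<rho>)+
        have Kkr: "kr_le (\<kappa> n (Suc i)) (\<kappa> n i) (w / N n)"
          using kr_le_mix_param[OF P t(3,4) t(1,2) kr] N[of n]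
          unfolding \<kappa>_def by (simp add: diff_divide_distrib[symmetric])
        have V: "\<nu> n i \<in> P2" "\<nu> n (Suc i) \<in> P2" "\<nu>' n i \<in> P2" "\<nu>' n (Suc i) \<in> P2"
          using e1 K by (auto simp: \<nu>_def \<nu>'_def intro!: mix_P2)
        have VM: "\<rho> \<le> moment_norm 1 (\<nu> n i)" "\<rho> \<le> moment_norm 1 (\<nu> n (Suc i))"
          "\<rho> \<le> moment_norm 1 (\<nu>' n i)" "\<rho> \<le> moment_norm 1 (\<nu>' n (Suc i))"
          unfolding \<nu>_def \<nu>'_def using e[of n] by (intro moment_norm_mix_return_ge K KM; simp)+
        have wN: "0 \<le> w / N n" using w by simp
        have le1: "(1 - \<epsilon> n) * (w / N n) \<le> w / N n"
          using mult_right_mono[of "1 - \<epsilon> n" 1, OF _ wN] e1[of n] by simp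
        have kr1: "kr_le (\<nu>' n (Suc i)) (\<nu> n i) (2 * (w / N n))"
          unfolding \<nu>_def \<nu>'_def
          by (rule kr_le_mono[OF kr_le_mix_mix[OF return_P2 return_P2 K(2,1) e1[of n] kr_le_return Kkr]])
            (use le1 ed[of n] in \<open>simp flip: d_def\<close>)
        have kr2: "kr_le (\<nu> n (Suc i)) (\<nu> n i) (w / N n)"
          unfolding \<nu>_def
          by (rule kr_le_mono[OF kr_le_mix_mix[OF return_P2 return_P2 K(2,1) e1[of n] kr_le_refl Kkr]])
            (use le1 in simp)
        have kr3: "kr_le (\<nu>' n j) (\<nu> n j) (w / N n)" if "\<kappa> n j \<in> P2" for j
          using kr_le_mix_mix[OF return_P2 return_P2 that that e1[of n] kr_le_return kr_le_refl, of y x] ed[of n]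
          unfolding \<nu>_def \<nu>'_def by (simp add: d_def)
        define R where "R a b = h a - h b - dint a b (lfd h b)" for a b
        have R: "norm (R a b) \<le> c * v\<^sup>2"
          if "a \<in> P2" "b \<in> P2" "\<rho> \<le> moment_norm 1 a" "\<rho> \<le> moment_norm 1 b" "kr_le a b v" for a b v
          unfolding R_def by (rule lfd2_remainder[OF h])
            (use that in \<open>auto intro!: c mix_P2 moment_norm_mix_ge[unfolded One_nat_def]\<close>)
        have int: "integrable \<sigma> (lfd h \<tau>)" if "\<sigma> \<in> P2" "\<tau> \<in> P2" for \<sigma> \<tau>
          by (rule regular2_integrable_lfd[OF h that(2,1)])
        have A: "dint (\<nu>' n j) (\<nu> n j) (lfd h \<tau>) = \<epsilon> n *\<^sub>R (lfd h \<tau> y - lfd h \<tau> x)"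
          if "\<kappa> n j \<in> P2" "\<tau> \<in> P2" for j \<tau>
          unfolding \<nu>_def \<nu>'_def by (rule dint_mix_return[OF that(1) e1 int[OF _ that(2)]])
        have split: "dint a b \<phi> = dint a b' \<phi> + dint b' b \<phi>" for a b b' and \<phi> :: "'x \<Rightarrow> 'b"
          by (simp add: dint_def)
        \<comment> \<open>In this combination all values of \<open>h\<close> cancel, and of the
          first-order terms only those remain that pair the move from \<open>x\<close> to
          \<open>y\<close> with the two derivatives.\<close>
        have "\<epsilon> n *\<^sub>R (?A n (Suc i) - ?A n i)
          = R (\<nu>' n (Suc i)) (\<nu> n i) - R (\<nu> n (Suc i)) (\<nu> n i) - R (\<nu>' n (Suc i)) (\<nu> n (Suc i))"
          unfolding R_def A[OF K(2) V(2)] split[of "\<nu>' n (Suc i)" "\<nu> n i" _ "\<nu> n (Suc i)"] A[OF K(2) V(1)]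
          by (simp add: algebra_simps)
        then have "\<epsilon> n * norm (?A n (Suc i) - ?A n i)
          = norm (R (\<nu>' n (Suc i)) (\<nu> n i) - R (\<nu> n (Suc i)) (\<nu> n i) - R (\<nu>' n (Suc i)) (\<nu> n (Suc i)))"
          using e(1)[of n] by (metis abs_of_pos norm_scaleR)
        also have "\<dots> \<le> norm (R (\<nu>' n (Suc i)) (\<nu> n i)) + norm (R (\<nu> n (Suc i)) (\<nu> n i))
            + norm (R (\<nu>' n (Suc i)) (\<nu> n (Suc i)))"
          by (meson add_right_mono norm_triangle_ineq4 order_trans)
        \<comment> \<open>The diagonal move has length \<open>2 * (w / N n)\<close>, the other two
          \<open>w / N n\<close>: hence \<open>4 + 1 + 1 = 6\<close>.\<close>
        also have "\<dots> \<le> c * (2 * (w / N n))\<^sup>2 + c * (w / N n)\<^sup>2 + c * (w / N n)\<^sup>2"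
          by (intro add_mono R V VM kr1 kr2 kr3 K)
        finally show ?thesis unfolding power_mult_distrib by simp
      qed
      have bound: "norm (?A n (N n) - ?A n 0) \<le> 6 * c * w * d" for n
      proof -
        have "norm (?A n (N n) - ?A n 0) = norm (\<Sum>i<N n. ?A n (Suc i) - ?A n i)"
          by (rule arg_cong[OF sum_lessThan_telescope[of "?A n" "N n", symmetric]])
        also have "\<dots> \<le> (\<Sum>i<N n. norm (?A n (Suc i) - ?A n i))" by (rule norm_sum)
        also have "\<dots> \<le> (\<Sum>i<N n. 6 * c * (w / N n)\<^sup>2 / \<epsilon> n)"
          using step e(1)[of n] by (intro sum_mono) (auto simp: field_simps)
        also have "\<dots> = 6 * c * w * d"
          using w d N[of n] by (simp add: \<epsilon>_def power2_eq_square field_simps)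
        finally show ?thesis .
      qed
      have ends: "\<kappa> n (N n) = \<mu>1" "\<kappa> n 0 = \<mu>2" for n
        using N[of n] P by (simp_all add: \<kappa>_def mix_0_1 P2_D(2))
      have lim: "(\<lambda>n. lfd h (mix (\<epsilon> n) (return borel x) \<mu>) z) \<longlonglongrightarrow> lfd h \<mu> z" if "\<mu> \<in> P2" for \<mu> z
        using that h is_lfd_lfd[of h] elim e1
        by (intro jointly_continuous_mix_return) (auto simp: regular2_def is_lfd_def)
      have "(\<lambda>n. norm (?A n (N n) - ?A n 0)) \<longlonglongrightarrow>
          norm ((lfd h \<mu>1 y - lfd h \<mu>1 x) - (lfd h \<mu>2 y - lfd h \<mu>2 x))"
        unfolding \<nu>_def ends by (intro tendsto_intros lim P)
      then have "norm ((lfd h \<mu>1 y - lfd h \<mu>1 x) - (lfd h \<mu>2 y - lfd h \<mu>2 x)) \<le> 6 * c * w * d"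
        by (rule LIMSEQ_le_const2) (use bound in auto)
      then show ?thesis by (simp add: d_def algebra_simps)
    qed simp
  qed
  show ?thesis
  proof (rule field_le_epsilon)
    fix e :: real assume e: "e > 0"
    define v where "v = w + e / (6 * c + 1)"
    have w: "0 \<le> w" by (rule kr_le_nonneg[OF kr])
    have q: "0 < e / (6 * c + 1)" using e c0 by simp
    have "norm (D_mu h \<mu>1 x - D_mu h \<mu>2 x) \<le> 6 * c * v"
      using w q by (intro pos kr_le_mono[OF kr]) (auto simp: v_def)
    also have "\<dots> \<le> 6 * c * w + e"
      using c0 e by (simp add: v_def field_simps)
    finally show "norm (D_mu h \<mu>1 x - D_mu h \<mu>2 x) \<le> 6 * c * w + e" .
  qed
qed

section \<open>Partial derivatives, gradients, and the weight of the cone\<close>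

lemma Dfr_eqI:
  assumes "(F has_derivative A) (at u)"
  shows "Dfr F u = Blinfun A"
  unfolding Dfr_def frechet_derivative_at[OF assms] ..

lemma Dfr_comp_affine:
  fixes P :: "'u::real_normed_vector \<Rightarrow> 'v::real_normed_vector"
    and c :: "'w::real_normed_vector \<Rightarrow> 'u"
  assumes P: "P differentiable (at (c x))" and c: "(c has_derivative blinfun_apply B) (at x)"
  shows "(\<lambda>x. P (c x)) differentiable (at x)" "Dfr (\<lambda>x. P (c x)) x = Dfr P (c x) o\<^sub>L B"
proof -
  have "((\<lambda>x. P (c x)) has_derivative (\<lambda>v. Dfr P (c x) (B v))) (at x)"
    by (rule has_derivative_compose[OF c has_derivative_Dfr[OF P]])
  then have *: "((\<lambda>x. P (c x)) has_derivative blinfun_apply (Dfr P (c x) o\<^sub>L B)) (at x)"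
    by (simp add: blinfun_compose.rep_eq o_def)
  then show "(\<lambda>x. P (c x)) differentiable (at x)" by (rule differentiableI)
  show "Dfr (\<lambda>x. P (c x)) x = Dfr P (c x) o\<^sub>L B"
    using Dfr_eqI[OF *] by (simp add: blinfun_apply_inverse)
qed

text \<open>A partial derivative is the joint derivative composed with one of the constant
  injections \<open>B1\<close>, \<open>B2\<close>. Composition is linear in the joint derivative, so
  differentiability of the latter passes to all pure and mixed second partials.\<close>

lemma twice_differentiable_pair:
  fixes F :: "'u::real_normed_vector \<Rightarrow> 'w::real_normed_vector \<Rightarrow> 'v::real_normed_vector"
  assumes "twice_differentiable (\<lambda>(x, a). F x a)"
  shows "(\<lambda>x. F x a) differentiable (at x)" "F x differentiable (at a)"
    "(\<lambda>x. Dfr (\<lambda>x. F x a) x) differentiable (at x)"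
    "(\<lambda>a. Dfr (\<lambda>x. F x a) x) differentiable (at a)"
    "(\<lambda>x. Dfr (F x) a) differentiable (at x)"
    "(\<lambda>a. Dfr (F x) a) differentiable (at a)"
proof -
  let ?P = "\<lambda>(x, a). F x a"
  define B1 :: "'u \<Rightarrow>\<^sub>L ('u \<times> 'w)" where "B1 = Blinfun (\<lambda>h. (h, 0))"
  define B2 :: "'w \<Rightarrow>\<^sub>L ('u \<times> 'w)" where "B2 = Blinfun (\<lambda>h. (0, h))"
  have B: "blinfun_apply B1 = (\<lambda>h. (h, 0))" "blinfun_apply B2 = (\<lambda>h. (0, h))"
    unfolding B1_def B2_def
    by (auto intro!: bounded_linear_Blinfun_apply bounded_linear_Pair bounded_linear_ident bounded_linear_zero)
  have c1: "((\<lambda>x. (x, a)) has_derivative blinfun_apply B1) (at x)" for x a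
    unfolding B by (auto intro!: derivative_eq_intros)
  have c2: "((\<lambda>a. (x, a)) has_derivative blinfun_apply B2) (at a)" for x a
    unfolding B by (auto intro!: derivative_eq_intros)
  have P: "?P differentiable (at p)" "Dfr ?P differentiable (at p)" for p
    using assms unfolding twice_differentiable_def by blast+
  note x = Dfr_comp_affine[OF P(1) c1, simplified] and a = Dfr_comp_affine[OF P(1) c2, simplified]
  note dx = Dfr_comp_affine(1)[OF P(2) c1] and da = Dfr_comp_affine(1)[OF P(2) c2]
  have comp: "(\<lambda>x. A x o\<^sub>L B) differentiable (at x)" if "A differentiable (at x)"
    for A :: "'s::real_normed_vector \<Rightarrow> ('u \<times> 'w) \<Rightarrow>\<^sub>L 'v" and B :: "'t::real_normed_vector \<Rightarrow>\<^sub>L ('u \<times> 'w)" and x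
    using bounded_linear.has_derivative[OF bounded_bilinear.bounded_linear_left[OF bounded_bilinear_blinfun_compose]
        has_derivative_Dfr[OF that]]
    by (rule differentiableI)
  show "(\<lambda>x. F x a) differentiable (at x)" by (rule x(1))
  show "F x differentiable (at a)" by (rule a(1))
  show "(\<lambda>x. Dfr (\<lambda>x. F x a) x) differentiable (at x)" unfolding x(2) by (intro comp dx)
  show "(\<lambda>a. Dfr (\<lambda>x. F x a) x) differentiable (at a)" unfolding x(2) by (intro comp da)
  show "(\<lambda>x. Dfr (F x) a) differentiable (at x)" unfolding a(2) by (intro comp dx)
  show "(\<lambda>a. Dfr (F x) a) differentiable (at a)" unfolding a(2) by (intro comp da)
qed

lemma norm_dotD_le:
  fixes A :: "'u::euclidean_space \<Rightarrow>\<^sub>L 'v::euclidean_space"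
  shows "norm (A \<bullet>\<^sub>D z) \<le> DIM('u) * (norm A * norm z)"
proof -
  have "norm (A \<bullet>\<^sub>D z) \<le> (\<Sum>b\<in>(Basis :: 'u set). norm A * norm z)"
    unfolding dotD_def
  proof (rule order_trans[OF norm_sum sum_mono])
    fix b :: 'u assume b: "b \<in> Basis"
    have "\<bar>blinfun_apply A b \<bullet> z\<bar> \<le> norm (blinfun_apply A b) * norm z" by (rule Cauchy_Schwarz_ineq2)
    also have "\<dots> \<le> norm A * norm z"
      using norm_blinfun[of A b] b by (intro mult_right_mono) auto
    finally show "norm ((blinfun_apply A b \<bullet> z) *\<^sub>R b) \<le> norm A * norm z" using b by simp
  qed
  then show ?thesis by simp
qed

lemma norm_grad_le:
  fixes A :: "'u::euclidean_space \<Rightarrow>\<^sub>L real"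
  shows "norm (grad A) \<le> DIM('u) * norm A"
proof -
  have "norm (grad A) \<le> (\<Sum>b\<in>(Basis :: 'u set). norm A)"
    unfolding grad_def
  proof (rule order_trans[OF norm_sum sum_mono])
    fix b :: 'u assume b: "b \<in> Basis"
    show "norm (blinfun_apply A b *\<^sub>R b) \<le> norm A"
      using norm_blinfun[of A b] b by simp
  qed
  then show ?thesis by simp
qed

lemma dotD_diff: "A1 \<bullet>\<^sub>D z1 - A2 \<bullet>\<^sub>D z2 = A1 \<bullet>\<^sub>D (z1 - z2) + (A1 - A2) \<bullet>\<^sub>D z2"
  by (simp add: dotD_def blinfun.diff_left inner_diff_left inner_diff_right
      flip: sum.distrib sum_subtractf scaleR_add_left scaleR_diff_left)

lemma grad_diff: "grad A - grad B = grad (A - B)"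
  by (simp add: grad_def blinfun.diff_left flip: sum_subtractf scaleR_diff_left)

text \<open>The product is split so that the difference \<open>A1 - A2\<close> meets
  \<open>z2\<close> alone. The growth of \<open>z2\<close> like \<open>N\<close>, later the weight,
  is paid for by the decay of \<open>A1 - A2\<close> like \<open>1 / N\<close>. Nothing is asked of
  \<open>z1\<close>.\<close>

lemma norm_dotD_grad_diff:
  fixes A1 A2 :: "'u::euclidean_space \<Rightarrow>\<^sub>L 'v::euclidean_space" and B1 B2 :: "'u \<Rightarrow>\<^sub>L real"
  assumes "norm A1 \<le> Lam" "norm (A1 - A2) * N \<le> C * d" "norm z2 \<le> L * N" "norm (B1 - B2) \<le> C' * d" "0 \<le> L"
  shows "norm ((A1 \<bullet>\<^sub>D z1 + grad B1) - (A2 \<bullet>\<^sub>D z2 + grad B2))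
    \<le> DIM('u) * (Lam * norm (z1 - z2) + (L * C + C') * d)"
proof -
  have "(A1 \<bullet>\<^sub>D z1 + grad B1) - (A2 \<bullet>\<^sub>D z2 + grad B2)
      = A1 \<bullet>\<^sub>D (z1 - z2) + (A1 - A2) \<bullet>\<^sub>D z2 + grad (B1 - B2)"
    using dotD_diff[of A1 z1 A2 z2] grad_diff[of B1 B2] by (simp add: algebra_simps)
  also have "norm \<dots> \<le> norm (A1 \<bullet>\<^sub>D (z1 - z2)) + norm ((A1 - A2) \<bullet>\<^sub>D z2) + norm (grad (B1 - B2))"
    by (meson add_right_mono norm_triangle_ineq order_trans)
  also have "\<dots> \<le> DIM('u) * (norm A1 * norm (z1 - z2)) + DIM('u) * (norm (A1 - A2) * norm z2)
      + DIM('u) * norm (B1 - B2)"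
    by (intro add_mono norm_dotD_le norm_grad_le)
  also have "\<dots> = DIM('u) * (norm A1 * norm (z1 - z2) + norm (A1 - A2) * norm z2 + norm (B1 - B2))"
    by (simp add: algebra_simps)
  also have "\<dots> \<le> DIM('u) * (Lam * norm (z1 - z2) + L * (C * d) + C' * d)"
  proof (intro mult_left_mono add_mono)
    show "norm A1 * norm (z1 - z2) \<le> Lam * norm (z1 - z2)"
      by (rule mult_right_mono) (use assms in auto)
    have "norm (A1 - A2) * norm z2 \<le> norm (A1 - A2) * (L * N)"
      by (rule mult_left_mono) (use assms in auto)
    also have "\<dots> = L * (norm (A1 - A2) * N)" by simp
    also have "\<dots> \<le> L * (C * d)" by (rule mult_left_mono) (use assms in auto)
    finally show "norm (A1 - A2) * norm z2 \<le> L * (C * d)" .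
  qed (use assms in auto)
  finally show ?thesis by (simp add: algebra_simps)
qed

definition weight :: "'x::euclidean_space \<Rightarrow> 'x measure \<Rightarrow> real" where
  "weight x \<mu> = 1 + norm x + moment_norm 1 \<mu>"

lemma weight_ge_1: "1 \<le> weight x \<mu>"
  using moment_norm_1_nonneg[of \<mu>] by (simp add: weight_def)

lemma weight_pos: "0 < weight x \<mu>"
  using weight_ge_1[of x \<mu>] by simp

lemma decay_bound: "decay l C Q \<Longrightarrow> \<mu> \<in> P2 \<Longrightarrow> norm (Q x \<mu> a y z) \<le> l / weight x \<mu>"
  by (simp add: decay_def weight_def)

text \<open>The decay in \<open>weight\<close> is only available while the segment between the two points stays
  comparable to \<open>N\<close>; otherwise \<open>d\<close> itself is of size \<open>N\<close> and the trivial bound suffices.\<close>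

lemma weighted_of_local:
  fixes Q1 Q2 :: "'v::real_normed_vector"
  assumes "norm Q1 \<le> Lam" "norm Q2 \<le> Lam" "0 < N" "0 \<le> C" "0 \<le> s" "s \<le> d"
    and loc: "s < N / 2 \<Longrightarrow> norm (Q1 - Q2) \<le> C / N * d"
  shows "norm (Q1 - Q2) * N \<le> (C + 4 * Lam) * d"
proof (cases "s < N / 2")
  case True
  have L: "0 \<le> Lam" using order_trans[OF norm_ge_zero assms(1)] .
  have "norm (Q1 - Q2) * N \<le> C / N * d * N"
    using loc[OF True] assms(3) by (intro mult_right_mono) auto
  also have "\<dots> = C * d" using assms(3) by simp
  also have "\<dots> \<le> (C + 4 * Lam) * d" using L assms by (intro mult_right_mono) auto
  finally show ?thesis .
next
  case False
  have L: "0 \<le> Lam" using order_trans[OF norm_ge_zero assms(1)] .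
  have "norm (Q1 - Q2) * N \<le> (2 * Lam) * (2 * d)"
    using False assms L norm_triangle_ineq4[of Q1 Q2] by (intro mult_mono) auto
  also have "\<dots> \<le> (C + 4 * Lam) * d" using assms L by (simp add: algebra_simps)
  finally show ?thesis .
qed

lemma weight_segment:
  assumes "x \<in> closed_segment x1 x2"
  shows "norm x2 - norm (x1 - x2) \<le> norm x"
proof -
  have "norm (x - x2) \<le> norm (x1 - x2)"
    using segment_bound[OF assms] by (simp add: norm_minus_commute)
  then show ?thesis using norm_triangle_ineq2[of x2 x] by (simp add: norm_minus_commute)
qed

section \<open>Lipschitz estimates for the optimal control and the coefficients\<close>

text \<open>\<open>L\<close> will be \<open>L0\<close>: at once the bound on the derivatives of the
  field and the opening of the cone. The last inequality is the trace of (h2): on the cone the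
  curvature of \<open>f\<close> in the control, multiplied by \<open>z\<close>, uses up at most half
  of the convexity of \<open>g\<close>.\<close>

locale control_problem =
  fixes f :: "'x::euclidean_space \<Rightarrow> 'x measure \<Rightarrow> 'a::euclidean_space \<Rightarrow> 'x"
    and g :: "'x \<Rightarrow> 'x measure \<Rightarrow> 'a \<Rightarrow> real"
    and \<alpha> :: "'x \<Rightarrow> 'x measure \<Rightarrow> 'x \<Rightarrow> 'a"
    and lam_f Lam_f bl_f Lip_f lam_g Lam_g bl_g l_g L :: real
  assumes a1: "assumption_a1 f lam_f Lam_f bl_f Lip_f"
    and a2: "assumption_a2 g lam_g Lam_g bl_g l_g"
    and opt: "optimal_control f g \<alpha>"
    and D_f0: "f 0 dirac0 0 = 0"
    and D_g0: "D_x g 0 dirac0 0 = 0" "D_a g 0 dirac0 0 = 0" "D_m g 0 dirac0 0 0 = 0"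
    and L0: "0 \<le> L" and bl_f_L: "bl_f * L \<le> lam_g / 2"
begin

lemma pos: "lam_g > 0" "Lam_f > 0" "bl_f > 0" "Lam_g > 0" "bl_g > 0"
  using a1 a2 by (simp_all add: assumption_a1_def assumption_a2_def)

lemma f_diff:
  assumes "\<mu> \<in> P2"
  shows "(\<lambda>x. f x \<mu> a) differentiable (at x)" "f x \<mu> differentiable (at a)"
    "(\<lambda>x. D_x f x \<mu> a) differentiable (at x)"
    "(\<lambda>a. D_x f x \<mu> a) differentiable (at a)"
    "(\<lambda>x. D_a f x \<mu> a) differentiable (at x)"
    "(\<lambda>a. D_a f x \<mu> a) differentiable (at a)"
  unfolding D_x_def D_a_def
  by (rule twice_differentiable_pair, use a1 assms in \<open>simp add: assumption_a1_def\<close>)+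

lemma g_diff:
  assumes "\<mu> \<in> P2"
  shows "(\<lambda>x. g x \<mu> a) differentiable (at x)" "g x \<mu> differentiable (at a)"
    "(\<lambda>x. D_x g x \<mu> a) differentiable (at x)"
    "(\<lambda>a. D_x g x \<mu> a) differentiable (at a)"
    "(\<lambda>x. D_a g x \<mu> a) differentiable (at x)"
    "(\<lambda>a. D_a g x \<mu> a) differentiable (at a)"
  unfolding D_x_def D_a_def
  by (rule twice_differentiable_pair, use a2 assms in \<open>simp add: assumption_a2_def\<close>)+

lemma f_regular: "regular2 (\<lambda>\<mu>. f x \<mu> a)"
  using a1 by (simp add: assumption_a1_def)

lemma g_regular: "regular2 (\<lambda>\<mu>. g x \<mu> a)"
  using a2 by (simp add: assumption_a2_def)

lemma f_bounds:
  assumes "\<mu> \<in> P2"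
  shows "norm (D_a f x \<mu> a) \<le> Lam_f" "norm (D_m f x \<mu> a y) \<le> Lam_f" "norm (D_x f x \<mu> a) \<le> Lam_f"
  using a1 assms by (simp_all add: assumption_a1_def)

lemma f_decay:
  assumes "\<mu> \<in> P2"
  shows "norm (D_mm f x \<mu> a y z) \<le> bl_f / weight x \<mu>"
    "norm (D_a (D_a f) x \<mu> a) \<le> bl_f / weight x \<mu>"
    "norm (D_ma f x \<mu> a y) \<le> bl_f / weight x \<mu>"
    "norm (D_a (D_x f) x \<mu> a) \<le> bl_f / weight x \<mu>"
    "norm (D_x (D_x f) x \<mu> a) \<le> bl_f / weight x \<mu>"
    "norm (D_ym f x \<mu> a y) \<le> bl_f / weight x \<mu>"
    "norm (D_xm f x \<mu> a y) \<le> bl_f / weight x \<mu>"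
proof -
  have d: "decay bl_f Lip_f (D_mm f)" "decay bl_f Lip_f (\<lambda>x \<mu> a y z. D_a (D_a f) x \<mu> a)"
    "decay bl_f Lip_f (\<lambda>x \<mu> a y z. D_ma f x \<mu> a y)" "decay bl_f Lip_f (\<lambda>x \<mu> a y z. D_a (D_x f) x \<mu> a)"
    "decay bl_f Lip_f (\<lambda>x \<mu> a y z. D_x (D_x f) x \<mu> a)" "decay bl_f Lip_f (\<lambda>x \<mu> a y z. D_ym f x \<mu> a y)"
    "decay bl_f Lip_f (\<lambda>x \<mu> a y z. D_xm f x \<mu> a y)"
    using a1 by (simp_all add: assumption_a1_def)
  show "norm (D_mm f x \<mu> a y z) \<le> bl_f / weight x \<mu>"
    "norm (D_a (D_a f) x \<mu> a) \<le> bl_f / weight x \<mu>"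
    "norm (D_ma f x \<mu> a y) \<le> bl_f / weight x \<mu>"
    "norm (D_a (D_x f) x \<mu> a) \<le> bl_f / weight x \<mu>"
    "norm (D_x (D_x f) x \<mu> a) \<le> bl_f / weight x \<mu>"
    "norm (D_ym f x \<mu> a y) \<le> bl_f / weight x \<mu>"
    "norm (D_xm f x \<mu> a y) \<le> bl_f / weight x \<mu>"
    by (rule d[THEN decay_bound, OF assms])+
qed

lemma g_bounds:
  assumes "\<mu> \<in> P2"
  shows "norm (D_mm g x \<mu> a y z) \<le> Lam_g" "norm (D_a (D_a g) x \<mu> a) \<le> Lam_g"
    "norm (D_xm g x \<mu> a y) \<le> Lam_g" "norm (D_x (D_x g) x \<mu> a) \<le> Lam_g"
    "norm (D_ym g x \<mu> a y) \<le> Lam_g" "norm (D_x (D_a g) x \<mu> a) \<le> bl_g"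
    "norm (D_am g x \<mu> a y) \<le> bl_g"
  using a2 assms unfolding assumption_a2_def by blast+

section \<open>Increments of the first derivatives of \<open>f\<close> and \<open>g\<close>\<close>

lemma decay_le:
  assumes "0 < M" "M \<le> weight x \<mu>"
  shows "bl_f / weight x \<mu> \<le> bl_f / M"
  using assms pos by (intro divide_left_mono) auto

text \<open>(a1) differentiates \<open>D_a f\<close> in the measure one basis direction at a time,
  so the increment is assembled from its components; this produces \<open>DIM('a)\<close>.\<close>

lemma norm_D_a_f_measure:
  assumes P: "\<nu>1 \<in> P2" "\<nu>2 \<in> P2" and kr: "kr_le \<nu>1 \<nu>2 w"
    and \<rho>: "\<rho> \<le> moment_norm 1 \<nu>1" "\<rho> \<le> moment_norm 1 \<nu>2" and M: "0 < M" "M \<le> 1 + norm x + \<rho>"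
  shows "norm (D_a f x \<nu>1 a - D_a f x \<nu>2 a) \<le> DIM('a) * (bl_f / M * w)"
proof -
  have "norm (D_a f x \<nu>1 a - D_a f x \<nu>2 a)
      \<le> (\<Sum>b\<in>(Basis :: 'a set). norm (blinfun_apply (D_a f x \<nu>1 a - D_a f x \<nu>2 a) b))"
    by (rule norm_blinfun_euclidean_le)
  also have "\<dots> \<le> (\<Sum>b\<in>(Basis :: 'a set). bl_f / M * w)"
  proof (rule sum_mono)
    fix b :: 'a assume b: "b \<in> Basis"
    have "norm (blinfun_apply (D_a f x \<nu>1 a) b - blinfun_apply (D_a f x \<nu>2 a) b) \<le> bl_f / M * w"
    proof (rule lfd_bound[OF _ P kr, where h = "\<lambda>\<mu>. blinfun_apply (D_a f x \<mu> a) b"])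
      show "mu_differentiable (\<lambda>\<mu>. blinfun_apply (D_a f x \<mu> a) b)"
        using a1 b by (simp add: assumption_a1_def)
      fix \<theta> :: real and y assume t: "0 \<le> \<theta>" "\<theta> \<le> 1"
      let ?M = "mix \<theta> \<nu>1 \<nu>2"
      have MP: "?M \<in> P2" by (rule mix_P2[OF P t])
      have "\<rho> \<le> moment_norm 1 ?M" by (rule moment_norm_mix_ge[OF P t \<rho>])
      then have w: "M \<le> weight x ?M" using M by (simp add: weight_def)
      let ?B = "\<lambda>u. \<Sum>b\<in>Basis. (u \<bullet> b) *\<^sub>R D_mu (\<lambda>\<nu>. blinfun_apply (D_a f x \<nu> a) b) ?M y"
      have "bounded_linear ?B"
        by (auto intro!: bounded_linear_sum bounded_linear_scaleR_const bounded_linear_inner_left)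
      then have "blinfun_apply (D_ma f x ?M a y) = ?B"
        unfolding D_ma_def by (rule bounded_linear_Blinfun_apply)
      then have "blinfun_apply (D_ma f x ?M a y) b = D_mu (\<lambda>\<nu>. blinfun_apply (D_a f x \<nu> a) b) ?M y"
        using b by (simp add: inner_Basis if_distrib[of "\<lambda>t. t *\<^sub>R _"] sum.delta' cong: if_cong)
      then have "norm (D_mu (\<lambda>\<nu>. blinfun_apply (D_a f x \<nu> a) b) ?M y) \<le> norm (D_ma f x ?M a y) * norm b"
        using norm_blinfun[of "D_ma f x ?M a y" b] by simp
      also have "\<dots> \<le> bl_f / M"
        using f_decay(3)[OF MP, of x a y] decay_le[OF M(1) w] b by simp
      finally show "norm (D_mu (\<lambda>\<mu>. blinfun_apply (D_a f x \<mu> a) b) ?M y) \<le> bl_f / M" .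
    qed
    then show "norm (blinfun_apply (D_a f x \<nu>1 a - D_a f x \<nu>2 a) b) \<le> bl_f / M * w"
      by (simp add: blinfun.diff_left)
  qed
  finally show ?thesis by simp
qed

text \<open>(a1) controls \<open>D_ma f\<close>, the measure derivative of \<open>D_a f\<close>, and
  does not state that \<open>D_m f\<close> is differentiable in the control. A mean value estimate
  in the control turns the bound into one on increments of \<open>f x \<mu> a - f x \<mu> a'\<close>
  in the measure, which \<open>norm_D_mu_diff_le\<close> passes to the measure derivative.\<close>

lemma norm_D_m_f_control:
  assumes \<mu>: "\<mu> \<in> P2"
  shows "norm (D_m f x \<mu> a y - D_m f x \<mu> a' y) \<le> 2 * DIM('a) * bl_f / weight x \<mu> * norm (a - a')"
  unfolding D_m_def
proof (rule norm_D_mu_diff_le[OF f_regular f_regular \<mu>, where \<rho> = "moment_norm 1 \<mu> / 2" and c = "2 * bl_f / weight x \<mu>"])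
  have M: "weight x \<mu> / 2 \<le> 1 + norm x + moment_norm 1 \<mu> / 2" "0 < weight x \<mu> / 2"
    using weight_pos[of x \<mu>] by (auto simp: weight_def field_simps)
  show c: "norm (D_mumu (\<lambda>\<nu>. f x \<nu> a) \<nu> y z) \<le> 2 * bl_f / weight x \<mu>"
    if "\<nu> \<in> P2" "moment_norm 1 \<mu> / 2 \<le> moment_norm 1 \<nu>" for a \<nu> y z
  proof -
    have "weight x \<mu> / 2 \<le> weight x \<nu>" using M that by (simp add: weight_def[of _ \<nu>])
    from order_trans[OF f_decay(1)[OF that(1), of x a y z] decay_le[OF M(2) this]]
    show ?thesis by (simp add: D_mm_def mult.commute)
  qed
  then show "norm (D_mumu (\<lambda>\<nu>. f x \<nu> a') \<nu> y z) \<le> 2 * bl_f / weight x \<mu>"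
    if "\<nu> \<in> P2" "moment_norm 1 \<mu> / 2 \<le> moment_norm 1 \<nu>" for \<nu> y z using that by blast
  show "0 \<le> 2 * DIM('a) * bl_f / weight x \<mu> * norm (a - a')" using pos weight_pos[of x \<mu>] by simp
  fix \<nu>1 \<nu>2 :: "'x measure" and w
  assume P: "\<nu>1 \<in> P2" "\<nu>2 \<in> P2" and m: "moment_norm 1 \<mu> / 2 \<le> moment_norm 1 \<nu>1" "moment_norm 1 \<mu> / 2 \<le> moment_norm 1 \<nu>2"
    and kr: "kr_le \<nu>1 \<nu>2 w"
  have "norm (D_a f x \<nu>1 a - D_a f x \<nu>2 a) \<le> DIM('a) * (bl_f / (weight x \<mu> / 2) * w)" for a
    by (rule norm_D_a_f_measure[OF P kr m M(2,1)])
  then have "norm ((f x \<nu>1 a - f x \<nu>2 a) - (f x \<nu>1 a' - f x \<nu>2 a')) \<le> DIM('a) * (bl_f / (weight x \<mu> / 2) * w) * norm (a - a')"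
    by (intro norm_diff_diff_le_Dfr[of UNIV]) (use f_diff P in \<open>auto simp: D_a_def\<close>)
  then show "norm (f x \<nu>1 a - f x \<nu>2 a - (f x \<nu>1 a' - f x \<nu>2 a')) \<le> 2 * DIM('a) * bl_f / weight x \<mu> * norm (a - a') * w"
    by (simp add: field_simps)
qed simp

text \<open>\<open>26 + 4 * DIM('a)\<close> dominates the factors that arise when one argument is
  changed at a time: 24, 4, 2, 1, \<open>4 * DIM('a)\<close> and \<open>2 * DIM('a)\<close>.
  \<open>4 * Lam_f\<close> is the price of distant points in
  \<open>weighted_of_local\<close>.\<close>

definition f_lip :: real where "f_lip = (26 + 4 * DIM('a)) * bl_f + 4 * Lam_f"

text \<open>The 6 comes from \<open>D_mu_lipschitz\<close>, \<open>bl_g\<close> from the derivatives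
  that mix the control with state or measure.\<close>

definition g_lip :: real where "g_lip = 6 * Lam_g + bl_g"

lemma lip_nonneg: "0 \<le> f_lip" "0 \<le> g_lip"
  using pos by (simp_all add: f_lip_def g_lip_def)

text \<open>As long as the two points are closer than half the weight, everything in between keeps a
  quarter of it. \<open>\<rho>\<close> is half of a lower bound for both first moments, the other
  half being reserved for mixing in a Dirac mass.\<close>

lemma moment_half_weight:
  assumes kr: "kr_le \<mu>1 \<mu>2 w" and s: "norm (x1 - x2) + w < weight x2 \<mu>2 / 2"
  defines "\<rho> \<equiv> (moment_norm 1 \<mu>2 - w) / 2"
  shows "2 * \<rho> \<le> moment_norm 1 \<mu>1" "2 * \<rho> \<le> moment_norm 1 \<mu>2"
    "\<And>\<nu>. \<rho> \<le> moment_norm 1 \<nu> \<Longrightarrow> weight x2 \<mu>2 / 4 \<le> weight x1 \<nu>"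
    "\<And>\<nu> v. 2 * \<rho> \<le> moment_norm 1 \<nu> \<Longrightarrow> norm (v - x1) < weight x2 \<mu>2 / 4 \<Longrightarrow> weight x2 \<mu>2 / 4 \<le> weight v \<nu>"
proof -
  have w: "0 \<le> w" by (rule kr_le_nonneg[OF kr])
  note m = moment_norm_kr[OF kr]
  show "2 * \<rho> \<le> moment_norm 1 \<mu>1" using m by (simp add: \<rho>_def abs_le_iff)
  show "2 * \<rho> \<le> moment_norm 1 \<mu>2" using w by (simp add: \<rho>_def)
  have n: "norm x2 - norm (x1 - x2) \<le> norm x1"
    using norm_triangle_ineq2[of x2 x1] by (simp add: norm_minus_commute)
  show "weight x2 \<mu>2 / 4 \<le> weight x1 \<nu>" if "\<rho> \<le> moment_norm 1 \<nu>" for \<nu>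
    using that s n moment_norm_1_nonneg[of \<nu>] norm_ge_zero[of x1] unfolding \<rho>_def weight_def
    by argo
  show "weight x2 \<mu>2 / 4 \<le> weight v \<nu>" if "2 * \<rho> \<le> moment_norm 1 \<nu>" "norm (v - x1) < weight x2 \<mu>2 / 4" for \<nu> v
  proof -
    have "norm x1 - norm (v - x1) \<le> norm v"
      using norm_triangle_ineq2[of x1 v] by (simp add: norm_minus_commute)
    then show ?thesis
      using that s n unfolding \<rho>_def weight_def by argo
  qed
qed

lemma segment_half_weight:
  assumes s: "norm (x1 - x2) < weight x2 \<mu> / 2" and x: "x \<in> closed_segment x1 x2"
  shows "weight x2 \<mu> / 2 \<le> weight x \<mu>"
  using weight_segment[OF x] s unfolding weight_def by argo

text \<open>The arguments are changed one at a time in an order that keeps the weight under control: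
  the measure at \<open>x1\<close>, where at least \<open>N / 4\<close> is left; the state along the
  segment, with at least \<open>N / 2\<close>; then control and \<open>y\<close> at
  \<open>(x2, \<mu>2)\<close>, where it is \<open>N\<close>. The decay does not involve the control,
  so \<open>s\<close>, which decides between near and far, leaves it out.\<close>

lemma weighted_lipschitz_f:
  fixes x1 x2 :: 'x and a1 a2 :: 'a
  assumes P: "\<mu>1 \<in> P2" "\<mu>2 \<in> P2" and kr: "kr_le \<mu>1 \<mu>2 w"
  defines "d \<equiv> norm (x1 - x2) + w + norm (a1 - a2)"
  shows "norm (D_a f x1 \<mu>1 a1 - D_a f x2 \<mu>2 a2) * weight x2 \<mu>2 \<le> f_lip * d"
    "norm (D_x f x1 \<mu>1 a1 - D_x f x2 \<mu>2 a2) * weight x2 \<mu>2 \<le> f_lip * d"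
    "norm (D_m f x1 \<mu>1 a1 y1 - D_m f x2 \<mu>2 a2 y2) * weight x2 \<mu>2 \<le> f_lip * (d + norm (y1 - y2))"
proof -
  define N where "N = weight x2 \<mu>2"
  define s where "s = norm (x1 - x2) + w"
  have N: "0 < N" unfolding N_def by (rule weight_pos)
  have w: "0 \<le> w" by (rule kr_le_nonneg[OF kr])
  have b: "0 < bl_f / N" using pos N by simp
  define \<rho> where "\<rho> = (moment_norm 1 \<mu>2 - w) / 2"
  let ?C = "(26 + 4 * DIM('a)) * bl_f"
  have C0: "0 \<le> ?C" using pos by simp
  have d: "d = s + norm (a1 - a2)" by (simp add: d_def s_def)
  have s0: "0 \<le> s" using w by (simp add: s_def)
  have seg: "bl_f / weight x \<mu>2 \<le> 2 * (bl_f / N)" if "s < N / 2" "x \<in> closed_segment x1 x2" for x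
  proof -
    have "N / 2 \<le> weight x \<mu>2"
      unfolding N_def by (rule segment_half_weight) (use that w in \<open>auto simp: s_def N_def\<close>)
    then show ?thesis using decay_le[of "N / 2" x \<mu>2] N by (simp add: mult.commute)
  qed
  have near: "2 * \<rho> \<le> moment_norm 1 \<mu>1" "2 * \<rho> \<le> moment_norm 1 \<mu>2"
    "\<And>\<nu>. \<rho> \<le> moment_norm 1 \<nu> \<Longrightarrow> bl_f / weight x1 \<nu> \<le> 4 * (bl_f / N)"
    "\<And>\<nu> v. 2 * \<rho> \<le> moment_norm 1 \<nu> \<Longrightarrow> norm (v - x1) < N / 4 \<Longrightarrow> bl_f / weight v \<nu> \<le> 4 * (bl_f / N)"
    if "s < N / 2"
  proof -
    note * = moment_half_weight[OF kr, of x1 x2, folded s_def N_def \<rho>_def, OF that]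
    show "2 * \<rho> \<le> moment_norm 1 \<mu>1" "2 * \<rho> \<le> moment_norm 1 \<mu>2" by (rule *)+
    show "bl_f / weight x1 \<nu> \<le> 4 * (bl_f / N)" if "\<rho> \<le> moment_norm 1 \<nu>" for \<nu>
      using decay_le[OF _ *(3)[OF that]] N by (simp add: mult.commute)
    show "bl_f / weight v \<nu> \<le> 4 * (bl_f / N)" if "2 * \<rho> \<le> moment_norm 1 \<nu>" "norm (v - x1) < N / 4" for \<nu> v
      using decay_le[OF _ *(4)[OF that]] N by (simp add: mult.commute)
  qed
  have aux: "A * (bl_f / N) * t \<le> A' * (bl_f / N) * t" if "A \<le> A'" "0 \<le> t" for A A' t
    using that b by (intro mult_right_mono) auto
  have dim: "1 \<le> real DIM('a)" using DIM_positive[where 'a='a] by linarith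
  \<comment> \<open>\<open>r\<close> is the displacement \<open>norm (y1 - y2)\<close> for
    \<open>D_m f\<close> and 0 for the other two derivatives.\<close>
  have comb: "norm (q1 - q2) \<le> ?C / N * D"
    if "norm (q1 - q') \<le> A1 * (bl_f / N) * w"
      "norm (q' - q'') \<le> A2 * (bl_f / N) * norm (x1 - x2)"
      "norm (q'' - q''') \<le> A3 * (bl_f / N) * norm (a1 - a2)"
      "norm (q''' - q2) \<le> A4 * (bl_f / N) * r"
      "A1 \<le> 26 + 4 * DIM('a)" "A2 \<le> 26 + 4 * DIM('a)" "A3 \<le> 26 + 4 * DIM('a)" "A4 \<le> 26 + 4 * DIM('a)"
      "D = d + r" "0 \<le> r"
    for q1 q2 q' q'' q''' :: "'v::real_normed_vector" and A1 A2 A3 A4 r D :: real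
  proof -
    have "norm (q1 - q2) \<le> norm (q1 - q') + norm (q' - q'') + norm (q'' - q''') + norm (q''' - q2)"
      using norm_triangle_ineq[of "q1 - q'" "q' - q''"] norm_triangle_ineq[of "q1 - q''" "q'' - q'''"]
        norm_triangle_ineq[of "q1 - q'''" "q''' - q2"] by simp
    also have "\<dots> \<le> (26 + 4 * DIM('a)) * (bl_f / N) * w + (26 + 4 * DIM('a)) * (bl_f / N) * norm (x1 - x2)
        + (26 + 4 * DIM('a)) * (bl_f / N) * norm (a1 - a2) + (26 + 4 * DIM('a)) * (bl_f / N) * r"
      using that(1-4) aux[OF that(5) w] aux[OF that(6) norm_ge_zero[of "x1 - x2"]]
        aux[OF that(7) norm_ge_zero[of "a1 - a2"]] aux[OF that(8,10)]
      by (intro add_mono) linarith+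
    also have "\<dots> = ?C / N * D" by (simp add: that(9) d_def algebra_simps add_divide_distrib)
    finally show ?thesis .
  qed
  have mixm: "2 * \<rho> \<le> moment_norm 1 (mix \<theta> \<mu>1 \<mu>2)" if "s < N / 2" "0 \<le> \<theta>" "\<theta> \<le> 1" for \<theta>
    by (rule moment_norm_mix_ge[OF P that(2,3) near(1,2)]) (use that in auto)
  show "norm (D_a f x1 \<mu>1 a1 - D_a f x2 \<mu>2 a2) * weight x2 \<mu>2 \<le> f_lip * d"
    unfolding f_lip_def N_def[symmetric]
  proof (rule weighted_of_local[OF f_bounds(1)[OF P(1)] f_bounds(1)[OF P(2)] N C0 s0])
    show "s \<le> d" by (simp add: d)
    assume s: "s < N / 2"
    have wm: "N / 4 \<le> 1 + norm x1 + \<rho>"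
      using s norm_triangle_ineq2[of x2 x1] norm_ge_zero[of x1] unfolding \<rho>_def s_def N_def weight_def norm_minus_commute[of x2 x1]
      by argo
    have r: "\<rho> \<le> moment_norm 1 \<mu>1" "\<rho> \<le> moment_norm 1 \<mu>2"
      using near(1,2)[OF s] moment_norm_1_nonneg[of \<mu>1] moment_norm_1_nonneg[of \<mu>2] by linarith+
    have e1: "norm (D_a f x1 \<mu>1 a1 - D_a f x1 \<mu>2 a1) \<le> (4 * DIM('a)) * (bl_f / N) * w"
      using norm_D_a_f_measure[OF P kr r _ wm, of a1] N by (simp add: mult_ac)
    have e2: "norm (D_a f x1 \<mu>2 a1 - D_a f x2 \<mu>2 a1) \<le> 2 * (bl_f / N) * norm (x1 - x2)"
      unfolding D_a_def
    proof (rule norm_Dfr_diff_interchange[where h = "\<lambda>x. f x \<mu>2"])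
      show "(\<lambda>u. f u \<mu>2 w) differentiable at u" "f u \<mu>2 differentiable at w"
        "(\<lambda>w. Dfr (\<lambda>u. f u \<mu>2 w) u) differentiable at w" for u w
        using f_diff[OF P(2)] by (simp_all add: D_x_def)
      fix u w assume "u \<in> closed_segment x1 x2"
      then show "norm (Dfr (\<lambda>w. Dfr (\<lambda>u. f u \<mu>2 w) u) w) \<le> 2 * (bl_f / N)"
        using order_trans[OF f_decay(4)[OF P(2), of u w] seg[OF s]] by (simp add: D_x_def D_a_def)
    qed
    have e3: "norm (D_a f x2 \<mu>2 a1 - D_a f x2 \<mu>2 a2) \<le> 1 * (bl_f / N) * norm (a1 - a2)"
      by (rule norm_diff_le_Dfr[of UNIV "\<lambda>a. D_a f x2 \<mu>2 a"])
        (use f_diff[OF P(2)] f_decay(2)[OF P(2), of x2] in \<open>auto simp: N_def D_a_def[of "D_a f"]\<close>)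
    show "norm (D_a f x1 \<mu>1 a1 - D_a f x2 \<mu>2 a2) \<le> ?C / N * d"
      by (rule comb[where ?r1 = 0 and ?A1.1 = "4 * DIM('a)" and ?A4.1 = 0, OF _ e2 e3]) (use e1 dim in auto)
  qed
  show "norm (D_x f x1 \<mu>1 a1 - D_x f x2 \<mu>2 a2) * weight x2 \<mu>2 \<le> f_lip * d"
    unfolding f_lip_def N_def[symmetric]
  proof (rule weighted_of_local[OF f_bounds(3)[OF P(1)] f_bounds(3)[OF P(2)] N C0 s0])
    show "s \<le> d" by (simp add: d)
    assume s: "s < N / 2"
    have e1: "norm (D_x f x1 \<mu>1 a1 - D_x f x1 \<mu>2 a1) \<le> 4 * (bl_f / N) * w"
      unfolding D_x_def
    proof (rule norm_Dfr_diff_measure[OF _ P kr, where h = "\<lambda>x \<mu>. f x \<mu> a1" and r = "N / 4"])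
      show "0 < N / 4" using N by simp
      show "mu_differentiable (\<lambda>\<mu>. f v \<mu> a1)" for v by (rule regular2_mu_differentiable[OF f_regular])
      show "(\<lambda>v. D_mu (\<lambda>\<mu>. f v \<mu> a1) \<mu> y) differentiable at v" if "\<mu> \<in> P2" for v y \<mu>
        using a1 that by (simp add: assumption_a1_def D_m_def)
      show "(\<lambda>v. f v \<mu> a1) differentiable at x1" if "\<mu> \<in> P2" for \<mu> by (rule f_diff[OF that])
      fix v y \<theta> assume v: "norm (v - x1) < N / 4" and t: "0 \<le> \<theta>" "\<theta> \<le> (1::real)"
      show "norm (Dfr (\<lambda>v. D_mu (\<lambda>\<mu>. f v \<mu> a1) (mix \<theta> \<mu>1 \<mu>2) y) v) \<le> 4 * (bl_f / N)"
        using order_trans[OF f_decay(7)[OF mix_P2[OF P t], of v a1 y] near(4)[OF s mixm[OF s t] v]]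
        by (simp add: D_xm_def D_m_def)
    qed
    have e2: "norm (D_x f x1 \<mu>2 a1 - D_x f x2 \<mu>2 a1) \<le> 2 * (bl_f / N) * norm (x1 - x2)"
      by (rule norm_diff_le_Dfr[of "closed_segment x1 x2" "\<lambda>x. D_x f x \<mu>2 a1"])
        (use f_diff[OF P(2)] order_trans[OF f_decay(5)[OF P(2), of _ a1] seg[OF s]] in \<open>auto simp: D_x_def[of "D_x f"]\<close>)
    have e3: "norm (D_x f x2 \<mu>2 a1 - D_x f x2 \<mu>2 a2) \<le> 1 * (bl_f / N) * norm (a1 - a2)"
      by (rule norm_diff_le_Dfr[of UNIV "\<lambda>a. D_x f x2 \<mu>2 a"])
        (use f_diff[OF P(2)] f_decay(4)[OF P(2), of x2] in \<open>auto simp: N_def D_a_def[of "D_x f"]\<close>)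
    show "norm (D_x f x1 \<mu>1 a1 - D_x f x2 \<mu>2 a2) \<le> ?C / N * d"
      by (rule comb[where ?r1 = 0 and ?A1.1 = 4 and ?A4.1 = 0, OF _ e2 e3]) (use e1 dim in auto)
  qed
  show "norm (D_m f x1 \<mu>1 a1 y1 - D_m f x2 \<mu>2 a2 y2) * weight x2 \<mu>2 \<le> f_lip * (d + norm (y1 - y2))"
    unfolding f_lip_def N_def[symmetric]
  proof (rule weighted_of_local[OF f_bounds(2)[OF P(1)] f_bounds(2)[OF P(2)] N C0 s0])
    show "s \<le> d + norm (y1 - y2)" by (simp add: d add_increasing2)
    assume s: "s < N / 2"
    have e1: "norm (D_m f x1 \<mu>1 a1 y1 - D_m f x1 \<mu>2 a1 y1) \<le> 24 * (bl_f / N) * w"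
    proof -
      have "norm (D_m f x1 \<mu>1 a1 y1 - D_m f x1 \<mu>2 a1 y1) \<le> 6 * (4 * (bl_f / N)) * w"
        unfolding D_m_def
      proof (rule D_mu_lipschitz[OF f_regular P near(1,2)[OF s] kr])
        show "norm (D_mumu (\<lambda>\<mu>. f x1 \<mu> a1) \<nu> y z) \<le> 4 * (bl_f / N)"
          if "\<nu> \<in> P2" "\<rho> \<le> moment_norm 1 \<nu>" for \<nu> y z
          using order_trans[OF f_decay(1)[OF that(1), of x1 a1 y z] near(3)[OF s that(2)]] by (simp add: D_mm_def)
      qed (use b in auto)
      then show ?thesis by simp
    qed
    have e2: "norm (D_m f x1 \<mu>2 a1 y1 - D_m f x2 \<mu>2 a1 y1) \<le> 2 * (bl_f / N) * norm (x1 - x2)"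
    proof (rule norm_diff_le_Dfr[of "closed_segment x1 x2" "\<lambda>x. D_m f x \<mu>2 a1 y1"])
      show "(\<lambda>x. D_m f x \<mu>2 a1 y1) differentiable at x" for x
        using a1 P by (simp add: assumption_a1_def)
      show "norm (Dfr (\<lambda>x. D_m f x \<mu>2 a1 y1) x) \<le> 2 * (bl_f / N)" if "x \<in> closed_segment x1 x2" for x
        using order_trans[OF f_decay(7)[OF P(2), of x a1 y1] seg[OF s that]] by (simp add: D_xm_def)
    qed auto
    have e3: "norm (D_m f x2 \<mu>2 a1 y1 - D_m f x2 \<mu>2 a2 y1) \<le> (2 * DIM('a)) * (bl_f / N) * norm (a1 - a2)"
      using norm_D_m_f_control[OF P(2), of x2 a1 y1 a2] by (simp add: N_def)
    have e4: "norm (D_m f x2 \<mu>2 a2 y1 - D_m f x2 \<mu>2 a2 y2) \<le> 1 * (bl_f / N) * norm (y1 - y2)"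
    proof (rule norm_diff_le_Dfr[of UNIV "D_m f x2 \<mu>2 a2"])
      show "D_m f x2 \<mu>2 a2 differentiable at y" for y
        using f_regular[of x2 a2] P(2) unfolding regular2_def twice_differentiable_def D_m_def D_mu_def by auto
      show "norm (Dfr (D_m f x2 \<mu>2 a2) y) \<le> 1 * (bl_f / N)" for y
        using f_decay(6)[OF P(2), of x2 a2 y] by (simp add: D_ym_def N_def)
    qed auto
    show "norm (D_m f x1 \<mu>1 a1 y1 - D_m f x2 \<mu>2 a2 y2) \<le> ?C / N * (d + norm (y1 - y2))"
      by (rule comb[where ?A1.1 = 24, OF _ e2 e3 e4]) (use e1 dim in auto)
  qed
qed

lemma lipschitz_f:
  assumes P: "\<mu>1 \<in> P2" "\<mu>2 \<in> P2" and kr: "kr_le \<mu>1 \<mu>2 w"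
  shows "norm (f x1 \<mu>1 a1 - f x2 \<mu>2 a2) \<le> Lam_f * (norm (x1 - x2) + w + norm (a1 - a2))"
proof -
  have e1: "norm (f x1 \<mu>1 a1 - f x1 \<mu>2 a1) \<le> Lam_f * w"
    by (rule lfd_bound[OF regular2_mu_differentiable[OF f_regular] P kr])
      (use f_bounds(2)[OF mix_P2[OF P]] in \<open>auto simp: D_m_def\<close>)
  have e2: "norm (f x1 \<mu>2 a1 - f x2 \<mu>2 a1) \<le> Lam_f * norm (x1 - x2)"
    by (rule norm_diff_le_Dfr[of UNIV "\<lambda>x. f x \<mu>2 a1"])
      (use f_diff[OF P(2)] f_bounds(3)[OF P(2), of _ a1] in \<open>auto simp: D_x_def\<close>)
  have e3: "norm (f x2 \<mu>2 a1 - f x2 \<mu>2 a2) \<le> Lam_f * norm (a1 - a2)"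
    by (rule norm_diff_le_Dfr[of UNIV "f x2 \<mu>2"])
      (use f_diff[OF P(2)] f_bounds(1)[OF P(2), of x2] in \<open>auto simp: D_a_def\<close>)
  have "norm (f x1 \<mu>1 a1 - f x2 \<mu>2 a2) \<le> norm (f x1 \<mu>1 a1 - f x1 \<mu>2 a1)
      + norm (f x1 \<mu>2 a1 - f x2 \<mu>2 a1) + norm (f x2 \<mu>2 a1 - f x2 \<mu>2 a2)"
    using norm_triangle_ineq[of "f x1 \<mu>1 a1 - f x1 \<mu>2 a1" "f x1 \<mu>2 a1 - f x2 \<mu>2 a1"]
      norm_triangle_ineq[of "f x1 \<mu>1 a1 - f x2 \<mu>2 a1" "f x2 \<mu>2 a1 - f x2 \<mu>2 a2"] by simp
  with e1 e2 e3 show ?thesis by (simp add: algebra_simps)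
qed

text \<open>The second derivatives of \<open>g\<close> are bounded without decay and multiply no
  \<open>z\<close>, so there is neither a weight nor a distinction between near and far
  points.\<close>

lemma lipschitz_g:
  fixes x1 x2 :: 'x and a1 a2 :: 'a
  assumes P: "\<mu>1 \<in> P2" "\<mu>2 \<in> P2" and kr: "kr_le \<mu>1 \<mu>2 w"
  defines "d \<equiv> norm (x1 - x2) + w + norm (a1 - a2)"
  shows "norm (D_a g x1 \<mu>1 a1 - D_a g x2 \<mu>2 a2) \<le> g_lip * d"
    "norm (D_x g x1 \<mu>1 a1 - D_x g x2 \<mu>2 a2) \<le> g_lip * d"
    "norm (D_m g x1 \<mu>1 a1 y1 - D_m g x2 \<mu>2 a2 y2) \<le> g_lip * (d + norm (y1 - y2))"
proof -
  have w: "0 \<le> w" by (rule kr_le_nonneg[OF kr])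
  have comb: "norm (q1 - q2) \<le> g_lip * (d + r)"
    if "norm (q1 - q') \<le> A1 * w" "norm (q' - q'') \<le> A2 * norm (x1 - x2)"
      "norm (q'' - q''') \<le> A3 * norm (a1 - a2)" "norm (q''' - q2) \<le> A4 * r"
      "A1 \<le> g_lip" "A2 \<le> g_lip" "A3 \<le> g_lip" "A4 \<le> g_lip" "0 \<le> r"
    for q1 q2 q' q'' q''' :: "'v::real_normed_vector" and A1 A2 A3 A4 r :: real
  proof -
    have "norm (q1 - q2) \<le> norm (q1 - q') + norm (q' - q'') + norm (q'' - q''') + norm (q''' - q2)"
      using norm_triangle_ineq[of "q1 - q'" "q' - q''"] norm_triangle_ineq[of "q1 - q''" "q'' - q'''"]
        norm_triangle_ineq[of "q1 - q'''" "q''' - q2"] by simp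
    also have "\<dots> \<le> g_lip * w + g_lip * norm (x1 - x2) + g_lip * norm (a1 - a2) + g_lip * r"
      using that(1-4) mult_right_mono[OF that(5) w] mult_right_mono[OF that(6) norm_ge_zero[of "x1 - x2"]]
        mult_right_mono[OF that(7) norm_ge_zero[of "a1 - a2"]] mult_right_mono[OF that(8,9)]
      by (intro add_mono) linarith+
    finally show ?thesis by (simp add: d_def algebra_simps)
  qed
  have Cs: "bl_g \<le> g_lip" "Lam_g \<le> g_lip" "6 * Lam_g \<le> g_lip" "0 \<le> g_lip" using pos by (auto simp: g_lip_def)
  have mu: "mu_differentiable (\<lambda>\<mu>. g x \<mu> a)" for x a by (rule regular2_mu_differentiable[OF g_regular])
  have dmx: "(\<lambda>x. D_m g x \<mu> a y) differentiable at x" "(\<lambda>a. D_m g x \<mu> a y) differentiable at a"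
    if "\<mu> \<in> P2" for x \<mu> a y using a2 that by (simp_all add: assumption_a2_def)
  have "norm (D_a g x1 \<mu>1 a1 - D_a g x2 \<mu>2 a2) \<le> g_lip * (d + 0)"
  proof (rule comb[OF _ _ _ _ Cs(1) Cs(1) Cs(2) Cs(4)])
    show "norm (D_a g x1 \<mu>1 a1 - D_a g x1 \<mu>2 a1) \<le> bl_g * w"
      unfolding D_a_def
      by (rule norm_Dfr_diff_measure[OF zero_less_one P kr, where h = "\<lambda>a \<mu>. g x1 \<mu> a"])
        (use mu dmx g_diff g_bounds(7)[OF mix_P2[OF P], of _ x1] in \<open>auto simp: D_m_def D_am_def\<close>)
    show "norm (D_a g x1 \<mu>2 a1 - D_a g x2 \<mu>2 a1) \<le> bl_g * norm (x1 - x2)"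
      by (rule norm_diff_le_Dfr[of UNIV "\<lambda>x. D_a g x \<mu>2 a1"])
        (use g_diff[OF P(2)] g_bounds(6)[OF P(2), of _ a1] in \<open>auto simp: D_x_def[of "D_a g"]\<close>)
    show "norm (D_a g x2 \<mu>2 a1 - D_a g x2 \<mu>2 a2) \<le> Lam_g * norm (a1 - a2)"
      by (rule norm_diff_le_Dfr[of UNIV "\<lambda>a. D_a g x2 \<mu>2 a"])
        (use g_diff[OF P(2)] g_bounds(2)[OF P(2), of x2] in \<open>auto simp: D_a_def[of "D_a g"]\<close>)
  qed auto
  then show "norm (D_a g x1 \<mu>1 a1 - D_a g x2 \<mu>2 a2) \<le> g_lip * d" by simp
  have "norm (D_x g x1 \<mu>1 a1 - D_x g x2 \<mu>2 a2) \<le> g_lip * (d + 0)"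
  proof (rule comb[OF _ _ _ _ Cs(2) Cs(2) Cs(1) Cs(4)])
    show "norm (D_x g x1 \<mu>1 a1 - D_x g x1 \<mu>2 a1) \<le> Lam_g * w"
      unfolding D_x_def
      by (rule norm_Dfr_diff_measure[OF zero_less_one P kr, where h = "\<lambda>x \<mu>. g x \<mu> a1"])
        (use mu dmx g_diff g_bounds(3)[OF mix_P2[OF P], of _ _ a1] in \<open>auto simp: D_m_def D_xm_def\<close>)
    show "norm (D_x g x1 \<mu>2 a1 - D_x g x2 \<mu>2 a1) \<le> Lam_g * norm (x1 - x2)"
      by (rule norm_diff_le_Dfr[of UNIV "\<lambda>x. D_x g x \<mu>2 a1"])
        (use g_diff[OF P(2)] g_bounds(4)[OF P(2), of _ a1] in \<open>auto simp: D_x_def[of "D_x g"]\<close>)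
    show "norm (D_x g x2 \<mu>2 a1 - D_x g x2 \<mu>2 a2) \<le> bl_g * norm (a1 - a2)"
      unfolding D_x_def
      by (rule norm_Dfr_diff_interchange[where h = "\<lambda>a x. g x \<mu>2 a"])
        (use g_diff[OF P(2)] g_bounds(6)[OF P(2)] in \<open>auto simp: D_x_def D_a_def\<close>)
  qed auto
  then show "norm (D_x g x1 \<mu>1 a1 - D_x g x2 \<mu>2 a2) \<le> g_lip * d" by simp
  show "norm (D_m g x1 \<mu>1 a1 y1 - D_m g x2 \<mu>2 a2 y2) \<le> g_lip * (d + norm (y1 - y2))"
  proof (rule comb[OF _ _ _ _ Cs(3) Cs(2) Cs(1) Cs(2)])
    show "norm (D_m g x1 \<mu>1 a1 y1 - D_m g x1 \<mu>2 a1 y1) \<le> 6 * Lam_g * w"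
      unfolding D_m_def
      by (rule D_mu_lipschitz[OF g_regular P _ _ kr, where \<rho> = 0])
        (use g_bounds(1) moment_norm_1_nonneg[unfolded One_nat_def] pos in \<open>auto simp: D_mm_def\<close>)
    show "norm (D_m g x1 \<mu>2 a1 y1 - D_m g x2 \<mu>2 a1 y1) \<le> Lam_g * norm (x1 - x2)"
      by (rule norm_diff_le_Dfr[of UNIV "\<lambda>x. D_m g x \<mu>2 a1 y1"])
        (use dmx[OF P(2)] g_bounds(3)[OF P(2), of _ a1 y1] in \<open>auto simp: D_xm_def\<close>)
    show "norm (D_m g x2 \<mu>2 a1 y1 - D_m g x2 \<mu>2 a2 y1) \<le> bl_g * norm (a1 - a2)"
      by (rule norm_diff_le_Dfr[of UNIV "\<lambda>a. D_m g x2 \<mu>2 a y1"])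
        (use dmx[OF P(2)] g_bounds(7)[OF P(2), of x2 _ y1] in \<open>auto simp: D_am_def\<close>)
    show "norm (D_m g x2 \<mu>2 a2 y1 - D_m g x2 \<mu>2 a2 y2) \<le> Lam_g * norm (y1 - y2)"
    proof (rule norm_diff_le_Dfr[of UNIV "D_m g x2 \<mu>2 a2"])
      show "D_m g x2 \<mu>2 a2 differentiable at y" for y
        using g_regular[of x2 a2] P(2) unfolding regular2_def twice_differentiable_def D_m_def D_mu_def by auto
      show "norm (Dfr (D_m g x2 \<mu>2 a2) y) \<le> Lam_g" for y
        using g_bounds(5)[OF P(2), of x2 a2 y] by (simp add: D_ym_def)
    qed auto
  qed auto
qed

section \<open>The optimal control\<close>

text \<open>A minimizer over the whole space is critical for every \<open>z\<close>, in the cone or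
  not; outside the cone no other property of the control is used.\<close>

lemma first_order_condition:
  assumes "\<mu> \<in> P2"
  shows "blinfun_apply (D_a f x \<mu> (\<alpha> x \<mu> z)) v \<bullet> z + blinfun_apply (D_a g x \<mu> (\<alpha> x \<mu> z)) v = 0"
proof -
  let ?F = "\<lambda>a. f x \<mu> a \<bullet> z + g x \<mu> a"
  have "is_arg_min ?F (\<lambda>_. True) (\<alpha> x \<mu> z)"
    using opt assms unfolding optimal_control_def by blast
  then have min: "\<forall>y\<in>UNIV. ?F (\<alpha> x \<mu> z) \<le> ?F y"
    by (auto simp: is_arg_min_def not_less)
  have "(?F has_derivative (\<lambda>v. blinfun_apply (D_a f x \<mu> (\<alpha> x \<mu> z)) v \<bullet> z
      + blinfun_apply (D_a g x \<mu> (\<alpha> x \<mu> z)) v)) (at (\<alpha> x \<mu> z))"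
    unfolding D_a_def
    by (intro has_derivative_add has_derivative_inner_left has_derivative_Dfr f_diff g_diff assms)
  then have "(\<lambda>v. blinfun_apply (D_a f x \<mu> (\<alpha> x \<mu> z)) v \<bullet> z
      + blinfun_apply (D_a g x \<mu> (\<alpha> x \<mu> z)) v) = (\<lambda>v. 0)"
    by (rule differential_zero_maxmin[OF UNIV_I open_UNIV]) (use min in blast)
  then show ?thesis by meson
qed

lemma strongly_monotone_D_a_g:
  assumes \<mu>: "\<mu> \<in> P2"
  shows "lam_g * (norm (a1 - a2))\<^sup>2
    \<le> blinfun_apply (D_a g x \<mu> a1) (a1 - a2) - blinfun_apply (D_a g x \<mu> a2) (a1 - a2)"
proof -
  define v where "v = a1 - a2"
  define \<phi> where "\<phi> t = blinfun_apply (D_a g x \<mu> (a2 + t *\<^sub>R v)) v - lam_g * (norm v)\<^sup>2 * t" for t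
  have "\<phi> 0 \<le> \<phi> 1"
  proof (rule DERIV_nonneg_imp_nondecreasing[of 0 1])
    fix t :: real
    let ?D = "D_a (D_a g) x \<mu> (a2 + t *\<^sub>R v)"
    have l: "((\<lambda>t. a2 + t *\<^sub>R v) has_derivative (\<lambda>h. h *\<^sub>R v)) (at t)"
      by (auto intro!: derivative_eq_intros)
    have "((\<lambda>t. D_a g x \<mu> (a2 + t *\<^sub>R v)) has_derivative (\<lambda>h. blinfun_apply ?D (h *\<^sub>R v))) (at t)"
      using has_derivative_compose[OF l has_derivative_Dfr[OF g_diff(6)[OF \<mu>, of x "a2 + t *\<^sub>R v"]]]
      by (simp add: D_a_def[of "D_a g"])
    then have "((\<lambda>t. blinfun_apply (D_a g x \<mu> (a2 + t *\<^sub>R v)) v) has_derivative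
        (\<lambda>h. blinfun_apply (blinfun_apply ?D (h *\<^sub>R v)) v)) (at t)"
      by (auto intro!: derivative_eq_intros)
    then have "((\<lambda>t. blinfun_apply (D_a g x \<mu> (a2 + t *\<^sub>R v)) v) has_real_derivative
        blinfun_apply (blinfun_apply ?D v) v) (at t)"
      by (simp add: has_field_derivative_def blinfun.scaleR_right blinfun.scaleR_left mult_commute_abs)
    then have "(\<phi> has_real_derivative blinfun_apply (blinfun_apply ?D v) v - lam_g * (norm v)\<^sup>2) (at t)"
      unfolding \<phi>_def by (auto intro!: derivative_eq_intros)
    moreover have "lam_g * (norm v)\<^sup>2 \<le> blinfun_apply (blinfun_apply ?D v) v"
      using a2 \<mu> unfolding assumption_a2_def by blast
    ultimately show "\<exists>y. (\<phi> has_real_derivative y) (at t) \<and> 0 \<le> y" by force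
  qed simp
  then show ?thesis by (simp add: \<phi>_def v_def)
qed

text \<open>The factor \<open>2 / lam_g\<close> stems from the half of the convexity that is left
  over. The sum collects the dependence of the first order condition on \<open>z\<close> and,
  through \<open>f\<close> and \<open>g\<close>, on state and law.\<close>

definition control_lip :: real where "control_lip = 2 / lam_g * (Lam_f + f_lip * L + g_lip)"

text \<open>Strong monotonicity of \<open>D_a g\<close> produces
  \<open>lam_g * (norm v)\<^sup>2\<close>; the two first order conditions rewrite it as terms linear
  in \<open>norm v\<close> and one quadratic term, which the cone bound on \<open>z2\<close> keeps
  below half of it.\<close>

lemma control_lipschitz:
  assumes P: "\<mu>1 \<in> P2" "\<mu>2 \<in> P2" and kr: "kr_le \<mu>1 \<mu>2 w" and z2: "norm z2 \<le> L * weight x2 \<mu>2"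
  shows "norm (\<alpha> x1 \<mu>1 z1 - \<alpha> x2 \<mu>2 z2) \<le> control_lip * (norm (x1 - x2) + w + norm (z1 - z2))"
proof -
  define a1 a2 where "a1 = \<alpha> x1 \<mu>1 z1" and "a2 = \<alpha> x2 \<mu>2 z2"
  define v where "v = a1 - a2"
  define d where "d = norm (x1 - x2) + w"
  define N where "N = weight x2 \<mu>2"
  have w: "0 \<le> w" by (rule kr_le_nonneg[OF kr])
  then have d0: "0 \<le> d" by (simp add: d_def)
  have N: "0 < N" unfolding N_def by (rule weight_pos)
  \<comment> \<open>\<open>?A'\<close> and \<open>?B'\<close> separate a change of state and law
    from a change of control, at opposite corners: for \<open>f\<close> the control moves at the
    cone point, for \<open>g\<close> at the first point, where monotonicity is applied.\<close>
  let ?A1 = "D_a f x1 \<mu>1 a1" and ?A2 = "D_a f x2 \<mu>2 a2" and ?A' = "D_a f x2 \<mu>2 a1"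
  let ?B1 = "D_a g x1 \<mu>1 a1" and ?B2 = "D_a g x2 \<mu>2 a2" and ?B' = "D_a g x1 \<mu>1 a2"
  have foc: "blinfun_apply ?A1 v \<bullet> z1 + blinfun_apply ?B1 v = 0" "blinfun_apply ?A2 v \<bullet> z2 + blinfun_apply ?B2 v = 0"
    unfolding a1_def a2_def by (intro first_order_condition P)+
  have t1: "- (blinfun_apply ?A1 v \<bullet> (z1 - z2)) \<le> Lam_f * norm v * norm (z1 - z2)"
  proof -
    have "\<bar>blinfun_apply ?A1 v \<bullet> (z1 - z2)\<bar> \<le> norm (blinfun_apply ?A1 v) * norm (z1 - z2)"
      by (rule Cauchy_Schwarz_ineq2)
    also have "\<dots> \<le> (Lam_f * norm v) * norm (z1 - z2)"
      using norm_blinfun[of ?A1 v] mult_right_mono[OF f_bounds(1)[OF P(1), of x1 a1] norm_ge_zero[of v]]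
      by (intro mult_right_mono) auto
    finally show ?thesis by simp
  qed
  have t2: "- (blinfun_apply (?A1 - ?A') v \<bullet> z2) \<le> f_lip * d * L * norm v"
  proof -
    have "\<bar>blinfun_apply (?A1 - ?A') v \<bullet> z2\<bar> \<le> norm (blinfun_apply (?A1 - ?A') v) * norm z2"
      by (rule Cauchy_Schwarz_ineq2)
    also have "\<dots> \<le> (norm (?A1 - ?A') * norm v) * (L * N)"
      using norm_blinfun[of "?A1 - ?A'" v] z2 by (intro mult_mono) (auto simp: N_def)
    also have "\<dots> = (norm (?A1 - ?A') * N) * (L * norm v)" by simp
    also have "\<dots> \<le> (f_lip * d) * (L * norm v)"
      using weighted_lipschitz_f(1)[OF P kr, of x1 a1 x2 a1] L0
      by (intro mult_right_mono) (auto simp: d_def N_def)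
    finally show ?thesis by (simp add: mult.assoc)
  qed
  \<comment> \<open>Curvature at most \<open>bl_f / N\<close> against \<open>z2\<close> of size at
    most \<open>L * N\<close>: the weight cancels, and \<open>bl_f_L\<close> applies.\<close>
  have t3: "- (blinfun_apply (?A' - ?A2) v \<bullet> z2) \<le> lam_g / 2 * (norm v)\<^sup>2"
  proof -
    have "norm (?A' - ?A2) \<le> bl_f / N * norm v"
      unfolding v_def by (rule norm_diff_le_Dfr[of UNIV "\<lambda>a. D_a f x2 \<mu>2 a"])
        (use f_diff[OF P(2)] f_decay(2)[OF P(2), of x2] in \<open>auto simp: N_def D_a_def[of "D_a f"]\<close>)
    then have n: "norm (blinfun_apply (?A' - ?A2) v) \<le> bl_f / N * norm v * norm v"
      using norm_blinfun[of "?A' - ?A2" v] by (meson mult_right_mono norm_ge_zero order_trans)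
    have "\<bar>blinfun_apply (?A' - ?A2) v \<bullet> z2\<bar> \<le> norm (blinfun_apply (?A' - ?A2) v) * norm z2"
      by (rule Cauchy_Schwarz_ineq2)
    also have "\<dots> \<le> (bl_f / N * norm v * norm v) * (L * N)"
      using n z2 pos N by (intro mult_mono) (auto simp: N_def)
    also have "\<dots> = (bl_f * L) * (norm v)\<^sup>2" using N by (simp add: power2_eq_square)
    also have "\<dots> \<le> lam_g / 2 * (norm v)\<^sup>2" by (intro mult_right_mono bl_f_L) simp
    finally show ?thesis by simp
  qed
  have t4: "- (blinfun_apply (?B' - ?B2) v) \<le> g_lip * d * norm v"
  proof -
    have "\<bar>blinfun_apply (?B' - ?B2) v\<bar> \<le> norm (?B' - ?B2) * norm v"
      using norm_blinfun[of "?B' - ?B2" v] by simp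
    also have "\<dots> \<le> g_lip * d * norm v"
      using lipschitz_g(1)[OF P kr, of x1 a2 x2 a2] by (intro mult_right_mono) (auto simp: d_def)
    finally show ?thesis by simp
  qed
  have "lam_g * (norm v)\<^sup>2 \<le> blinfun_apply ?B1 v - blinfun_apply ?B' v"
    unfolding v_def by (rule strongly_monotone_D_a_g[OF P(1)])
  also have "\<dots> = - (blinfun_apply ?A1 v \<bullet> (z1 - z2)) - (blinfun_apply (?A1 - ?A') v \<bullet> z2)
      - (blinfun_apply (?A' - ?A2) v \<bullet> z2) - blinfun_apply (?B' - ?B2) v"
    using foc by (simp add: blinfun.diff_left inner_diff_left inner_diff_right)
  also have "\<dots> \<le> Lam_f * norm v * norm (z1 - z2) + f_lip * d * L * norm v + lam_g / 2 * (norm v)\<^sup>2 + g_lip * d * norm v"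
    using t1 t2 t3 t4 by linarith
  finally have "norm v * norm v \<le> norm v * (2 / lam_g * (Lam_f * norm (z1 - z2) + f_lip * d * L + g_lip * d))"
    using pos by (simp add: field_simps power2_eq_square)
  then have "norm v \<le> 2 / lam_g * (Lam_f * norm (z1 - z2) + f_lip * d * L + g_lip * d)" if "v \<noteq> 0"
    by (rule mult_left_le_imp_le) (use that in simp)
  then have "norm v \<le> 2 / lam_g * (Lam_f * norm (z1 - z2) + f_lip * d * L + g_lip * d)"
    using d0 lip_nonneg L0 pos by (cases "v = 0") simp_all
  also have "\<dots> \<le> 2 / lam_g * ((Lam_f + f_lip * L + g_lip) * (d + norm (z1 - z2)))"
    using pos d0 lip_nonneg L0 by (intro mult_left_mono) (auto simp: algebra_simps)
  finally show ?thesis unfolding v_def a1_def a2_def d_def control_lip_def by (simp only: mult.assoc)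
qed

section \<open>The coefficients as functions of state, law and adjoint variable\<close>

definition drift :: "'x \<Rightarrow> 'x measure \<Rightarrow> 'x \<Rightarrow> 'x" where
  "drift x \<mu> z = f x \<mu> (\<alpha> x \<mu> z)"

definition local_part :: "'x \<Rightarrow> 'x measure \<Rightarrow> 'x \<Rightarrow> 'x" where
  "local_part x \<mu> z = D_x f x \<mu> (\<alpha> x \<mu> z) \<bullet>\<^sub>D z + grad (D_x g x \<mu> (\<alpha> x \<mu> z))"

definition mean_field_part :: "'x \<Rightarrow> 'x measure \<Rightarrow> 'x \<Rightarrow> 'x \<Rightarrow> 'x" where
  "mean_field_part x \<mu> z y = D_m f x \<mu> (\<alpha> x \<mu> z) y \<bullet>\<^sub>D z + grad (D_m g x \<mu> (\<alpha> x \<mu> z) y)"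

lemma Phi_eq:
  "Phi f g \<alpha> X Z m x = local_part (X x) (push m X) (Z x)
     + (\<integral>y. mean_field_part (X y) (push m X) (Z y) (X x) \<partial>m)"
  by (simp add: Phi_def Phi_integrand_def local_part_def mean_field_part_def Let_def)

lemma Phi_integrand_eq: "Phi_integrand f g \<alpha> X Z m x y = mean_field_part (X y) (push m X) (Z y) (X x)"
  by (simp add: Phi_integrand_def mean_field_part_def Let_def)

text \<open>One constant for the drift and both adjoint parts. The summand 1 makes it positive, as a
  rate of growth has to be.\<close>

definition lip :: real where
  "lip = 1 + Lam_f * (1 + control_lip) + DIM('x) * (Lam_f + (L * f_lip + g_lip) * (1 + control_lip))"

lemma lip_ge:
  "0 \<le> control_lip" "1 \<le> lip" "Lam_f * (1 + control_lip) \<le> lip"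
  "DIM('x) * (Lam_f + (L * f_lip + g_lip) * (1 + control_lip)) \<le> lip"
proof -
  show c: "0 \<le> control_lip" unfolding control_lip_def using pos lip_nonneg L0 by simp
  have "0 \<le> Lam_f * (1 + control_lip)" "0 \<le> DIM('x) * (Lam_f + (L * f_lip + g_lip) * (1 + control_lip))"
    using pos c lip_nonneg L0 by simp_all
  then show "1 \<le> lip" "Lam_f * (1 + control_lip) \<le> lip"
    "DIM('x) * (Lam_f + (L * f_lip + g_lip) * (1 + control_lip)) \<le> lip"
    unfolding lip_def by linarith+
qed

text \<open>Only the second point has to lie in the cone; the adjoint variable of the first is
  unrestricted, which is what makes uniqueness hold for solutions that may leave the cone.\<close>

lemma coefficients_lipschitz:
  fixes x1 x2 z1 z2 :: 'x
  assumes P: "\<mu>1 \<in> P2" "\<mu>2 \<in> P2" and kr: "kr_le \<mu>1 \<mu>2 w" and z2: "norm z2 \<le> L * weight x2 \<mu>2"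
  defines "D \<equiv> norm (x1 - x2) + w + norm (z1 - z2)"
  shows "norm (drift x1 \<mu>1 z1 - drift x2 \<mu>2 z2) \<le> lip * D"
    "norm (local_part x1 \<mu>1 z1 - local_part x2 \<mu>2 z2) \<le> lip * D"
    "norm (mean_field_part x1 \<mu>1 z1 y1 - mean_field_part x2 \<mu>2 z2 y2) \<le> lip * (D + norm (y1 - y2))"
proof -
  let ?a1 = "\<alpha> x1 \<mu>1 z1" and ?a2 = "\<alpha> x2 \<mu>2 z2" and ?F = "L * f_lip + g_lip"
  define d where "d = norm (x1 - x2) + w"
  have d0: "0 \<le> d" using kr_le_nonneg[OF kr] by (simp add: d_def)
  have D: "D = d + norm (z1 - z2)" by (simp add: D_def d_def)
  have D0: "0 \<le> D" "norm (z1 - z2) \<le> D" "d \<le> D" using d0 by (simp_all add: D)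
  have Lf: "0 \<le> Lam_f" and LC: "0 \<le> ?F" using pos L0 lip_nonneg by simp_all
  have da: "d + norm (?a1 - ?a2) \<le> (1 + control_lip) * D"
    using control_lipschitz[OF P kr z2, of x1 z1] D0(3) by (simp add: D_def distrib_right)
  have "norm (drift x1 \<mu>1 z1 - drift x2 \<mu>2 z2) \<le> Lam_f * (d + norm (?a1 - ?a2))"
    using lipschitz_f[OF P kr] by (simp add: drift_def d_def)
  also have "\<dots> \<le> Lam_f * (1 + control_lip) * D" using mult_left_mono[OF da Lf] by (simp add: mult.assoc)
  also have "\<dots> \<le> lip * D" by (rule mult_right_mono[OF lip_ge(3) D0(1)])
  finally show "norm (drift x1 \<mu>1 z1 - drift x2 \<mu>2 z2) \<le> lip * D" .
  have fin: "DIM('x) * (Lam_f * norm (z1 - z2) + ?F * (d + norm (?a1 - ?a2) + r)) \<le> lip * (D + r)"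
    if r: "0 \<le> r" for r
  proof -
    have "Lam_f * norm (z1 - z2) + ?F * (d + norm (?a1 - ?a2) + r)
        \<le> Lam_f * (D + r) + ?F * ((1 + control_lip) * (D + r))"
    proof (intro add_mono mult_left_mono Lf LC)
      show "norm (z1 - z2) \<le> D + r" using D0 r by simp
      show "d + norm (?a1 - ?a2) + r \<le> (1 + control_lip) * (D + r)"
        using da r mult_nonneg_nonneg[OF lip_ge(1) r] unfolding distrib_left distrib_right mult_1_left by linarith
    qed
    also have "\<dots> = (Lam_f + ?F * (1 + control_lip)) * (D + r)" by (simp add: algebra_simps)
    finally have "DIM('x) * (Lam_f * norm (z1 - z2) + ?F * (d + norm (?a1 - ?a2) + r))
        \<le> DIM('x) * (Lam_f + ?F * (1 + control_lip)) * (D + r)"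
      by (simp add: mult.assoc mult_left_mono)
    also have "\<dots> \<le> lip * (D + r)" using lip_ge(4) D0 r by (intro mult_right_mono) auto
    finally show ?thesis .
  qed
  have "norm (local_part x1 \<mu>1 z1 - local_part x2 \<mu>2 z2)
      \<le> DIM('x) * (Lam_f * norm (z1 - z2) + ?F * (d + norm (?a1 - ?a2)))"
    unfolding local_part_def
    by (rule norm_dotD_grad_diff[OF f_bounds(3)[OF P(1)] _ z2 _ L0])
      (use weighted_lipschitz_f(2)[OF P kr] lipschitz_g(2)[OF P kr] in \<open>simp_all add: d_def\<close>)
  also have "\<dots> \<le> lip * D" using fin[of 0] by simp
  finally show "norm (local_part x1 \<mu>1 z1 - local_part x2 \<mu>2 z2) \<le> lip * D" .
  have "norm (mean_field_part x1 \<mu>1 z1 y1 - mean_field_part x2 \<mu>2 z2 y2)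
      \<le> DIM('x) * (Lam_f * norm (z1 - z2) + ?F * (d + norm (?a1 - ?a2) + norm (y1 - y2)))"
    unfolding mean_field_part_def
    by (rule norm_dotD_grad_diff[OF f_bounds(2)[OF P(1)] _ z2 _ L0])
      (use weighted_lipschitz_f(3)[OF P kr] lipschitz_g(3)[OF P kr] in \<open>simp_all add: d_def\<close>)
  also have "\<dots> \<le> lip * (D + norm (y1 - y2))" by (rule fin) simp
  finally show "norm (mean_field_part x1 \<mu>1 z1 y1 - mean_field_part x2 \<mu>2 z2 y2) \<le> lip * (D + norm (y1 - y2))" .
qed

text \<open>With \<open>z = 0\<close> both 0, by (h1), and the control are critical points of the
  strongly convex map \<open>g 0 dirac0\<close>.\<close>

lemma control_zero: "\<alpha> 0 dirac0 0 = 0"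
proof -
  let ?a = "\<alpha> 0 dirac0 0"
  have "lam_g * (norm (?a - 0))\<^sup>2 \<le> blinfun_apply (D_a g 0 dirac0 ?a) (?a - 0) - blinfun_apply (D_a g 0 dirac0 0) (?a - 0)"
    by (rule strongly_monotone_D_a_g) simp
  also have "\<dots> = 0"
    using first_order_condition[of dirac0 0 0 ?a] D_g0 by simp
  finally show ?thesis using pos by (simp add: mult_le_0_iff)
qed

lemma coefficients_zero:
  "drift 0 dirac0 0 = 0" "local_part 0 dirac0 0 = 0" "mean_field_part 0 dirac0 0 0 = 0"
  by (simp_all add: drift_def local_part_def mean_field_part_def control_zero D_f0 D_g0 dotD_def grad_def)

text \<open>The origin with adjoint variable 0 lies in the cone, so the Lipschitz estimate may take
  it as second point. The bound therefore holds at every point, which makes a priori estimates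
  possible for solutions outside the cone.\<close>

lemma coefficients_growth:
  fixes x z :: 'x
  assumes \<mu>: "\<mu> \<in> P2"
  defines "D \<equiv> norm x + moment_norm 1 \<mu> + norm z"
  shows "norm (drift x \<mu> z) \<le> lip * D" "norm (local_part x \<mu> z) \<le> lip * D"
    "norm (mean_field_part x \<mu> z y) \<le> lip * (D + norm y)"
proof -
  have "norm (0 :: 'x) \<le> L * weight 0 dirac0"
    using mult_nonneg_nonneg[OF L0 less_imp_le[OF weight_pos[of 0 dirac0]]] by simp
  note * = coefficients_lipschitz[OF \<mu> return_P2 kr_le_dirac0[OF \<mu>] this, of x z,
      unfolded coefficients_zero diff_0_right, folded D_def]
  show "norm (drift x \<mu> z) \<le> lip * D" "norm (local_part x \<mu> z) \<le> lip * D" by (fact *)+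
  show "norm (mean_field_part x \<mu> z y) \<le> lip * (D + norm y)"
    using *(3)[of y 0] unfolding coefficients_zero diff_0_right .
qed

end

section \<open>Lipschitz continuity from a bounded L-derivative\<close>

lemma prob_space_unit: "prob_space unit_prob"
  by (rule prob_spaceI) (simp add: emeasure_restrict_space space_restrict_space)

lemma sets_unit: "B \<in> sets unit_prob \<longleftrightarrow> B \<subseteq> {0..1} \<and> B \<in> sets borel"
  by (subst sets_restrict_space_iff) auto

text \<open>Lebesgue measure has no atoms: the mass of \<open>A\<close> below \<open>t\<close> is
  1-Lipschitz in \<open>t\<close>, and the intermediate value theorem finds the level
  \<open>p\<close>.\<close>

lemma unit_sub_measure:
  assumes A: "A \<in> sets unit_prob" and p: "0 \<le> p" "p \<le> measure unit_prob A"
  obtains B where "B \<subseteq> A" "B \<in> sets unit_prob" "measure unit_prob B = p"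
proof -
  interpret prob_space unit_prob by (rule prob_space_unit)
  have S: "A \<inter> {..t} \<in> sets unit_prob" for t :: real
    using A by (auto simp: sets_unit)
  define m where "m t = measure unit_prob (A \<inter> {..t})" for t
  have lip: "\<bar>m s - m t\<bar> \<le> \<bar>s - t\<bar>" for s t
  proof -
    have *: "m t - m s \<le> t - s" if "s \<le> t" for s t
    proof -
      have eq: "A \<inter> {..t} = (A \<inter> {..s}) \<union> (A \<inter> {s<..t})" using that by auto
      have i: "{s<..t} \<inter> {0..1} \<in> sets unit_prob" "A \<inter> {s<..t} \<in> sets unit_prob"
        using A by (auto simp: sets_unit)
      have "m t = m s + measure unit_prob (A \<inter> {s<..t})"
        unfolding m_def eq by (rule finite_measure_Union) (use S[of s] i in auto)
      moreover have "measure unit_prob (A \<inter> {s<..t}) \<le> measure unit_prob ({s<..t} \<inter> {0..1})"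
        using A i by (intro finite_measure_mono) (auto simp: sets_unit)
      moreover have "measure unit_prob ({s<..t} \<inter> {0..1}) \<le> t - s"
      proof -
        have "measure unit_prob ({s<..t} \<inter> {0..1}) = measure lborel ({s<..t} \<inter> {0..1})"
          by (rule measure_restrict_space) auto
        also have "\<dots> \<le> measure lborel {s<..t}"
          by (rule measure_mono_fmeasurable) (use that in \<open>auto simp: fmeasurable_def\<close>)
        finally show ?thesis using that by simp
      qed
      ultimately show ?thesis by linarith
    qed
    have mono: "m s \<le> m t" if "s \<le> t" for s t
      unfolding m_def by (rule finite_measure_mono[OF _ S]) (use that in auto)
    show ?thesis using *[of s t] *[of t s] mono[of s t] mono[of t s] by (cases "s \<le> t") auto
  qed
  have "1-lipschitz_on {0..1} m"
    by (rule lipschitz_onI) (use lip in \<open>auto simp: dist_real_def\<close>)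
  then have c: "continuous_on {0..1} m" by (rule lipschitz_on_continuous_on)
  have sub: "A \<subseteq> {0..1}" using sets.sets_into_space[OF A] by (simp add: space_restrict_space)
  have "A \<inter> {..1} = A" using sub by auto
  then have m1: "m 1 = measure unit_prob A" by (simp add: m_def)
  have "m 0 \<le> measure lborel {0::real}"
  proof -
    have z: "{0 :: real} \<in> sets unit_prob" by (simp add: sets_unit)
    have "m 0 \<le> measure unit_prob {0}"
      unfolding m_def by (rule finite_measure_mono[OF _ z]) (use sub in auto)
    also have "\<dots> = measure lborel {0::real}"
      by (rule measure_restrict_space) auto
    finally show ?thesis .
  qed
  then have "m 0 \<le> p" using p by simp
  then obtain t where "0 \<le> t" "t \<le> 1" "m t = p"
    using IVT'[OF _ _ _ c, of p] p m1 by auto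
  then show ?thesis using that[of "A \<inter> {..t}"] S by (auto simp: m_def)
qed

lemma unit_partition:
  assumes "finite I" "A \<in> sets unit_prob" "\<And>i. i \<in> I \<Longrightarrow> 0 \<le> p i" "(\<Sum>i\<in>I. p i) \<le> measure unit_prob A"
  shows "\<exists>B. (\<forall>i\<in>I. B i \<subseteq> A \<and> B i \<in> sets unit_prob \<and> measure unit_prob (B i) = p i) \<and> disjoint_family_on B I"
  using assms
proof (induction I arbitrary: A rule: finite_induct)
  case empty
  then show ?case by (simp add: disjoint_family_on_def)
next
  case (insert j I)
  interpret prob_space unit_prob by (rule prob_space_unit)
  have pj: "0 \<le> p j" "0 \<le> sum p I" using insert by (auto intro: sum_nonneg)
  obtain C where C: "C \<subseteq> A" "C \<in> sets unit_prob" "measure unit_prob C = p j"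
    using unit_sub_measure[OF insert.prems(1) pj(1)] insert pj by auto
  have "measure unit_prob (A - C) = measure unit_prob A - p j"
    using finite_measure_Diff[OF insert.prems(1) C(2,1)] C(3) by simp
  then have "\<exists>B. (\<forall>i\<in>I. B i \<subseteq> A - C \<and> B i \<in> sets unit_prob \<and> measure unit_prob (B i) = p i) \<and> disjoint_family_on B I"
    using insert C by (intro insert.IH) auto
  then obtain B where B: "\<And>i. i \<in> I \<Longrightarrow> B i \<subseteq> A - C \<and> B i \<in> sets unit_prob \<and> measure unit_prob (B i) = p i"
    "disjoint_family_on B I" by blast
  have "\<forall>i\<in>insert j I. (B(j := C)) i \<subseteq> A \<and> (B(j := C)) i \<in> sets unit_prob \<and> measure unit_prob ((B(j := C)) i) = p i"
    using B(1) C insert.hyps by auto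
  moreover have "disjoint_family_on (B(j := C)) (insert j I)"
  proof (subst disjoint_family_on_insert[OF insert.hyps(2)], intro conjI)
    show "(B(j := C)) j \<inter> (\<Union>i\<in>I. (B(j := C)) i) = {}"
      using B(1) insert.hyps(2) by (auto split: if_splits)
    have "(B(j := C)) i = B i" if "i \<in> I" for i using insert.hyps(2) that by auto
    then show "disjoint_family_on (B(j := C)) I"
      using B(2) by (simp add: disjoint_family_on_def)
  qed
  ultimately show ?case by blast
qed

text \<open>The cells have total mass 1 but may miss a null set; a partition copied to the unit
  interval is of this kind.\<close>

lemma measure_push_finite:
  fixes W :: "'y \<Rightarrow> 'x::euclidean_space"
  assumes "prob_space M" and W: "W \<in> borel_measurable M" and I: "finite I" and B: "\<And>i. i \<in> I \<Longrightarrow> B i \<in> sets M"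
    and dis: "disjoint_family_on B I" and p: "(\<Sum>i\<in>I. measure M (B i)) = 1"
    and z: "\<And>i y. i \<in> I \<Longrightarrow> y \<in> B i \<Longrightarrow> W y = z i" and S: "S \<in> sets borel"
  shows "measure (push M W) S = (\<Sum>i\<in>I. measure M (B i) * indicator S (z i))"
proof -
  interpret prob_space M by fact
  have V: "W -` S \<inter> space M \<in> sets M" by (rule measurable_sets[OF W S])
  have U: "(\<Union>i\<in>I. B i) \<in> sets M" using I B by auto
  have "measure M (\<Union>i\<in>I. B i) = 1"
    using finite_measure_finite_Union[OF I _ dis] B p by auto
  then have nul: "measure M (space M - (\<Union>i\<in>I. B i)) = 0"
    using prob_compl[OF U] by simp
  have dis': "disjoint_family_on (\<lambda>i. B i \<inter> W -` S) I"
    using dis unfolding disjoint_family_on_def by blast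
  have Bi: "B i \<inter> W -` S = (if z i \<in> S then B i else {})" if "i \<in> I" for i
    using z[OF that] by auto
  have UV: "(\<Union>i\<in>I. B i \<inter> W -` S) \<in> sets M" using I B Bi by auto
  have "measure M (W -` S \<inter> space M) = measure M (\<Union>i\<in>I. B i \<inter> W -` S)"
  proof (rule antisym)
    have "measure M (W -` S \<inter> space M) \<le> measure M ((\<Union>i\<in>I. B i \<inter> W -` S) \<union> (space M - (\<Union>i\<in>I. B i)))"
      by (rule finite_measure_mono) (use UV U in auto)
    also have "\<dots> \<le> measure M (\<Union>i\<in>I. B i \<inter> W -` S) + measure M (space M - (\<Union>i\<in>I. B i))"
      by (rule measure_Un_le) (use UV U in auto)
    finally show "measure M (W -` S \<inter> space M) \<le> measure M (\<Union>i\<in>I. B i \<inter> W -` S)" using nul by simp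
    show "measure M (\<Union>i\<in>I. B i \<inter> W -` S) \<le> measure M (W -` S \<inter> space M)"
      by (rule finite_measure_mono[OF _ V]) (use B sets.sets_into_space in auto)
  qed
  also have "\<dots> = (\<Sum>i\<in>I. measure M (B i \<inter> W -` S))"
    by (rule finite_measure_finite_Union[OF I _ dis']) (use B Bi in auto)
  also have "\<dots> = (\<Sum>i\<in>I. measure M (B i) * indicator S (z i))"
    by (rule sum.cong) (use Bi in auto)
  finally show ?thesis using measure_distr[OF W S] by simp
qed

lemma push_finite_eq:
  fixes W :: "'y \<Rightarrow> 'x::euclidean_space" and W' :: "'z \<Rightarrow> 'x"
  assumes M: "prob_space M" and W: "W \<in> borel_measurable M" and I: "finite I"
    and B: "\<And>i. i \<in> I \<Longrightarrow> B i \<in> sets M" and dis: "disjoint_family_on B I"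
    and M': "prob_space M'" and W': "W' \<in> borel_measurable M'"
    and B': "\<And>i. i \<in> I \<Longrightarrow> B' i \<in> sets M'" and dis': "disjoint_family_on B' I"
    and p: "(\<Sum>i\<in>I. measure M (B i)) = 1" and pp: "\<And>i. i \<in> I \<Longrightarrow> measure M' (B' i) = measure M (B i)"
    and z: "\<And>i y. i \<in> I \<Longrightarrow> y \<in> B i \<Longrightarrow> W y = z i" and z': "\<And>i y. i \<in> I \<Longrightarrow> y \<in> B' i \<Longrightarrow> W' y = z i"
  shows "push M W = push M' W'"
proof (rule measure_eqI)
  fix S assume "S \<in> sets (push M W)"
  then have S: "S \<in> sets borel" by simp
  interpret P: prob_space "push M W" by (rule prob_space.prob_space_distr[OF M W])
  interpret P': prob_space "push M' W'" by (rule prob_space.prob_space_distr[OF M' W'])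
  have p': "(\<Sum>i\<in>I. measure M' (B' i)) = 1" using p pp by simp
  have "measure (push M W) S = measure (push M' W') S"
    using measure_push_finite[OF M W I B dis p z S] measure_push_finite[OF M' W' I B' dis' p' z' S] pp by simp
  then show "emeasure (push M W) S = emeasure (push M' W') S"
    by (simp add: P.emeasure_eq_measure P'.emeasure_eq_measure)
qed simp

lemma integrable_of_square:
  fixes W :: "'y \<Rightarrow> 'x::euclidean_space"
  assumes "prob_space M" and W: "W \<in> borel_measurable M" and i: "integrable M (\<lambda>x. (norm (W x))\<^sup>2)"
  shows "integrable M W"
proof -
  interpret prob_space M by fact
  have "(\<lambda>x. norm (W x)) \<in> borel_measurable M" using W by measurable
  then have "integrable M (\<lambda>x. norm (W x))" using i by (rule square_integrable_imp_integrable)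
  then show ?thesis using integrable_norm_iff[OF W] by simp
qed

lemma simple_function_P2:
  assumes M: "prob_space M" and W: "simple_function M (W :: 'y \<Rightarrow> 'x::euclidean_space)"
  shows "push M W \<in> P2"
proof -
  interpret prob_space M by fact
  have m: "W \<in> borel_measurable M" by (rule borel_measurable_simple_function[OF W])
  have "integrable M (\<lambda>\<omega>. (norm (W \<omega>))\<^sup>2)"
  proof (rule integrable_const_bound)
    show "AE \<omega> in M. norm ((norm (W \<omega>))\<^sup>2) \<le> Max ((\<lambda>w. (norm w)\<^sup>2) ` W ` space M)"
      using W by (intro AE_I2) (auto simp: simple_function_def intro!: Max_ge)
    show "(\<lambda>\<omega>. (norm (W \<omega>))\<^sup>2) \<in> borel_measurable M" using m by measurable
  qed
  then show ?thesis
    using m prob_space.prob_space_distr[OF M m]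
    by (simp add: P2_def integrable_distr_eq)
qed

text \<open>An L-derivative expands \<open>h\<close> at one lift \<open>U\<close> only, on which nothing but its law is known.
  Splitting the level sets of \<open>U\<close> lets a finite partition of \<open>M\<close> be copied to the unit interval
  compatibly with \<open>U\<close>.\<close>

lemma unit_representation:
  fixes z :: "'i \<Rightarrow> 'x::euclidean_space"
  assumes M: "prob_space M" and W: "W \<in> borel_measurable M" and I: "finite I"
    and A: "\<And>i. i \<in> I \<Longrightarrow> A i \<in> sets M" and dis: "disjoint_family_on A I" and p: "(\<Sum>i\<in>I. measure M (A i)) = 1"
    and z: "\<And>i y. i \<in> I \<Longrightarrow> y \<in> A i \<Longrightarrow> W y = z i"
    and U: "U \<in> borel_measurable unit_prob" and eq: "push unit_prob U = push M W"
  shows "\<exists>B. (\<forall>i\<in>I. B i \<in> sets unit_prob \<and> measure unit_prob (B i) = measure M (A i) \<and> (\<forall>\<omega>\<in>B i. U \<omega> = z i))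
    \<and> disjoint_family_on B I"
proof -
  define V where "V v = U -` {v} \<inter> space unit_prob" for v
  define J where "J v = {i\<in>I. z i = v}" for v
  have V: "V v \<in> sets unit_prob" for v
    unfolding V_def by (rule measurable_sets[OF U]) simp
  \<comment> \<open>A level set of \<open>U\<close> has exactly the mass of the cells with that
    value, so copies of them fit into it.\<close>
  have "(\<Sum>i\<in>J v. measure M (A i)) \<le> measure unit_prob (V v)" for v
  proof -
    have "measure unit_prob (V v) = measure (push unit_prob U) {v}"
      using measure_distr[OF U, of "{v}"] by (simp add: V_def)
    also have "\<dots> = (\<Sum>i\<in>I. measure M (A i) * indicator {v} (z i))"
      unfolding eq by (rule measure_push_finite[OF M W I A dis p z]) auto
    also have "\<dots> = (\<Sum>i\<in>J v. measure M (A i))"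
      unfolding J_def by (rule sum.mono_neutral_cong_right) (use I in \<open>auto simp: indicator_def\<close>)
    finally show ?thesis by simp
  qed
  then have "\<exists>B. (\<forall>i\<in>J v. B i \<subseteq> V v \<and> B i \<in> sets unit_prob \<and> measure unit_prob (B i) = measure M (A i))
      \<and> disjoint_family_on B (J v)" for v
    using I by (intro unit_partition V) (auto simp: J_def)
  then obtain F where F: "\<And>v i. i \<in> J v \<Longrightarrow> F v i \<subseteq> V v \<and> F v i \<in> sets unit_prob \<and> measure unit_prob (F v i) = measure M (A i)"
    "\<And>v. disjoint_family_on (F v) (J v)"
    by metis
  have Jz: "i \<in> J (z i)" if "i \<in> I" for i using that by (simp add: J_def)
  show ?thesis
  proof (intro exI[of _ "\<lambda>i. F (z i) i"] conjI ballI)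
    show "disjoint_family_on (\<lambda>i. F (z i) i) I"
      unfolding disjoint_family_on_def
    proof (intro ballI impI)
      fix i j assume ij: "i \<in> I" "j \<in> I" "i \<noteq> j"
      show "F (z i) i \<inter> F (z j) j = {}"
      proof (cases "z i = z j")
        case True
        then show ?thesis
          using F(2)[of "z i"] ij Jz[OF ij(1)] Jz[OF ij(2)] unfolding disjoint_family_on_def by metis
      next
        case False
        then have "V (z i) \<inter> V (z j) = {}" by (auto simp: V_def)
        then show ?thesis using F(1)[OF Jz[OF ij(1)]] F(1)[OF Jz[OF ij(2)]] by blast
      qed
    qed
    show "U \<omega> = z i" if "i \<in> I" "\<omega> \<in> F (z i) i" for i \<omega>
      using F(1)[OF Jz[OF that(1)]] that(2) by (auto simp: V_def)
  qed (use F(1)[OF Jz] in auto)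
qed

text \<open>Along the segment \<open>S t\<close> from \<open>X\<close> to \<open>Y\<close> the law
  always has finitely many atoms. At each \<open>t\<close> the L-derivative brings its own lift
  \<open>V\<close>; the partition by the values of \<open>(X, Y)\<close> is copied to it, and the
  direction \<open>Y - X\<close> with it, so \<open>h (push M (S t))\<close> is differentiable in
  \<open>t\<close>. A bound on the derivative that is uniform in \<open>y\<close> pairs with the
  first moment of the direction: the estimate is in mean although differentiability is in mean
  square.\<close>

lemma L_derivative_lipschitz_simple:
  fixes h :: "'x::euclidean_space measure \<Rightarrow> 'b::euclidean_space"
  assumes h: "\<And>\<mu>. \<mu> \<in> P2 \<Longrightarrow> \<exists>D. has_L_derivative h D \<mu> \<and> (\<forall>y. norm (D y) \<le> L)"
    and M: "prob_space M" and X: "simple_function M X" and Y: "simple_function M Y"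
  shows "norm (h (push M X) - h (push M Y)) \<le> L * (\<integral>\<omega>. norm (X \<omega> - Y \<omega>) \<partial>M)"
proof -
  interpret M: prob_space M by fact
  interpret U: prob_space unit_prob by (rule prob_space_unit)
  define I where "I = (\<lambda>\<omega>. (X \<omega>, Y \<omega>)) ` space M"
  define A where "A i = (\<lambda>\<omega>. (X \<omega>, Y \<omega>)) -` {i} \<inter> space M" for i
  have XY: "simple_function M (\<lambda>\<omega>. (X \<omega>, Y \<omega>))" by (rule simple_function_Pair[OF X Y])
  have I: "finite I" using XY by (simp add: I_def simple_function_def)
  have A: "A i \<in> sets M" for i using simple_functionD(2)[OF XY] by (simp add: A_def)
  have dis: "disjoint_family_on A I" by (auto simp: disjoint_family_on_def A_def)
  have cov: "(\<Union>i\<in>I. A i) = space M" by (auto simp: I_def A_def)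
  have p: "(\<Sum>i\<in>I. measure M (A i)) = 1"
  proof -
    have "A ` I \<subseteq> sets M" using A by blast
    from M.finite_measure_finite_Union[OF I this dis] show ?thesis by (simp add: cov M.prob_space)
  qed
  define w where "w i = snd i - fst i" for i :: "'x \<times> 'x"
  define z where "z t i = fst i + t *\<^sub>R w i" for t i
  define S where "S t \<omega> = X \<omega> + t *\<^sub>R (Y \<omega> - X \<omega>)" for t \<omega>
  have S: "simple_function M (S t)" for t
    unfolding S_def using simple_function_compose1[OF XY, of "\<lambda>i. fst i + t *\<^sub>R (snd i - fst i)"] by simp
  have Sm: "S t \<in> borel_measurable M" for t by (rule borel_measurable_simple_function[OF S])
  have Sz: "S t \<omega> = z t i" if "i \<in> I" "\<omega> \<in> A i" for t i \<omega>
    using that by (auto simp: S_def z_def w_def A_def)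
  define \<phi> where "\<phi> t = h (push M (S t))" for t
  define K where "K = (\<Sum>i\<in>I. measure M (A i) * norm (w i))"
  have K: "(\<integral>\<omega>. norm (X \<omega> - Y \<omega>) \<partial>M) = K"
  proof -
    have "norm (X \<omega> - Y \<omega>) = (\<Sum>i\<in>I. indicator (A i) \<omega> * norm (w i))" if "\<omega> \<in> space M" for \<omega>
    proof -
      have "(\<Sum>i\<in>I. indicator (A i) \<omega> * norm (w i)) = (\<Sum>i\<in>I. if i = (X \<omega>, Y \<omega>) then norm (w i) else 0)"
        by (rule sum.cong) (use that in \<open>auto simp: A_def indicator_def\<close>)
      then show ?thesis using I that by (auto simp: I_def w_def norm_minus_commute)
    qed
    then have "(\<integral>\<omega>. norm (X \<omega> - Y \<omega>) \<partial>M) = (\<integral>\<omega>. (\<Sum>i\<in>I. indicator (A i) \<omega> * norm (w i)) \<partial>M)"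
      by (intro Bochner_Integration.integral_cong) auto
    also have "\<dots> = K"
      unfolding K_def using A M.finite_measure
      by (subst Bochner_Integration.integral_sum) (auto simp: M.emeasure_eq_measure)
    finally show ?thesis .
  qed
  have deriv: "\<exists>c. (\<phi> has_derivative (\<lambda>\<tau>. \<tau> *\<^sub>R c)) (at t) \<and> norm c \<le> L * K" for t
  proof -
    obtain D where D: "has_L_derivative h D (push M (S t))" and DL: "\<And>y. norm (D y) \<le> L"
      using h[OF simple_function_P2[OF M S]] by blast
    have L: "0 \<le> L" using order_trans[OF norm_ge_zero DL] by blast
    obtain V where V: "V \<in> L2_rv" "push unit_prob V = push M (S t)" and DV: "(\<lambda>w. D (V w)) \<in> L2_rv"
      and exp: "\<And>\<epsilon>. \<epsilon> > 0 \<Longrightarrow> \<exists>\<delta>>0. \<forall>Y\<in>L2_rv. L2_norm_rv Y < \<delta> \<longrightarrow>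
           norm (h (push unit_prob (\<lambda>w. V w + Y w)) - h (push M (S t))
                 - (\<integral>w. blinfun_apply (D (V w)) (Y w) \<partial>unit_prob)) \<le> \<epsilon> * L2_norm_rv Y"
      using D unfolding has_L_derivative_def by blast
    have Vm: "V \<in> borel_measurable unit_prob" using V(1) by (simp add: L2_rv_def)
    have "\<exists>B. (\<forall>i\<in>I. B i \<in> sets unit_prob \<and> measure unit_prob (B i) = measure M (A i)
        \<and> (\<forall>\<omega>\<in>B i. V \<omega> = z t i)) \<and> disjoint_family_on B I"
      by (rule unit_representation[OF M Sm I A dis p Sz Vm V(2)])
    then obtain B where B0: "\<forall>i\<in>I. B i \<in> sets unit_prob \<and> measure unit_prob (B i) = measure M (A i)
        \<and> (\<forall>\<omega>\<in>B i. V \<omega> = z t i)" and B3: "disjoint_family_on B I"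
      by (elim exE conjE)
    have B: "\<And>i. i \<in> I \<Longrightarrow> B i \<in> sets unit_prob"
      "\<And>i. i \<in> I \<Longrightarrow> measure unit_prob (B i) = measure M (A i)" "disjoint_family_on B I"
      "\<And>i \<omega>. i \<in> I \<Longrightarrow> \<omega> \<in> B i \<Longrightarrow> V \<omega> = z t i"
      using B0 B3 by simp_all
    \<comment> \<open>The copy of the direction \<open>Y - X\<close>: constant \<open>w i\<close> on
      the cell \<open>B i\<close>.\<close>
    define W where "W \<omega> = (\<Sum>i\<in>I. indicator (B i) \<omega> *\<^sub>R w i)" for \<omega>
    have WB: "W \<omega> = w i" if "i \<in> I" "\<omega> \<in> B i" for i \<omega>
    proof -
      have "W \<omega> = (\<Sum>j\<in>I. if j = i then w j else 0)"
        unfolding W_def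
      proof (rule sum.cong)
        fix j assume "j \<in> I"
        then have "j = i \<or> \<omega> \<notin> B j" using B(3) that unfolding disjoint_family_on_def by blast
        then show "indicator (B j) \<omega> *\<^sub>R w j = (if j = i then w j else 0)"
          using that by (auto simp: indicator_def)
      qed simp
      then show ?thesis using I that by simp
    qed
    have Wm: "W \<in> borel_measurable unit_prob"
      unfolding W_def using B(1) by (intro borel_measurable_sum borel_measurable_scaleR) auto
    have Wn: "norm (W \<omega>) \<le> (\<Sum>i\<in>I. indicator (B i) \<omega> * norm (w i))" for \<omega>
      unfolding W_def by (rule order_trans[OF norm_sum]) (simp add: sum_mono)
    have Wb: "norm (W \<omega>) \<le> (\<Sum>i\<in>I. norm (w i))" for \<omega>
      by (rule order_trans[OF Wn sum_mono]) (auto simp: indicator_def)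
    have tau: "(\<lambda>\<omega>. \<tau> *\<^sub>R W \<omega>) \<in> L2_rv" for \<tau>
    proof -
      have "integrable unit_prob (\<lambda>\<omega>. (norm (\<tau> *\<^sub>R W \<omega>))\<^sup>2)"
      proof (rule U.integrable_const_bound)
        show "AE \<omega> in unit_prob. norm ((norm (\<tau> *\<^sub>R W \<omega>))\<^sup>2) \<le> (\<bar>\<tau>\<bar> * (\<Sum>i\<in>I. norm (w i)))\<^sup>2"
          using Wb by (intro AE_I2) (auto intro!: power_mono mult_left_mono)
        show "(\<lambda>\<omega>. (norm (\<tau> *\<^sub>R W \<omega>))\<^sup>2) \<in> borel_measurable unit_prob" using Wm by measurable
      qed
      then show ?thesis using Wm by (simp add: L2_rv_def)
    qed
    \<comment> \<open>On \<open>B i\<close> the sum equals \<open>z (t + \<tau>) i\<close>, so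
      moving the lift in direction \<open>W\<close> realizes \<open>S (t + \<tau>)\<close> in
      law.\<close>
    have pushe: "push unit_prob (\<lambda>\<omega>. V \<omega> + \<tau> *\<^sub>R W \<omega>) = push M (S (t + \<tau>))" for \<tau>
    proof (rule push_finite_eq[OF prob_space_unit _ I B(1,3) M Sm A dis, where z = "z (t + \<tau>)", simplified])
      show "(\<lambda>\<omega>. V \<omega> + \<tau> *\<^sub>R W \<omega>) \<in> borel_measurable unit_prob" using Vm Wm by measurable
      show "(\<Sum>i\<in>I. measure unit_prob (B i)) = 1" using B(2) p by simp
      show "V y + \<tau> *\<^sub>R W y = z (t + \<tau>) i" if "i \<in> I" "y \<in> B i" for i y
        using B(4)[OF that] WB[OF that] by (simp add: z_def scaleR_left_distrib)
    qed (use B(2) Sz in auto)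
    define c where "c = (\<integral>\<omega>. blinfun_apply (D (V \<omega>)) (W \<omega>) \<partial>unit_prob)"
    have ctau: "(\<integral>\<omega>. blinfun_apply (D (V \<omega>)) (\<tau> *\<^sub>R W \<omega>) \<partial>unit_prob) = \<tau> *\<^sub>R c" for \<tau>
      by (simp add: c_def blinfun.scaleR_right)
    have int: "integrable unit_prob (\<lambda>\<omega>. L * (\<Sum>i\<in>I. indicator (B i) \<omega> * norm (w i)))"
      using B(1) by (intro integrable_mult_right Bochner_Integration.integrable_sum integrable_mult_left)
        (auto simp: U.emeasure_eq_measure)
    have "norm c \<le> (\<integral>\<omega>. norm (blinfun_apply (D (V \<omega>)) (W \<omega>)) \<partial>unit_prob)"
      unfolding c_def by (rule integral_norm_bound)
    also have "\<dots> \<le> (\<integral>\<omega>. L * (\<Sum>i\<in>I. indicator (B i) \<omega> * norm (w i)) \<partial>unit_prob)"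
    proof (rule integral_mono'[OF int])
      fix \<omega>
      have "norm (blinfun_apply (D (V \<omega>)) (W \<omega>)) \<le> norm (D (V \<omega>)) * norm (W \<omega>)" by (rule norm_blinfun)
      also have "\<dots> \<le> L * (\<Sum>i\<in>I. indicator (B i) \<omega> * norm (w i))"
        by (intro mult_mono DL Wn L) simp
      finally show "norm (blinfun_apply (D (V \<omega>)) (W \<omega>)) \<le> L * (\<Sum>i\<in>I. indicator (B i) \<omega> * norm (w i))" .
      show "0 \<le> L * (\<Sum>i\<in>I. indicator (B i) \<omega> * norm (w i))"
        using L by (intro mult_nonneg_nonneg sum_nonneg) auto
    qed
    also have "\<dots> = L * K"
    proof -
      have one: "(\<integral>\<omega>. indicator (B i) \<omega> * norm (w i) \<partial>unit_prob) = measure M (A i) * norm (w i)" if "i \<in> I" for i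
        unfolding integral_mult_left_zero Bochner_Integration.integral_indicator
          sets.Int_space_eq2[OF B(1)[OF that]] B(2)[OF that] by (rule refl)
      have sum: "(\<integral>\<omega>. (\<Sum>i\<in>I. indicator (B i) \<omega> * norm (w i)) \<partial>unit_prob)
          = (\<Sum>i\<in>I. \<integral>\<omega>. indicator (B i) \<omega> * norm (w i) \<partial>unit_prob)"
        by (rule Bochner_Integration.integral_sum)
          (use B(1) in \<open>auto intro!: integrable_mult_left simp: U.emeasure_eq_measure\<close>)
      show ?thesis
        unfolding integral_mult_right_zero sum K_def by (simp only: one cong: sum.cong)
    qed
    finally have cL: "norm c \<le> L * K" .
    define nW where "nW = L2_norm_rv W"
    have nW0: "0 \<le> nW" by (simp add: nW_def L2_norm_rv_def)
    have ntau: "L2_norm_rv (\<lambda>\<omega>. \<tau> *\<^sub>R W \<omega>) = \<bar>\<tau>\<bar> * nW" for \<tau>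
      by (simp add: nW_def L2_norm_rv_def power_mult_distrib real_sqrt_mult)
    have "(\<phi> has_derivative (\<lambda>\<tau>. \<tau> *\<^sub>R c)) (at t)"
      unfolding has_derivative_at_alt
    proof (intro conjI allI impI)
      show "bounded_linear (\<lambda>\<tau>. \<tau> *\<^sub>R c)" by (rule bounded_linear_scaleR_left)
      fix e :: real assume e: "0 < e"
      \<comment> \<open>\<open>nW\<close> may be 0, hence the added 1.\<close>
      define \<epsilon> where "\<epsilon> = e / (nW + 1)"
      have eps: "0 < \<epsilon>" "\<epsilon> * nW \<le> e" using e nW0 by (auto simp: \<epsilon>_def field_simps)
      obtain \<delta> where \<delta>: "\<delta> > 0" and dd: "\<And>Y. Y \<in> L2_rv \<Longrightarrow> L2_norm_rv Y < \<delta> \<Longrightarrow>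
           norm (h (push unit_prob (\<lambda>w. V w + Y w)) - h (push M (S t))
                 - (\<integral>w. blinfun_apply (D (V w)) (Y w) \<partial>unit_prob)) \<le> \<epsilon> * L2_norm_rv Y"
        using exp[OF eps(1)] by blast
      show "\<exists>d>0. \<forall>y. norm (y - t) < d \<longrightarrow> norm (\<phi> y - \<phi> t - (y - t) *\<^sub>R c) \<le> e * norm (y - t)"
      proof (intro exI conjI allI impI)
        show "0 < \<delta> / (nW + 1)" using \<delta> nW0 by simp
        fix y assume y: "norm (y - t) < \<delta> / (nW + 1)"
        have "\<bar>y - t\<bar> * (nW + 1) < \<delta>" using y nW0 by (simp add: field_simps)
        then have "\<bar>y - t\<bar> * nW < \<delta>" using abs_ge_zero[of "y - t"] by (simp only: distrib_left mult_1_right)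
        then have "norm (\<phi> y - \<phi> t - (y - t) *\<^sub>R c) \<le> \<epsilon> * (\<bar>y - t\<bar> * nW)"
          using dd[OF tau[of "y - t"]] unfolding ntau ctau pushe \<phi>_def add.commute[of t "y - t"] diff_add_cancel
          by blast
        also have "\<dots> = (\<epsilon> * nW) * \<bar>y - t\<bar>" by simp
        also have "\<dots> \<le> e * norm (y - t)" unfolding real_norm_def by (rule mult_right_mono[OF eps(2)]) simp
        finally show "norm (\<phi> y - \<phi> t - (y - t) *\<^sub>R c) \<le> e * norm (y - t)" .
      qed
    qed
    with cL show ?thesis by blast
  qed
  then obtain c where c: "\<And>t. (\<phi> has_derivative (\<lambda>\<tau>. \<tau> *\<^sub>R c t)) (at t)" "\<And>t. norm (c t) \<le> L * K" by metis
  have "norm (\<phi> 0 - \<phi> 1) \<le> L * K * norm (0 - 1 :: real)"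
  proof (rule differentiable_bound[of UNIV \<phi> "\<lambda>t \<tau>. \<tau> *\<^sub>R c t"])
    show "onorm (\<lambda>\<tau>. \<tau> *\<^sub>R c t) \<le> L * K" for t
      by (rule onorm_le) (use mult_left_mono[OF c(2)[of t] abs_ge_zero] in \<open>auto simp: mult.commute\<close>)
  qed (use c in auto)
  then show ?thesis by (simp add: \<phi>_def S_def[abs_def] K)
qed

text \<open>\<open>F n\<close> applied to the lift \<open>V\<close> is \<open>V\<close> plus a
  perturbation that tends to 0 in mean square by dominated convergence. So the expansion at a single
  lift gives continuity along these approximations, through which simple functions are left
  behind.\<close>

lemma L_derivative_continuous_along:
  fixes h :: "'x::euclidean_space measure \<Rightarrow> 'b::euclidean_space"
  assumes h: "\<exists>D. has_L_derivative h D \<mu> \<and> (\<forall>y. norm (D y) \<le> L)"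
    and F: "\<And>n. F n \<in> borel_measurable borel" "\<And>x. (\<lambda>n. F n x) \<longlonglongrightarrow> x" "\<And>n x. norm (F n x) \<le> 2 * norm x"
  shows "(\<lambda>n. h (distr \<mu> borel (F n))) \<longlonglongrightarrow> h \<mu>"
proof -
  interpret U: prob_space unit_prob by (rule prob_space_unit)
  obtain D where D: "has_L_derivative h D \<mu>" and DL: "\<And>y. norm (D y) \<le> L" using h by blast
  have L: "0 \<le> L" using order_trans[OF norm_ge_zero DL] by blast
  obtain V where V: "V \<in> L2_rv" "push unit_prob V = \<mu>"
    and exp: "\<And>\<epsilon>. \<epsilon> > 0 \<Longrightarrow> \<exists>\<delta>>0. \<forall>Y\<in>L2_rv. L2_norm_rv Y < \<delta> \<longrightarrow>
         norm (h (push unit_prob (\<lambda>w. V w + Y w)) - h \<mu>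
               - (\<integral>w. blinfun_apply (D (V w)) (Y w) \<partial>unit_prob)) \<le> \<epsilon> * L2_norm_rv Y"
    using D unfolding has_L_derivative_def by blast
  have Vm[measurable]: "V \<in> borel_measurable unit_prob" and V2: "integrable unit_prob (\<lambda>w. (norm (V w))\<^sup>2)"
    using V(1) by (auto simp: L2_rv_def)
  have V1: "integrable unit_prob V" by (rule integrable_of_square[OF prob_space_unit Vm V2])
  define Y where "Y n w = F n (V w) - V w" for n w
  have FV[measurable]: "(\<lambda>w. F n (V w)) \<in> borel_measurable unit_prob" for n
    by (rule measurable_compose[OF Vm F(1)])
  have Ym[measurable]: "Y n \<in> borel_measurable unit_prob" for n unfolding Y_def by measurable
  have Yb: "norm (Y n w) \<le> 3 * norm (V w)" for n w
    unfolding Y_def using norm_triangle_ineq4[of "F n (V w)" "V w"] F(3)[of n "V w"] by linarith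
  have Yl: "(\<lambda>n. Y n w) \<longlonglongrightarrow> 0" for w
    unfolding Y_def using tendsto_diff[OF F(2)[of "V w"] tendsto_const[of "V w"]] by simp
  have Yb2: "(norm (Y n w))\<^sup>2 \<le> 9 * (norm (V w))\<^sup>2" for n w
    using power_mono[OF Yb[of n w] norm_ge_zero, of 2] by (simp add: power_mult_distrib)
  have YL2: "Y n \<in> L2_rv" for n
    unfolding L2_rv_def using Ym
    by (auto intro!: Bochner_Integration.integrable_bound[OF integrable_mult_right[OF V2, of 9]] simp: Yb2)
  have "(\<lambda>n. \<integral>w. (norm (Y n w))\<^sup>2 \<partial>unit_prob) \<longlonglongrightarrow> (\<integral>w. 0 \<partial>unit_prob)"
  proof (rule integral_dominated_convergence[where w = "\<lambda>w. 9 * (norm (V w))\<^sup>2"])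
    show "AE w in unit_prob. (\<lambda>n. (norm (Y n w))\<^sup>2) \<longlonglongrightarrow> 0"
      using tendsto_power[OF tendsto_norm[OF Yl], of _ 2] by (intro AE_I2) simp
  qed (use V2 Yb2 in \<open>auto intro!: AE_I2\<close>)
  then have n2: "(\<lambda>n. L2_norm_rv (Y n)) \<longlonglongrightarrow> 0"
    unfolding L2_norm_rv_def using tendsto_real_sqrt by fastforce
  have "(\<lambda>n. \<integral>w. norm (Y n w) \<partial>unit_prob) \<longlonglongrightarrow> (\<integral>w. 0 \<partial>unit_prob)"
  proof (rule integral_dominated_convergence[where w = "\<lambda>w. 3 * norm (V w)"])
    show "AE w in unit_prob. (\<lambda>n. norm (Y n w)) \<longlonglongrightarrow> 0"
      using tendsto_norm[OF Yl] by (intro AE_I2) simp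
  qed (use V1 Yb in \<open>auto intro!: AE_I2\<close>)
  then have n1: "(\<lambda>n. L * (\<integral>w. norm (Y n w) \<partial>unit_prob)) \<longlonglongrightarrow> 0"
    using tendsto_mult_right_zero by auto
  \<comment> \<open>Both terms of the resulting bound tend to 0, so the expansion may be used with
    constant 1.\<close>
  obtain \<delta> where \<delta>: "\<delta> > 0" and dd: "\<And>Y. Y \<in> L2_rv \<Longrightarrow> L2_norm_rv Y < \<delta> \<Longrightarrow>
         norm (h (push unit_prob (\<lambda>w. V w + Y w)) - h \<mu>
               - (\<integral>w. blinfun_apply (D (V w)) (Y w) \<partial>unit_prob)) \<le> 1 * L2_norm_rv Y"
    using exp[of 1] by auto
  have "eventually (\<lambda>n. norm (h (distr \<mu> borel (F n)) - h \<mu>) \<le> L2_norm_rv (Y n) + L * (\<integral>w. norm (Y n w) \<partial>unit_prob)) sequentially"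
    using order_tendstoD(2)[OF n2 \<delta>]
  proof eventually_elim
    case (elim n)
    have eq: "push unit_prob (\<lambda>w. V w + Y n w) = distr \<mu> borel (F n)"
      unfolding V(2)[symmetric] by (subst distr_distr) (use F Vm in \<open>auto simp: Y_def o_def\<close>)
    have iY: "integrable unit_prob (\<lambda>w. norm (Y n w))"
      by (rule Bochner_Integration.integrable_bound[OF integrable_mult_right[OF integrable_norm[OF V1], of 3]]) (use Yb in auto)
    have "norm (\<integral>w. blinfun_apply (D (V w)) (Y n w) \<partial>unit_prob) \<le> (\<integral>w. norm (blinfun_apply (D (V w)) (Y n w)) \<partial>unit_prob)"
      by (rule integral_norm_bound)
    also have "\<dots> \<le> (\<integral>w. L * norm (Y n w) \<partial>unit_prob)"
    proof (rule integral_mono')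
      show "norm (blinfun_apply (D (V w)) (Y n w)) \<le> L * norm (Y n w)" for w
        by (rule order_trans[OF norm_blinfun]) (intro mult_right_mono DL norm_ge_zero)
    qed (use iY L in auto)
    finally have "norm (\<integral>w. blinfun_apply (D (V w)) (Y n w) \<partial>unit_prob) \<le> L * (\<integral>w. norm (Y n w) \<partial>unit_prob)" by simp
    moreover have "norm (h (distr \<mu> borel (F n)) - h \<mu> - (\<integral>w. blinfun_apply (D (V w)) (Y n w) \<partial>unit_prob)) \<le> L2_norm_rv (Y n)"
      using dd[OF YL2 elim] eq by simp
    ultimately show ?case
      using norm_triangle_sub[of "h (distr \<mu> borel (F n)) - h \<mu>" "\<integral>w. blinfun_apply (D (V w)) (Y n w) \<partial>unit_prob"]
      by linarith
  qed
  moreover have "(\<lambda>n. L2_norm_rv (Y n) + L * (\<integral>w. norm (Y n w) \<partial>unit_prob)) \<longlonglongrightarrow> 0"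
    using tendsto_add[OF n2 n1] by simp
  ultimately have "(\<lambda>n. h (distr \<mu> borel (F n)) - h \<mu>) \<longlonglongrightarrow> 0"
    by (rule Lim_null_comparison)
  then show ?thesis by (simp add: LIM_zero_iff)
qed

text \<open>The same simple maps \<open>F n\<close> approximate both variables, with
  \<open>norm (F n x) \<le> 2 * norm x\<close> as domination, so both sides of the estimate for
  simple functions pass to the limit.\<close>

lemma L_derivative_lipschitz:
  fixes h :: "'x::euclidean_space measure \<Rightarrow> 'b::euclidean_space"
  assumes h: "\<And>\<mu>. \<mu> \<in> P2 \<Longrightarrow> \<exists>D. has_L_derivative h D \<mu> \<and> (\<forall>y. norm (D y) \<le> L)"
    and M: "prob_space M" and X: "X \<in> borel_measurable M" and Y: "Y \<in> borel_measurable M"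
    and P: "push M X \<in> P2" "push M Y \<in> P2"
  shows "norm (h (push M X) - h (push M Y)) \<le> L * (\<integral>\<omega>. norm (X \<omega> - Y \<omega>) \<partial>M)"
proof -
  interpret M: prob_space M by fact
  obtain F where F: "\<And>n. simple_function borel (F n)" "\<And>x. (\<lambda>n. F n x) \<longlonglongrightarrow> (x :: 'x)"
    "\<And>n x. dist (F n x) 0 \<le> 2 * dist x 0"
    using borel_measurable_implies_sequence_metric[of "\<lambda>x :: 'x. x" borel 0] by auto
  have Fm: "F n \<in> borel_measurable borel" for n by (rule borel_measurable_simple_function[OF F(1)])
  have Fn: "norm (F n x) \<le> 2 * norm x" for n x using F(3) by simp
  have lim: "(\<lambda>n. h (push M (\<lambda>\<omega>. F n (W \<omega>)))) \<longlonglongrightarrow> h (push M W)"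
    if W: "W \<in> borel_measurable M" "push M W \<in> P2" for W
  proof -
    have "(\<lambda>n. h (distr (push M W) borel (F n))) \<longlonglongrightarrow> h (push M W)"
      by (rule L_derivative_continuous_along[OF h[OF W(2)] Fm F(2) Fn])
    then show ?thesis using W(1) Fm by (simp add: distr_distr o_def)
  qed
  have sf: "simple_function M (\<lambda>\<omega>. F n (W \<omega>))" if "W \<in> borel_measurable M" for n W
    using simple_function_comp[OF that F(1)] by (simp add: o_def)
  have l1: "(\<lambda>n. norm (h (push M (\<lambda>\<omega>. F n (X \<omega>))) - h (push M (\<lambda>\<omega>. F n (Y \<omega>))))) \<longlonglongrightarrow> norm (h (push M X) - h (push M Y))"
    by (intro tendsto_intros lim X Y P)
  have l2: "(\<lambda>n. L * (\<integral>\<omega>. norm (F n (X \<omega>) - F n (Y \<omega>)) \<partial>M)) \<longlonglongrightarrow> L * (\<integral>\<omega>. norm (X \<omega> - Y \<omega>) \<partial>M)"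
  proof (intro tendsto_mult_left integral_dominated_convergence[where w = "\<lambda>\<omega>. 2 * norm (X \<omega>) + 2 * norm (Y \<omega>)"])
    show "AE \<omega> in M. (\<lambda>n. norm (F n (X \<omega>) - F n (Y \<omega>))) \<longlonglongrightarrow> norm (X \<omega> - Y \<omega>)"
      by (intro AE_I2 tendsto_intros F(2))
    show "AE \<omega> in M. norm (norm (F n (X \<omega>) - F n (Y \<omega>))) \<le> 2 * norm (X \<omega>) + 2 * norm (Y \<omega>)" for n
    proof (rule AE_I2)
      fix \<omega>
      show "norm (norm (F n (X \<omega>) - F n (Y \<omega>))) \<le> 2 * norm (X \<omega>) + 2 * norm (Y \<omega>)"
        using norm_triangle_ineq4[of "F n (X \<omega>)" "F n (Y \<omega>)"] Fn[of n "X \<omega>"] Fn[of n "Y \<omega>"] by simp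
    qed
    show "(\<lambda>\<omega>. norm (F n (X \<omega>) - F n (Y \<omega>))) \<in> borel_measurable M" for n
      using measurable_compose[OF X Fm] measurable_compose[OF Y Fm] by measurable
  qed (use X Y integrable_push_P2[OF X P(1)] integrable_push_P2[OF Y P(2)] in auto)
  have le: "norm (h (push M (\<lambda>\<omega>. F n (X \<omega>))) - h (push M (\<lambda>\<omega>. F n (Y \<omega>))))
      \<le> L * (\<integral>\<omega>. norm (F n (X \<omega>) - F n (Y \<omega>)) \<partial>M)" for n
  proof (rule L_derivative_lipschitz_simple[where h = h and L = L, OF _ M])
    show "simple_function M (\<lambda>\<omega>. F n (X \<omega>))" by (rule sf[OF X])
    show "simple_function M (\<lambda>\<omega>. F n (Y \<omega>))" by (rule sf[OF Y])
  qed (rule h)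
  show ?thesis by (rule LIMSEQ_le[OF l1 l2]) (intro exI[of _ 0] allI impI le)
qed

section \<open>A priori bounds for mean field paths\<close>

text \<open>The supremum \<open>S\<close> of \<open>\<phi> i / wt i\<close> is finite by
  \<open>B\<close> and satisfies \<open>S \<le> A + S / 2\<close>. The size of \<open>B\<close>
  disappears from the conclusion, and the index set is arbitrary, so a supremum over times and
  points at once is allowed.\<close>

lemma contraction_bound:
  fixes \<phi> wt :: "'i \<Rightarrow> real"
  assumes wt: "\<And>i. i \<in> I \<Longrightarrow> 0 < wt i" and B: "\<And>i. i \<in> I \<Longrightarrow> \<phi> i \<le> B * wt i" and A: "0 \<le> A"
    and step: "\<And>M j. 0 \<le> M \<Longrightarrow> (\<And>i. i \<in> I \<Longrightarrow> \<phi> i \<le> M * wt i) \<Longrightarrow> j \<in> I \<Longrightarrow> \<phi> j \<le> (A + M / 2) * wt j"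
    and i: "i \<in> I"
  shows "\<phi> i \<le> 2 * A * wt i"
proof -
  \<comment> \<open>\<open>max 0\<close> because \<open>step\<close> is available for nonnegative
    \<open>M\<close> only.\<close>
  define S where "S = (SUP i\<in>I. max 0 (\<phi> i / wt i))"
  have bdd: "bdd_above ((\<lambda>i. max 0 (\<phi> i / wt i)) ` I)"
  proof (rule bdd_aboveI2)
    fix i assume i: "i \<in> I"
    have "\<phi> i / wt i \<le> B" using B[OF i] wt[OF i] by (simp add: divide_le_eq)
    then show "max 0 (\<phi> i / wt i) \<le> max 0 B" by auto
  qed
  have up: "max 0 (\<phi> j / wt j) \<le> S" if "j \<in> I" for j
    unfolding S_def by (rule cSUP_upper[OF that bdd])
  have S0: "0 \<le> S" using up[OF i] by simp
  have le: "\<phi> j \<le> S * wt j" if "j \<in> I" for j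
    using up[OF that] wt[OF that] by (simp add: field_simps)
  have "S \<le> A + S / 2"
    unfolding S_def
  proof (rule cSUP_least)
    show "I \<noteq> {}" using i by auto
    fix j assume j: "j \<in> I"
    show "max 0 (\<phi> j / wt j) \<le> A + (SUP i\<in>I. max 0 (\<phi> i / wt i)) / 2"
    proof -
      have "\<phi> j / wt j \<le> A + S / 2" using step[OF S0 le j] wt[OF j] by (simp add: divide_le_eq)
      then show ?thesis unfolding S_def[symmetric] using A S0 by simp
    qed
  qed
  then have "S \<le> 2 * A" by simp
  then show ?thesis using le[OF i] wt[OF i] by (meson less_imp_le mult_right_mono order_trans)
qed

text \<open>Integrating an exponential divides by its rate. In \<open>1 / \<nu>\<close> and
  \<open>1 / \<eta>\<close> lies the gain that turns the later estimates into contractions.\<close>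

lemma norm_has_integral_exp_le:
  fixes \<phi> :: "real \<Rightarrow> 'b::euclidean_space"
  assumes I: "(\<phi> has_integral J) {s..t}" and st: "s \<le> t"
    and le: "\<And>r. s \<le> r \<Longrightarrow> r \<le> t \<Longrightarrow> norm (\<phi> r) \<le> P * exp (\<nu> * (r - s)) + Q * exp (\<eta> * (T - r))"
    and pos: "0 < \<nu>" "0 < \<eta>" "0 \<le> P" "0 \<le> Q"
  shows "norm J \<le> P / \<nu> * exp (\<nu> * (t - s)) + Q / \<eta> * exp (\<eta> * (T - s))"
proof -
  let ?G = "\<lambda>r. P / \<nu> * exp (\<nu> * (r - s)) - Q / \<eta> * exp (\<eta> * (T - r))"
  have G: "((\<lambda>r. P * exp (\<nu> * (r - s)) + Q * exp (\<eta> * (T - r))) has_integral (?G t - ?G s)) {s..t}"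
  proof (rule fundamental_theorem_of_calculus[OF st])
    fix r
    have "(?G has_real_derivative P * exp (\<nu> * (r - s)) + Q * exp (\<eta> * (T - r))) (at r)"
      by (rule derivative_eq_intros refl | use pos in simp)+
    then show "(?G has_vector_derivative P * exp (\<nu> * (r - s)) + Q * exp (\<eta> * (T - r))) (at r within {s..t})"
      using has_real_derivative_iff_has_vector_derivative has_vector_derivative_at_within by blast
  qed
  have "norm J \<le> ?G t - ?G s"
    unfolding integral_unique[OF I, symmetric] integral_unique[OF G, symmetric]
    by (rule integral_norm_bound_integral) (use I G le in \<open>auto simp: has_integral_integrable\<close>)
  moreover have "0 \<le> P / \<nu>" "0 \<le> Q / \<eta> * exp (\<eta> * (T - t))" using pos by simp_all
  ultimately show ?thesis by simp
qed

section \<open>Boundedness in time of first moments\<close>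

lemma locally_bounded_imp_bounded:
  fixes U :: "'t::metric_space \<Rightarrow> real"
  assumes K: "compact K" and loc: "\<And>r. r \<in> K \<Longrightarrow> \<exists>e>0. \<exists>M. \<forall>q\<in>K. dist q r < e \<longrightarrow> U q \<le> M"
  shows "\<exists>M. \<forall>q\<in>K. U q \<le> M"
proof (rule ccontr)
  assume "\<not> (\<exists>M. \<forall>q\<in>K. U q \<le> M)"
  then have "\<forall>n::nat. \<exists>q\<in>K. real n < U q" by (meson not_le)
  then obtain q where q: "\<And>n::nat. q n \<in> K" "\<And>n. real n < U (q n)" by metis
  obtain r \<sigma> where r: "r \<in> K" and \<sigma>: "strict_mono (\<sigma> :: nat \<Rightarrow> nat)" and lim: "(q \<circ> \<sigma>) \<longlonglongrightarrow> r"
    using K q(1) unfolding compact_def by metis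
  obtain e M where e: "e > 0" and M: "\<And>q. q \<in> K \<Longrightarrow> dist q r < e \<Longrightarrow> U q \<le> M" using loc[OF r] by blast
  have "eventually (\<lambda>n. dist (q (\<sigma> n)) r < e) sequentially"
    using tendstoD[OF lim e] by simp
  moreover have "eventually (\<lambda>n. M < real n) sequentially"
    using reals_Archimedean2[of M] by (meson eventually_sequentiallyI of_nat_le_iff order_less_le_trans)
  ultimately have "eventually (\<lambda>n. False) sequentially"
  proof eventually_elim
    case (elim n)
    have "real n \<le> real (\<sigma> n)" using seq_suble[OF \<sigma>, of n] by simp
    then show False using M[OF q(1) elim(1)] q(2)[of "\<sigma> n"] elim(2) by linarith
  qed
  then show False by simp
qed

text \<open>Covers the pair of a solution as well as a flow of the field. Each slice is integrable,
  but the mean of \<open>norm (v r y)\<close> over \<open>m\<close> comes without measurability or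
  boundedness in time, and \<open>bd\<close> bounds the speed in terms of it.\<close>

locale mean_field_path =
  fixes m :: "'y measure" and v d :: "real \<Rightarrow> 'y \<Rightarrow> 'b::euclidean_space" and a b C :: real
  assumes m: "prob_space m" and C: "0 < C"
    and int: "\<And>s. a \<le> s \<Longrightarrow> s \<le> b \<Longrightarrow> integrable m (v s)"
    and d: "\<And>s t x. a \<le> s \<Longrightarrow> s \<le> t \<Longrightarrow> t \<le> b \<Longrightarrow> ((\<lambda>r. d r x) has_integral (v t x - v s x)) {s..t}"
    and bd: "\<And>r x. a \<le> r \<Longrightarrow> r \<le> b \<Longrightarrow> norm (d r x) \<le> C * (norm (v r x) + (\<integral>y. norm (v r y) \<partial>m))"
begin

definition U :: "real \<Rightarrow> real" where "U r = (\<integral>y. norm (v r y) \<partial>m)"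

lemma U_nonneg: "0 \<le> U r" by (simp add: U_def)

lemma increment:
  assumes p: "p \<in> {a..b}" and q: "q \<in> {a..b}"
    and N: "\<And>r. r \<in> closed_segment p q \<Longrightarrow> norm (v r x) \<le> N" and M: "\<And>r. r \<in> closed_segment p q \<Longrightarrow> U r \<le> M"
  shows "norm (v p x - v q x) \<le> C * (N + M) * \<bar>p - q\<bar>"
proof -
  have *: "norm (v t x - v s x) \<le> C * (N + M) * \<bar>t - s\<bar>" if st: "s \<le> t" "{s..t} = closed_segment p q" and ab: "a \<le> s" "t \<le> b" for s t
  proof -
    have NM: "0 \<le> N" "0 \<le> M"
      using order_trans[OF norm_ge_zero N[of p]] order_trans[OF U_nonneg M[of p]] by auto
    have "norm (v t x - v s x) \<le> C * (N + M) * measure lborel {s..t}"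
    proof (rule has_integral_bound_real[OF _ _ d[OF ab(1) st(1) ab(2)]])
      show "0 \<le> C * (N + M)" using C NM by simp
      show "finite {}" by simp
      show "norm (d r x) \<le> C * (N + M)" if "r \<in> {s..t} - {}" for r
      proof -
        have "norm (d r x) \<le> C * (norm (v r x) + U r)"
          using bd[of r x] that ab by (simp add: U_def)
        also have "\<dots> \<le> C * (N + M)"
          using C N[of r] M[of r] that st(2) by (intro mult_left_mono add_mono) auto
        finally show ?thesis .
      qed
    qed
    then show ?thesis using st(1) by simp
  qed
  show ?thesis
  proof (cases "p \<le> q")
    case True
    then show ?thesis using *[of p q] p q by (simp add: closed_segment_eq_real_ivl norm_minus_commute abs_minus_commute)
  next
    case False
    then show ?thesis using *[of q p] p q by (simp add: closed_segment_eq_real_ivl)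
  qed
qed

lemma continuous_path: "continuous_on {a..b} (\<lambda>r. v r x)"
proof (cases "a \<le> b")
  case True
  have "continuous_on {a..b} (\<lambda>r. v a x + integral {a..r} (\<lambda>r. d r x))"
    using d[OF order_refl True order_refl, of x]
    by (intro continuous_intros indefinite_integral_continuous_1) (auto simp: has_integral_integrable)
  then show ?thesis
  proof (rule continuous_on_eq)
    fix r assume "r \<in> {a..b}"
    then show "v a x + integral {a..r} (\<lambda>r. d r x) = v r x"
      using integral_unique[OF d[of a r x]] by simp
  qed
qed auto

text \<open>Two nested contractions. For fixed \<open>x\<close> a bound \<open>M\<close> on the
  means gives \<open>norm (v j x) \<le> 2 * norm (v q x) + M / 2\<close>, and integrating this
  improves \<open>M\<close> to \<open>2 * U q + M / 2\<close>. Finiteness on the segment starts the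
  argument, but no trace of the bound is left in the conclusion: this makes the comparison useful
  near times where \<open>U\<close> might explode.\<close>

lemma short_comparison:
  assumes pq: "p0 \<in> {a..b}" "q0 \<in> {a..b}" and short: "C * \<bar>p0 - q0\<bar> \<le> 1 / 8"
    and bdd: "\<exists>B. \<forall>r\<in>closed_segment p0 q0. U r \<le> B"
    and p: "p \<in> closed_segment p0 q0" and q: "q \<in> closed_segment p0 q0"
  shows "U p \<le> 4 * U q"
proof -
  let ?S = "closed_segment p0 q0"
  obtain B where B: "\<And>r. r \<in> ?S \<Longrightarrow> U r \<le> B" using bdd by blast
  have sub: "?S \<subseteq> {a..b}" using pq by (auto simp: closed_segment_eq_real_ivl split: if_splits)
  have sub2: "closed_segment r q \<subseteq> ?S" "C * \<bar>r - q\<bar> \<le> 1 / 8" if "r \<in> ?S" for r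
  proof -
    show "closed_segment r q \<subseteq> ?S" by (rule closed_segment_subset[OF that q convex_closed_segment])
    have "\<bar>r - q\<bar> \<le> \<bar>p0 - q0\<bar>" using that q by (auto simp: closed_segment_eq_real_ivl split: if_splits)
    then show "C * \<bar>r - q\<bar> \<le> 1 / 8" using short C by (meson mult_left_mono order_trans less_imp_le)
  qed
  have "U p \<le> 2 * (2 * U q) * 1"
  proof (rule contraction_bound[where I = ?S and wt = "\<lambda>_. 1" and \<phi> = U and B = B])
    show "0 \<le> 2 * U q" using U_nonneg by simp
    fix M j assume M0: "0 \<le> M" and M: "\<And>i. i \<in> ?S \<Longrightarrow> U i \<le> M * 1" and j: "j \<in> ?S"
    have pt: "norm (v j x) \<le> 2 * norm (v q x) + M / 2" for x
    proof -
      obtain N0 where N0: "\<And>r. r \<in> {a..b} \<Longrightarrow> norm (v r x) \<le> N0"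
        using compact_imp_bounded[OF compact_continuous_image[OF continuous_path compact_Icc, of x]]
        unfolding bounded_iff by blast
      have "norm (v j x) \<le> 2 * (norm (v q x) + M / 4) * 1"
      proof (rule contraction_bound[where I = ?S and wt = "\<lambda>_. 1" and \<phi> = "\<lambda>r. norm (v r x)" and B = N0])
        show "0 \<le> norm (v q x) + M / 4" using M0 by simp
        fix N r assume NN: "0 \<le> N" and N: "\<And>i. i \<in> ?S \<Longrightarrow> norm (v i x) \<le> N * 1" and r: "r \<in> ?S"
        have "norm (v r x - v q x) \<le> C * (N + M) * \<bar>r - q\<bar>"
          by (rule increment) (use r q sub sub2(1)[OF r] N M in auto)
        also have "\<dots> = (N + M) * (C * \<bar>r - q\<bar>)" by simp
        also have "\<dots> \<le> (N + M) * (1 / 8)"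
          using sub2(2)[OF r] NN M0 by (intro mult_left_mono) auto
        finally show "norm (v r x) \<le> (norm (v q x) + M / 4 + N / 2) * 1"
          using norm_triangle_sub[of "v r x" "v q x"] NN M0 by (simp add: field_simps)
      qed (use j N0 sub in auto)
      then show ?thesis by simp
    qed
    have iv: "integrable m (\<lambda>x. norm (v j x))" "integrable m (\<lambda>x. norm (v q x))"
      using int[of j] int[of q] sub j q by auto
    have ic: "integrable m (\<lambda>x. M / 2)"
      by (rule finite_measure.integrable_const[OF prob_space.finite_measure[OF m]])
    have "U j \<le> (\<integral>x. 2 * norm (v q x) + M / 2 \<partial>m)"
      unfolding U_def by (intro integral_mono pt Bochner_Integration.integrable_add integrable_mult_right iv ic)
    also have "\<dots> = 2 * U q + M / 2"
      using iv ic by (simp add: U_def prob_space.prob_space[OF m])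
    finally show "U j \<le> (2 * U q + M / 2) * 1" by simp
  qed (use B p in auto)
  then show ?thesis by simp
qed

text \<open>Fatou's lemma: every single path is continuous in time, so \<open>U\<close> is lower
  semicontinuous even where it is not known to be bounded.\<close>

lemma closed_sublevel: "closed {r \<in> {a..b}. U r \<le> n}"
  unfolding closed_sequential_limits
proof (intro allI impI)
  fix r l assume rl: "(\<forall>k. r k \<in> {r \<in> {a..b}. U r \<le> n}) \<and> r \<longlonglongrightarrow> l"
  then have r: "\<And>k. r k \<in> {a..b}" "\<And>k. U (r k) \<le> n" and lim: "r \<longlonglongrightarrow> l" by auto
  have l: "l \<in> {a..b}" using closed_sequentially[OF closed_atLeastAtMost r(1) lim] .
  have vl: "(\<lambda>k. ennreal (norm (v (r k) x))) \<longlonglongrightarrow> ennreal (norm (v l x))" for x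
    by (intro tendsto_ennrealI tendsto_norm continuous_on_tendsto_compose[OF continuous_path lim l]) (use r in auto)
  have nn: "(\<integral>\<^sup>+x. ennreal (norm (v s x)) \<partial>m) = ennreal (U s)" if "s \<in> {a..b}" for s
    unfolding U_def by (rule nn_integral_eq_integral) (use int that in auto)
  have "ennreal (U l) = (\<integral>\<^sup>+x. liminf (\<lambda>k. ennreal (norm (v (r k) x))) \<partial>m)"
    unfolding nn[OF l, symmetric] using lim_imp_Liminf[OF _ vl] by simp
  also have "\<dots> \<le> liminf (\<lambda>k. \<integral>\<^sup>+x. ennreal (norm (v (r k) x)) \<partial>m)"
  proof (rule nn_integral_liminf)
    fix k
    have "v (r k) \<in> borel_measurable m" using int[of "r k"] r(1)[of k] by auto
    then show "(\<lambda>x. ennreal (norm (v (r k) x))) \<in> borel_measurable m" by measurable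
  qed
  also have "\<dots> \<le> liminf (\<lambda>k. ennreal n)"
    unfolding nn[OF r(1)] by (intro Liminf_mono eventuallyI ennreal_leI r(2))
  also have "\<dots> = ennreal n" by (simp add: Liminf_const)
  finally have "U l \<le> n" using order_trans[OF U_nonneg r(2)[of 0]] by simp
  with l show "l \<in> {r \<in> {a..b}. U r \<le> n}" by simp
qed

text \<open>The equation gives no control of \<open>U\<close> where \<open>U\<close> is not yet known to be locally bounded. By lower
  semicontinuity and Baire's theorem, \<open>U\<close> is bounded on a relatively open part of the closed set \<open>F\<close>
  of bad times; comparing a nearby time with the nearest point of \<open>F\<close> then shows that \<open>F\<close> is empty.\<close>

lemma U_bounded: "\<exists>M. \<forall>r\<in>{a..b}. U r \<le> M"
proof -
  define loc where "loc r \<longleftrightarrow> (\<exists>e>0. \<exists>M. \<forall>q\<in>{a..b}. dist q r < e \<longrightarrow> U q \<le> M)" for r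
  define F where "F = {r\<in>{a..b}. \<not> loc r}"
  have segb: "\<exists>B. \<forall>r\<in>closed_segment p q. U r \<le> B"
    if "p \<in> {a..b}" "q \<in> {a..b}" "closed_segment p q \<inter> F = {}" for p q
  proof (rule locally_bounded_imp_bounded[OF compact_segment])
    fix r assume r: "r \<in> closed_segment p q"
    have sub: "closed_segment p q \<subseteq> {a..b}" using that(1,2) by (auto simp: closed_segment_eq_real_ivl split: if_splits)
    have "loc r" using r that(3) sub unfolding F_def by blast
    then show "\<exists>e>0. \<exists>M. \<forall>q\<in>closed_segment p q. dist q r < e \<longrightarrow> U q \<le> M"
      unfolding loc_def using sub by (meson subsetD)
  qed
  have closedF: "closed F"
    unfolding closed_sequential_limits
  proof (intro allI impI)
    fix r l assume rl: "(\<forall>k. r k \<in> F) \<and> r \<longlonglongrightarrow> l"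
    then have r: "\<And>k. r k \<in> {a..b}" "\<And>k. \<not> loc (r k)" and lim: "r \<longlonglongrightarrow> l" by (auto simp: F_def)
    have l: "l \<in> {a..b}" using closed_sequentially[OF closed_atLeastAtMost r(1) lim] .
    have "\<not> loc l"
    proof
      assume "loc l"
      then obtain e M where e: "e > 0" and M: "\<And>q. q \<in> {a..b} \<Longrightarrow> dist q l < e \<Longrightarrow> U q \<le> M" unfolding loc_def by blast
      obtain k where k: "dist (r k) l < e / 2"
        using tendstoD[OF lim, of "e / 2"] e by (auto dest: eventually_happens)
      have "loc (r k)"
        unfolding loc_def
      proof (rule exI[of _ "e / 2"], rule conjI, simp add: e, rule exI[of _ M], intro ballI impI)
        fix q assume "q \<in> {a..b}" "dist q (r k) < e / 2"
        then show "U q \<le> M" using M k dist_triangle[of q l "r k"] by (simp add: dist_commute)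
      qed
      with r(2) show False by blast
    qed
    with l show "l \<in> F" by (simp add: F_def)
  qed
  have "F = {}"
  proof (rule ccontr)
    assume ne: "F \<noteq> {}"
    define G where "G n = F - {r \<in> {a..b}. U r \<le> real n}" for n :: nat
    \<comment> \<open>Were all \<open>G n\<close> dense in \<open>F\<close>, Baire's theorem would
      make their intersection dense; but it is empty, as \<open>U r\<close> is a real number for
      every \<open>r\<close>.\<close>
    have "\<exists>n. \<not> F \<subseteq> closure (G n)"
    proof (rule ccontr)
      assume "\<not> (\<exists>n. \<not> F \<subseteq> closure (G n))"
      moreover have "openin (top_of_set F) (G n)" for n
        using openin_open_Int[OF open_Compl[OF closed_sublevel[of "real n"]], of F]
        unfolding G_def Diff_eq .
      ultimately have "F \<subseteq> closure (\<Inter> (range G))"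
        by (intro Baire[OF closedF]) auto
      moreover have "\<Inter> (range G) = {}"
      proof -
        have "r \<notin> G (nat \<lceil>U r\<rceil>)" for r
          using real_nat_ceiling_ge[of "U r"] by (auto simp: G_def F_def)
        then show ?thesis by blast
      qed
      ultimately show False using ne by simp
    qed
    then obtain n s where s: "s \<in> F" "s \<notin> closure (G n)" by blast
    obtain e where e: "e > 0" "ball s e \<subseteq> - closure (G n)"
      using openE[of "- closure (G n)" s] s(2) by auto
    then have "ball s e \<inter> G n = {}" using closure_subset[of "G n"] by auto
    then have Fn: "U r \<le> real n" if "r \<in> F" "dist s r < e" for r
      using that by (auto simp: G_def F_def)
    \<comment> \<open>\<open>1 / (8 * C)\<close> is the length up to which
      \<open>short_comparison\<close> holds.\<close>
    define e' where "e' = min e (1 / (8 * C))"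
    have e': "e' > 0" "e' \<le> e" "C * e' \<le> 1 / 8" using e C by (auto simp: e'_def min_def field_simps)
    have "loc s"
      unfolding loc_def
    proof (rule exI[of _ e'], rule conjI, rule e'(1), rule exI[of _ "4 * real n"], intro ballI impI)
      fix r assume r: "r \<in> {a..b}" "dist r s < e'"
      let ?Q = "F \<inter> closed_segment r s"
      have "closed ?Q" "?Q \<noteq> {}" using closedF s by auto
      \<comment> \<open>\<open>q\<close> is the first bad time met on the way from \<open>r\<close>
        to \<open>s\<close>; the bound \<open>n\<close> is available at \<open>q\<close>.\<close>
      then obtain q where q: "q \<in> ?Q" and qmin: "\<And>y. y \<in> ?Q \<Longrightarrow> dist r q \<le> dist r y"
        using distance_attains_inf[of ?Q r] by blast
      have qs: "dist s q < e" "C * \<bar>r - q\<bar> \<le> 1 / 8" and qab: "q \<in> {a..b}"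
      proof -
        have "dist s q \<le> dist r s" "\<bar>r - q\<bar> \<le> dist r s"
          using q by (auto simp: closed_segment_eq_real_ivl dist_real_def split: if_splits)
        then show "dist s q < e" using r e' by simp
        show "C * \<bar>r - q\<bar> \<le> 1 / 8"
          using \<open>\<bar>r - q\<bar> \<le> dist r s\<close> r e' C by (smt (verit) mult_left_mono)
        show "q \<in> {a..b}" using q by (simp add: F_def)
      qed
      have free: "closed_segment r t \<inter> F = {}" if "t \<in> closed_segment r q" "t \<noteq> q" for t
      proof -
        have "y \<notin> F" if y: "y \<in> closed_segment r t" for y
        proof
          assume "y \<in> F"
          moreover have "y \<in> closed_segment r s" "dist r y < dist r q"
            using y \<open>t \<in> closed_segment r q\<close> \<open>t \<noteq> q\<close> q
            by (auto simp: closed_segment_eq_real_ivl dist_real_def split: if_splits)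
          ultimately show False using qmin[of y] by auto
        qed
        then show ?thesis by blast
      qed
      have tab: "t \<in> {a..b}" "C * \<bar>r - t\<bar> \<le> 1 / 8" if "t \<in> closed_segment r q" for t
      proof -
        show "t \<in> {a..b}" using that r qab by (auto simp: closed_segment_eq_real_ivl split: if_splits)
        have "\<bar>r - t\<bar> \<le> \<bar>r - q\<bar>" using that by (auto simp: closed_segment_eq_real_ivl split: if_splits)
        then show "C * \<bar>r - t\<bar> \<le> 1 / 8" using qs(2) C by (meson less_imp_le mult_left_mono order_trans)
      qed
      \<comment> \<open>Between \<open>r\<close> and \<open>t\<close> there are no bad times, so
        \<open>U\<close> is bounded there, and \<open>short_comparison\<close> replaces the bound by
        one that is uniform in \<open>t\<close>.\<close>
      have "U t \<le> 4 * U r" if "t \<in> closed_segment r q" "t \<noteq> q" for t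
        by (rule short_comparison[OF r(1) tab(1)[OF that(1)] tab(2)[OF that(1)] segb[OF r(1) tab(1)[OF that(1)] free[OF that]]]) auto
      then have "\<exists>B. \<forall>t\<in>closed_segment r q. U t \<le> B"
        by (intro exI[of _ "max (4 * U r) (U q)"]) (auto simp: le_max_iff_disj)
      \<comment> \<open>With \<open>q\<close> included \<open>U\<close> is bounded on the closed
        segment, and the comparison can be run in the opposite direction.\<close>
      then have "U r \<le> 4 * U q"
        by (rule short_comparison[OF r(1) qab qs(2)]) auto
      also have "\<dots> \<le> 4 * real n" using Fn[of q] q qs by simp
      finally show "U r \<le> 4 * real n" .
    qed
    with s show False by (simp add: F_def)
  qed
  then show ?thesis
    by (intro locally_bounded_imp_bounded[OF compact_Icc]) (auto simp: F_def loc_def)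
qed

text \<open>With \<open>U\<close> bounded by \<open>M\<close>, each single path obeys a linear
  growth inequality with bounded inhomogeneity. The weight
  \<open>exp (2 * C * \<bar>r - s\<bar>)\<close> extends in both directions from \<open>s\<close>,
  so any slice controls all the others.\<close>

lemma growth:
  obtains K where "0 \<le> K" "\<And>r s x. r \<in> {a..b} \<Longrightarrow> s \<in> {a..b} \<Longrightarrow> norm (v r x) \<le> K * (1 + norm (v s x))"
proof -
  obtain M0 where M0: "\<And>r. r \<in> {a..b} \<Longrightarrow> U r \<le> M0" using U_bounded by blast
  define M where "M = max 0 M0"
  have M: "0 \<le> M" "\<And>r. r \<in> {a..b} \<Longrightarrow> U r \<le> M" using M0 by (auto simp: M_def le_max_iff_disj)
  define K where "K = 2 * (1 + M) * exp (2 * C * \<bar>b - a\<bar>)"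
  show ?thesis
  proof (rule that[of K])
    show "0 \<le> K" using M by (simp add: K_def)
    fix r s x assume r: "r \<in> {a..b}" and s: "s \<in> {a..b}"
    obtain N0 where N0: "\<And>r. r \<in> {a..b} \<Longrightarrow> norm (v r x) \<le> N0"
      using compact_imp_bounded[OF compact_continuous_image[OF continuous_path compact_Icc, of x]]
      unfolding bounded_iff by blast
    have N00: "0 \<le> N0" using order_trans[OF norm_ge_zero N0[OF r]] .
    have "norm (v r x) \<le> 2 * (norm (v s x) + M / 2) * exp (2 * C * \<bar>r - s\<bar>)"
    proof (rule contraction_bound[where I = "{a..b}" and wt = "\<lambda>r. exp (2 * C * \<bar>r - s\<bar>)" and \<phi> = "\<lambda>r. norm (v r x)" and B = N0])
      show "norm (v i x) \<le> N0 * exp (2 * C * \<bar>i - s\<bar>)" if "i \<in> {a..b}" for i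
      proof -
        have "N0 * 1 \<le> N0 * exp (2 * C * \<bar>i - s\<bar>)" using N00 C by (intro mult_left_mono) auto
        then show ?thesis using N0[OF that] by simp
      qed
      show "0 \<le> norm (v s x) + M / 2" using M by simp
      fix N j assume NN: "0 \<le> N" and N: "\<And>i. i \<in> {a..b} \<Longrightarrow> norm (v i x) \<le> N * exp (2 * C * \<bar>i - s\<bar>)" and j: "j \<in> {a..b}"
      have dle: "norm (d i x) \<le> C * (N + M) * exp (2 * C * \<bar>i - s\<bar>)" if "i \<in> {a..b}" for i
      proof -
        have "M * 1 \<le> M * exp (2 * C * \<bar>i - s\<bar>)" using M C by (intro mult_left_mono) auto
        then have "norm (v i x) + U i \<le> (N + M) * exp (2 * C * \<bar>i - s\<bar>)"
          using N[OF that] M(2)[OF that] by (simp add: algebra_simps)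
        then have "C * (norm (v i x) + U i) \<le> C * ((N + M) * exp (2 * C * \<bar>i - s\<bar>))"
          using C by (intro mult_left_mono) auto
        then show ?thesis using bd[of i x] that by (simp add: U_def mult.assoc)
      qed
      have dle1: "norm (d i x) \<le> C * (N + M) * exp (2 * C * (i - s))" if "i \<in> {a..b}" "s \<le> i" for i
        using dle[OF that(1)] that(2) by simp
      have dle2: "norm (d i x) \<le> C * (N + M) * exp (2 * C * (s - i))" if "i \<in> {a..b}" "i \<le> s" for i
        using dle[OF that(1)] that(2) by (simp add: abs_minus_commute)
      have CNM: "0 \<le> C * (N + M)" using C NN M by simp
      have "norm (v j x - v s x) \<le> (N + M) / 2 * exp (2 * C * \<bar>j - s\<bar>)"
      proof (cases "s \<le> j")
        case True
        have "norm (v j x - v s x) \<le> C * (N + M) / (2 * C) * exp (2 * C * (j - s)) + 0 / 1 * exp (1 * (0 - s))"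
          by (rule norm_has_integral_exp_le[OF d[of s j x] True]) (use s j True dle1 CNM C in auto)
        then show ?thesis using C True by simp
      next
        case False
        have "norm (v s x - v j x) \<le> 0 / 1 * exp (1 * (s - j)) + C * (N + M) / (2 * C) * exp (2 * C * (s - j))"
          by (rule norm_has_integral_exp_le[OF d[of j s x]]) (use s j False dle2 CNM C in auto)
        then show ?thesis using C False by (simp add: norm_minus_commute)
      qed
      moreover have "norm (v s x) * 1 \<le> norm (v s x) * exp (2 * C * \<bar>j - s\<bar>)"
        using C by (intro mult_left_mono) auto
      ultimately show "norm (v j x) \<le> (norm (v s x) + M / 2 + N / 2) * exp (2 * C * \<bar>j - s\<bar>)"
        using norm_triangle_sub[of "v j x" "v s x"] by (simp add: algebra_simps add_divide_distrib)
    qed (use r in auto)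
    also have "\<dots> \<le> 2 * (norm (v s x) + M / 2) * exp (2 * C * \<bar>b - a\<bar>)"
      using r s C M by (intro mult_left_mono) auto
    also have "\<dots> \<le> K * (1 + norm (v s x))"
    proof -
      have "norm (v s x) + M / 2 \<le> (1 + M) * (1 + norm (v s x))"
        using M mult_nonneg_nonneg[OF M(1) norm_ge_zero[of "v s x"]] unfolding distrib_left distrib_right by simp
      then have "2 * (norm (v s x) + M / 2) * exp (2 * C * \<bar>b - a\<bar>) \<le> 2 * ((1 + M) * (1 + norm (v s x))) * exp (2 * C * \<bar>b - a\<bar>)"
        by (intro mult_right_mono mult_left_mono) auto
      then show ?thesis unfolding K_def by (simp only: mult_ac)
    qed
    finally show "norm (v r x) \<le> K * (1 + norm (v s x))" .
  qed
qed

end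

section \<open>Comparison with the decoupling field\<close>

lemma continuous_on_Icc_bounded:
  fixes u :: "real \<Rightarrow> 'b::real_normed_vector"
  assumes "continuous_on {a..b} u"
  shows "\<exists>B. \<forall>r\<in>{a..b}. norm (u r) \<le> B"
  using compact_imp_bounded[OF compact_continuous_image[OF assms compact_Icc]]
  unfolding bounded_iff by blast

text \<open>The family over \<open>i\<close> is treated as a whole because the mean field term
  couples its members. The rate \<open>2 * K\<close> makes the forward error contribute half of
  itself; the backward error enters through \<open>D / \<eta>\<close>.\<close>

lemma forward_estimate:
  fixes \<epsilon> \<phi> :: "real \<Rightarrow> 'i \<Rightarrow> 'b::euclidean_space"
  assumes K: "0 < K" and \<eta>: "0 < \<eta>" and D: "0 \<le> D" and \<omega>: "\<And>i. 0 < \<omega> i"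
    and bdd: "\<And>\<tau> i. s \<le> \<tau> \<Longrightarrow> \<tau> \<le> T \<Longrightarrow> norm (\<epsilon> \<tau> i) \<le> B * \<omega> i"
    and eq: "\<And>\<tau> i. s \<le> \<tau> \<Longrightarrow> \<tau> \<le> T \<Longrightarrow> ((\<lambda>r. \<phi> r i) has_integral \<epsilon> \<tau> i) {s..\<tau>}"
    and le: "\<And>M r i. 0 \<le> M \<Longrightarrow> (\<And>r i. s \<le> r \<Longrightarrow> r \<le> T \<Longrightarrow> norm (\<epsilon> r i) \<le> M * exp (2 * K * (r - s)) * \<omega> i) \<Longrightarrow>
      s \<le> r \<Longrightarrow> r \<le> T \<Longrightarrow> norm (\<phi> r i) \<le> K * (M * exp (2 * K * (r - s)) + D * exp (\<eta> * (T - r))) * \<omega> i"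
    and \<tau>: "s \<le> \<tau>" "\<tau> \<le> T"
  shows "norm (\<epsilon> \<tau> i) \<le> 2 * (K * D / \<eta> * exp (\<eta> * (T - s))) * exp (2 * K * (\<tau> - s)) * \<omega> i"
proof -
  let ?I = "{s..T} \<times> (UNIV :: 'i set)"
  let ?A = "K * D / \<eta> * exp (\<eta> * (T - s))"
  have "norm (\<epsilon> (fst (\<tau>, i)) (snd (\<tau>, i))) \<le> 2 * ?A * (exp (2 * K * (fst (\<tau>, i) - s)) * \<omega> (snd (\<tau>, i)))"
  proof (rule contraction_bound[where I = ?I and \<phi> = "\<lambda>p. norm (\<epsilon> (fst p) (snd p))"
        and wt = "\<lambda>p. exp (2 * K * (fst p - s)) * \<omega> (snd p)" and B = "max 0 B"])
    show "0 < exp (2 * K * (fst p - s)) * \<omega> (snd p)" for p using \<omega> by simp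
    show "0 \<le> ?A" using K \<eta> D by simp
    show "norm (\<epsilon> (fst p) (snd p)) \<le> max 0 B * (exp (2 * K * (fst p - s)) * \<omega> (snd p))" if "p \<in> ?I" for p
    proof -
      have "norm (\<epsilon> (fst p) (snd p)) \<le> max 0 B * (1 * \<omega> (snd p))"
        using bdd[of "fst p" "snd p"] that \<omega>[of "snd p"] mult_right_mono[of B "max 0 B" "\<omega> (snd p)"]
        by (auto intro: order_trans)
      also have "\<dots> \<le> max 0 B * (exp (2 * K * (fst p - s)) * \<omega> (snd p))"
        using that K \<omega>[of "snd p"] by (intro mult_left_mono mult_right_mono) auto
      finally show ?thesis .
    qed
    fix M and q :: "real \<times> 'i"
    assume M: "0 \<le> M" and h: "\<And>p. p \<in> ?I \<Longrightarrow> norm (\<epsilon> (fst p) (snd p)) \<le> M * (exp (2 * K * (fst p - s)) * \<omega> (snd p))"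
      and q: "q \<in> ?I"
    obtain t j where tj: "q = (t, j)" "s \<le> t" "t \<le> T" using q by auto
    have h': "norm (\<epsilon> r i) \<le> M * exp (2 * K * (r - s)) * \<omega> i" if "s \<le> r" "r \<le> T" for r i
      using h[of "(r, i)"] that by (simp add: mult.assoc)
    have "norm (\<epsilon> t j) \<le> (K * M * \<omega> j) / (2 * K) * exp (2 * K * (t - s)) + (K * D * \<omega> j) / \<eta> * exp (\<eta> * (T - s))"
    proof (rule norm_has_integral_exp_le[OF eq[OF tj(2,3)] tj(2)])
      fix r assume r: "s \<le> r" "r \<le> t"
      show "norm (\<phi> r j) \<le> K * M * \<omega> j * exp (2 * K * (r - s)) + K * D * \<omega> j * exp (\<eta> * (T - r))"
        using le[OF M h', of r j] r tj by (simp add: algebra_simps)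
    qed (use K \<eta> M D \<omega>[of j] in auto)
    also have "\<dots> = M / 2 * (exp (2 * K * (t - s)) * \<omega> j) + ?A * (1 * \<omega> j)" using K by (simp add: mult_ac)
    also have "\<dots> \<le> M / 2 * (exp (2 * K * (t - s)) * \<omega> j) + ?A * (exp (2 * K * (t - s)) * \<omega> j)"
      using K \<eta> D tj \<omega>[of j] by (intro add_left_mono mult_left_mono mult_right_mono) auto
    finally show "norm (\<epsilon> (fst q) (snd q)) \<le> (?A + M / 2) * (exp (2 * K * (fst q - s)) * \<omega> (snd q))"
      by (simp add: tj algebra_simps)
  qed (use \<tau> in auto)
  then show ?thesis by (simp add: mult.assoc)
qed

text \<open>There is no inhomogeneity: for \<open>\<eta> \<ge> 2 * K\<close> the hypothesis halves
  every bound, so the supremum vanishes. \<open>K\<close> does not depend on \<open>\<eta>\<close>,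
  which is why the rate may be chosen after it.\<close>

lemma backward_estimate:
  fixes \<delta> :: "real \<Rightarrow> 'i \<Rightarrow> 'b::euclidean_space"
  assumes \<omega>: "\<And>i. 0 < \<omega> i"
    and bdd: "\<And>s i. 0 \<le> s \<Longrightarrow> s \<le> T \<Longrightarrow> norm (\<delta> s i) \<le> B * \<omega> i"
    and le: "\<And>D \<eta> s i. 0 \<le> D \<Longrightarrow> 1 \<le> \<eta> \<Longrightarrow>
      (\<And>r i. 0 \<le> r \<Longrightarrow> r \<le> T \<Longrightarrow> norm (\<delta> r i) \<le> D * exp (\<eta> * (T - r)) * \<omega> i) \<Longrightarrow>
      0 \<le> s \<Longrightarrow> s \<le> T \<Longrightarrow> norm (\<delta> s i) \<le> K * (D / \<eta> * exp (\<eta> * (T - s))) * \<omega> i"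
    and s: "0 \<le> s" "s \<le> T"
  shows "\<delta> s i = 0"
proof -
  define \<eta> where "\<eta> = max 1 (2 * K)"
  have \<eta>: "1 \<le> \<eta>" "2 * K \<le> \<eta>" by (auto simp: \<eta>_def)
  let ?I = "{0..T} \<times> (UNIV :: 'i set)"
  have "norm (\<delta> (fst (s, i)) (snd (s, i))) \<le> 2 * 0 * (exp (\<eta> * (T - fst (s, i))) * \<omega> (snd (s, i)))"
  proof (rule contraction_bound[where I = ?I and \<phi> = "\<lambda>p. norm (\<delta> (fst p) (snd p))"
        and wt = "\<lambda>p. exp (\<eta> * (T - fst p)) * \<omega> (snd p)" and B = "max 0 B"])
    show "0 < exp (\<eta> * (T - fst p)) * \<omega> (snd p)" for p using \<omega> by simp
    show "norm (\<delta> (fst p) (snd p)) \<le> max 0 B * (exp (\<eta> * (T - fst p)) * \<omega> (snd p))" if "p \<in> ?I" for p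
    proof -
      have "norm (\<delta> (fst p) (snd p)) \<le> max 0 B * (1 * \<omega> (snd p))"
        using bdd[of "fst p" "snd p"] that \<omega>[of "snd p"] mult_right_mono[of B "max 0 B" "\<omega> (snd p)"]
        by (auto intro: order_trans)
      also have "\<dots> \<le> max 0 B * (exp (\<eta> * (T - fst p)) * \<omega> (snd p))"
        using that \<eta> \<omega>[of "snd p"] by (intro mult_left_mono mult_right_mono) auto
      finally show ?thesis .
    qed
    fix M and q :: "real \<times> 'i"
    assume M: "0 \<le> M" and h: "\<And>p. p \<in> ?I \<Longrightarrow> norm (\<delta> (fst p) (snd p)) \<le> M * (exp (\<eta> * (T - fst p)) * \<omega> (snd p))"
      and q: "q \<in> ?I"
    obtain t j where tj: "q = (t, j)" "0 \<le> t" "t \<le> T" using q by auto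
    have h': "norm (\<delta> r i) \<le> M * exp (\<eta> * (T - r)) * \<omega> i" if "0 \<le> r" "r \<le> T" for r i
      using h[of "(r, i)"] that by (simp add: mult.assoc)
    have "norm (\<delta> t j) \<le> K * (M / \<eta> * exp (\<eta> * (T - t))) * \<omega> j" by (rule le[OF M \<eta>(1) h' tj(2,3)])
    also have "\<dots> = K / \<eta> * (M * (exp (\<eta> * (T - t)) * \<omega> j))" by simp
    also have "\<dots> \<le> 1 / 2 * (M * (exp (\<eta> * (T - t)) * \<omega> j))"
      using \<eta> M \<omega>[of j] by (intro mult_right_mono) (auto simp: field_simps)
    finally show "norm (\<delta> (fst q) (snd q)) \<le> (0 + M / 2) * (exp (\<eta> * (T - fst q)) * \<omega> (snd q))"
      by (simp add: tj)
  qed (use s in auto)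
  then show ?thesis by simp
qed

lemma has_integral_Icc_diff:
  fixes \<phi> :: "real \<Rightarrow> 'b::euclidean_space"
  assumes "(\<phi> has_integral J1) {s..p}" "(\<phi> has_integral J2) {s..t}" "s \<le> p" "p \<le> t"
  shows "(\<phi> has_integral (J2 - J1)) {p..t}"
proof -
  have i: "\<phi> integrable_on {p..t}"
    by (rule integrable_on_subinterval[OF has_integral_integrable[OF assms(2)]]) (use assms in auto)
  have "integral {s..p} \<phi> + integral {p..t} \<phi> = integral {s..t} \<phi>"
    by (rule Henstock_Kurzweil_Integration.integral_combine[OF assms(3,4) has_integral_integrable[OF assms(2)]])
  then have "integral {p..t} \<phi> = J2 - J1"
    using integral_unique[OF assms(1)] integral_unique[OF assms(2)] by (simp add: algebra_simps)
  then show ?thesis using integrable_integral[OF i] by simp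
qed

lemma moment_norm_push:
  assumes "X \<in> borel_measurable m"
  shows "moment_norm 1 (push m X) = (\<integral>y. norm (X y) \<partial>m)"
  unfolding moment_norm_1 by (rule integral_distr) (use assms in auto)

locale decoupled_problem = control_problem f g \<alpha> lam_f Lam_f bl_f Lip_f lam_g Lam_g bl_g l_g L
  for f :: "'x::euclidean_space \<Rightarrow> 'x measure \<Rightarrow> 'a::euclidean_space \<Rightarrow> 'x"
    and g :: "'x \<Rightarrow> 'x measure \<Rightarrow> 'a \<Rightarrow> real"
    and \<alpha> :: "'x \<Rightarrow> 'x measure \<Rightarrow> 'x \<Rightarrow> 'a"
    and lam_f Lam_f bl_f Lip_f lam_g Lam_g bl_g l_g L :: real +
  fixes p :: "'x \<Rightarrow> 'x measure \<Rightarrow> 'x" and \<gamma> :: "real \<Rightarrow> 'x \<Rightarrow> 'x measure \<Rightarrow> 'x" and T :: real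
  assumes T: "0 < T" and dec: "decoupling_field f g \<alpha> p T \<gamma>" and reg: "regular_field T L \<gamma>"
    and p0: "p 0 dirac0 = 0"
begin

section \<open>Properties of the decoupling field and its flows\<close>

lemma field_lipschitz:
  assumes s: "s \<in> {0..T}" and M: "prob_space M" and X: "X \<in> borel_measurable M" and Y: "Y \<in> borel_measurable M"
    and P: "push M X \<in> P2" "push M Y \<in> P2"
  shows "norm (\<gamma> s x (push M X) - \<gamma> s y (push M Y)) \<le> L * (norm (x - y) + (\<integral>\<omega>. norm (X \<omega> - Y \<omega>) \<partial>M))"
proof -
  have e1: "norm (\<gamma> s x (push M X) - \<gamma> s y (push M X)) \<le> L * norm (x - y)"
    by (rule norm_diff_le_Dfr[of UNIV "\<lambda>x. \<gamma> s x (push M X)"])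
      (use reg s P in \<open>auto simp: regular_field_def\<close>)
  have "\<exists>D :: real \<Rightarrow> 'x \<Rightarrow> 'x measure \<Rightarrow> 'x \<Rightarrow> 'x \<Rightarrow>\<^sub>L 'x.
        (\<forall>s\<in>{0..T}. \<forall>x. \<forall>\<mu>\<in>P2. has_L_derivative (\<gamma> s x) (D s x \<mu>) \<mu>) \<and>
        jointly_continuous ({0..T} \<times> UNIV) (\<lambda>(s, x, y) \<mu>. D s x \<mu> y) \<and>
        (\<forall>s\<in>{0..T}. \<forall>x y. \<forall>\<mu>\<in>P2. norm (D s x \<mu> y) \<le> L)"
    using reg unfolding regular_field_def by (elim conjE)
  then obtain D :: "real \<Rightarrow> 'x \<Rightarrow> 'x measure \<Rightarrow> 'x \<Rightarrow> 'x \<Rightarrow>\<^sub>L 'x"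
    where "\<forall>s\<in>{0..T}. \<forall>x. \<forall>\<mu>\<in>P2. has_L_derivative (\<gamma> s x) (D s x \<mu>) \<mu>"
      "\<forall>s\<in>{0..T}. \<forall>x y. \<forall>\<mu>\<in>P2. norm (D s x \<mu> y) \<le> L"
    by (elim exE conjE)
  then have "\<exists>D. has_L_derivative (\<gamma> s y) D \<mu> \<and> (\<forall>y. norm (D y) \<le> L)" if "\<mu> \<in> P2" for \<mu>
    using s that by (intro exI[of _ "D s y \<mu>"]) auto
  then have e2: "norm (\<gamma> s y (push M X) - \<gamma> s y (push M Y)) \<le> L * (\<integral>\<omega>. norm (X \<omega> - Y \<omega>) \<partial>M)"
    by (rule L_derivative_lipschitz[OF _ M X Y P])
  show ?thesis
    using norm_triangle_ineq[of "\<gamma> s x (push M X) - \<gamma> s y (push M X)" "\<gamma> s y (push M X) - \<gamma> s y (push M Y)"] e1 e2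
    by (simp add: algebra_simps)
qed

lemma field_flow_integral_start:
  assumes "field_flow f \<alpha> \<gamma> T s m X" "s \<le> t" "t \<le> T"
  shows "((\<lambda>r. drift (X r y) (push m (X r)) (\<gamma> r (X r y) (push m (X r)))) has_integral (X t y - y)) {s..t}"
  using assms unfolding field_flow_def drift_def by auto

lemma field_flow_start:
  assumes "field_flow f \<alpha> \<gamma> T s m X" "s \<le> T"
  shows "X s y = y"
proof -
  have "X s y - y = 0"
    using field_flow_integral_start[OF assms(1) order_refl assms(2), of y] has_integral_refl(2)
    unfolding atLeastAtMost_singleton by (rule has_integral_unique)
  then show ?thesis by simp
qed

lemma field_flow_integral:
  assumes "field_flow f \<alpha> \<gamma> T s m X" "s \<le> q" "q \<le> t" "t \<le> T"
  shows "((\<lambda>r. drift (X r y) (push m (X r)) (\<gamma> r (X r y) (push m (X r)))) has_integral (X t y - X q y)) {q..t}"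
proof -
  have "((\<lambda>r. drift (X r y) (push m (X r)) (\<gamma> r (X r y) (push m (X r)))) has_integral ((X t y - y) - (X q y - y))) {q..t}"
    by (rule has_integral_Icc_diff[OF field_flow_integral_start[OF assms(1)] field_flow_integral_start[OF assms(1)] assms(2,3)])
      (use assms in auto)
  then show ?thesis by simp
qed

text \<open>This is the defining relation of a decoupling field at \<open>s = T\<close>, where the
  flow is the identity and the integral extends over a single point.\<close>

lemma field_terminal:
  assumes m: "m \<in> P2"
  shows "\<gamma> T x m = p x m"
proof -
  have "T \<in> {0..T}" using T by simp
  then have "\<exists>X Z. field_flow f \<alpha> \<gamma> T T m X \<and>
        (\<forall>x. ((\<lambda>\<tau>. Phi f g \<alpha> (X \<tau>) (Z \<tau>) m x)
                has_integral (\<gamma> T x m - p (X T x) (push m (X T)))) {T..T})"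
    using dec m unfolding decoupling_field_def by meson
  then obtain X Z where X: "field_flow f \<alpha> \<gamma> T T m X"
    and I: "((\<lambda>\<tau>. Phi f g \<alpha> (X \<tau>) (Z \<tau>) m x) has_integral (\<gamma> T x m - p (X T x) (push m (X T)))) {T..T}"
    by blast
  have XT: "X T = (\<lambda>y. y)" using field_flow_start[OF X] by auto
  have "\<gamma> T x m - p (X T x) (push m (X T)) = 0"
    using I has_integral_refl(2) unfolding atLeastAtMost_singleton by (rule has_integral_unique)
  moreover have "push m (X T) = m"
    unfolding XT by (rule distr_id2) (use P2_D(2)[OF m] in simp)
  ultimately show ?thesis by (simp add: XT)
qed

lemma decoupling_at:
  assumes "s \<in> {0..T}" "m \<in> P2"
  obtains X Z where "field_flow f \<alpha> \<gamma> T s m X"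
    "\<And>\<tau> x. \<tau> \<in> {s..T} \<Longrightarrow> Z \<tau> x = \<gamma> \<tau> (X \<tau> x) (push m (X \<tau>))"
    "\<And>\<tau>. \<tau> \<in> {s..T} \<Longrightarrow> Phi_defined f g \<alpha> (X \<tau>) (Z \<tau>) m"
    "\<And>x. ((\<lambda>\<tau>. Phi f g \<alpha> (X \<tau>) (Z \<tau>) m x) has_integral (\<gamma> s x m - p (X T x) (push m (X T)))) {s..T}"
proof -
  have "\<exists>X Z. field_flow f \<alpha> \<gamma> T s m X \<and>
        (\<forall>\<tau>\<in>{s..T}. \<forall>x. Z \<tau> x = \<gamma> \<tau> (X \<tau> x) (push m (X \<tau>))) \<and>
        (\<forall>\<tau>\<in>{s..T}. Phi_defined f g \<alpha> (X \<tau>) (Z \<tau>) m) \<and>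
        (\<forall>x. ((\<lambda>\<tau>. Phi f g \<alpha> (X \<tau>) (Z \<tau>) m x)
                has_integral (\<gamma> s x m - p (X T x) (push m (X T)))) {s..T})"
    using dec assms unfolding decoupling_field_def by blast
  then show ?thesis using that by blast
qed

text \<open>Under (h1) the origin is an equilibrium. For the Dirac mass at 0 all means are values at
  0, so the flow from 0 and the backward relation can be estimated by
  \<open>\<zeta> r = \<gamma> r 0 dirac0\<close> alone, and \<open>backward_estimate\<close>
  applies. Its a priori bound comes from the continuity of \<open>\<zeta>\<close>.\<close>

lemma field_zero:
  assumes s: "s \<in> {0..T}"
  shows "\<gamma> s 0 dirac0 = 0"
proof -
  note C = lip_ge(2)
  define \<zeta> where "\<zeta> r = \<gamma> r 0 dirac0" for r
  \<comment> \<open>State and first moment both equal \<open>norm (X r 0)\<close> in norm, which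
    gives the 2; the field contributes \<open>2 * L\<close> times the same norm, apart from
    \<open>\<zeta>\<close>.\<close>
  define K where "K = lip * (2 + 2 * L)"
  have K: "0 < K" "lip \<le> K" "lip * (2 + 2 * L) \<le> K"
    using C L0 mult_left_mono[of 1 "2 + 2 * L" lip] by (auto simp: K_def intro!: mult_pos_pos)
  \<comment> \<open>The terms come from the terminal value, from the state inside
    \<open>Phi\<close>, and from \<open>\<zeta>\<close> inside \<open>Phi\<close>.\<close>
  define K' where "K' = (2 * L + 2 * lip * (3 + 2 * L) / (2 * K)) * (2 * K * exp (2 * K * T)) + 2 * lip"
  have "continuous_on {0..T} \<zeta>"
    using reg unfolding regular_field_def \<zeta>_def continuous_on_eq_continuous_within
    by (auto intro!: differentiable_imp_continuous_within)
  then obtain B where B: "\<And>r. r \<in> {0..T} \<Longrightarrow> norm (\<zeta> r) \<le> B"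
    using continuous_on_Icc_bounded by blast
  have "(\<lambda>r (u :: unit). \<zeta> r) s () = 0"
  proof (rule backward_estimate[where \<delta> = "\<lambda>r (u :: unit). \<zeta> r" and \<omega> = "\<lambda>_. 1" and T = T and B = B and K = K'])
    fix D \<eta> s :: real and i :: unit
    assume D: "0 \<le> D" and \<eta>: "1 \<le> \<eta>" and s: "0 \<le> s" "s \<le> T"
      and le': "\<And>r (i :: unit). 0 \<le> r \<Longrightarrow> r \<le> T \<Longrightarrow> norm (\<zeta> r) \<le> D * exp (\<eta> * (T - r)) * 1"
    have le: "norm (\<zeta> r) \<le> D * exp (\<eta> * (T - r)) * 1" if "0 \<le> r" "r \<le> T" for r by (rule le'[OF that])
    have s': "s \<in> {0..T}" using s by simp
    obtain X Z where X: "field_flow f \<alpha> \<gamma> T s dirac0 X"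
      and Z: "\<And>\<tau> x. \<tau> \<in> {s..T} \<Longrightarrow> Z \<tau> x = \<gamma> \<tau> (X \<tau> x) (push dirac0 (X \<tau>))"
      and Phd: "\<And>\<tau>. \<tau> \<in> {s..T} \<Longrightarrow> Phi_defined f g \<alpha> (X \<tau>) (Z \<tau>) dirac0"
      and Ph: "\<And>x. ((\<lambda>\<tau>. Phi f g \<alpha> (X \<tau>) (Z \<tau>) dirac0 x) has_integral (\<gamma> s x dirac0 - p (X T x) (push dirac0 (X T)))) {s..T}"
      by (rule decoupling_at[OF s' return_P2]) blast
    let ?\<mu> = "\<lambda>r. push dirac0 (X r)"
    let ?b = "\<lambda>r. drift (X r 0) (?\<mu> r) (\<gamma> r (X r 0) (?\<mu> r))"
    have XP: "X r \<in> borel_measurable borel" "?\<mu> r \<in> P2" if "r \<in> {s..T}" for r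
      using X that by (auto simp: field_flow_def)
    have mom: "moment_norm 1 (?\<mu> r) = norm (X r 0)" if "r \<in> {s..T}" for r
      using XP(1)[OF that] by (subst moment_norm_push) simp_all
    have gam: "norm (\<gamma> r (X r 0) (?\<mu> r)) \<le> norm (\<zeta> r) + 2 * L * norm (X r 0)" if r: "r \<in> {s..T}" for r
    proof -
      have "norm (\<gamma> r (X r 0) (?\<mu> r) - \<gamma> r 0 (push dirac0 (\<lambda>x. x))) \<le> L * (norm (X r 0 - 0) + (\<integral>y. norm (X r y - y) \<partial>dirac0))"
        by (rule field_lipschitz) (use XP[OF r] r s in \<open>auto simp: prob_space_return distr_id2\<close>)
      moreover have "(\<integral>y. norm (X r y - y) \<partial>dirac0) = norm (X r 0)"
        using XP(1)[OF r] by (subst integral_return_borel) auto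
      moreover have "push dirac0 (\<lambda>x :: 'x. x) = dirac0" by (rule distr_id2) simp
      ultimately show ?thesis
        using norm_triangle_sub[of "\<gamma> r (X r 0) (?\<mu> r)" "\<gamma> r 0 dirac0"] by (simp add: \<zeta>_def)
    qed
    define q where "q r u = X r 0" for r and u :: unit
    have I0: "(?b has_integral X t 0) {s..t}"
      if "s \<le> t" "t \<le> T" for t using field_flow_integral_start[OF X that, of 0] by simp
    have "continuous_on {s..T} (\<lambda>t. integral {s..t} ?b)"
      by (rule indefinite_integral_continuous_1[OF has_integral_integrable[OF I0[OF s(2) order_refl]]])
    then have "continuous_on {s..T} (\<lambda>t. X t 0)"
    proof (rule continuous_on_eq)
      fix t assume "t \<in> {s..T}"
      then show "integral {s..t} ?b = X t 0"
        using integral_unique[OF I0[of t]] by simp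
    qed
    then obtain Bq where Bq: "\<And>r. r \<in> {s..T} \<Longrightarrow> norm (X r 0) \<le> Bq"
      using continuous_on_Icc_bounded by blast
    have qle: "norm (q \<tau> i) \<le> 2 * (K * D / \<eta> * exp (\<eta> * (T - s))) * exp (2 * K * (\<tau> - s)) * 1" if t: "s \<le> \<tau>" "\<tau> \<le> T" for \<tau> i
    proof (rule forward_estimate[where \<omega> = "\<lambda>_. 1" and B = Bq and T = T
          and \<phi> = "\<lambda>r (u :: unit). ?b r"])
      show "norm (q \<tau> i) \<le> Bq * 1" if "s \<le> \<tau>" "\<tau> \<le> T" for \<tau> i using Bq that by (simp add: q_def)
      show "(?b has_integral q \<tau> i) {s..\<tau>}"
        if "s \<le> \<tau>" "\<tau> \<le> T" for \<tau> i using I0[OF that] by (simp add: q_def)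
      fix M r and i :: unit
      assume M: "0 \<le> M" and h: "\<And>r i. s \<le> r \<Longrightarrow> r \<le> T \<Longrightarrow> norm (q r i) \<le> M * exp (2 * K * (r - s)) * 1" and r: "s \<le> r" "r \<le> T"
      have r': "r \<in> {s..T}" using r by simp
      have "norm (?b r)
          \<le> lip * (norm (X r 0) + norm (X r 0) + (norm (\<zeta> r) + 2 * L * norm (X r 0)))"
        using coefficients_growth(1)[OF XP(2)[OF r'], of "X r 0" "\<gamma> r (X r 0) (?\<mu> r)"] gam[OF r'] C
        unfolding mom[OF r'] by (elim order_trans) (intro mult_left_mono add_left_mono, auto)
      also have "\<dots> = lip * (2 + 2 * L) * norm (X r 0) + lip * norm (\<zeta> r)" by (simp add: algebra_simps)
      also have "\<dots> \<le> K * (M * exp (2 * K * (r - s))) + K * (D * exp (\<eta> * (T - r)))"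
        using K h[OF r] le[of r] r s M D by (intro add_mono mult_mono) (auto simp: q_def)
      finally show "norm (?b r)
          \<le> K * (M * exp (2 * K * (r - s)) + D * exp (\<eta> * (T - r))) * 1" by (simp add: algebra_simps)
    qed (use K D \<eta> t in auto)
    define A where "A = D / \<eta> * exp (\<eta> * (T - s))"
    have A: "0 \<le> A" using D \<eta> by (simp add: A_def)
    have Xle: "norm (X r 0) \<le> 2 * K * A * exp (2 * K * (r - s))" if "s \<le> r" "r \<le> T" for r
      using qle[OF that] by (simp add: q_def A_def mult_ac)
    have Phi0: "norm (Phi f g \<alpha> (X r) (Z r) dirac0 0) \<le> 2 * lip * (3 + 2 * L) * (2 * K * A) * exp (2 * K * (r - s)) + 2 * lip * D * exp (\<eta> * (T - r))"
      if r: "s \<le> r" "r \<le> T" for r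
    proof -
      have r': "r \<in> {s..T}" using r by simp
      let ?n = "norm (X r 0)" and ?z = "norm (Z r 0)"
      have "integrable dirac0 (Phi_integrand f g \<alpha> (X r) (Z r) dirac0 0)"
        using Phd[OF r'] by (simp add: Phi_defined_def)
      \<comment> \<open>Evaluating an integral against a Dirac mass requires measurability, which
        \<open>Phi_defined\<close> supplies.\<close>
      from borel_measurable_integrable[OF this]
      have "(\<lambda>y. mean_field_part (X r y) (?\<mu> r) (Z r y) (X r 0)) \<in> borel_measurable borel"
        by (simp add: Phi_integrand_eq[abs_def])
      then have eq: "Phi f g \<alpha> (X r) (Z r) dirac0 0 = local_part (X r 0) (?\<mu> r) (Z r 0)
          + mean_field_part (X r 0) (?\<mu> r) (Z r 0) (X r 0)"
        by (simp add: Phi_eq)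
      have "norm (Phi f g \<alpha> (X r) (Z r) dirac0 0) \<le> lip * (?n + ?n + ?z) + lip * (?n + ?n + ?z + ?n)"
        unfolding eq using coefficients_growth(2)[OF XP(2)[OF r'], of "X r 0" "Z r 0"] coefficients_growth(3)[OF XP(2)[OF r'], of "X r 0" "Z r 0" "X r 0"]
        unfolding mom[OF r'] by (intro order_trans[OF norm_triangle_ineq add_mono])
      also have "\<dots> = lip * (5 * ?n + 2 * ?z)" by (simp add: algebra_simps)
      also have "\<dots> \<le> lip * (6 * ?n + 2 * (norm (\<zeta> r) + 2 * L * ?n))"
        using C gam[OF r'] Z[OF r'] by (intro mult_left_mono add_mono) auto
      also have "\<dots> = 2 * lip * (3 + 2 * L) * ?n + 2 * lip * norm (\<zeta> r)" by (simp add: algebra_simps)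
      also have "\<dots> \<le> 2 * lip * (3 + 2 * L) * (2 * K * A * exp (2 * K * (r - s))) + 2 * lip * (D * exp (\<eta> * (T - r)))"
        using C L0 Xle[OF r] le[of r] r s by (intro add_mono mult_left_mono) auto
      finally show ?thesis by (simp add: mult.assoc)
    qed
    have J: "norm (\<gamma> s 0 dirac0 - p (X T 0) (?\<mu> T))
        \<le> 2 * lip * (3 + 2 * L) * (2 * K * A) / (2 * K) * exp (2 * K * (T - s)) + 2 * lip * D / \<eta> * exp (\<eta> * (T - s))"
      by (rule norm_has_integral_exp_le[OF Ph s(2) Phi0]) (use K C D \<eta> L0 A in auto)
    have T': "T \<in> {s..T}" using s by simp
    have "\<zeta> T = 0" using field_terminal[OF return_P2, of 0 0] p0 by (simp add: \<zeta>_def)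
    then have "norm (p (X T 0) (?\<mu> T)) \<le> 2 * L * norm (X T 0)"
      using gam[OF T'] field_terminal[OF XP(2)[OF T']] by simp
    also have "\<dots> \<le> 2 * L * (2 * K * A * exp (2 * K * (T - s)))"
      using L0 Xle[OF s(2) order_refl] by (intro mult_left_mono) auto
    finally have "norm (\<zeta> s) \<le> 2 * L * (2 * K * A * exp (2 * K * (T - s)))
        + (2 * lip * (3 + 2 * L) * (2 * K * A) / (2 * K) * exp (2 * K * (T - s)) + 2 * lip * D / \<eta> * exp (\<eta> * (T - s)))"
      using J norm_triangle_sub[of "\<gamma> s 0 dirac0" "p (X T 0) (?\<mu> T)"] by (simp add: \<zeta>_def)
    also have "\<dots> = (2 * L + 2 * lip * (3 + 2 * L) / (2 * K)) * (2 * K * A) * exp (2 * K * (T - s)) + 2 * lip * A"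
      by (simp add: A_def algebra_simps)
    also have "\<dots> \<le> (2 * L + 2 * lip * (3 + 2 * L) / (2 * K)) * (2 * K * A) * exp (2 * K * T) + 2 * lip * A"
      using s K L0 C A by (intro add_right_mono mult_left_mono) (auto intro!: mult_nonneg_nonneg add_nonneg_nonneg)
    also have "\<dots> = K' * A" by (simp add: K'_def algebra_simps)
    finally show "norm (\<zeta> s) \<le> K' * (D / \<eta> * exp (\<eta> * (T - s))) * 1" by (simp add: A_def)
  qed (use s B in auto)
  then show ?thesis by (simp add: \<zeta>_def)
qed

lemma field_growth:
  assumes s: "s \<in> {0..T}" and m: "prob_space m" and X: "X \<in> borel_measurable m" "push m X \<in> P2"
  shows "norm (\<gamma> s x (push m X)) \<le> L * (norm x + (\<integral>y. norm (X y) \<partial>m))"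
proof -
  interpret prob_space m by fact
  have "push m (\<lambda>_. 0 :: 'x) = dirac0"
  proof (rule measure_eqI)
    fix A assume "A \<in> sets (push m (\<lambda>_. 0 :: 'x))"
    then show "emeasure (push m (\<lambda>_. 0)) A = emeasure dirac0 A"
      by (auto simp: emeasure_distr emeasure_space_1 indicator_def vimage_def)
  qed simp
  then have "norm (\<gamma> s x (push m X) - \<gamma> s 0 dirac0) \<le> L * (norm (x - 0) + (\<integral>y. norm (X y - 0) \<partial>m))"
    using field_lipschitz[OF s m X(1) _ X(2), of "\<lambda>_. 0" x 0] by simp
  then show ?thesis by (simp add: field_zero[OF s])
qed

lemma field_cone:
  assumes s: "s \<in> {0..T}" and \<mu>: "\<mu> \<in> P2"
  shows "norm (\<gamma> s x \<mu>) \<le> L * weight x \<mu>"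
proof -
  have "push \<mu> (\<lambda>x. x) = \<mu>" by (rule distr_id2) (use P2_D(2)[OF \<mu>] in simp)
  then have "norm (\<gamma> s x \<mu>) \<le> L * (norm x + moment_norm 1 \<mu>)"
    using field_growth[OF s P2_D(1)[OF \<mu>], of "\<lambda>x. x" x] \<mu> by (simp add: moment_norm_1[unfolded One_nat_def])
  also have "\<dots> \<le> L * weight x \<mu>" using L0 by (intro mult_left_mono) (auto simp: weight_def)
  finally show ?thesis .
qed

text \<open>Supplies the finite bound from which \<open>forward_estimate\<close> starts:
  \<open>field_flow\<close> puts the law into \<open>P2\<close> at each time, with no
  uniformity.\<close>

lemma flow_growth:
  assumes s: "s \<in> {0..T}" and \<mu>: "\<mu> \<in> P2" and X: "field_flow f \<alpha> \<gamma> T s \<mu> X"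
  obtains K where "0 \<le> K" "\<And>\<tau> y. s \<le> \<tau> \<Longrightarrow> \<tau> \<le> T \<Longrightarrow> norm (X \<tau> y) \<le> K * (1 + norm y)"
proof -
  let ?\<mu> = "\<lambda>r. push \<mu> (X r)"
  note C = lip_ge(2)
  have XP: "X r \<in> borel_measurable borel" "X r \<in> borel_measurable \<mu>" "push \<mu> (X r) \<in> P2" if "s \<le> r" "r \<le> T" for r
    using X \<mu> that by (auto simp: field_flow_def)
  interpret mean_field_path \<mu> X "\<lambda>r y. drift (X r y) (?\<mu> r) (\<gamma> r (X r y) (?\<mu> r))" s T "lip * (1 + L)"
  proof (intro mean_field_path.intro P2_D(1)[OF \<mu>])
    show "0 < lip * (1 + L)" using C L0 by simp
    show "integrable \<mu> (X r)" if "s \<le> r" "r \<le> T" for r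
      by (rule integrable_push_P2[OF XP(2,3)[OF that]])
    show "((\<lambda>r. drift (X r y) (?\<mu> r) (\<gamma> r (X r y) (?\<mu> r))) has_integral X t y - X q y) {q..t}"
      if "s \<le> q" "q \<le> t" "t \<le> T" for q t y
      by (rule field_flow_integral[OF X that])
    show "norm (drift (X r y) (?\<mu> r) (\<gamma> r (X r y) (?\<mu> r))) \<le> lip * (1 + L) * (norm (X r y) + (\<integral>y. norm (X r y) \<partial>\<mu>))"
      if r: "s \<le> r" "r \<le> T" for r y
    proof -
      have "norm (\<gamma> r (X r y) (?\<mu> r)) \<le> L * (norm (X r y) + (\<integral>y. norm (X r y) \<partial>\<mu>))"
        by (rule field_growth) (use r s XP[OF r] P2_D(1)[OF \<mu>] in auto)
      then have "lip * (norm (X r y) + (\<integral>y. norm (X r y) \<partial>\<mu>) + norm (\<gamma> r (X r y) (?\<mu> r)))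
          \<le> lip * (norm (X r y) + (\<integral>y. norm (X r y) \<partial>\<mu>) + L * (norm (X r y) + (\<integral>y. norm (X r y) \<partial>\<mu>)))"
        using C by (intro mult_left_mono add_left_mono) auto
      then show ?thesis
        using coefficients_growth(1)[OF XP(3)[OF r], of "X r y" "\<gamma> r (X r y) (?\<mu> r)"]
        unfolding moment_norm_push[OF XP(2)[OF r]] by (simp add: algebra_simps)
    qed
  qed
  obtain K where K: "0 \<le> K" "\<And>r q y. r \<in> {s..T} \<Longrightarrow> q \<in> {s..T} \<Longrightarrow> norm (X r y) \<le> K * (1 + norm (X q y))"
    by (rule growth) blast
  show ?thesis
  proof (rule that[OF K(1)])
    fix \<tau> y assume "s \<le> \<tau>" "\<tau> \<le> T"
    then show "norm (X \<tau> y) \<le> K * (1 + norm y)"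
      using K(2)[of \<tau> s y] s field_flow_start[OF X, of y] by simp
  qed
qed

text \<open>Both variables live on \<open>m\<close>, so the distance of their laws is at most
  \<open>E\<close> times the mean of \<open>\<omega>\<close>. Inserting
  \<open>\<gamma> r (X1 x) (push m X1)\<close> relates the unrestricted \<open>Z1\<close> to the
  field at \<open>Y\<close>, the form in which the coefficient estimates compare it with a point of
  the cone. \<open>1 \<le> \<omega> x\<close> absorbs constants into the weight.\<close>

lemma coupled_difference:
  assumes m: "prob_space m" and X1: "X1 \<in> borel_measurable m" "push m X1 \<in> P2" and Y: "Y \<in> borel_measurable m" "push m Y \<in> P2"
    and r: "r \<in> {0..T}" and \<omega>: "\<And>x. 1 \<le> \<omega> x" "integrable m \<omega>"
    and e: "\<And>x. norm (X1 x - Y x) \<le> E * \<omega> x"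
    and \<delta>: "\<And>x. norm (Z1 x - \<gamma> r (X1 x) (push m X1)) \<le> W * \<omega> x"
  shows "kr_le (push m X1) (push m Y) (E * (\<integral>x. \<omega> x \<partial>m))"
    "norm (Z1 x - \<gamma> r (Y x) (push m Y)) \<le> (W + L * (1 + (\<integral>x. \<omega> x \<partial>m)) * E) * \<omega> x"
    "1 \<le> (\<integral>x. \<omega> x \<partial>m)" "0 \<le> E"
proof -
  interpret prob_space m by fact
  have iX: "integrable m X1" "integrable m Y" using X1 Y by (auto intro: integrable_push_P2)
  have "(\<integral>x. norm (X1 x - Y x) \<partial>m) \<le> (\<integral>x. E * \<omega> x \<partial>m)"
    using e \<omega> iX by (intro integral_mono) auto
  then have le: "(\<integral>x. norm (X1 x - Y x) \<partial>m) \<le> E * (\<integral>x. \<omega> x \<partial>m)" using \<omega> by simp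
  show "kr_le (push m X1) (push m Y) (E * (\<integral>x. \<omega> x \<partial>m))"
    by (rule kr_le_mono[OF kr_le_push[OF X1(1) Y(1) X1(2) Y(2)] le])
  have "(\<integral>x. 1 \<partial>m) \<le> (\<integral>x. \<omega> x \<partial>m)" using \<omega> by (intro integral_mono) auto
  then show O: "1 \<le> (\<integral>x. \<omega> x \<partial>m)" by (simp add: prob_space)
  show E: "0 \<le> E"
    using order_trans[OF norm_ge_zero e[of x]] \<omega>(1)[of x] by (simp add: zero_le_mult_iff)
  have "norm (\<gamma> r (X1 x) (push m X1) - \<gamma> r (Y x) (push m Y)) \<le> L * (norm (X1 x - Y x) + (\<integral>x. norm (X1 x - Y x) \<partial>m))"
    by (rule field_lipschitz[OF r m X1(1) Y(1) X1(2) Y(2)])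
  also have "\<dots> \<le> L * (E * \<omega> x + E * (\<integral>x. \<omega> x \<partial>m) * \<omega> x)"
  proof (intro mult_left_mono add_mono e L0)
    have "E * (\<integral>x. \<omega> x \<partial>m) * 1 \<le> E * (\<integral>x. \<omega> x \<partial>m) * \<omega> x"
      using E O \<omega>(1)[of x] by (intro mult_left_mono) auto
    then show "(\<integral>x. norm (X1 x - Y x) \<partial>m) \<le> E * (\<integral>x. \<omega> x \<partial>m) * \<omega> x" using le by simp
  qed
  finally have "norm (Z1 x - \<gamma> r (Y x) (push m Y)) \<le> W * \<omega> x + L * (E * \<omega> x + E * (\<integral>x. \<omega> x \<partial>m) * \<omega> x)"
    using \<delta>[of x] norm_triangle_ineq[of "Z1 x - \<gamma> r (X1 x) (push m X1)" "\<gamma> r (X1 x) (push m X1) - \<gamma> r (Y x) (push m Y)"]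
    by simp
  then show "norm (Z1 x - \<gamma> r (Y x) (push m Y)) \<le> (W + L * (1 + (\<integral>x. \<omega> x \<partial>m)) * E) * \<omega> x"
    by (simp add: algebra_simps)
qed

text \<open>The flow starts at time \<open>s\<close> from the law of \<open>X' s\<close> and is read
  at the points \<open>X' s x\<close>, which makes it a process on \<open>m\<close> with the same
  values at \<open>s\<close>. The constant is the same for all \<open>s\<close>, \<open>D\<close>
  and \<open>\<eta>\<close>, as the backward contraction demands.\<close>

lemma flow_comparison:
  assumes m: "m \<in> P2"
    and X': "\<And>r. r \<in> {0..T} \<Longrightarrow> X' r \<in> borel_measurable borel" "\<And>r. r \<in> {0..T} \<Longrightarrow> push m (X' r) \<in> P2"
    and eq: "\<And>s t x. 0 \<le> s \<Longrightarrow> s \<le> t \<Longrightarrow> t \<le> T \<Longrightarrow>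
      ((\<lambda>r. drift (X' r x) (push m (X' r)) (Z' r x)) has_integral (X' t x - X' s x)) {s..t}"
    and \<omega>: "\<And>x. 1 \<le> \<omega> x" "integrable m \<omega>" and B: "\<And>r x. r \<in> {0..T} \<Longrightarrow> norm (X' r x) \<le> B * \<omega> x"
  obtains K where "0 \<le> K" "\<And>s X D \<eta> \<tau> x. s \<in> {0..T} \<Longrightarrow> field_flow f \<alpha> \<gamma> T s (push m (X' s)) X \<Longrightarrow> 0 \<le> D \<Longrightarrow> 1 \<le> \<eta> \<Longrightarrow>
      (\<And>r x. r \<in> {0..T} \<Longrightarrow> norm (Z' r x - \<gamma> r (X' r x) (push m (X' r))) \<le> D * exp (\<eta> * (T - r)) * \<omega> x) \<Longrightarrow>
      s \<le> \<tau> \<Longrightarrow> \<tau> \<le> T \<Longrightarrow> norm (X' \<tau> x - X \<tau> (X' s x)) \<le> K * (D / \<eta> * exp (\<eta> * (T - s))) * \<omega> x"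
proof -
  have C: "0 \<le> lip" using lip_ge(2) by simp
  have pm: "prob_space m" by (rule P2_D(1)[OF m])
  define \<Omega> where "\<Omega> = (\<integral>x. \<omega> x \<partial>m)"
  have \<omega>0: "0 < \<omega> x" for x using \<omega>(1)[of x] by simp
  have \<Omega>: "0 \<le> \<Omega>" unfolding \<Omega>_def using \<omega>0 by (intro integral_nonneg_AE AE_I2) (simp add: less_imp_le)
  \<comment> \<open>\<open>1 + L\<close> reflects the dependence through the field besides the
    direct one, \<open>1 + \<Omega>\<close> the distance of the laws besides that of the
    points.\<close>
  define K where "K = (lip + 1) * ((1 + L) * (1 + \<Omega>))"
  have l1: "1 \<le> (1 + L) * (1 + \<Omega>)" using L0 \<Omega> mult_mono[of 1 "1 + L" 1 "1 + \<Omega>"] by simp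
  have K: "0 < K" "lip \<le> K" "lip * ((1 + L) * (1 + \<Omega>)) \<le> K"
  proof -
    show "0 < K" unfolding K_def by (rule mult_pos_pos) (use C l1 in linarith)+
    show "lip * ((1 + L) * (1 + \<Omega>)) \<le> K" unfolding K_def using l1 by (intro mult_right_mono) auto
    have "(lip + 1) * 1 \<le> K" unfolding K_def using l1 C by (intro mult_left_mono) auto
    then show "lip \<le> K" by simp
  qed
  show ?thesis
  proof (rule that[of "2 * K * exp (2 * K * T)"])
    show "0 \<le> 2 * K * exp (2 * K * T)" using K by simp
    fix s X D \<eta> \<tau> x
    assume s: "s \<in> {0..T}" and X: "field_flow f \<alpha> \<gamma> T s (push m (X' s)) X" and D: "0 \<le> D" and \<eta>: "1 \<le> (\<eta> :: real)"
      and \<delta>: "\<And>r x. r \<in> {0..T} \<Longrightarrow> norm (Z' r x - \<gamma> r (X' r x) (push m (X' r))) \<le> D * exp (\<eta> * (T - r)) * \<omega> x"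
      and \<tau>: "s \<le> \<tau>" "\<tau> \<le> T"
    have \<mu>: "push m (X' s) \<in> P2" by (rule X'(2)[OF s])
    have mX's: "X' s \<in> borel_measurable m" using X'(1)[OF s] m by simp
    let ?\<mu> = "\<lambda>r. push (push m (X' s)) (X r)"
    have XP: "X r \<in> borel_measurable borel" "?\<mu> r \<in> P2" if "s \<le> r" "r \<le> T" for r
      using X that by (auto simp: field_flow_def)
    have Y: "(\<lambda>y. X r (X' s y)) \<in> borel_measurable m" "?\<mu> r = push m (\<lambda>y. X r (X' s y))"
      if "s \<le> r" "r \<le> T" for r
      using measurable_compose[OF mX's XP(1)[OF that]] distr_distr[OF XP(1)[OF that] mX's] by (auto simp: o_def)
    obtain K0 where K0: "0 \<le> K0" "\<And>\<tau> y. s \<le> \<tau> \<Longrightarrow> \<tau> \<le> T \<Longrightarrow> norm (X \<tau> y) \<le> K0 * (1 + norm y)"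
      by (rule flow_growth[OF s \<mu> X]) blast
    have "norm (X' \<tau> x - X \<tau> (X' s x)) \<le> 2 * (K * D / \<eta> * exp (\<eta> * (T - s))) * exp (2 * K * (\<tau> - s)) * \<omega> x"
    \<comment> \<open>The a priori bound combines \<open>B\<close> with the growth of this
      particular flow; \<open>K0\<close> may depend on \<open>s\<close> and drops out of the
      estimate.\<close>
    proof (rule forward_estimate[where \<epsilon> = "\<lambda>\<tau> x. X' \<tau> x - X \<tau> (X' s x)" and T = T and B = "B + K0 * (1 + B)"
          and \<phi> = "\<lambda>r x. drift (X' r x) (push m (X' r)) (Z' r x)
            - drift (X r (X' s x)) (?\<mu> r) (\<gamma> r (X r (X' s x)) (?\<mu> r))"])
      fix t i assume t: "s \<le> t" "t \<le> T"
      have "norm (X' t i - X t (X' s i)) \<le> norm (X' t i) + norm (X t (X' s i))" by (rule norm_triangle_ineq4)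
      also have "\<dots> \<le> B * \<omega> i + K0 * (\<omega> i + B * \<omega> i)"
        using B[of t i] K0(2)[OF t, of "X' s i"] K0(1) t s B[OF s, of i] \<omega>(1)[of i]
        by (intro add_mono order_trans[OF K0(2)[OF t]] mult_left_mono) auto
      finally show "norm (X' t i - X t (X' s i)) \<le> (B + K0 * (1 + B)) * \<omega> i" by (simp add: algebra_simps)
      have "((\<lambda>r. drift (X' r i) (push m (X' r)) (Z' r i)
            - drift (X r (X' s i)) (?\<mu> r) (\<gamma> r (X r (X' s i)) (?\<mu> r)))
          has_integral ((X' t i - X' s i) - (X t (X' s i) - X' s i))) {s..t}"
        by (intro has_integral_diff eq field_flow_integral_start[OF X t]) (use s t in auto)
      then show "((\<lambda>r. drift (X' r i) (push m (X' r)) (Z' r i)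
            - drift (X r (X' s i)) (?\<mu> r) (\<gamma> r (X r (X' s i)) (?\<mu> r)))
          has_integral X' t i - X t (X' s i)) {s..t}" by simp
    next
      fix M r i
      assume M: "0 \<le> M" and h: "\<And>r i. s \<le> r \<Longrightarrow> r \<le> T \<Longrightarrow> norm (X' r i - X r (X' s i)) \<le> M * exp (2 * K * (r - s)) * \<omega> i"
        and r: "s \<le> r" "r \<le> T"
      have r': "r \<in> {0..T}" using r s by simp
      define E where "E = M * exp (2 * K * (r - s))"
      define W where "W = D * exp (\<eta> * (T - r))"
      have W: "0 \<le> W" using D by (simp add: W_def)
      have mX'r: "X' r \<in> borel_measurable m" using X'(1)[OF r'] m by simp
      note cd = coupled_difference[OF pm mX'r X'(2)[OF r'] Y(1)[OF r] XP(2)[OF r, unfolded Y(2)[OF r]] r' \<omega>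
          h[OF r, folded E_def] \<delta>[OF r', folded W_def], folded \<Omega>_def Y(2)[OF r]]
      let ?Y = "X r (X' s i)"
      have "norm (drift (X' r i) (push m (X' r)) (Z' r i) - drift ?Y (?\<mu> r) (\<gamma> r ?Y (?\<mu> r)))
          \<le> lip * (norm (X' r i - ?Y) + E * \<Omega> + norm (Z' r i - \<gamma> r ?Y (?\<mu> r)))"
        by (rule coefficients_lipschitz(1)[OF X'(2)[OF r'] XP(2)[OF r] cd(1) field_cone[OF r' XP(2)[OF r]]])
      also have "\<dots> \<le> lip * (E * \<omega> i + E * \<Omega> * \<omega> i + (W + L * (1 + \<Omega>) * E) * \<omega> i)"
      proof (intro mult_left_mono add_mono cd(2) C)
        show "norm (X' r i - ?Y) \<le> E * \<omega> i" using h[OF r] by (simp add: E_def)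
        show "E * \<Omega> \<le> E * \<Omega> * \<omega> i"
          using mult_left_mono[OF \<omega>(1)[of i], of "E * \<Omega>"] cd(4) \<Omega> by simp
      qed
      also have "\<dots> = (lip * ((1 + L) * (1 + \<Omega>)) * E + lip * W) * \<omega> i" by (simp add: algebra_simps)
      also have "\<dots> \<le> (K * E + K * W) * \<omega> i"
        using K cd(4) W \<omega>0[of i] by (intro mult_right_mono add_mono) auto
      finally show "norm (drift (X' r i) (push m (X' r)) (Z' r i) - drift ?Y (?\<mu> r) (\<gamma> r ?Y (?\<mu> r)))
          \<le> K * (M * exp (2 * K * (r - s)) + D * exp (\<eta> * (T - r))) * \<omega> i"
        by (simp add: E_def W_def distrib_left)
    qed (use K \<eta> D \<omega>0 \<tau> in auto)
    also have "\<dots> \<le> 2 * (K * D / \<eta> * exp (\<eta> * (T - s))) * exp (2 * K * T) * \<omega> x"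
      using K \<eta> D \<tau> s \<omega>0[of x] by (intro mult_right_mono mult_left_mono) auto
    also have "\<dots> = 2 * K * exp (2 * K * T) * (D / \<eta> * exp (\<eta> * (T - s))) * \<omega> x" by simp
    finally show "norm (X' \<tau> x - X \<tau> (X' s x)) \<le> 2 * K * exp (2 * K * T) * (D / \<eta> * exp (\<eta> * (T - s))) * \<omega> x" .
  qed
qed

section \<open>Solutions of the forward-backward system\<close>

lemma solution_facts:
  assumes m: "m \<in> P2" and sol: "fbode_solution f g \<alpha> p 0 T m X' Z'" and r: "r \<in> {0..T}"
  shows "X' r \<in> borel_measurable borel" "X' r \<in> borel_measurable m" "push m (X' r) \<in> P2"
    "integrable m (X' r)" "integrable m (Z' r)"
    "integrable m (\<lambda>y. mean_field_part (X' r y) (push m (X' r)) (Z' r y) (X' r x))"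
    "((\<lambda>r. X' r x) has_vector_derivative drift (X' r x) (push m (X' r)) (Z' r x)) (at r within {0..T})"
    "((\<lambda>r. Z' r x) has_vector_derivative - Phi f g \<alpha> (X' r) (Z' r) m x) (at r within {0..T})"
proof -
  have Phd: "Phi_defined f g \<alpha> (X' r) (Z' r) m" using sol r by (auto simp: fbode_solution_def)
  show X': "X' r \<in> borel_measurable borel" "X' r \<in> borel_measurable m" "push m (X' r) \<in> P2" "integrable m (Z' r)"
    "integrable m (\<lambda>y. mean_field_part (X' r y) (push m (X' r)) (Z' r y) (X' r x))"
    using Phd m by (auto simp: Phi_defined_def Phi_integrand_eq[abs_def])
  show "integrable m (X' r)" by (rule integrable_push_P2[OF X'(2,3)])
  show "((\<lambda>r. X' r x) has_vector_derivative drift (X' r x) (push m (X' r)) (Z' r x)) (at r within {0..T})"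
    "((\<lambda>r. Z' r x) has_vector_derivative - Phi f g \<alpha> (X' r) (Z' r) m x) (at r within {0..T})"
    using sol r unfolding fbode_solution_def drift_def by blast+
qed

lemma solution_integral:
  assumes m: "m \<in> P2" and sol: "fbode_solution f g \<alpha> p 0 T m X' Z'" and st: "0 \<le> s" "s \<le> t" "t \<le> T"
  shows "((\<lambda>r. drift (X' r x) (push m (X' r)) (Z' r x)) has_integral (X' t x - X' s x)) {s..t}"
    "((\<lambda>r. - Phi f g \<alpha> (X' r) (Z' r) m x) has_integral (Z' t x - Z' s x)) {s..t}"
  by (rule fundamental_theorem_of_calculus[OF st(2)]; rule has_vector_derivative_within_subset[OF solution_facts(7)[OF m sol]]
        has_vector_derivative_within_subset[OF solution_facts(8)[OF m sol]]; use st in auto)+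

text \<open>The weight is a slice of the solution itself, \<open>1 + norm (v T x)\<close>:
  integrable because every slice is, and dominating the other slices by \<open>growth\<close>. The
  growth bounds behind it hold outside the cone too.\<close>

lemma solution_growth:
  assumes m: "m \<in> P2" and sol: "fbode_solution f g \<alpha> p 0 T m X' Z'"
  obtains B \<omega> where "0 \<le> B" "\<And>x. 1 \<le> \<omega> x" "integrable m \<omega>"
    "\<And>r x. r \<in> {0..T} \<Longrightarrow> norm (X' r x) \<le> B * \<omega> x" "\<And>r x. r \<in> {0..T} \<Longrightarrow> norm (Z' r x) \<le> B * \<omega> x"
proof -
  have pm: "prob_space m" by (rule P2_D(1)[OF m])
  interpret M: prob_space m by (rule pm)
  note C = lip_ge(2)
  note X' = solution_facts(1,3)[OF m sol] and iX = solution_facts(4)[OF m sol] and iZ = solution_facts(5)[OF m sol]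
    and iPhi = solution_facts(6)[OF m sol] and dX = solution_facts(7)[OF m sol] and dZ = solution_facts(8)[OF m sol]
  have mom: "moment_norm 1 (push m (X' r)) = (\<integral>y. norm (X' r y) \<partial>m)" if "r \<in> {0..T}" for r
    by (rule moment_norm_push[OF solution_facts(2)[OF m sol that]])
  define v where "v r x = (X' r x, Z' r x)" for r x
  define d where "d r x = (drift (X' r x) (push m (X' r)) (Z' r x), - Phi f g \<alpha> (X' r) (Z' r) m x)" for r x
  have vX: "norm (X' r x) \<le> norm (v r x)" and vZ: "norm (Z' r x) \<le> norm (v r x)" for r x
    by (auto simp: v_def norm_fst_le norm_snd_le)
  have iv: "integrable m (v r)" if "r \<in> {0..T}" for r
  proof (rule Bochner_Integration.integrable_bound)
    show "integrable m (\<lambda>x. norm (X' r x) + norm (Z' r x))" using iX[OF that] iZ[OF that] by auto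
    show "v r \<in> borel_measurable m"
      unfolding v_def using iX[OF that] iZ[OF that] by (intro borel_measurable_Pair) auto
    show "AE x in m. norm (v r x) \<le> norm (norm (X' r x) + norm (Z' r x))"
      by (rule AE_I2) (simp add: v_def norm_Pair_le)
  qed
  \<comment> \<open>The drift and the two parts of \<open>Phi\<close> add up to
    \<open>5 * lip\<close>; the rest is slack.\<close>
  have V: "mean_field_path m v d 0 T (10 * lip)"
  proof (intro mean_field_path.intro pm)
    show "0 < 10 * lip" using C by simp
    show "integrable m (v r)" if "0 \<le> r" "r \<le> T" for r using iv that by simp
    show "((\<lambda>r. d r x) has_integral v t x - v s x) {s..t}" if "0 \<le> s" "s \<le> t" "t \<le> T" for s t x
    proof (rule fundamental_theorem_of_calculus[OF that(2)])
      fix r assume r: "r \<in> {s..t}"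
      have "((\<lambda>r. (X' r x, Z' r x)) has_vector_derivative d r x) (at r within {0..T})"
        unfolding d_def by (rule has_vector_derivative_Pair[OF dX dZ]) (use r that in auto)
      then show "((\<lambda>r. v r x) has_vector_derivative d r x) (at r within {s..t})"
        unfolding v_def by (rule has_vector_derivative_within_subset) (use that in auto)
    qed
    show "norm (d r x) \<le> 10 * lip * (norm (v r x) + (\<integral>y. norm (v r y) \<partial>m))" if "0 \<le> r" "r \<le> T" for r x
    proof -
      have r: "r \<in> {0..T}" using that by simp
      let ?\<mu> = "push m (X' r)"
      define U where "U = (\<integral>y. norm (v r y) \<partial>m)"
      have mU: "moment_norm 1 ?\<mu> \<le> U"
        unfolding mom[OF r] U_def using iX[OF r] iv[OF r] vX by (intro integral_mono) auto
      have b1: "norm (drift (X' r x) ?\<mu> (Z' r x)) \<le> lip * (norm (v r x) + U + norm (v r x))"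
        using C mU vX vZ by (intro order_trans[OF coefficients_growth(1)[OF X'(2)[OF r]]] mult_left_mono add_mono) auto
      have b2: "norm (local_part (X' r x) ?\<mu> (Z' r x)) \<le> lip * (norm (v r x) + U + norm (v r x))"
        using C mU vX vZ by (intro order_trans[OF coefficients_growth(2)[OF X'(2)[OF r]]] mult_left_mono add_mono) auto
      have "norm (\<integral>y. mean_field_part (X' r y) ?\<mu> (Z' r y) (X' r x) \<partial>m)
          \<le> (\<integral>y. norm (mean_field_part (X' r y) ?\<mu> (Z' r y) (X' r x)) \<partial>m)" by (rule integral_norm_bound)
      also have "\<dots> \<le> (\<integral>y. lip * (norm (v r y) + U + norm (v r y) + norm (v r x)) \<partial>m)"
      proof (rule integral_mono)
        show "norm (mean_field_part (X' r y) ?\<mu> (Z' r y) (X' r x)) \<le> lip * (norm (v r y) + U + norm (v r y) + norm (v r x))" for y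
          using C mU vX vZ by (intro order_trans[OF coefficients_growth(3)[OF X'(2)[OF r]]] mult_left_mono add_mono) auto
      qed (use iPhi[OF r] iv[OF r] in auto)
      also have "\<dots> = lip * (3 * U + norm (v r x))"
        using iv[OF r] by (simp add: U_def M.prob_space)
      finally have b3: "norm (\<integral>y. mean_field_part (X' r y) ?\<mu> (Z' r y) (X' r x) \<partial>m) \<le> lip * (3 * U + norm (v r x))" .
      have "norm (d r x) \<le> norm (drift (X' r x) ?\<mu> (Z' r x)) + norm (Phi f g \<alpha> (X' r) (Z' r) m x)"
        unfolding d_def using norm_Pair_le[of "drift (X' r x) ?\<mu> (Z' r x)" "- Phi f g \<alpha> (X' r) (Z' r) m x"] by simp
      also have "\<dots> \<le> lip * (norm (v r x) + U + norm (v r x)) + (lip * (norm (v r x) + U + norm (v r x)) + lip * (3 * U + norm (v r x)))"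
        unfolding Phi_eq using b1 b2 b3 by (intro add_mono order_trans[OF norm_triangle_ineq add_mono]) auto
      also have "\<dots> \<le> 10 * lip * (norm (v r x) + U)"
      proof -
        have "0 \<le> lip * norm (v r x)" "0 \<le> lip * U" using C by (auto simp: U_def)
        then show ?thesis by (simp add: algebra_simps)
      qed
      finally show ?thesis by (simp add: U_def)
    qed
  qed
  obtain B where B: "0 \<le> B" "\<And>r s x. r \<in> {0..T} \<Longrightarrow> s \<in> {0..T} \<Longrightarrow> norm (v r x) \<le> B * (1 + norm (v s x))"
    by (rule mean_field_path.growth[OF V]) blast
  have T': "T \<in> {0..T}" using T by simp
  show ?thesis
  proof (rule that[OF B(1), of "\<lambda>x. 1 + norm (v T x)"])
    show "integrable m (\<lambda>x. 1 + norm (v T x))" using iv[OF T'] by simp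
    show "norm (X' r x) \<le> B * (1 + norm (v T x))" "norm (Z' r x) \<le> B * (1 + norm (v T x))" if "r \<in> {0..T}" for r x
      using B(2)[OF that T', of x] vX[of r x] vZ[of r x] by auto
  qed simp
qed

text \<open>\<open>Phi\<close> for the flow contains an integral over the law of \<open>X0\<close>;
  pulled back to \<open>m\<close> it can be subtracted pointwise. In each comparison the flow
  provides the cone point. The error \<open>E\<close> of the state and \<open>W\<close> of the
  adjoint variable enter linearly, and \<open>\<omega> x\<close> is kept as a factor so that the
  estimate can be iterated.\<close>

lemma Phi_comparison:
  assumes m: "prob_space m" and X1: "X1 \<in> borel_measurable m" "push m X1 \<in> P2" and X0: "X0 \<in> borel_measurable m"
    and YP: "Y \<in> borel_measurable borel" "push (push m X0) Y \<in> P2"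
    and iPhi: "integrable m (\<lambda>y. mean_field_part (X1 y) (push m X1) (Z1 y) (X1 x))"
    and PhY: "Phi_defined f g \<alpha> Y Z2 (push m X0)"
    and r: "r \<in> {0..T}" and Z2: "\<And>y. Z2 y = \<gamma> r (Y y) (push (push m X0) Y)"
    and \<omega>: "\<And>x. 1 \<le> \<omega> x" "integrable m \<omega>"
    and E: "\<And>x. norm (X1 x - Y (X0 x)) \<le> E * \<omega> x"
    and \<delta>: "\<And>x. norm (Z1 x - \<gamma> r (X1 x) (push m X1)) \<le> W * \<omega> x"
  defines "\<Omega> \<equiv> (\<integral>x. \<omega> x \<partial>m)"
  shows "norm (Phi f g \<alpha> X1 Z1 m x - Phi f g \<alpha> Y Z2 (push m X0) (X0 x))
    \<le> lip * ((3 + L) * (1 + \<Omega>) * (1 + \<Omega>) * (E + W)) * \<omega> x"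
proof -
  interpret M: prob_space m by (rule m)
  let ?\<mu> = "push m X1" and ?\<nu> = "push (push m X0) Y"
  have C: "0 \<le> lip" using lip_ge(2) by simp
  have \<omega>0: "0 < \<omega> x" for x using \<omega>(1)[of x] by simp
  have Y: "(\<lambda>y. Y (X0 y)) \<in> borel_measurable m" "?\<nu> = push m (\<lambda>y. Y (X0 y))"
    using measurable_compose[OF X0 YP(1)] distr_distr[OF YP(1) X0] by (auto simp: o_def)
  note cd0 = coupled_difference(3,4)[OF m X1 Y(1) YP(2)[unfolded Y(2)] r \<omega> E \<delta>, folded \<Omega>_def]
  have \<Omega>: "0 \<le> \<Omega>" and E0: "0 \<le> E" using cd0 by simp_all
  have W0: "0 \<le> W" using order_trans[OF norm_ge_zero \<delta>[of x]] \<omega>0[of x] by (simp add: zero_le_mult_iff)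
  \<comment> \<open>The error of \<open>Z1\<close> against the field at the flow: \<open>W\<close>
    plus the effect of \<open>E\<close> through state and law.\<close>
  define G where "G = W + L * (1 + \<Omega>) * E"
  have G0: "0 \<le> G" using W0 L0 \<Omega> E0 by (simp add: G_def)
  note cd = coupled_difference[OF m X1 Y(1) YP(2)[unfolded Y(2)] r \<omega> E \<delta>, folded \<Omega>_def Y(2), folded G_def]
  have ZG: "norm (Z1 y - Z2 (X0 y)) \<le> G * \<omega> y" for y
    using cd(2)[of y] by (simp add: Z2)
  have cone: "norm (Z2 y) \<le> L * weight (Y y) ?\<nu>" for y
    unfolding Z2 by (rule field_cone[OF r YP(2)])
  have \<Omega>\<omega>: "E * \<Omega> \<le> E * \<Omega> * \<omega> y" for y
    using mult_left_mono[OF \<omega>(1)[of y], of "E * \<Omega>"] E0 \<Omega> by simp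
  have l: "norm (local_part (X1 x) ?\<mu> (Z1 x) - local_part (Y (X0 x)) ?\<nu> (Z2 (X0 x)))
      \<le> lip * (E * \<omega> x + E * \<Omega> * \<omega> x + G * \<omega> x)"
    using C E[of x] \<Omega>\<omega>[of x] ZG[of x]
    by (intro order_trans[OF coefficients_lipschitz(2)[OF X1(2) YP(2) cd(1) cone]] mult_left_mono add_mono)
  let ?m1 = "\<lambda>y. mean_field_part (X1 y) ?\<mu> (Z1 y) (X1 x)"
  let ?m2 = "\<lambda>y. mean_field_part (Y y) ?\<nu> (Z2 y) (Y (X0 x))"
  have i2: "integrable (push m X0) ?m2"
    using PhY by (simp add: Phi_defined_def Phi_integrand_eq[abs_def])
  have i2': "integrable m (\<lambda>y. ?m2 (X0 y))" by (rule integrable_distr[OF X0 i2])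
  have d2: "(\<integral>y. ?m2 y \<partial>push m X0) = (\<integral>y. ?m2 (X0 y) \<partial>m)"
    by (rule integral_distr[OF X0]) (use borel_measurable_integrable[OF i2] in simp)
  have "norm ((\<integral>y. ?m1 y \<partial>m) - (\<integral>y. ?m2 y \<partial>push m X0)) = norm (\<integral>y. ?m1 y - ?m2 (X0 y) \<partial>m)"
    unfolding d2 using iPhi i2' by simp
  also have "\<dots> \<le> (\<integral>y. norm (?m1 y - ?m2 (X0 y)) \<partial>m)" by (rule integral_norm_bound)
  \<comment> \<open>The last summand is the displacement of the point at which the measure
    derivative is evaluated; it carries the weight of \<open>x\<close>, not of the integration
    variable.\<close>
  also have "\<dots> \<le> (\<integral>y. lip * (E * \<omega> y + E * \<Omega> * \<omega> y + G * \<omega> y + E * \<omega> x) \<partial>m)"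
  proof (rule integral_mono)
    fix y
    show "norm (?m1 y - ?m2 (X0 y)) \<le> lip * (E * \<omega> y + E * \<Omega> * \<omega> y + G * \<omega> y + E * \<omega> x)"
      using C E[of x] E[of y] \<Omega>\<omega>[of y] ZG[of y]
      by (intro order_trans[OF coefficients_lipschitz(3)[OF X1(2) YP(2) cd(1) cone]] mult_left_mono add_mono)
  qed (use iPhi i2' \<omega>(2) in auto)
  also have "\<dots> = lip * ((E + E * \<Omega> + G) * \<Omega> + E * \<omega> x)"
    using \<omega>(2) by (simp add: \<Omega>_def M.prob_space algebra_simps)
  also have "\<dots> \<le> lip * ((E + E * \<Omega> + G) * \<Omega> * \<omega> x + E * \<omega> x)"
  proof (intro mult_left_mono add_right_mono C)
    have "0 \<le> (E + E * \<Omega> + G) * \<Omega>" using E0 G0 \<Omega> by simp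
    then show "(E + E * \<Omega> + G) * \<Omega> \<le> (E + E * \<Omega> + G) * \<Omega> * \<omega> x"
      using mult_left_mono[OF \<omega>(1)[of x], of "(E + E * \<Omega> + G) * \<Omega>"] by simp
  qed
  finally have mm: "norm ((\<integral>y. ?m1 y \<partial>m) - (\<integral>y. ?m2 y \<partial>push m X0)) \<le> lip * ((E + E * \<Omega> + G) * \<Omega> * \<omega> x + E * \<omega> x)" .
  have split: "Phi f g \<alpha> X1 Z1 m x - Phi f g \<alpha> Y Z2 (push m X0) (X0 x)
      = (local_part (X1 x) ?\<mu> (Z1 x) - local_part (Y (X0 x)) ?\<nu> (Z2 (X0 x)))
        + ((\<integral>y. ?m1 y \<partial>m) - (\<integral>y. ?m2 y \<partial>push m X0))"
    unfolding Phi_eq by simp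
  have "norm (Phi f g \<alpha> X1 Z1 m x - Phi f g \<alpha> Y Z2 (push m X0) (X0 x))
      \<le> lip * (E * \<omega> x + E * \<Omega> * \<omega> x + G * \<omega> x) + lip * ((E + E * \<Omega> + G) * \<Omega> * \<omega> x + E * \<omega> x)"
    unfolding split by (rule order_trans[OF norm_triangle_ineq add_mono[OF l mm]])
  also have "\<dots> = lip * (((1 + \<Omega>) * (1 + \<Omega>) + 1) * E + (1 + \<Omega>) * G) * \<omega> x" by (simp add: algebra_simps)
  also have "\<dots> \<le> lip * ((3 + L) * (1 + \<Omega>) * (1 + \<Omega>) * (E + W)) * \<omega> x"
  proof (intro mult_right_mono mult_left_mono C)
    have o2: "1 \<le> (1 + \<Omega>) * (1 + \<Omega>)" "1 + \<Omega> \<le> (1 + \<Omega>) * (1 + \<Omega>)"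
      using mult_mono[of 1 "1 + \<Omega>" 1 "1 + \<Omega>"] mult_right_mono[of 1 "1 + \<Omega>" "1 + \<Omega>"] \<Omega> by auto
    have "((1 + \<Omega>) * (1 + \<Omega>) + 1) * E + (1 + \<Omega>) * G
        = ((1 + \<Omega>) * (1 + \<Omega>) + 1) * E + L * ((1 + \<Omega>) * (1 + \<Omega>)) * E + (1 + \<Omega>) * W"
      by (simp add: G_def algebra_simps)
    also have "\<dots> \<le> ((1 + \<Omega>) * (1 + \<Omega>) + (1 + \<Omega>) * (1 + \<Omega>)) * E + L * ((1 + \<Omega>) * (1 + \<Omega>)) * E + (1 + \<Omega>) * (1 + \<Omega>) * W"
      by (intro add_mono mult_right_mono o2 E0 W0 order_refl)
    also have "\<dots> = (1 + \<Omega>) * (1 + \<Omega>) * ((2 + L) * E + W)" by (simp add: algebra_simps)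
    also have "\<dots> \<le> (1 + \<Omega>) * (1 + \<Omega>) * ((3 + L) * (E + W))"
    proof (rule mult_left_mono)
      have "0 \<le> L * W" "0 \<le> L * E" using L0 W0 E0 by auto
      then show "(2 + L) * E + W \<le> (3 + L) * (E + W)" using E0 W0 by (simp add: algebra_simps)
    qed (use \<Omega> in auto)
    finally show "((1 + \<Omega>) * (1 + \<Omega>) + 1) * E + (1 + \<Omega>) * G \<le> (3 + L) * (1 + \<Omega>) * (1 + \<Omega>) * (E + W)"
      by (simp add: mult_ac)
  qed (use \<omega>0[of x] in auto)
  finally show ?thesis .
qed

lemma solution_unique:
  assumes m: "m \<in> P2" and sol: "fbode_solution f g \<alpha> p 0 T m X' Z'" and X: "field_flow f \<alpha> \<gamma> T 0 m X"
    and s: "s \<in> {0..T}"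
  shows "X' s x = X s x \<and> Z' s x = \<gamma> s (X s x) (push m (X s))"
proof -
  have pm: "prob_space m" by (rule P2_D(1)[OF m])
  note X' = solution_facts(1,3,2)[OF m sol] and iX = solution_facts(4)[OF m sol] and iPhi = solution_facts(6)[OF m sol]
    and IX = solution_integral(1)[OF m sol] and IZ = solution_integral(2)[OF m sol]
  have X0: "X' 0 x = x" and ZT: "Z' T x = p (X' T x) (push m (X' T))" for x
    using sol by (auto simp: fbode_solution_def)
  have T': "T \<in> {0..T}" "0 \<in> {0..T}" using T by auto
  obtain K0 \<omega> where K0: "0 \<le> K0" and \<omega>: "\<And>x. 1 \<le> \<omega> x" "integrable m \<omega>"
    and XB: "\<And>r x. r \<in> {0..T} \<Longrightarrow> norm (X' r x) \<le> K0 * \<omega> x" and ZB: "\<And>r x. r \<in> {0..T} \<Longrightarrow> norm (Z' r x) \<le> K0 * \<omega> x"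
    by (rule solution_growth[OF m sol]) blast
  have \<omega>0: "0 < \<omega> x" for x using \<omega>(1)[of x] by simp
  define \<Omega> where "\<Omega> = (\<integral>x. \<omega> x \<partial>m)"
  have \<Omega>: "0 \<le> \<Omega>" unfolding \<Omega>_def using \<omega>0 by (intro integral_nonneg_AE AE_I2) (simp add: less_imp_le)
  obtain K1 where K1: "0 \<le> K1" and flow: "\<And>s X D \<eta> \<tau> x. s \<in> {0..T} \<Longrightarrow> field_flow f \<alpha> \<gamma> T s (push m (X' s)) X \<Longrightarrow> 0 \<le> D \<Longrightarrow> 1 \<le> \<eta> \<Longrightarrow>
      (\<And>r x. r \<in> {0..T} \<Longrightarrow> norm (Z' r x - \<gamma> r (X' r x) (push m (X' r))) \<le> D * exp (\<eta> * (T - r)) * \<omega> x) \<Longrightarrow>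
      s \<le> \<tau> \<Longrightarrow> \<tau> \<le> T \<Longrightarrow> norm (X' \<tau> x - X \<tau> (X' s x)) \<le> K1 * (D / \<eta> * exp (\<eta> * (T - s))) * \<omega> x"
    by (rule flow_comparison[OF m X'(1,2) IX \<omega> XB]) blast+
  define \<delta> where "\<delta> r x = Z' r x - \<gamma> r (X' r x) (push m (X' r))" for r x
  define C3 where "C3 = lip * ((3 + L) * (1 + \<Omega>) * (1 + \<Omega>))"
  have C30: "0 \<le> C3" unfolding C3_def using lip_ge(2) L0 \<Omega> by (intro mult_nonneg_nonneg) auto
  \<comment> \<open>Contributions of the terminal value, of the forward error inside
    \<open>Phi\<close>, and of the bound on \<open>\<delta>\<close> inside \<open>Phi\<close>. The
    forward error already contains \<open>1 / \<eta>\<close>, so its integral may cost a factor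
    \<open>exp T\<close>.\<close>
  define K where "K = L * (1 + \<Omega>) * K1 + C3 * K1 * exp T + C3"
  have delta0: "\<delta> s x = 0" if s: "s \<in> {0..T}" for s x
  proof (rule backward_estimate[where \<delta> = \<delta> and \<omega> = \<omega> and T = T and B = "K0 + L * (K0 + K0 * \<Omega>)" and K = K])
    show "0 < \<omega> i" for i by (rule \<omega>0)
    show "norm (\<delta> r i) \<le> (K0 + L * (K0 + K0 * \<Omega>)) * \<omega> i" if "0 \<le> r" "r \<le> T" for r i
    proof -
      have r: "r \<in> {0..T}" using that by simp
      have "(\<integral>y. norm (X' r y) \<partial>m) \<le> (\<integral>y. K0 * \<omega> y \<partial>m)"
        using iX[OF r] \<omega>(2) XB[OF r] by (intro integral_mono) auto
      also have "\<dots> = K0 * \<Omega>" by (simp add: \<Omega>_def)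
      also have "\<dots> \<le> K0 * \<Omega> * \<omega> i"
        using mult_left_mono[OF \<omega>(1)[of i], of "K0 * \<Omega>"] K0 \<Omega> by simp
      finally have "L * (norm (X' r i) + (\<integral>y. norm (X' r y) \<partial>m)) \<le> L * (K0 * \<omega> i + K0 * \<Omega> * \<omega> i)"
        using XB[OF r] L0 by (intro mult_left_mono add_mono) auto
      then have "norm (\<gamma> r (X' r i) (push m (X' r))) \<le> L * (K0 * \<omega> i + K0 * \<Omega> * \<omega> i)"
        using field_growth[OF r pm X'(3,2)[OF r], of "X' r i"] by simp
      then show ?thesis
        using norm_triangle_ineq4[of "Z' r i" "\<gamma> r (X' r i) (push m (X' r))"] ZB[OF r, of i]
        by (simp add: \<delta>_def algebra_simps)
    qed
    fix D \<eta> s :: real and x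
    assume D: "0 \<le> D" and \<eta>: "1 \<le> \<eta>" and s': "0 \<le> s" "s \<le> T"
      and le: "\<And>r i. 0 \<le> r \<Longrightarrow> r \<le> T \<Longrightarrow> norm (\<delta> r i) \<le> D * exp (\<eta> * (T - r)) * \<omega> i"
    have s: "s \<in> {0..T}" using s' by simp
    have \<delta>: "norm (Z' r x - \<gamma> r (X' r x) (push m (X' r))) \<le> D * exp (\<eta> * (T - r)) * \<omega> x" if "r \<in> {0..T}" for r x
      using le[of r x] that by (simp add: \<delta>_def)
    have \<mu>: "push m (X' s) \<in> P2" by (rule X'(2)[OF s])
    obtain Y Z where Y: "field_flow f \<alpha> \<gamma> T s (push m (X' s)) Y"
      and Z: "\<And>\<tau> x. \<tau> \<in> {s..T} \<Longrightarrow> Z \<tau> x = \<gamma> \<tau> (Y \<tau> x) (push (push m (X' s)) (Y \<tau>))"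
      and PhY: "\<And>\<tau>. \<tau> \<in> {s..T} \<Longrightarrow> Phi_defined f g \<alpha> (Y \<tau>) (Z \<tau>) (push m (X' s))"
      and IY: "\<And>x. ((\<lambda>\<tau>. Phi f g \<alpha> (Y \<tau>) (Z \<tau>) (push m (X' s)) x) has_integral
          (\<gamma> s x (push m (X' s)) - p (Y T x) (push (push m (X' s)) (Y T)))) {s..T}"
      by (rule decoupling_at[OF s \<mu>]) blast
    define E where "E = K1 * (D / \<eta> * exp (\<eta> * (T - s)))"
    have E: "norm (X' r x - Y r (X' s x)) \<le> E * \<omega> x" if "s \<le> r" "r \<le> T" for r x
      unfolding E_def by (rule flow[OF s Y D \<eta> \<delta> that])
    have E0: "0 \<le> E" using K1 D \<eta> by (simp add: E_def)
    have YP: "Y r \<in> borel_measurable borel" "push (push m (X' s)) (Y r) \<in> P2" if "s \<le> r" "r \<le> T" for r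
      using Y that by (auto simp: field_flow_def)
    have Ym: "(\<lambda>y. Y r (X' s y)) \<in> borel_measurable m" "push (push m (X' s)) (Y r) = push m (\<lambda>y. Y r (X' s y))"
      if "s \<le> r" "r \<le> T" for r
      using measurable_compose[OF X'(3)[OF s] YP(1)[OF that]] distr_distr[OF YP(1)[OF that] X'(3)[OF s]] by (auto simp: o_def)
    let ?\<nu> = "\<lambda>r. push (push m (X' s)) (Y r)"
    have Phd: "norm (Phi f g \<alpha> (X' r) (Z' r) m x - Phi f g \<alpha> (Y r) (Z r) (push m (X' s)) (X' s x))
        \<le> C3 * E * \<omega> x * exp (1 * (r - s)) + C3 * D * \<omega> x * exp (\<eta> * (T - r))" if r: "s \<le> r" "r \<le> T" for r
    proof -
      have r': "r \<in> {0..T}" "r \<in> {s..T}" using r s by auto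
      have "norm (Phi f g \<alpha> (X' r) (Z' r) m x - Phi f g \<alpha> (Y r) (Z r) (push m (X' s)) (X' s x))
          \<le> lip * ((3 + L) * (1 + \<Omega>) * (1 + \<Omega>) * (E + D * exp (\<eta> * (T - r)))) * \<omega> x"
        unfolding \<Omega>_def
        by (rule Phi_comparison[OF pm X'(3)[OF r'(1)] X'(2)[OF r'(1)] X'(3)[OF s] YP[OF r] iPhi[OF r'(1)] PhY[OF r'(2)] r'(1) Z[OF r'(2)] \<omega>
              E[OF r] \<delta>[OF r'(1)]])
      also have "\<dots> = C3 * E * \<omega> x * 1 + C3 * D * \<omega> x * exp (\<eta> * (T - r))"
        by (simp add: C3_def algebra_simps)
      also have "\<dots> \<le> C3 * E * \<omega> x * exp (1 * (r - s)) + C3 * D * \<omega> x * exp (\<eta> * (T - r))"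
        using C30 E0 \<omega>0[of x] r by (intro add_right_mono mult_left_mono) auto
      finally show ?thesis .
    qed
    \<comment> \<open>The backward equation of the solution meets the representation of
      \<open>\<gamma> s\<close>; together with the difference of terminal values their sum gives
      \<open>\<delta> s x\<close>.\<close>
    have "((\<lambda>r. - Phi f g \<alpha> (X' r) (Z' r) m x + Phi f g \<alpha> (Y r) (Z r) (push m (X' s)) (X' s x)) has_integral
        ((Z' T x - Z' s x) + (\<gamma> s (X' s x) (push m (X' s)) - p (Y T (X' s x)) (?\<nu> T)))) {s..T}"
      by (rule has_integral_add[OF IZ[OF s' order_refl] IY])
    then have J: "norm ((Z' T x - Z' s x) + (\<gamma> s (X' s x) (push m (X' s)) - p (Y T (X' s x)) (?\<nu> T)))
        \<le> C3 * E * \<omega> x / 1 * exp (1 * (T - s)) + C3 * D * \<omega> x / \<eta> * exp (\<eta> * (T - s))"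
    proof (rule norm_has_integral_exp_le[OF _ s'(2)])
      show "norm (- Phi f g \<alpha> (X' r) (Z' r) m x + Phi f g \<alpha> (Y r) (Z r) (push m (X' s)) (X' s x))
          \<le> C3 * E * \<omega> x * exp (1 * (r - s)) + C3 * D * \<omega> x * exp (\<eta> * (T - r))" if "s \<le> r" "r \<le> T" for r
        using Phd[OF that] by (simp add: norm_minus_commute add.commute)
    qed (use C30 E0 D \<eta> \<omega>0[of x] in auto)
    have terminal: "norm (p (X' T x) (push m (X' T)) - p (Y T (X' s x)) (?\<nu> T)) \<le> L * (1 + \<Omega>) * E * \<omega> x"
    proof -
      \<comment> \<open>At time \<open>T\<close> the adjoint variable is exactly the field at
        \<open>X' T\<close>, so the lemma is used with error 0 in place of \<open>W\<close>.\<close>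
      note cd = coupled_difference(2)[OF pm X'(3)[OF T'(1)] X'(2)[OF T'(1)] Ym(1)[OF s'(2) order_refl]
          YP(2)[OF s'(2) order_refl, unfolded Ym(2)[OF s'(2) order_refl]] T'(1) \<omega> E[OF s'(2) order_refl],
          folded \<Omega>_def Ym(2)[OF s'(2) order_refl], of "\<lambda>x. p (X' T x) (push m (X' T))" 0 x]
      show ?thesis
        using cd field_terminal[OF X'(2)[OF T'(1)]] field_terminal[OF YP(2)[OF s'(2) order_refl]] by simp
    qed
    have "\<delta> s x = (p (X' T x) (push m (X' T)) - p (Y T (X' s x)) (?\<nu> T))
        - ((Z' T x - Z' s x) + (\<gamma> s (X' s x) (push m (X' s)) - p (Y T (X' s x)) (?\<nu> T)))"
      by (simp add: \<delta>_def ZT)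
    then have "norm (\<delta> s x) \<le> L * (1 + \<Omega>) * E * \<omega> x
        + (C3 * E * \<omega> x / 1 * exp (1 * (T - s)) + C3 * D * \<omega> x / \<eta> * exp (\<eta> * (T - s)))"
      using order_trans[OF norm_triangle_ineq4 add_mono[OF terminal J]] by simp
    also have "\<dots> \<le> L * (1 + \<Omega>) * E * \<omega> x
        + (C3 * E * \<omega> x / 1 * exp T + C3 * D * \<omega> x / \<eta> * exp (\<eta> * (T - s)))"
      using C30 E0 \<omega>0[of x] s' by (intro add_mono mult_left_mono order_refl) auto
    also have "\<dots> = K * (D / \<eta> * exp (\<eta> * (T - s))) * \<omega> x"
      by (simp add: K_def E_def algebra_simps add_divide_distrib)
    finally show "norm (\<delta> s x) \<le> K * (D / \<eta> * exp (\<eta> * (T - s))) * \<omega> x" .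
  qed (use s in auto)
  have "X' 0 = (\<lambda>x. x)" using X0 by auto
  then have start: "push m (X' 0) = m" using P2_D(2)[OF m] by (simp add: distr_id2)
  have same: "X' s x = X s x" for x
  proof -
    \<comment> \<open>Started from \<open>m\<close> at time 0 and with \<open>D = 0\<close>, the
      flow leaves no room for a forward error.\<close>
    have "norm (X' s x - X s (X' 0 x)) \<le> K1 * (0 / 1 * exp (1 * (T - 0))) * \<omega> x"
      by (rule flow[OF T'(2)]) (use X s start delta0 in \<open>auto simp: \<delta>_def\<close>)
    then show ?thesis by (simp add: X0)
  qed
  then have "X' s = X s" by auto
  then show ?thesis using delta0[OF s, of x] by (simp add: \<delta>_def)
qed

end

text \<open>Differentiability of \<open>D_mu (k y) dirac0 0\<close> in \<open>y\<close> makes the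
  integrand continuous, so that integrating against the Dirac mass is evaluation at 0, where (h1)
  applies.\<close>

lemma terminal_p_zero:
  assumes a3: "assumption_a3 k lam_k Lam_k l_k" and h1: "assumption_h1 f g k"
  shows "terminal_p k 0 dirac0 = 0"
proof -
  have "(\<lambda>y. D_mu (k y) dirac0 0) differentiable (at y)" for y
    using a3 by (simp add: assumption_a3_def)
  then have "continuous_on UNIV (\<lambda>y. D_mu (k y) dirac0 0)"
    using differentiable_imp_continuous_within by (auto simp: continuous_on_eq_continuous_within)
  then have "continuous_on UNIV (\<lambda>y. grad (D_mu (k y) dirac0 0))"
    unfolding grad_def by (intro continuous_intros)
  then have "(\<integral>y. grad (D_mu (k y) dirac0 0) \<partial>dirac0) = grad (D_mu (k 0) dirac0 0)"
    by (intro integral_return_borel borel_measurable_continuous_onI)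
  then show ?thesis
    using h1 by (simp add: terminal_p_def assumption_h1_def grad_def)
qed

theorem theorem9p2:
  fixes f :: "real ^ 'dx \<Rightarrow> (real ^ 'dx) measure \<Rightarrow> real ^ 'da \<Rightarrow> real ^ 'dx"
    and g :: "real ^ 'dx \<Rightarrow> (real ^ 'dx) measure \<Rightarrow> real ^ 'da \<Rightarrow> real"
    and k :: "real ^ 'dx \<Rightarrow> (real ^ 'dx) measure \<Rightarrow> real"
    and \<alpha> :: "real ^ 'dx \<Rightarrow> (real ^ 'dx) measure \<Rightarrow> real ^ 'dx \<Rightarrow> real ^ 'da"
    and \<gamma> :: "real \<Rightarrow> real ^ 'dx \<Rightarrow> (real ^ 'dx) measure \<Rightarrow> real ^ 'dx"
    and m :: "(real ^ 'dx) measure"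
    and X X' Z' :: "real \<Rightarrow> real ^ 'dx \<Rightarrow> real ^ 'dx"
    and T lam_f Lam_f bl_f Lip_f lam_g Lam_g bl_g l_g lam_k Lam_k l_k L0 :: real
  defines "L0 \<equiv> L0_star CARD('dx) lam_f Lam_f lam_g Lam_g lam_k Lam_k"
  assumes a1: "assumption_a1 f lam_f Lam_f bl_f Lip_f"
    and a2: "assumption_a2 g lam_g Lam_g bl_g l_g"
    and a3: "assumption_a3 k lam_k Lam_k l_k"
    and h1: "assumption_h1 f g k"
    and h2: "assumption_h2 bl_f lam_g bl_g Lam_k L0"
    and \<alpha>: "optimal_control f g \<alpha>"
    and T: "T > 0"
    and m: "m \<in> P2"
    and \<gamma>: "decoupling_field f g \<alpha> (terminal_p k) T \<gamma>" "regular_field T L0 \<gamma>"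
    and X: "field_flow f \<alpha> \<gamma> T 0 m X"
    and sol: "fbode_solution f g \<alpha> (terminal_p k) 0 T m X' Z'"
    and C1: "\<And>x. C1_on 0 T (\<lambda>s. X' s x)" "\<And>x. C1_on 0 T (\<lambda>s. Z' s x)"
  shows "\<forall>s\<in>{0..T}. \<forall>x. X' s x = X s x \<and> Z' s x = \<gamma> s (X s x) (push m (X s))"
proof -
  \<comment> \<open>Read off from a norm bounded by \<open>L0\<close>, which avoids the formula for
    \<open>L0_star\<close>.\<close>
  have L0: "0 \<le> L0"
  proof -
    have "norm (Dfr (\<lambda>x. \<gamma> 0 x dirac0) 0) \<le> L0"
      using \<gamma>(2) T by (simp add: regular_field_def)
    then show ?thesis using norm_ge_zero order_trans by blast
  qed
  have pos: "0 < Lam_k" "0 < bl_f" "0 < lam_g"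
    using a1 a2 a3 by (simp_all add: assumption_a1_def assumption_a2_def assumption_a3_def)
  \<comment> \<open>In the maximum of (h2) one branch guarantees positivity, the other yields the
    bound. \<open>lam_g / 40\<close> lies well below the \<open>lam_g / 2\<close> that the control
    estimate absorbs.\<close>
  have "bl_f * L0 \<le> bl_f * max (3 * Lam_k) L0" using pos by (intro mult_left_mono) auto
  also have "\<dots> \<le> lam_g / 40"
  proof -
    have "0 < max (3 * Lam_k) L0" using pos by (simp add: less_max_iff_disj)
    then show ?thesis using h2 by (simp add: assumption_h2_def field_simps)
  qed
  finally have "bl_f * L0 \<le> lam_g / 2" using pos by simp
  then interpret decoupled_problem f g \<alpha> lam_f Lam_f bl_f Lip_f lam_g Lam_g bl_g l_g L0 "terminal_p k" \<gamma> T
    using a1 a2 \<alpha> h1 L0 T \<gamma> terminal_p_zero[OF a3 h1]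
    by unfold_locales (simp_all add: assumption_h1_def)
  show ?thesis using solution_unique[OF m sol X] by blast
qed

end
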